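(* Let $M$ be a compact complex manifold holomorphically immersed in $\mathbb{C}P^N$, and let $\widetilde{M}$ be the circle bundle over $M$ which is induced by the Hopf fibration $\pi:S^{2N+1}\to\mathbb{C}P^N$. With the immersion of $\widetilde{M}$ in $S^{2N+1}$ induced by the immersion of $M$ in $\mathbb{C}P^N$, we have $$\mathcal{T}_{S^{2N+1}}(\widetilde{M})=\mathcal{T}_{\mathbb{C}P^N}(M).$$
   Context: $\mathbb{C}P^N$ carries its canonical (Fubini–Study) metric with holomorphic sectional curvature $4$; $S^{2N+1}$ is the unit sphere with constant curvature $1$. If $f:M\to\mathbb{C}P^N$ is the immersion, $\widetilde M=\{(p,z)\in M\times S^{2N+1}: f(p)=\pi(z)\}$, immersed in $S^{2N+1}$ by $(p,z)\mapsto z$; immersed manifolds carry the induced metrics. For a normal vector $\vec v$ at $p$, $A_{\vec v}$ denotes the second fundamental form (shape operator) $A_{\vec v}(x)=-(\nabla_xV)^{\top}$, $V$ any normal field extending $\vec v$; $r=\|\vec v\|$; $\nu^{<\rho}M$ is the bundle of normal vectors of length less than $\rho$, with its natural volume form ($dVol_M$ times Lebesgue measure on fibres). For $M$ of complex dimension $m$ holomorphically immersed in $\mathbb{C}P^N$, the total absolute curvature is $$\mathcal{T}_{\mathbb{C}P^N}(M)=\frac{2}{\mathrm{Vol}(\mathbb{C}P^N)}\int_{\nu^{<\pi/2}M}\left|\det\left(\cos(r)\,\mathrm{Id}_{T_pM}-\left(\tfrac{\sin r}{r}\right)A_{\vec v}\right)\right|\cos(r)\left(\tfrac{\sin r}{r}\right)^{2N-2m-1}dVol(\vec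 v).$$ For an $n$-dimensional manifold $X$ immersed in $S^{k}$, the total absolute curvature is $$\mathcal{T}_{S^{k}}(X)=\frac{1}{\mathrm{Vol}(S^{k})}\int_{\nu^{<\pi}X}\left|\det\left(\cos(r)\,\mathrm{Id}_{T_pX}-\left(\tfrac{\sin r}{r}\right)A_{\vec v}\right)\right|\left(\tfrac{\sin r}{r}\right)^{k-n-1}dVol(\vec v).$$
   Formalization: M is assumed to have positive codimension (complex dimension m < N); in codimension zero the identity fails, since for M = CP^N the left side is 1 and the right side is 2. *)

theory Defs
  imports "HOL-Analysis.Analysis" "HOL-Combinatorics.Permutations"
begin

text \<open>
  Dimensions vary inside the statement, so \<open>\<real>\<^sup>n\<close> is realised as an \<open>n\<close>-dimensional
  linear subspace \<open>W\<close> of a Euclidean type; dimension \<open>0\<close> is included.  A function on a relatively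
  open \<open>D \<subseteq> W\<close> has its Frechet derivative within \<open>D\<close> determined only on \<open>W\<close>, so derivatives
  are evaluated at vectors of \<open>W\<close> only.
\<close>

section \<open>Linear algebra and Lebesgue measure on subspaces\<close>

definition onb :: "'v::euclidean_space set \<Rightarrow> 'v set" where
  "onb S = (SOME B. pairwise orthogonal B \<and> (\<forall>b\<in>B. norm b = 1) \<and> span B = S)"

definition subspace_lborel :: "'v::euclidean_space set \<Rightarrow> 'v measure" where
  "subspace_lborel S =
     distr (\<Pi>\<^sub>M b\<in>onb S. (lborel :: real measure)) borel (\<lambda>c. \<Sum>b\<in>onb S. c b *\<^sub>R b)"

definition orth_proj :: "'v::euclidean_space set \<Rightarrow> 'v \<Rightarrow> 'v" where
  "orth_proj S x = (THE y. y \<in> S \<and> (\<forall>s\<in>S. (x - y) \<bullet> s = 0))"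

text \<open>Leibniz formula for the determinant of a matrix indexed by a finite set.\<close>

definition set_det :: "'i set \<Rightarrow> ('i \<Rightarrow> 'i \<Rightarrow> real) \<Rightarrow> real" where
  "set_det B a = (\<Sum>\<pi> | \<pi> permutes B. of_int (sign \<pi>) * (\<Prod>b\<in>B. a b (\<pi> b)))"

definition endo_det :: "'v::euclidean_space set \<Rightarrow> ('v \<Rightarrow> 'v) \<Rightarrow> real" where
  "endo_det S L = set_det (onb S) (\<lambda>b c. b \<bullet> L c)"

section \<open>Smooth and holomorphic maps\<close>

primrec Ck_on ::
  "nat \<Rightarrow> 'e::real_normed_vector set \<Rightarrow> 'e set \<Rightarrow> ('e \<Rightarrow> 'v::real_normed_vector) \<Rightarrow> bool" where
  "Ck_on 0 W D G \<longleftrightarrow> continuous_on D G"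
| "Ck_on (Suc k) W D G \<longleftrightarrow>
     (\<forall>u\<in>D. G differentiable (at u within D)) \<and>
     (\<forall>x\<in>W. Ck_on k W D (\<lambda>u. frechet_derivative G (at u within D) x))"

definition smooth_map_on ::
  "'e::real_normed_vector set \<Rightarrow> 'e set \<Rightarrow> ('e \<Rightarrow> 'v::real_normed_vector) \<Rightarrow> bool" where
  "smooth_map_on W D G \<longleftrightarrow> (\<forall>k. Ck_on k W D G)"

definition holomorphic_map_on ::
  "(complex^'k) set \<Rightarrow> (complex^'k) set \<Rightarrow> (complex^'k \<Rightarrow> complex^'j) \<Rightarrow> bool" where
  "holomorphic_map_on W D G \<longleftrightarrow>
     smooth_map_on W D G \<and>
     (\<forall>u\<in>D. \<forall>x\<in>W. frechet_derivative G (at u within D) (\<i> *s x)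
                    = \<i> *s frechet_derivative G (at u within D) x)"

section \<open>Immersed manifolds in a Euclidean space\<close>

text \<open>A local parametrization of \<open>X\<close> is a triple \<open>(W, D, \<psi>)\<close> with \<open>\<psi>\<close> a homeomorphism of the open
  subset \<open>D\<close> of the model space \<open>W\<close> onto an open subset of \<open>X\<close>.\<close>

type_synonym ('e, 'x) param = "'e set \<times> 'e set \<times> ('e \<Rightarrow> 'x)"

definition local_param ::
  "'x::topological_space set \<Rightarrow> 'e::real_normed_vector set \<Rightarrow> 'e set \<Rightarrow> ('e \<Rightarrow> 'x) \<Rightarrow> bool" where
  "local_param X W D \<psi> \<longleftrightarrow>
     openin (top_of_set W) D \<and> openin (top_of_set X) (\<psi> ` D) \<and>
     (\<exists>g. homeomorphism D (\<psi> ` D) \<psi> g)"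

text \<open>For an immersion \<open>F\<close> of an \<open>n\<close>-manifold \<open>X\<close> into a Euclidean space, the smooth structure
  of \<open>X\<close> is determined by \<open>F\<close>: its maximal atlas consists of all local parametrizations
  in which \<open>F\<close> is a smooth immersion.\<close>

definition regular_params ::
  "nat \<Rightarrow> 'x::topological_space set \<Rightarrow> ('x \<Rightarrow> 'v::euclidean_space) \<Rightarrow> ('v, 'x) param set" where
  "regular_params n X F = {(W, D, \<psi>).
     subspace W \<and> dim W = n \<and> local_param X W D \<psi> \<and> smooth_map_on W D (F \<circ> \<psi>) \<and>
     (\<forall>u\<in>D. \<forall>x\<in>W. frechet_derivative (F \<circ> \<psi>) (at u within D) x = 0 \<longrightarrow> x = 0)}"

text \<open>The tangent space at \<open>p\<close> is identified with its image under the differential of \<open>F\<close>, so that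
  the inner product of the Euclidean type is the induced metric.\<close>

definition tangent_space ::
  "nat \<Rightarrow> 'x::topological_space set \<Rightarrow> ('x \<Rightarrow> 'v::euclidean_space) \<Rightarrow> 'x \<Rightarrow> 'v set" where
  "tangent_space n X F p = {frechet_derivative (F \<circ> \<psi>) (at u within D) x | W D \<psi> u x.
     (W, D, \<psi>) \<in> regular_params n X F \<and> u \<in> D \<and> \<psi> u = p \<and> x \<in> W}"

definition volume_density ::
  "'v set \<Rightarrow> 'v set \<Rightarrow> ('v \<Rightarrow> 'v::euclidean_space) \<Rightarrow> 'v \<Rightarrow> real" where
  "volume_density W D G u = sqrt (set_det (onb W) (\<lambda>b c.
     frechet_derivative G (at u within D) b \<bullet> frechet_derivative G (at u within D) c))"

definition riemannian_volume ::
  "nat \<Rightarrow> 'x::topological_space set \<Rightarrow> ('x \<Rightarrow> 'v::euclidean_space) \<Rightarrow> 'x measure" where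
  "riemannian_volume n X F = (THE \<mu>.
     sets \<mu> = sets (restrict_space borel X) \<and>
     (\<forall>(W, D, \<psi>) \<in> regular_params n X F. \<forall>E\<in>sets borel. E \<subseteq> D \<longrightarrow>
        emeasure \<mu> (\<psi> ` E) =
          (\<integral>\<^sup>+u\<in>E. ennreal (volume_density W D (F \<circ> \<psi>) u) \<partial>subspace_lborel W)))"

section \<open>Normal bundle and shape operator inside an ambient submanifold\<close>

text \<open>From here on \<open>F\<close> maps the \<open>n\<close>-manifold \<open>X\<close> into a \<open>k\<close>-dimensional submanifold \<open>Y\<close> of the Euclidean
  type, which carries the induced metric.\<close>

definition normal_space ::
  "nat \<Rightarrow> 'v set \<Rightarrow> nat \<Rightarrow> 'x::topological_space set \<Rightarrow> ('x \<Rightarrow> 'v::euclidean_space) \<Rightarrow> 'x \<Rightarrow> 'v set" where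
  "normal_space k Y n X F p =
     {v \<in> tangent_space k Y id (F p). \<forall>x\<in>tangent_space n X F p. v \<bullet> x = 0}"

definition normal_field ::
  "nat \<Rightarrow> 'v set \<Rightarrow> nat \<Rightarrow> 'x::topological_space set \<Rightarrow> ('x \<Rightarrow> 'v::euclidean_space) \<Rightarrow>
     'x set \<Rightarrow> ('x \<Rightarrow> 'v) \<Rightarrow> bool" where
  "normal_field k Y n X F U V \<longleftrightarrow>
     openin (top_of_set X) U \<and> (\<forall>q\<in>U. V q \<in> normal_space k Y n X F q) \<and>
     (\<forall>(W, D, \<psi>) \<in> regular_params n X F. \<psi> ` D \<subseteq> U \<longrightarrow> smooth_map_on W D (V \<circ> \<psi>))"

text \<open>The derivative of \<open>V\<close> at \<open>p\<close> in the direction of the tangent vector \<open>x\<close>, as a vector of the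
  Euclidean type.\<close>

definition deriv_along ::
  "nat \<Rightarrow> 'x::topological_space set \<Rightarrow> ('x \<Rightarrow> 'v::euclidean_space) \<Rightarrow> ('x \<Rightarrow> 'v) \<Rightarrow> 'x \<Rightarrow> 'v \<Rightarrow> 'v" where
  "deriv_along n X F V p x = (THE d. \<exists>W D \<psi> u \<xi>.
     (W, D, \<psi>) \<in> regular_params n X F \<and> u \<in> D \<and> \<psi> u = p \<and> \<xi> \<in> W \<and>
     frechet_derivative (F \<circ> \<psi>) (at u within D) \<xi> = x \<and>
     d = frechet_derivative (V \<circ> \<psi>) (at u within D) \<xi>)"

text \<open>The Levi-Civita connection of an isometrically embedded submanifold \<open>Y\<close> is the tangential part
  of the flat derivative.\<close>

definition cov_deriv ::
  "nat \<Rightarrow> 'v set \<Rightarrow> nat \<Rightarrow> 'x::topological_space set \<Rightarrow> ('x \<Rightarrow> 'v::euclidean_space) \<Rightarrow>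
     ('x \<Rightarrow> 'v) \<Rightarrow> 'x \<Rightarrow> 'v \<Rightarrow> 'v" where
  "cov_deriv k Y n X F V p x =
     orth_proj (tangent_space k Y id (F p)) (deriv_along n X F V p x)"

definition shape_operator ::
  "nat \<Rightarrow> 'v set \<Rightarrow> nat \<Rightarrow> 'x::topological_space set \<Rightarrow> ('x \<Rightarrow> 'v::euclidean_space) \<Rightarrow>
     'x \<Rightarrow> 'v \<Rightarrow> 'v \<Rightarrow> 'v" where
  "shape_operator k Y n X F p v x = (THE a. \<exists>U V.
     p \<in> U \<and> normal_field k Y n X F U V \<and> V p = v \<and>
     a = - orth_proj (tangent_space n X F p) (cov_deriv k Y n X F V p x))"

text \<open>Integral over the bundle \<open>\<nu>\<^sup><\<^sup>\<rho>X\<close> of normal vectors of length less than \<open>\<rho>\<close>.\<close>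

definition normal_bundle_integral ::
  "nat \<Rightarrow> 'v set \<Rightarrow> nat \<Rightarrow> 'x::topological_space set \<Rightarrow> ('x \<Rightarrow> 'v::euclidean_space) \<Rightarrow>
     real \<Rightarrow> ('x \<Rightarrow> 'v \<Rightarrow> real) \<Rightarrow> ennreal" where
  "normal_bundle_integral k Y n X F \<rho> h =
     (\<integral>\<^sup>+p. (\<integral>\<^sup>+v\<in>{v \<in> normal_space k Y n X F p. norm v < \<rho>}. ennreal (h p v)
              \<partial>subspace_lborel (normal_space k Y n X F p))
        \<partial>riemannian_volume n X F)"

text \<open>\<open>sin r / r\<close>, continuously extended to \<open>r = 0\<close>.\<close>

definition sinc :: "real \<Rightarrow> real" where
  "sinc r = (if r = 0 then 1 else sin r / r)"

definition jacobi_det ::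
  "nat \<Rightarrow> 'v set \<Rightarrow> nat \<Rightarrow> 'x::topological_space set \<Rightarrow> ('x \<Rightarrow> 'v::euclidean_space) \<Rightarrow>
     'x \<Rightarrow> 'v \<Rightarrow> real" where
  "jacobi_det k Y n X F p v = endo_det (tangent_space n X F p)
     (\<lambda>x. cos (norm v) *\<^sub>R x - sinc (norm v) *\<^sub>R shape_operator k Y n X F p v x)"

section \<open>The Hopf fibration and complex projective space\<close>

text \<open>
  The complex line through a unit vector \<open>z\<close> is represented by the Hermitian matrix \<open>z z\<^sup>* / \<surd>2\<close>, i.e. by a
  multiple of the orthogonal projection onto it.  The factor \<open>1 / \<surd>2\<close> makes the Hopf map a
  Riemannian submersion for the metric induced from the matrices (see \<open>hopf_horizontal\<close> and
  \<open>hopf_vertical\<close>), so that metric is the Fubini-Study metric of holomorphic sectional curvature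
  \<open>4\<close>.
\<close>

definition hopf :: "complex^'n \<Rightarrow> complex^'n^'n" where
  "hopf z = (\<chi> i j. z $ i * cnj (z $ j) / complex_of_real (sqrt 2))"

definition CP :: "(complex^'n^'n) set" where
  "CP = hopf ` sphere 0 1"

definition proj_point :: "complex^'n \<Rightarrow> complex^'n^'n" where
  "proj_point w = hopf (w /\<^sub>R norm w)"

definition hopf_deriv :: "complex^'n \<Rightarrow> complex^'n \<Rightarrow> complex^'n^'n" where
  "hopf_deriv z h = (\<chi> i j. (h $ i * cnj (z $ j) + z $ i * cnj (h $ j)) / complex_of_real (sqrt 2))"

lemma hopf_has_derivative:
  fixes z :: "complex^'n"
  shows "(hopf has_derivative hopf_deriv z) (at z)"
proof (subst has_derivative_componentwise_within, intro ballI)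
  fix e :: "complex^'n^'n" assume "e \<in> Basis"
  have "((\<lambda>w. hopf w $ i $ j) has_derivative (\<lambda>h. hopf_deriv z h $ i $ j)) (at z)" for i j
    unfolding hopf_def hopf_deriv_def
    by (auto intro!: derivative_eq_intros bounded_linear.has_derivative[OF bounded_linear_cnj]
        bounded_linear.has_derivative[OF bounded_linear_vec_nth] simp: fun_eq_iff field_simps)
  then show "((\<lambda>w. hopf w \<bullet> e) has_derivative (\<lambda>h. hopf_deriv z h \<bullet> e)) (at z)"
    unfolding inner_vec_def by (intro has_derivative_sum has_derivative_inner_left) auto
qed

lemma hopf_vertical: "hopf_deriv z (\<i> *s z) = 0"
  by (simp add: hopf_deriv_def vec_eq_iff)

lemma hopf_horizontal:
  assumes z: "norm z = 1"
    and h: "(\<Sum>i\<in>UNIV. h $ i * cnj (z $ i)) = 0" and h': "(\<Sum>i\<in>UNIV. h' $ i * cnj (z $ i)) = 0"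
  shows "hopf_deriv z h \<bullet> hopf_deriv z h' = h \<bullet> h'"
proof -
  have in_eq: "a \<bullet> b = Re (\<Sum>i\<in>UNIV. a $ i * cnj (b $ i))" for a b :: "complex^'n"
    by (simp add: inner_vec_def inner_complex_def)
  have zz: "(\<Sum>i\<in>UNIV. z $ i * cnj (z $ i)) = 1"
  proof (rule complex_eqI)
    show "Re (\<Sum>i\<in>UNIV. z $ i * cnj (z $ i)) = Re 1"
      using z in_eq[of z z] by (simp add: dot_square_norm)
  qed simp
  have hz: "(\<Sum>i\<in>UNIV. z $ i * cnj (h' $ i)) = 0"
    using arg_cong[OF h', of cnj] by (simp add: mult.commute)
  have s2: "complex_of_real (sqrt 2) * complex_of_real (sqrt 2) = 2"
    by (simp flip: of_real_mult)
  let ?S = "\<lambda>a b :: complex^'n. \<Sum>i\<in>UNIV. a $ i * cnj (b $ i)"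
  have "hopf_deriv z h \<bullet> hopf_deriv z h' =
        Re (\<Sum>i\<in>UNIV. \<Sum>j\<in>UNIV. hopf_deriv z h $ i $ j * cnj (hopf_deriv z h' $ i $ j))"
    by (simp add: inner_vec_def inner_complex_def)
  also have "(\<Sum>i\<in>UNIV. \<Sum>j\<in>UNIV. hopf_deriv z h $ i $ j * cnj (hopf_deriv z h' $ i $ j)) =
        (\<Sum>i\<in>UNIV. \<Sum>j\<in>UNIV. ((h $ i * cnj (h' $ i)) * (z $ j * cnj (z $ j))
           + (h $ i * cnj (z $ i)) * (h' $ j * cnj (z $ j))
           + (z $ i * cnj (h' $ i)) * (z $ j * cnj (h $ j))
           + (z $ i * cnj (z $ i)) * (h' $ j * cnj (h $ j))) / 2)"
    by (intro sum.cong refl) (simp add: hopf_deriv_def s2 algebra_simps)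
  also have "\<dots> = (?S h h' * ?S z z + ?S h z * ?S h' z + ?S z h' * ?S z h + ?S z z * ?S h' h) / 2"
    by (simp only: sum_product sum.distrib[symmetric] sum_divide_distrib)
  also have "\<dots> = (?S h h' + ?S h' h) / 2"
    by (simp add: zz h h' hz)
  also have "Re \<dots> = (h \<bullet> h' + h' \<bullet> h) / 2"
    by (simp add: in_eq)
  finally show ?thesis by (simp add: inner_commute)
qed

lemma hopf_fibre:
  assumes "norm z = 1" "norm z' = 1"
  shows "hopf z = hopf z' \<longleftrightarrow> (\<exists>c. norm c = 1 \<and> z' = c *s z)"
proof
  assume eq: "hopf z = hopf z'"
  have e: "z $ i * cnj (z $ j) = z' $ i * cnj (z' $ j)" for i j
    using eq by (simp add: hopf_def vec_eq_iff)
  from assms have "z \<noteq> 0" by auto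
  then obtain j where j: "z $ j \<noteq> 0" by (auto simp: vec_eq_iff)
  then have j': "z' $ j \<noteq> 0" using e[of j j] by auto
  define c where "c = cnj (z $ j) / cnj (z' $ j)"
  have zc: "z' = c *s z"
    using e[of _ j] j' by (simp add: vec_eq_iff c_def field_simps)
  moreover have "norm c = 1"
  proof -
    have "(norm (z $ j))\<^sup>2 = (norm (z' $ j))\<^sup>2"
      using arg_cong[OF e[of j j], of norm] by (simp add: norm_mult power2_eq_square)
    then show ?thesis using j' by (simp add: c_def norm_divide)
  qed
  ultimately show "\<exists>c. norm c = 1 \<and> z' = c *s z" by blast
next
  assume "\<exists>c. norm c = 1 \<and> z' = c *s z"
  then obtain c where c: "norm c = 1" "z' = c *s z" by blast
  have "c * cnj c = 1" using c(1) by (simp add: complex_norm_square[symmetric])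
  then have "c * a * (cnj c * cnj b) = a * cnj b" for a b
    by (metis (no_types, opaque_lifting) mult.assoc mult.left_commute mult_1)
  then have "hopf z $ i $ j = hopf z' $ i $ j" for i j
    by (simp only: hopf_def c(2) vec_lambda_beta vector_smult_component complex_cnj_mult)
  then show "hopf z = hopf z'" by (simp add: vec_eq_iff)
qed

section \<open>Complex manifolds and holomorphic immersions\<close>

text \<open>Coordinates take values in complex subspaces of complex dimension \<open>m\<close>, which stand for
  \<open>\<complex>\<^sup>m\<close>.\<close>

definition complex_manifold ::
  "nat \<Rightarrow> 'p::t2_space set \<Rightarrow> (complex^'k, 'p) param set \<Rightarrow> bool" where
  "complex_manifold m M \<A> \<longleftrightarrow>
     (\<forall>(W, D, \<psi>) \<in> \<A>. vec.subspace W \<and> vec.dim W = m \<and> local_param M W D \<psi>) \<and>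
     (\<Union>(W, D, \<psi>) \<in> \<A>. \<psi> ` D) = M \<and>
     (\<forall>(W1, D1, \<psi>1) \<in> \<A>. \<forall>(W2, D2, \<psi>2) \<in> \<A>.
        holomorphic_map_on W1 (D1 \<inter> \<psi>1 -` (\<psi>2 ` D2)) (inv_into D2 \<psi>2 \<circ> \<psi>1))"

text \<open>A map to projective space is holomorphic iff it locally has holomorphic homogeneous
  coordinates \<open>G\<close>.\<close>

definition holomorphic_immersion ::
  "(complex^'k, 'p) param set \<Rightarrow> ('p \<Rightarrow> complex^'n^'n) \<Rightarrow> bool" where
  "holomorphic_immersion \<A> f \<longleftrightarrow>
     (\<forall>(W, D, \<psi>) \<in> \<A>. \<forall>u\<in>D.
        (\<exists>D' G. openin (top_of_set W) D' \<and> u \<in> D' \<and> D' \<subseteq> D \<and>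
           holomorphic_map_on W D' (G :: complex^'k \<Rightarrow> complex^'n) \<and>
           (\<forall>w\<in>D'. G w \<noteq> 0 \<and> f (\<psi> w) = proj_point (G w))) \<and>
        (\<forall>x\<in>W. frechet_derivative (f \<circ> \<psi>) (at u within D) x = 0 \<longrightarrow> x = 0))"

definition circle_bundle :: "'p set \<Rightarrow> ('p \<Rightarrow> complex^'n^'n) \<Rightarrow> ('p \<times> (complex^'n)) set" where
  "circle_bundle M f = {(p, z). p \<in> M \<and> z \<in> sphere 0 1 \<and> f p = hopf z}"

section \<open>Total absolute curvature\<close>

text \<open>Both definitions are meant for positive codimension, where the exponents are nonnegative.
  Here \<open>X\<close> is an \<open>n\<close>-manifold immersed by \<open>F\<close> in the unit sphere of \<open>'v\<close>.\<close>

definition total_abs_curvature_sphere ::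
  "nat \<Rightarrow> 'x::topological_space set \<Rightarrow> ('x \<Rightarrow> 'v::euclidean_space) \<Rightarrow> ennreal" where
  "total_abs_curvature_sphere n X F =
     (let k = DIM('v) - 1; S = sphere (0::'v) 1 in
      1 / emeasure (riemannian_volume k S id) S *
      normal_bundle_integral k S n X F pi
        (\<lambda>p v. \<bar>jacobi_det k S n X F p v\<bar> * sinc (norm v) ^ (k - n - 1)))"

text \<open>Here \<open>M\<close> has complex dimension \<open>m\<close>, hence real dimension \<open>2 * m\<close>.\<close>

definition total_abs_curvature_CP ::
  "nat \<Rightarrow> 'p::topological_space set \<Rightarrow> ('p \<Rightarrow> complex^'n^'n) \<Rightarrow> ennreal" where
  "total_abs_curvature_CP m M f =
     (let N = CARD('n) - 1 in
      2 / emeasure (riemannian_volume (2 * N) (CP :: (complex^'n^'n) set) id) CP *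
      normal_bundle_integral (2 * N) CP (2 * m) M f (pi / 2)
        (\<lambda>p v. \<bar>jacobi_det (2 * N) CP (2 * m) M f p v\<bar> * cos (norm v) *
                sinc (norm v) ^ (2 * N - 2 * m - 1)))"

end

theory Submission
  imports Defs
begin

text \<open>
  Let \<open>y\<close> be a point of the circle bundle over \<open>p\<close>, with image \<open>z\<close> in the sphere.  The differential of the Hopf
  map at \<open>z\<close> maps the normal space at \<open>y\<close> isometrically onto the normal space at \<open>p\<close>.  Computing
  second derivatives in a chart that has the angle of the fibre as an additional coordinate shows that the shape
  operator at \<open>y\<close> is the horizontal lift of the one at \<open>p\<close> and vanishes on \<open>\<i> z\<close>; here it is used that
  the tangent space at \<open>p\<close> is complex.  Hence the two Jacobi determinants differ by the factor \<open>cos r\<close>, and the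
  fibre integrand of the sphere over \<open>r < \<pi>\<close> is the one of projective space with \<open>\<bar>cos r\<bar>\<close> instead of \<open>cos r\<close>.
  As this is invariant under \<open>v = r u \<mapsto> (\<pi> - r) (- u)\<close>, the half-balls \<open>r < \<pi> / 2\<close> and \<open>r > \<pi> / 2\<close>
  contribute equally, which gives the factor \<open>2\<close>.  The fibres have length \<open>2 \<pi>\<close>, both over the manifold and, for
  the sphere, over projective space, and these two factors cancel.
\<close>

section \<open>Lebesgue measure on subspaces\<close>

text \<open>Volumes and shape operators enter as definite descriptions, so they have to be shown to
  exist: a shape operator needs a normal field with a prescribed value at a point, and a volume
  needs the change of variables formula between different subspaces of the same dimension. The
  vertical terms disappear for the following reason. Rotation along the fibre adds to the second
  derivatives of the lifted immersion only vectors of the form \<open>\<i>\<close> times a tangent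
  vector. Because the horizontal tangent vectors form a complex space, a normal vector is orthogonal
  to the tangent space for the Hermitian product, not just for its real part, and does not see these
  terms. A further obstacle is measurability. The integral over a normal space is not known to
  depend measurably on its base point, so integration along the circles and extraction of constants
  are proved for arbitrary nonnegative functions. The normal integrand itself is measurable because
  the shape operator extends to a map that is linear in the normal vector.\<close>

definition orthonormal :: "'v::euclidean_space set \<Rightarrow> bool" where
  "orthonormal B \<longleftrightarrow> pairwise orthogonal B \<and> (\<forall>b\<in>B. norm b = 1)"

text \<open>The basis is an explicit argument here, whereas \<open>subspace_lborel\<close> uses the
  basis selected by choice. This allows measures built from adapted bases; independence of the
  orthonormal basis is \<open>coord_lborel_cong\<close>.\<close>

definition coord_lborel :: "'v::euclidean_space set \<Rightarrow> 'v measure" where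
  "coord_lborel B = distr (\<Pi>\<^sub>M b\<in>B. (lborel :: real measure)) borel (\<lambda>c. \<Sum>b\<in>B. c b *\<^sub>R b)"

lemma orthonormal_inner:
  "orthonormal B \<Longrightarrow> b \<in> B \<Longrightarrow> c \<in> B \<Longrightarrow> b \<bullet> c = (if b = c then 1 else 0)"
  by (auto simp: orthonormal_def pairwise_def orthogonal_def norm_eq_1)

lemma orthonormal_indep: "orthonormal B \<Longrightarrow> independent B"
  by (rule pairwise_orthogonal_independent) (auto simp: orthonormal_def)

lemma orthonormal_finite: "orthonormal B \<Longrightarrow> finite B"
  using orthonormal_indep independent_imp_finite by blast

lemma orthonormal_card: "orthonormal B \<Longrightarrow> card B = dim (span B)"
  by (simp add: dim_eq_card_independent orthonormal_indep)

lemma orthonormal_subset: "orthonormal B \<Longrightarrow> C \<subseteq> B \<Longrightarrow> orthonormal C"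
  by (auto simp: orthonormal_def pairwise_def)

lemma orthonormal_sum_inner:
  assumes "orthonormal B" "b \<in> B"
  shows "(\<Sum>d\<in>B. c d *\<^sub>R d) \<bullet> b = c b"
proof -
  have "(\<Sum>d\<in>B. c d *\<^sub>R d) \<bullet> b = (\<Sum>d\<in>B. if d = b then c d else 0)"
    unfolding inner_sum_left
    by (intro sum.cong refl) (use assms in \<open>auto simp: orthonormal_inner\<close>)
  then show ?thesis using assms orthonormal_finite[OF assms(1)] by simp
qed

lemma orthonormal_expand:
  assumes "orthonormal B" "x \<in> span B"
  shows "(\<Sum>b\<in>B. (x \<bullet> b) *\<^sub>R b) = x"
proof -
  obtain c where c: "x = (\<Sum>d\<in>B. c d *\<^sub>R d)"
    using assms(2) span_finite[OF orthonormal_finite[OF assms(1)]] by auto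
  show ?thesis unfolding c by (intro sum.cong refl) (simp add: orthonormal_sum_inner[OF assms(1)])
qed

lemma orthonormal_inner_expand:
  assumes "orthonormal B" "x \<in> span B"
  shows "x \<bullet> y = (\<Sum>b\<in>B. (x \<bullet> b) * (b \<bullet> y))"
proof -
  have "x \<bullet> y = (\<Sum>b\<in>B. (x \<bullet> b) *\<^sub>R b) \<bullet> y" by (simp add: orthonormal_expand[OF assms])
  then show ?thesis by (simp add: inner_sum_left)
qed

lemma onb_exists:
  assumes "subspace S" shows "\<exists>B. orthonormal B \<and> span B = S"
proof -
  obtain B where "B \<subseteq> S" "pairwise orthogonal B" "\<And>x. x \<in> B \<Longrightarrow> norm x = 1" "span B = S"
    using orthonormal_basis_subspace[OF assms] by metis
  then show ?thesis by (auto simp: orthonormal_def)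
qed

lemma onb: assumes "subspace S" shows "orthonormal (onb S)" "span (onb S) = S"
proof -
  obtain B where "orthonormal B" "span B = S" using onb_exists[OF assms] by auto
  then have "\<exists>B. pairwise orthogonal B \<and> (\<forall>b\<in>B. norm b = 1) \<and> span B = S"
    by (auto simp: orthonormal_def)
  from someI_ex[OF this] show "orthonormal (onb S)" "span (onb S) = S"
    by (auto simp: orthonormal_def onb_def)
qed

lemma onb_finite: "subspace S \<Longrightarrow> finite (onb S)"
  and onb_subset: "subspace S \<Longrightarrow> onb S \<subseteq> S"
  and card_onb: "subspace S \<Longrightarrow> card (onb S) = dim S"
  using onb[of S] orthonormal_finite[of "onb S"] orthonormal_card[of "onb S"] span_superset[of "onb S"]
  by auto

lemma subspace_lborel_eq: "subspace_lborel S = coord_lborel (onb S)"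
  by (simp add: subspace_lborel_def coord_lborel_def)

interpretation lb: product_sigma_finite "\<lambda>_::'i. lborel :: real measure" ..

lemma coord_sum_measurable [measurable]:
  "(\<lambda>c. \<Sum>b\<in>B. c b *\<^sub>R b) \<in> (\<Pi>\<^sub>M b\<in>B. (lborel :: real measure)) \<rightarrow>\<^sub>M (borel :: 'v::euclidean_space measure)"
  by measurable

lemma sets_coord_lborel [simp, measurable_cong]: "sets (coord_lborel B) = sets borel"
  and space_coord_lborel [simp]: "space (coord_lborel B) = UNIV"
  by (simp_all add: coord_lborel_def)

lemma coord_lborel_Basis: "coord_lborel (Basis :: 'v::euclidean_space set) = lborel"
  by (simp add: coord_lborel_def lborel_eq_real) (simp add: lborel_def)

section \<open>Affine substitutions in coordinate Lebesgue measure\<close>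

lemma emeasure_lborel_affine_vimage:
  assumes "s \<noteq> 0" "A \<in> sets lborel"
  shows "ennreal \<bar>s\<bar> * emeasure lborel {x. a + s * x \<in> A} = emeasure lborel (A :: real set)"
proof -
  have A[measurable]: "A \<in> sets borel" using assms by simp
  have "emeasure lborel A = emeasure (density (distr lborel borel (\<lambda>x. a + s * x)) (\<lambda>_. ennreal \<bar>s\<bar>)) A"
    by (subst lborel_real_affine[OF assms(1), of a]) simp
  also have "\<dots> = ennreal \<bar>s\<bar> * emeasure (distr lborel borel (\<lambda>x. a + s * x)) A"
    by (subst emeasure_density_const) auto
  also have "emeasure (distr lborel borel (\<lambda>x. a + s * x)) A = emeasure lborel {x. a + s * x \<in> A}"
    by (subst emeasure_distr) (auto simp: vimage_def)
  finally show ?thesis by simp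
qed

text \<open>On a box each coordinate contributes one factor \<open>\<bar>s\<bar>\<close>, and a
  product measure is determined by its values on boxes.\<close>

lemma PiM_lborel_affine:
  assumes fin: "finite (B :: 'i set)" and s: "s \<noteq> 0"
  shows "density (distr (\<Pi>\<^sub>M b\<in>B. lborel) (\<Pi>\<^sub>M b\<in>B. lborel) (\<lambda>c. \<lambda>b\<in>B. a b + s * c b))
      (\<lambda>_. ennreal (\<bar>s\<bar> ^ card B)) = (\<Pi>\<^sub>M b\<in>B. (lborel :: real measure))"
proof (rule lb.PiM_eqI[OF fin])
  fix A :: "'i \<Rightarrow> real set" assume A: "\<And>i. i \<in> B \<Longrightarrow> A i \<in> sets lborel"
  interpret f: finite_product_sigma_finite "\<lambda>_::'i. lborel :: real measure" B by standard (rule fin)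
  have AA[measurable]: "Pi\<^sub>E B A \<in> sets (\<Pi>\<^sub>M b\<in>B. lborel)" using A fin by (intro sets_PiM_I_finite) auto
  have meas[measurable]: "(\<lambda>c. \<lambda>b\<in>B. a b + s * c b) \<in> (\<Pi>\<^sub>M b\<in>B. lborel) \<rightarrow>\<^sub>M (\<Pi>\<^sub>M b\<in>B. (lborel :: real measure))"
    by (rule measurable_restrict) measurable
  have pre: "(\<lambda>c. \<lambda>b\<in>B. a b + s * c b) -` Pi\<^sub>E B A \<inter> space (\<Pi>\<^sub>M b\<in>B. (lborel :: real measure)) =
     Pi\<^sub>E B (\<lambda>b. {x. a b + s * x \<in> A b})"
    by (auto simp: space_PiM PiE_iff)
  have "emeasure (density (distr (\<Pi>\<^sub>M b\<in>B. lborel) (\<Pi>\<^sub>M b\<in>B. lborel) (\<lambda>c. \<lambda>b\<in>B. a b + s * c b))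
      (\<lambda>_. ennreal (\<bar>s\<bar> ^ card B))) (Pi\<^sub>E B A) =
      ennreal (\<bar>s\<bar> ^ card B) * emeasure (\<Pi>\<^sub>M b\<in>B. (lborel :: real measure)) (Pi\<^sub>E B (\<lambda>b. {x. a b + s * x \<in> A b}))"
    by (subst emeasure_density_const) (auto simp: emeasure_distr pre)
  also have "emeasure (\<Pi>\<^sub>M b\<in>B. (lborel :: real measure)) (Pi\<^sub>E B (\<lambda>b. {x. a b + s * x \<in> A b})) =
     (\<Prod>b\<in>B. emeasure lborel {x. a b + s * x \<in> A b})"
  proof (rule f.measure_times)
    fix i assume "i \<in> B"
    from A[OF this] have [measurable]: "A i \<in> sets borel" by simp
    show "{x. a i + s * x \<in> A i} \<in> sets lborel" by measurable
  qed
  also have "ennreal (\<bar>s\<bar> ^ card B) * (\<Prod>b\<in>B. emeasure lborel {x. a b + s * x \<in> A b}) =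
     (\<Prod>b\<in>B. ennreal \<bar>s\<bar> * emeasure lborel {x. a b + s * x \<in> A b})"
    by (simp add: ennreal_power prod.distrib)
  also have "\<dots> = (\<Prod>b\<in>B. emeasure lborel (A b))"
    by (intro prod.cong refl emeasure_lborel_affine_vimage s A)
  finally show "emeasure (density (distr (\<Pi>\<^sub>M b\<in>B. lborel) (\<Pi>\<^sub>M b\<in>B. lborel) (\<lambda>c. \<lambda>b\<in>B. a b + s * c b))
      (\<lambda>_. ennreal (\<bar>s\<bar> ^ card B))) (Pi\<^sub>E B A) = (\<Prod>i\<in>B. emeasure lborel (A i))" .
qed simp

text \<open>Translations, the reflection \<open>s = -1\<close> and positive scalings are all needed
  later, so they are kept in one substitution. The shift must lie in the span, which carries the
  measure.\<close>

lemma nn_integral_coord_affine: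
  assumes B: "orthonormal B" and s: "s \<noteq> 0" and y: "y \<in> span B" and [measurable]: "h \<in> borel_measurable borel"
  shows "(\<integral>\<^sup>+x. h x \<partial>coord_lborel B) = ennreal (\<bar>s\<bar> ^ card B) * (\<integral>\<^sup>+x. h (y + s *\<^sub>R x) \<partial>coord_lborel B)"
proof -
  define a where "a b = y \<bullet> b" for b
  note fin = orthonormal_finite[OF B]
  have meas[measurable]: "(\<lambda>c. \<lambda>b\<in>B. a b + s * c b) \<in> (\<Pi>\<^sub>M b\<in>B. lborel) \<rightarrow>\<^sub>M (\<Pi>\<^sub>M b\<in>B. (lborel :: real measure))"
    by (rule measurable_restrict) measurable
  have "(\<integral>\<^sup>+x. h x \<partial>coord_lborel B) = (\<integral>\<^sup>+c. h (\<Sum>b\<in>B. c b *\<^sub>R b) \<partial>(\<Pi>\<^sub>M b\<in>B. lborel))"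
    by (simp add: coord_lborel_def nn_integral_distr)
  also have "\<dots> = ennreal (\<bar>s\<bar> ^ card B) *
      (\<integral>\<^sup>+c. h (\<Sum>b\<in>B. (a b + s * c b) *\<^sub>R b) \<partial>(\<Pi>\<^sub>M b\<in>B. lborel))"
    by (subst PiM_lborel_affine[OF fin s, of a, symmetric])
       (simp add: nn_integral_density nn_integral_distr nn_integral_cmult)
  also have "(\<lambda>c. (\<Sum>b\<in>B. (a b + s * c b) *\<^sub>R b)) = (\<lambda>c. y + s *\<^sub>R (\<Sum>b\<in>B. c b *\<^sub>R b))"
    using orthonormal_expand[OF B y]
    by (simp add: a_def scaleR_add_left sum.distrib scaleR_sum_right)
  also have "(\<integral>\<^sup>+c. h (y + s *\<^sub>R (\<Sum>b\<in>B. c b *\<^sub>R b)) \<partial>(\<Pi>\<^sub>M b\<in>B. lborel)) =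
      (\<integral>\<^sup>+x. h (y + s *\<^sub>R x) \<partial>coord_lborel B)"
    by (simp add: coord_lborel_def nn_integral_distr)
  finally show ?thesis .
qed

section \<open>Measures of balls and independence of the orthonormal basis\<close>

lemma emeasure_coord_lborel:
  assumes [measurable]: "E \<in> sets borel"
  shows "emeasure (coord_lborel B) E =
    emeasure (\<Pi>\<^sub>M b\<in>B. lborel) {c \<in> space (\<Pi>\<^sub>M b\<in>B. (lborel :: real measure)). (\<Sum>b\<in>B. c b *\<^sub>R b) \<in> E}"
  unfolding coord_lborel_def by (subst emeasure_distr) (auto intro!: arg_cong2[where f=emeasure])

lemma coord_lborel_AE_span: "AE x in coord_lborel B. x \<in> span B"
proof -
  have "closed (span B)" by (simp add: closed_subspace)
  then have [measurable]: "span B \<in> sets borel" by (rule borel_closed)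
  show ?thesis unfolding coord_lborel_def
    by (subst AE_distr_iff) (auto intro!: AE_I2 span_sum intro: span_scale span_base)
qed

text \<open>The coordinates of points in the ball lie in a box by Cauchy-Schwarz, and a small box
  lies in the ball by the triangle inequality. Finiteness gives sigma-finiteness; positivity permits
  division by the measure of the ball.\<close>

lemma emeasure_coord_lborel_cball:
  assumes B: "orthonormal (B :: 'a::euclidean_space set)"
  shows "emeasure (coord_lborel B) (cball 0 r) < \<infinity>"
    and "r > 0 \<Longrightarrow> emeasure (coord_lborel B) (cball 0 r) > 0"
proof -
  note fin = orthonormal_finite[OF B]
  let ?P = "\<Pi>\<^sub>M b\<in>B. (lborel :: real measure)"
  have times: "emeasure ?P (Pi\<^sub>E B A) = (\<Prod>i\<in>B. emeasure lborel (A i))"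
    if "\<And>i. i \<in> B \<Longrightarrow> A i \<in> sets lborel" for A :: "'a \<Rightarrow> real set"
    using lb.emeasure_PiM[OF fin, of A] that by auto
  have "{c \<in> space ?P. (\<Sum>b\<in>B. c b *\<^sub>R b) \<in> cball 0 r} \<subseteq> Pi\<^sub>E B (\<lambda>_. {-r..r})"
  proof
    fix c assume "c \<in> {c \<in> space ?P. (\<Sum>b\<in>B. c b *\<^sub>R b) \<in> cball 0 r}"
    then have c: "c \<in> space ?P" "(\<Sum>b\<in>B. c b *\<^sub>R b) \<in> cball 0 r" by auto
    have "\<bar>c b\<bar> \<le> r" if "b \<in> B" for b
    proof -
      have "\<bar>c b\<bar> = \<bar>(\<Sum>d\<in>B. c d *\<^sub>R d) \<bullet> b\<bar>" by (simp add: orthonormal_sum_inner[OF B that])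
      also have "\<dots> \<le> norm (\<Sum>d\<in>B. c d *\<^sub>R d) * norm b" by (rule Cauchy_Schwarz_ineq2)
      also have "norm b = 1" using B that by (auto simp: orthonormal_def)
      finally show ?thesis using c by simp
    qed
    then show "c \<in> Pi\<^sub>E B (\<lambda>_. {-r..r})" using c by (auto simp: space_PiM PiE_iff abs_le_iff minus_le_iff)
  qed
  then have "emeasure (coord_lborel B) (cball 0 r) \<le> emeasure ?P (Pi\<^sub>E B (\<lambda>_. {-r..r}))"
    unfolding emeasure_coord_lborel[OF borel_closed[OF closed_cball]]
    by (intro emeasure_mono sets_PiM_I_finite fin) auto
  also have "\<dots> = (\<Prod>b\<in>B. emeasure lborel {-r..r})" by (rule times) auto
  also have "\<dots> < \<infinity>" by (auto simp: less_top[symmetric] ennreal_prod_eq_top emeasure_lborel_Icc_eq simp del: prod_constant)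
  finally have lt: "emeasure (coord_lborel B) (cball 0 r) < \<infinity>" .
  have pos: "emeasure (coord_lborel B) (cball 0 r) > 0" if r: "r > 0"
  proof -
  \<comment> \<open>A sum of \<open>card B\<close> vectors of norm at most \<open>q\<close> has norm
    at most \<open>r\<close>. The \<open>+ 1\<close> keeps the quotient meaningful for the empty
    basis, that is in dimension zero.\<close>
  define q where "q = r / (card B + 1)"
  have q: "q > 0" using r by (simp add: q_def)
  have "0 < (\<Prod>b\<in>B. emeasure lborel {0..q})"
    using q by (auto simp: zero_less_iff_neq_zero fin)
  also have "\<dots> = emeasure ?P (Pi\<^sub>E B (\<lambda>_. {0..q}))" by (rule times[symmetric]) auto
  also have "\<dots> \<le> emeasure (coord_lborel B) (cball 0 r)"
    unfolding emeasure_coord_lborel[OF borel_closed[OF closed_cball]]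
  proof (intro emeasure_mono, safe)
    fix c assume c: "c \<in> Pi\<^sub>E B (\<lambda>_. {0..q})"
    then show "c \<in> space ?P" by (auto simp: space_PiM PiE_iff)
    have "norm (\<Sum>b\<in>B. c b *\<^sub>R b) \<le> (\<Sum>b\<in>B. q)"
      by (rule sum_norm_le) (use c B in \<open>auto simp: orthonormal_def PiE_iff\<close>)
    also have "\<dots> \<le> r" using r by (simp add: q_def field_simps)
    finally show "(\<Sum>b\<in>B. c b *\<^sub>R b) \<in> cball 0 r" by simp
  next
    show "{c \<in> space ?P. (\<Sum>b\<in>B. c b *\<^sub>R b) \<in> cball 0 r} \<in> sets ?P"
      using measurable_sets[OF coord_sum_measurable[of B] borel_closed[OF closed_cball[of 0 r]]]
      by (simp add: vimage_def Int_def conj_commute)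
  qed
  finally show "emeasure (coord_lborel B) (cball 0 r) > 0" .
  qed
  show "emeasure (coord_lborel B) (cball 0 r) < \<infinity>" by (rule lt)
  show "r > 0 \<Longrightarrow> emeasure (coord_lborel B) (cball 0 r) > 0" by (rule pos)
qed

lemma sigma_finite_coord_lborel:
  assumes B: "orthonormal B" shows "sigma_finite_measure (coord_lborel B)"
proof
  have "(\<Union>n::nat. cball (0::'a) (real n)) = UNIV"
    by (auto simp: real_arch_simple)
  then show "\<exists>A. countable A \<and> A \<subseteq> sets (coord_lborel B) \<and> \<Union>A = space (coord_lborel B) \<and>
      (\<forall>a\<in>A. emeasure (coord_lborel B) a \<noteq> \<infinity>)"
    using emeasure_coord_lborel_cball(1)[OF B]
    by (intro exI[of _ "range (\<lambda>n::nat. cball 0 (real n))"]) (auto simp: less_top)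
qed

lemma distr_coord_lborel:
  assumes B: "orthonormal (B :: 'v::euclidean_space set)" and f: "linear (f :: 'v \<Rightarrow> 'w::euclidean_space)"
    and inj: "inj_on f B"
  shows "distr (coord_lborel B) borel f = coord_lborel (f ` B)"
proof -
  note fin = orthonormal_finite[OF B]
  have fm[measurable]: "f \<in> borel \<rightarrow>\<^sub>M borel"
    using f by (intro borel_measurable_continuous_onI linear_continuous_on) (simp add: linear_conv_bounded_linear)
  define r where "r c = (\<lambda>b\<in>B. c (f b))" for c :: "'w \<Rightarrow> real"
  have r[measurable]: "r \<in> (\<Pi>\<^sub>M b\<in>f ` B. lborel) \<rightarrow>\<^sub>M (\<Pi>\<^sub>M b\<in>B. (lborel :: real measure))"
    unfolding r_def by (rule measurable_restrict) (auto intro!: measurable_component_singleton)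
  have "distr (\<Pi>\<^sub>M b\<in>f ` B. lborel) (\<Pi>\<^sub>M b\<in>B. (lborel :: real measure)) r = (\<Pi>\<^sub>M b\<in>B. lborel)"
  proof (rule lb.PiM_eqI[OF fin])
    interpret g: finite_product_sigma_finite "\<lambda>_::'w. lborel :: real measure" "f ` B" by standard (simp add: fin)
    fix A :: "'v \<Rightarrow> real set" assume A: "\<And>i. i \<in> B \<Longrightarrow> A i \<in> sets lborel"
    have pre: "r -` Pi\<^sub>E B A \<inter> space (\<Pi>\<^sub>M b\<in>f ` B. (lborel :: real measure)) = Pi\<^sub>E (f ` B) (\<lambda>d. A (the_inv_into B f d))"
      using inj by (auto simp: space_PiM PiE_iff r_def the_inv_into_f_f Pi_def)
    have "emeasure (distr (\<Pi>\<^sub>M b\<in>f ` B. lborel) (\<Pi>\<^sub>M b\<in>B. (lborel :: real measure)) r) (Pi\<^sub>E B A) =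
       emeasure (\<Pi>\<^sub>M b\<in>f ` B. lborel) (Pi\<^sub>E (f ` B) (\<lambda>d. A (the_inv_into B f d)))"
      using A fin by (subst emeasure_distr) (auto simp: pre intro!: sets_PiM_I_finite)
    also have "\<dots> = (\<Prod>d\<in>f ` B. emeasure lborel (A (the_inv_into B f d)))"
      by (rule g.measure_times) (use A inj in \<open>auto simp: the_inv_into_f_f\<close>)
    also have "\<dots> = (\<Prod>d\<in>B. emeasure lborel (A d))"
      by (subst prod.reindex[OF inj]) (simp add: the_inv_into_f_f[OF inj])
    finally show "emeasure (distr (\<Pi>\<^sub>M b\<in>f ` B. lborel) (\<Pi>\<^sub>M b\<in>B. (lborel :: real measure)) r) (Pi\<^sub>E B A) =
      (\<Prod>i\<in>B. emeasure lborel (A i))" .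
  qed simp
  then have "distr (coord_lborel B) borel f =
     distr (distr (\<Pi>\<^sub>M b\<in>f ` B. lborel) (\<Pi>\<^sub>M b\<in>B. (lborel :: real measure)) r) borel (\<lambda>c. f (\<Sum>b\<in>B. c b *\<^sub>R b))"
    by (simp add: coord_lborel_def distr_distr comp_def)
  also have "\<dots> = distr (\<Pi>\<^sub>M b\<in>f ` B. lborel) borel (\<lambda>c. f (\<Sum>b\<in>B. r c b *\<^sub>R b))"
    by (subst distr_distr) (auto simp: comp_def)
  also have "(\<lambda>c. f (\<Sum>b\<in>B. r c b *\<^sub>R b)) = (\<lambda>c. \<Sum>d\<in>f ` B. c d *\<^sub>R d)"
    by (simp add: sum.reindex[OF inj] linear_sum[OF f] linear_scale[OF f] r_def)
  finally show ?thesis by (simp add: coord_lborel_def)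
qed

text \<open>A bijection between orthonormal bases extends to a linear map that preserves norms on
  the span and transports the measure. This fixes the normalization in the uniqueness argument that
  follows.\<close>

lemma emeasure_coord_lborel_cball_cong:
  assumes B: "orthonormal (B :: 'v::euclidean_space set)" and C: "orthonormal (C :: 'w::euclidean_space set)"
    and card: "card B = card C"
  shows "emeasure (coord_lborel B) (cball 0 r) = emeasure (coord_lborel C) (cball 0 r)"
proof -
  obtain h where h: "bij_betw h B C"
    using finite_same_card_bij[OF orthonormal_finite[OF B] orthonormal_finite[OF C] card] by auto
  obtain f where f: "linear f" "\<And>b. b \<in> B \<Longrightarrow> f b = h b"
  proof -
    have "\<exists>g. linear g \<and> (\<forall>x\<in>B. g x = h x)"
      by (rule linear_independent_extend[OF orthonormal_indep[OF B]])
    then show ?thesis using that by auto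
  qed
  have fB: "f ` B = C" "inj_on f B" using h f(2) by (auto simp: bij_betw_def inj_on_def)
  have fm[measurable]: "f \<in> borel \<rightarrow>\<^sub>M borel"
    using f by (intro borel_measurable_continuous_onI linear_continuous_on) (simp add: linear_conv_bounded_linear)
  have nf: "norm (f x) = norm x" if "x \<in> span B" for x
  proof -
    have 1: "f x = (\<Sum>b\<in>B. (x \<bullet> b) *\<^sub>R h b)"
      by (subst orthonormal_expand[OF B that, symmetric]) (simp add: linear_sum f linear_scale)
    have "f x \<bullet> f x = (\<Sum>b\<in>B. \<Sum>c\<in>B. (x \<bullet> b) * (x \<bullet> c) * (h b \<bullet> h c))"
      unfolding 1 by (simp add: inner_sum_left inner_sum_right mult_ac sum_distrib_left inner_commute)
    also have "\<dots> = (\<Sum>b\<in>B. \<Sum>c\<in>B. (x \<bullet> b) * (x \<bullet> c) * (b \<bullet> c))"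
    proof (intro sum.cong refl)
      fix b c assume bc: "b \<in> B" "c \<in> B"
      then have "h b = h c \<longleftrightarrow> b = c" using h by (auto simp: bij_betw_def inj_on_def)
      moreover have "h b \<in> C" "h c \<in> C" using bc h by (auto simp: bij_betw_def)
      ultimately show "(x \<bullet> b) * (x \<bullet> c) * (h b \<bullet> h c) = (x \<bullet> b) * (x \<bullet> c) * (b \<bullet> c)"
        using bc B C by (simp add: orthonormal_inner)
    qed
    also have "\<dots> = (\<Sum>b\<in>B. (x \<bullet> b) *\<^sub>R b) \<bullet> (\<Sum>b\<in>B. (x \<bullet> b) *\<^sub>R b)"
      by (simp add: inner_sum_left inner_sum_right mult_ac sum_distrib_left inner_commute)
    also have "\<dots> = x \<bullet> x" by (simp add: orthonormal_expand[OF B that])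
    finally show ?thesis by (simp add: norm_eq_sqrt_inner)
  qed
  have "emeasure (coord_lborel C) (cball 0 r) = emeasure (distr (coord_lborel B) borel f) (cball 0 r)"
    using distr_coord_lborel[OF B f(1) fB(2)] fB(1) by simp
  also have "\<dots> = emeasure (coord_lborel B) (f -` cball 0 r)"
    by (subst emeasure_distr) auto
  also have "\<dots> = emeasure (coord_lborel B) (cball 0 r)"
  proof (rule emeasure_eq_AE)
    show "AE x in coord_lborel B. (x \<in> f -` cball 0 r) = (x \<in> cball 0 r)"
      using coord_lborel_AE_span by eventually_elim (simp add: nf)
    show "f -` cball 0 r \<in> sets (coord_lborel B)"
      using measurable_sets[OF fm, of "cball 0 r"] by simp
  qed simp
  finally show ?thesis by simp
qed

text \<open>Uniqueness of translation-invariant measures: both sides, multiplied by the measure of the unit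
  ball, are iterated integrals of the same function.\<close>

lemma coord_lborel_cong:
  assumes B: "orthonormal B" and C: "orthonormal C" and eq: "span B = span C"
  shows "coord_lborel B = coord_lborel C"
proof (rule measure_eqI)
  fix A assume "A \<in> sets (coord_lborel B)"
  then have A[measurable]: "A \<in> sets borel" by simp
  interpret m: sigma_finite_measure "coord_lborel B" by (rule sigma_finite_coord_lborel[OF B])
  interpret n: sigma_finite_measure "coord_lborel C" by (rule sigma_finite_coord_lborel[OF C])
  interpret mn: pair_sigma_finite "coord_lborel B" "coord_lborel C" ..
  interpret nm: pair_sigma_finite "coord_lborel C" "coord_lborel B" ..
  define \<mu> where "\<mu> = coord_lborel B"
  define \<nu> where "\<nu> = coord_lborel C"
  define K where "K = cball (0::'a) 1"
  have K[measurable]: "K \<in> sets borel" by (simp add: K_def)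
  have swap: "(\<integral>\<^sup>+y. \<integral>\<^sup>+x. h x y \<partial>\<mu> \<partial>\<nu>) = (\<integral>\<^sup>+x. \<integral>\<^sup>+y. h x y \<partial>\<nu> \<partial>\<mu>)"
    if "(\<lambda>(x, y). h x y) \<in> borel_measurable (borel \<Otimes>\<^sub>M borel)" for h
    using mn.Fubini'[of h] that unfolding \<mu>_def \<nu>_def by (simp cong: measurable_cong_sets)
  have spanB: "AE x in \<mu>. x \<in> span B" and spanC: "AE x in \<nu>. x \<in> span B"
    unfolding \<mu>_def \<nu>_def using coord_lborel_AE_span[of B] coord_lborel_AE_span[of C] eq by auto
  have tm: "(\<integral>\<^sup>+x. h x \<partial>\<mu>) = (\<integral>\<^sup>+x. h (y + s *\<^sub>R x) \<partial>\<mu>)"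
    if [measurable]: "h \<in> borel_measurable borel" and y: "y \<in> span B" and s: "\<bar>s\<bar> = 1" for h y s
    using nn_integral_coord_affine[OF B _ y that(1), of s] s unfolding \<mu>_def by (cases "s = 0") auto
  have tn: "(\<integral>\<^sup>+x. h x \<partial>\<nu>) = (\<integral>\<^sup>+x. h (y + x) \<partial>\<nu>)"
    if [measurable]: "h \<in> borel_measurable borel" and y: "y \<in> span B" for h y
    using nn_integral_coord_affine[OF C _ _ that(1), of 1 y] y eq unfolding \<nu>_def by auto
  have "emeasure \<nu> A * emeasure \<mu> K = (\<integral>\<^sup>+y. \<integral>\<^sup>+x. indicator A y * indicator K x \<partial>\<mu> \<partial>\<nu>)"
    unfolding \<mu>_def \<nu>_def by (simp add: nn_integral_cmult nn_integral_multc)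
  also have "\<dots> = (\<integral>\<^sup>+y. \<integral>\<^sup>+x. indicator A y * indicator K (y + (-1) *\<^sub>R x) \<partial>\<mu> \<partial>\<nu>)"
    by (rule nn_integral_cong_AE, use spanC in eventually_elim) (rule tm, auto)
  also have "\<dots> = (\<integral>\<^sup>+x. \<integral>\<^sup>+y. indicator A y * indicator K (y + (-1) *\<^sub>R x) \<partial>\<nu> \<partial>\<mu>)"
    by (rule swap) measurable
  also have "\<dots> = (\<integral>\<^sup>+x. \<integral>\<^sup>+y. indicator A (x + y) * indicator K ((x + y) + (-1) *\<^sub>R x) \<partial>\<nu> \<partial>\<mu>)"
    by (rule nn_integral_cong_AE, use spanB in eventually_elim) (rule tn, auto)
  also have "\<dots> = (\<integral>\<^sup>+x. \<integral>\<^sup>+y. indicator A (x + y) * indicator K y \<partial>\<nu> \<partial>\<mu>)"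
    by simp
  also have "\<dots> = (\<integral>\<^sup>+y. \<integral>\<^sup>+x. indicator A (x + y) * indicator K y \<partial>\<mu> \<partial>\<nu>)"
    by (rule swap[symmetric]) measurable
  also have "\<dots> = (\<integral>\<^sup>+y. \<integral>\<^sup>+x. indicator A x * indicator K y \<partial>\<mu> \<partial>\<nu>)"
  proof (rule nn_integral_cong_AE, use spanC in eventually_elim)
    fix y assume "y \<in> span B"
    from tm[of "\<lambda>x. indicator A x * indicator K y", OF _ this, of 1]
    show "(\<integral>\<^sup>+x. indicator A (x + y) * indicator K y \<partial>\<mu>) = (\<integral>\<^sup>+x. indicator A x * indicator K y \<partial>\<mu>)"
      by (simp add: add.commute)
  qed
  also have "\<dots> = emeasure \<mu> A * emeasure \<nu> K"
    unfolding \<mu>_def \<nu>_def by (simp add: nn_integral_cmult nn_integral_multc)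
  finally have *: "emeasure \<nu> A * emeasure \<mu> K = emeasure \<mu> A * emeasure \<nu> K" .
  \<comment> \<open>The identity just obtained only makes the two measures proportional. Equal
    values on the unit ball turn the factor into one.\<close>
  have KK: "emeasure \<nu> K = emeasure \<mu> K"
    unfolding \<mu>_def \<nu>_def K_def by (rule emeasure_coord_lborel_cball_cong) (simp_all add: B C eq orthonormal_card)
  have "emeasure \<mu> K \<noteq> 0" "emeasure \<mu> K \<noteq> \<infinity>"
    using emeasure_coord_lborel_cball[OF B, of 1] unfolding \<mu>_def K_def by auto
  then have "emeasure \<mu> A = emeasure \<nu> A"
    using * KK ennreal_mult_cancel_left[of "emeasure \<mu> K" "emeasure \<mu> A" "emeasure \<nu> A"]
    by (auto simp: mult.commute)
  then show "emeasure (coord_lborel B) A = emeasure (coord_lborel C) A" by (simp add: \<mu>_def \<nu>_def)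
qed simp

lemma coord_lborel_onb: "orthonormal B \<Longrightarrow> coord_lborel B = subspace_lborel (span B)"
  unfolding subspace_lborel_eq by (rule coord_lborel_cong) (auto simp: onb)

section \<open>Isometric images and orthogonal sums\<close>

lemma sets_subspace_lborel [simp, measurable_cong]: "sets (subspace_lborel S) = sets borel"
  and space_subspace_lborel [simp]: "space (subspace_lborel S) = UNIV"
  by (simp_all add: subspace_lborel_eq)

lemma subspace_lborel_AE: "subspace S \<Longrightarrow> AE x in subspace_lborel S. x \<in> S"
  using coord_lborel_AE_span[of "onb S"] unfolding subspace_lborel_eq by (simp add: onb)

text \<open>Linearity is global but inner products are preserved on \<open>S\<close> only. The map
  of interest is \<open>hopf_deriv z\<close>, which has a kernel and is isometric on horizontal
  vectors.\<close>

definition isometric_on :: "'v::euclidean_space set \<Rightarrow> ('v \<Rightarrow> 'w::euclidean_space) \<Rightarrow> bool" where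
  "isometric_on S f \<longleftrightarrow> linear f \<and> (\<forall>x\<in>S. \<forall>y\<in>S. f x \<bullet> f y = x \<bullet> y)"

lemma isometric_on_orthonormal:
  assumes "isometric_on S f" "orthonormal B" "B \<subseteq> S"
  shows "orthonormal (f ` B)" "inj_on f B" "card (f ` B) = card B"
proof -
  have *: "f b \<bullet> f c = (if b = c then 1 else 0)" if "b \<in> B" "c \<in> B" for b c
    using assms that by (auto simp: isometric_on_def orthonormal_inner subset_iff)
  show inj: "inj_on f B" using * by (auto simp: inj_on_def split: if_splits) (metis zero_neq_one)
  show "orthonormal (f ` B)"
    using * by (auto simp: orthonormal_def pairwise_def orthogonal_def norm_eq_1)
  show "card (f ` B) = card B" by (rule card_image[OF inj])
qed

lemma isometric_on_norm: "isometric_on S f \<Longrightarrow> x \<in> S \<Longrightarrow> norm (f x) = norm x"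
  by (simp add: isometric_on_def norm_eq_sqrt_inner)

lemma isometric_on_inj:
  assumes "isometric_on S f" "subspace S" shows "inj_on f S"
  using assms isometric_on_norm[OF assms(1)]
  by (subst linear_inj_on_iff_eq_0) (auto simp: isometric_on_def, metis norm_eq_zero)

lemma distr_subspace_lborel:
  assumes S: "subspace S" and f: "isometric_on S f"
  shows "distr (subspace_lborel S) borel f = subspace_lborel (f ` S)"
proof -
  note o = onb[OF S]
  have sub: "onb S \<subseteq> S" by (rule onb_subset[OF S])
  note i = isometric_on_orthonormal[OF f o(1) sub]
  have lin: "linear f" using f by (simp add: isometric_on_def)
  have "distr (subspace_lborel S) borel f = coord_lborel (f ` onb S)"
    unfolding subspace_lborel_eq by (rule distr_coord_lborel[OF o(1) lin i(2)])
  also have "\<dots> = subspace_lborel (span (f ` onb S))" by (rule coord_lborel_onb[OF i(1)])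
  also have "span (f ` onb S) = f ` S" by (simp add: linear_span_image[OF lin] o)
  finally show ?thesis .
qed

lemma linear_measurable:
  "linear (f :: 'v::euclidean_space \<Rightarrow> 'w::euclidean_space) \<Longrightarrow> f \<in> borel \<rightarrow>\<^sub>M borel"
  by (intro borel_measurable_continuous_onI linear_continuous_on) (simp add: linear_conv_bounded_linear)

text \<open>The splitting behind Fubini for orthogonal sums. It is used to attach auxiliary
  directions to a subspace and to separate the fibre angle from the base coordinates.\<close>

lemma coord_lborel_Un:
  assumes BC: "orthonormal (B \<union> C)" "B \<inter> C = {}"
  shows "coord_lborel (B \<union> C) = distr (coord_lborel B \<Otimes>\<^sub>M coord_lborel C) borel (\<lambda>(x, y). x + y)"
proof -
  have B: "orthonormal B" "orthonormal C" using BC(1) by (auto intro: orthonormal_subset)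
  note fin = B[THEN orthonormal_finite]
  interpret f: finite_product_sigma_finite "\<lambda>_::'a. lborel :: real measure" B by standard (rule fin)
  interpret g: finite_product_sigma_finite "\<lambda>_::'a. lborel :: real measure" C by standard (rule fin)
  have sc: "sigma_finite_measure (coord_lborel C)" by (rule sigma_finite_coord_lborel[OF B(2)])
  have "coord_lborel (B \<union> C) = distr (distr (Pi\<^sub>M B (\<lambda>_. lborel) \<Otimes>\<^sub>M Pi\<^sub>M C (\<lambda>_. lborel)) (Pi\<^sub>M (B \<union> C) (\<lambda>_. lborel)) (merge B C)) borel
      (\<lambda>c. \<Sum>b\<in>B \<union> C. c b *\<^sub>R b)"
    by (simp add: coord_lborel_def lb.distr_merge[OF BC(2) fin])
  also have "\<dots> = distr (Pi\<^sub>M B (\<lambda>_. lborel) \<Otimes>\<^sub>M Pi\<^sub>M C (\<lambda>_. lborel)) borel (\<lambda>c. \<Sum>b\<in>B \<union> C. merge B C c b *\<^sub>R b)"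
    by (subst distr_distr) (auto simp: comp_def)
  also have "(\<lambda>c. \<Sum>b\<in>B \<union> C. merge B C c b *\<^sub>R b) = (\<lambda>(x, y). x + y) \<circ> (\<lambda>(c, d). ((\<Sum>b\<in>B. c b *\<^sub>R b), (\<Sum>b\<in>C. d b *\<^sub>R b)))"
  proof
    fix c :: "('a \<Rightarrow> real) \<times> ('a \<Rightarrow> real)"
    obtain u v where c: "c = (u, v)" by force
    have "(\<Sum>b\<in>B \<union> C. merge B C (u, v) b *\<^sub>R b) =
      (\<Sum>b\<in>B. merge B C (u, v) b *\<^sub>R b) + (\<Sum>b\<in>C. merge B C (u, v) b *\<^sub>R b)"
      by (rule sum.union_disjoint[OF fin BC(2)])
    also have "(\<Sum>b\<in>B. merge B C (u, v) b *\<^sub>R b) = (\<Sum>b\<in>B. u b *\<^sub>R b)"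
      by (intro sum.cong refl) (simp add: merge_def)
    also have "(\<Sum>b\<in>C. merge B C (u, v) b *\<^sub>R b) = (\<Sum>b\<in>C. v b *\<^sub>R b)"
      using BC(2) by (intro sum.cong refl) (auto simp: merge_def)
    finally show "(\<Sum>b\<in>B \<union> C. merge B C c b *\<^sub>R b) = ((\<lambda>(x, y). x + y) \<circ> (\<lambda>(c, d). ((\<Sum>b\<in>B. c b *\<^sub>R b), (\<Sum>b\<in>C. d b *\<^sub>R b)))) c"
      by (simp add: c)
  qed
  also have "distr (Pi\<^sub>M B (\<lambda>_. lborel) \<Otimes>\<^sub>M Pi\<^sub>M C (\<lambda>_. lborel)) borel ((\<lambda>(x, y). x + y) \<circ> (\<lambda>(c, d). ((\<Sum>b\<in>B. c b *\<^sub>R b), (\<Sum>b\<in>C. d b *\<^sub>R b)))) =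
      distr (distr (Pi\<^sub>M B (\<lambda>_. lborel) \<Otimes>\<^sub>M Pi\<^sub>M C (\<lambda>_. lborel)) (borel \<Otimes>\<^sub>M borel)
        (\<lambda>(c, d). ((\<Sum>b\<in>B. c b *\<^sub>R b), (\<Sum>b\<in>C. d b *\<^sub>R b)))) borel (\<lambda>(x, y). x + y)"
    by (subst distr_distr) auto
  also have "distr (Pi\<^sub>M B (\<lambda>_. lborel) \<Otimes>\<^sub>M Pi\<^sub>M C (\<lambda>_. lborel)) (borel \<Otimes>\<^sub>M borel)
        (\<lambda>(c, d). ((\<Sum>b\<in>B. c b *\<^sub>R b), (\<Sum>b\<in>C. d b *\<^sub>R b))) = coord_lborel B \<Otimes>\<^sub>M coord_lborel C"
    unfolding coord_lborel_def
    by (rule pair_measure_distr[symmetric]) (use sc in \<open>auto simp: coord_lborel_def\<close>)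
  finally show ?thesis .
qed

lemma coord_lborel_singleton: "coord_lborel {b} = distr lborel borel (\<lambda>t. t *\<^sub>R b)"
proof -
  have "distr lborel borel (\<lambda>t. t *\<^sub>R b) = distr (distr (Pi\<^sub>M {b} (\<lambda>_. lborel)) lborel (\<lambda>x. x b)) borel (\<lambda>t. t *\<^sub>R b)"
    by (simp add: lb.distr_singleton)
  also have "\<dots> = coord_lborel {b}" by (subst distr_distr) (auto simp: coord_lborel_def comp_def)
  finally show ?thesis by simp
qed

section \<open>Determinants over finite index sets\<close>

lemma set_det_empty [simp]: "set_det {} a = 1"
  by (simp add: set_det_def)

lemma set_det_cong:
  assumes "\<And>i j. i \<in> B \<Longrightarrow> j \<in> B \<Longrightarrow> a i j = b i j"
  shows "set_det B a = set_det B b"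
  unfolding set_det_def
  by (intro sum.cong refl arg_cong2[where f="(*)"] prod.cong) (auto simp: permutes_in_image intro!: assms)

text \<open>A permutation that moves an index outside \<open>I\<close> meets a vanishing
  off-diagonal entry in that row, so only permutations of \<open>I\<close> survive in the Leibniz
  sum.\<close>

lemma set_det_block:
  assumes fin: "finite J" and sub: "I \<subseteq> J"
    and diag: "\<And>i j. i \<in> J - I \<Longrightarrow> j \<in> J \<Longrightarrow> j \<noteq> i \<Longrightarrow> a i j = 0"
  shows "set_det J a = (\<Prod>i\<in>J - I. a i i) * set_det I a"
proof -
  have "set_det J a = (\<Sum>\<pi> | \<pi> permutes I. of_int (sign \<pi>) * (\<Prod>b\<in>J. a b (\<pi> b)))"
    unfolding set_det_def
  proof (rule sum.mono_neutral_right)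
    show "finite {\<pi>. \<pi> permutes J}" by (rule finite_permutations[OF fin])
    show "{\<pi>. \<pi> permutes I} \<subseteq> {\<pi>. \<pi> permutes J}" using sub by (auto intro: permutes_subset)
    show "\<forall>\<pi>\<in>{\<pi>. \<pi> permutes J} - {\<pi>. \<pi> permutes I}. of_int (sign \<pi>) * (\<Prod>b\<in>J. a b (\<pi> b)) = 0"
    proof
      fix \<pi> assume "\<pi> \<in> {\<pi>. \<pi> permutes J} - {\<pi>. \<pi> permutes I}"
      then have p: "\<pi> permutes J" "\<not> \<pi> permutes I" by auto
      have "\<exists>i\<in>J - I. \<pi> i \<noteq> i"
        using p permutes_superset[OF p(1), of I] by blast
      then obtain i where i: "i \<in> J - I" "\<pi> i \<noteq> i" by blast
      have "\<pi> i \<in> J" using i p(1) by (simp add: permutes_in_image)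
      then have "a i (\<pi> i) = 0" using diag i by blast
      then have "(\<Prod>b\<in>J. a b (\<pi> b)) = 0" using i fin by (intro prod_zero) auto
      then show "of_int (sign \<pi>) * (\<Prod>b\<in>J. a b (\<pi> b)) = 0" by simp
    qed
  qed
  also have "\<dots> = (\<Sum>\<pi> | \<pi> permutes I. (\<Prod>i\<in>J - I. a i i) * (of_int (sign \<pi>) * (\<Prod>b\<in>I. a b (\<pi> b))))"
  proof (intro sum.cong refl)
    fix \<pi> assume "\<pi> \<in> {\<pi>. \<pi> permutes I}"
    then have p: "\<pi> permutes I" by simp
    have "(\<Prod>b\<in>J. a b (\<pi> b)) = (\<Prod>b\<in>J - I. a b (\<pi> b)) * (\<Prod>b\<in>I. a b (\<pi> b))"
      by (rule prod.subset_diff[OF sub fin])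
    also have "(\<Prod>b\<in>J - I. a b (\<pi> b)) = (\<Prod>b\<in>J - I. a b b)"
      using p by (intro prod.cong refl) (auto simp: permutes_not_in)
    finally show "of_int (sign \<pi>) * (\<Prod>b\<in>J. a b (\<pi> b)) = (\<Prod>i\<in>J - I. a i i) * (of_int (sign \<pi>) * (\<Prod>b\<in>I. a b (\<pi> b)))"
      by simp
  qed
  finally show ?thesis by (simp add: set_det_def sum_distrib_left)
qed

text \<open>Conjugation by \<open>e\<close> matches the permutations of the two index sets and
  preserves signs.\<close>

lemma set_det_reindex:
  assumes fin: "finite I" and bij: "bij_betw e I B"
  shows "set_det B a = set_det I (\<lambda>i j. a (e i) (e j))"
proof -
  have inj: "inj_on e I" and B: "B = e ` I" using bij by (auto simp: bij_betw_def)
  have bp: "bij_betw (\<lambda>\<pi>. map_permutation I e \<pi>) {\<pi>. \<pi> permutes I} {\<pi>. \<pi> permutes B}"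
  proof -
    have "(\<lambda>\<pi> x. if x \<in> B then e (\<pi> (inv_into I e x)) else x) = map_permutation I e"
      by (auto simp: map_permutation_def restrict_id_def B fun_eq_iff)
    then show ?thesis using bij_betw_permutations[OF bij] by simp
  qed
  show ?thesis unfolding set_det_def
  proof (rule sum.reindex_bij_betw[OF bp, symmetric, THEN trans], intro sum.cong refl)
    fix \<pi> assume "\<pi> \<in> {\<pi>. \<pi> permutes I}"
    then have p: "\<pi> permutes I" by simp
    have s: "sign (map_permutation I e \<pi>) = sign \<pi>"
      by (rule sign_map_permutation[OF inj p fin])
    have "(\<Prod>b\<in>B. a b (map_permutation I e \<pi> b)) = (\<Prod>i\<in>I. a (e i) (map_permutation I e \<pi> (e i)))"
      unfolding B by (rule prod.reindex_cong[OF inj refl refl])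
    also have "\<dots> = (\<Prod>i\<in>I. a (e i) (e (\<pi> i)))"
      by (intro prod.cong refl) (simp add: map_permutation_apply[OF inj])
    finally show "of_int (sign (map_permutation I e \<pi>)) * (\<Prod>b\<in>B. a b (map_permutation I e \<pi> b)) =
      of_int (sign \<pi>) * (\<Prod>b\<in>I. a (e b) (e (\<pi> b)))" by (simp add: s)
  qed
qed

lemma set_det_transpose:
  assumes fin: "finite B" shows "set_det B (\<lambda>i j. a j i) = set_det B a"
proof -
  have "set_det B a = (\<Sum>\<pi> | \<pi> permutes B. of_int (sign (inv \<pi>)) * (\<Prod>b\<in>B. a b (inv \<pi> b)))"
    unfolding set_det_def
    by (rule sum.reindex_bij_witness[of _ inv inv]) (auto simp: permutes_inv permutes_inv_inv)
  also have "\<dots> = (\<Sum>\<pi> | \<pi> permutes B. of_int (sign \<pi>) * (\<Prod>b\<in>B. a (\<pi> b) b))"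
  proof (intro sum.cong refl)
    fix \<pi> assume "\<pi> \<in> {\<pi>. \<pi> permutes B}"
    then have p: "\<pi> permutes B" by simp
    have "(\<Prod>b\<in>B. a b (inv \<pi> b)) = (\<Prod>b\<in>B. a (\<pi> b) (inv \<pi> (\<pi> b)))"
      by (rule prod.permute[OF p, unfolded comp_def])
    also have "\<dots> = (\<Prod>b\<in>B. a (\<pi> b) b)" by (simp add: permutes_inverses[OF p])
    finally have "(\<Prod>b\<in>B. a b (inv \<pi> b)) = (\<Prod>b\<in>B. a (\<pi> b) b)" .
    then show "of_int (sign (inv \<pi>)) * (\<Prod>b\<in>B. a b (inv \<pi> b)) = of_int (sign \<pi>) * (\<Prod>b\<in>B. a (\<pi> b) b)"
    proof -
      have "permutation \<pi>" using p fin unfolding permutation_permutes by blast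
      then have "sign (inv \<pi>) = sign \<pi>" by (rule sign_inverse)
      then show ?thesis using \<open>(\<Prod>b\<in>B. a b (inv \<pi> b)) = (\<Prod>b\<in>B. a (\<pi> b) b)\<close> by simp
    qed
  qed
  finally show ?thesis by (simp add: set_det_def)
qed

text \<open>The library determinant needs a type of indices; this one is large enough for every orthonormal set.\<close>

typedef (overloaded) 'v coord_index = "{..<DIM('v::euclidean_space)}"
  by (auto intro!: exI[of _ 0])

lemma type_definition_coord_index':
  "type_definition Rep_coord_index (Abs_coord_index :: nat \<Rightarrow> 'v::euclidean_space coord_index) {..<DIM('v)}"
  by (rule type_definition_coord_index)

text \<open>The order has no geometric meaning; the change of variables theorem on
  \<open>real^'d\<close> is stated for index types that are finite and wellordered.\<close>

instantiation coord_index :: (euclidean_space) "{finite, wellorder}"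
begin

definition less_eq_coord_index :: "'a coord_index \<Rightarrow> 'a coord_index \<Rightarrow> bool" where
  "less_eq_coord_index x y \<longleftrightarrow> Rep_coord_index x \<le> Rep_coord_index y"

definition less_coord_index :: "'a coord_index \<Rightarrow> 'a coord_index \<Rightarrow> bool" where
  "less_coord_index x y \<longleftrightarrow> Rep_coord_index x < Rep_coord_index y"

instance
proof
  fix x y z :: "'a coord_index" and P :: "'a coord_index \<Rightarrow> bool"
  show "(x < y) = (x \<le> y \<and> \<not> y \<le> x)" "x \<le> x" "x \<le> y \<or> y \<le> x"
    by (auto simp: less_eq_coord_index_def less_coord_index_def)
  show "x \<le> y \<Longrightarrow> y \<le> z \<Longrightarrow> x \<le> z" "x \<le> y \<Longrightarrow> y \<le> x \<Longrightarrow> x = y"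
    by (auto simp: less_eq_coord_index_def less_coord_index_def Rep_coord_index_inject)
  show "(\<And>x. (\<And>y. y < x \<Longrightarrow> P y) \<Longrightarrow> P x) \<Longrightarrow> P x"
  proof -
    assume *: "\<And>x. (\<And>y. y < x \<Longrightarrow> P y) \<Longrightarrow> P x"
    show "P x"
      by (rule measure_induct_rule[where f=Rep_coord_index]) (rule *, simp add: less_coord_index_def)
  qed
  show "finite (UNIV :: 'a coord_index set)"
    unfolding type_definition.univ[OF type_definition_coord_index'] by simp
qed

end

lemma card_coord_index: "CARD('v::euclidean_space coord_index) = DIM('v)"
  using type_definition.card[OF type_definition_coord_index'[where 'v='v]] by simp

lemma det_eq_set_det: "det (A :: real^'n^'n) = set_det UNIV (\<lambda>i j. A $ i $ j)"
  by (simp add: det_def set_det_def)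

text \<open>Completing a matrix by an identity block leaves its determinant unchanged and makes it a
  square matrix over a type, where \<open>det_mul\<close> applies.\<close>

lemma set_det_pad:
  fixes e :: "'i \<Rightarrow> 'd::finite"
  assumes fin: "finite I" and inj: "inj_on e I"
  shows "det ((\<chi> i j. if i \<in> e ` I \<and> j \<in> e ` I then a (the_inv_into I e i) (the_inv_into I e j)
     else if i = j then 1 else 0) :: real^'d^'d) = set_det I a"
proof -
  let ?a = "\<lambda>i j. if i \<in> e ` I \<and> j \<in> e ` I then a (the_inv_into I e i) (the_inv_into I e j)
     else if i = j then 1 else 0"
  have "set_det UNIV ?a = (\<Prod>i\<in>UNIV - e ` I. ?a i i) * set_det (e ` I) ?a"
    by (rule set_det_block) auto
  also have "(\<Prod>i\<in>UNIV - e ` I. ?a i i) = 1" by (intro prod.neutral) auto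
  also have "set_det (e ` I) ?a = set_det I (\<lambda>i j. ?a (e i) (e j))"
    by (rule set_det_reindex[OF fin]) (simp add: bij_betw_def inj)
  also have "\<dots> = set_det I a"
    by (rule set_det_cong) (simp add: the_inv_into_f_f[OF inj])
  finally show ?thesis by (simp add: det_eq_set_det)
qed

text \<open>Padding by an identity block respects matrix products, so multiplicativity is inherited
  from \<open>det_mul\<close>.\<close>

lemma set_det_mult:
  fixes B :: "'v::euclidean_space set"
  assumes fin: "finite B" and card: "card B \<le> DIM('v)"
  shows "set_det B (\<lambda>i k. \<Sum>j\<in>B. a i j * b j k) = set_det B a * set_det B b"
proof -
  obtain e :: "'v \<Rightarrow> 'v coord_index" where inj: "inj_on e B"
    using card_le_inj[OF fin, of "UNIV :: 'v coord_index set"] card card_coord_index[where 'v='v] by auto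
  define P where "P a = ((\<chi> i j. if i \<in> e ` B \<and> j \<in> e ` B then a (the_inv_into B e i) (the_inv_into B e j)
     else if i = j then 1 else 0) :: real^'v coord_index^'v coord_index)" for a :: "'v \<Rightarrow> 'v \<Rightarrow> real"
  have "P a ** P b = P (\<lambda>i k. \<Sum>j\<in>B. a i j * b j k)"
  proof (rule vec_eq_iff[THEN iffD2], intro allI, rule vec_eq_iff[THEN iffD2], intro allI)
    fix i k
    have "(P a ** P b) $ i $ k = (\<Sum>j\<in>UNIV. P a $ i $ j * P b $ j $ k)"
      by (simp add: matrix_matrix_mult_def)
    also have "\<dots> = P (\<lambda>i k. \<Sum>j\<in>B. a i j * b j k) $ i $ k"
    proof (cases "i \<in> e ` B")
      case True
      have "(\<Sum>j\<in>UNIV. P a $ i $ j * P b $ j $ k) = (\<Sum>j\<in>e ` B. P a $ i $ j * P b $ j $ k)"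
        by (rule sum.mono_neutral_right) (use True in \<open>auto simp: P_def\<close>)
      also have "\<dots> = (\<Sum>j\<in>B. P a $ i $ e j * P b $ e j $ k)"
        by (rule sum.reindex_cong[OF inj refl refl])
      also have "\<dots> = P (\<lambda>i k. \<Sum>j\<in>B. a i j * b j k) $ i $ k"
        using True by (auto simp: P_def the_inv_into_f_f[OF inj] intro!: sum.neutral)
      finally show ?thesis .
    next
      case False
      have "(\<Sum>j\<in>UNIV. P a $ i $ j * P b $ j $ k) = (\<Sum>j\<in>UNIV. if j = i then P b $ i $ k else 0)"
        by (rule sum.cong) (use False in \<open>auto simp: P_def\<close>)
      also have "\<dots> = P b $ i $ k" by simp
      finally show ?thesis using False by (simp add: P_def)
    qed
    finally show "(P a ** P b) $ i $ k = P (\<lambda>i k. \<Sum>j\<in>B. a i j * b j k) $ i $ k" .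
  qed
  then have "det (P (\<lambda>i k. \<Sum>j\<in>B. a i j * b j k)) = det (P a) * det (P b)"
    by (metis det_mul)
  moreover have "det (P a) = set_det B a" for a
    unfolding P_def by (rule set_det_pad[OF fin inj])
  ultimately show ?thesis by simp
qed

lemma orthonormal_card_le: "orthonormal (B :: 'v::euclidean_space set) \<Longrightarrow> card B \<le> DIM('v)"
  using orthonormal_indep independent_bound by blast

text \<open>If \<open>A\<close> is written as a matrix in the bases identified by \<open>h\<close>,
  the Gram matrix of \<open>G \<circ> A\<close> is the transpose of that matrix times the Gram
  matrix of \<open>G\<close> times the matrix. This yields both the transformation of volume
  densities and the removal of a shear in a lifted chart.\<close>

lemma set_det_gram_mult:
  fixes B1 :: "'v::euclidean_space set" and B2 :: "'w::euclidean_space set" and G :: "'w \<Rightarrow> 'z::euclidean_space"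
  assumes B1: "orthonormal B1" and B2: "orthonormal B2" and h: "bij_betw h B1 B2"
    and A: "\<And>b. b \<in> B1 \<Longrightarrow> A b \<in> span B2" and G: "linear G"
  shows "set_det B1 (\<lambda>b c. G (A b) \<bullet> G (A c)) =
     (set_det B1 (\<lambda>b c. h b \<bullet> A c))\<^sup>2 * set_det B2 (\<lambda>b c. G b \<bullet> G c)"
proof -
  note fin = orthonormal_finite[OF B1] and cle = orthonormal_card_le[OF B1]
  have hB: "B2 = h ` B1" "inj_on h B1" using h by (auto simp: bij_betw_def)
  have ex: "G (A b) = (\<Sum>d\<in>B1. (A b \<bullet> h d) *\<^sub>R G (h d))" if "b \<in> B1" for b
  proof -
    have "G (A b) = G (\<Sum>d\<in>B2. (A b \<bullet> d) *\<^sub>R d)" by (simp add: orthonormal_expand[OF B2 A[OF that]])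
    also have "\<dots> = (\<Sum>d\<in>B2. (A b \<bullet> d) *\<^sub>R G d)" by (simp add: linear_sum[OF G] linear_scale[OF G])
    finally show ?thesis unfolding hB(1) by (simp add: sum.reindex[OF hB(2)])
  qed
  have "set_det B1 (\<lambda>b c. G (A b) \<bullet> G (A c)) =
     set_det B1 (\<lambda>b c. \<Sum>d\<in>B1. (A b \<bullet> h d) * (\<Sum>e\<in>B1. (G (h d) \<bullet> G (h e)) * (h e \<bullet> A c)))"
  proof (rule set_det_cong)
    fix b c assume bc: "b \<in> B1" "c \<in> B1"
    have "G (A b) \<bullet> G (A c) = (\<Sum>d\<in>B1. (A b \<bullet> h d) * (G (h d) \<bullet> G (A c)))"
      by (simp add: ex[OF bc(1)] inner_sum_left)
    also have "\<dots> = (\<Sum>d\<in>B1. (A b \<bullet> h d) * (\<Sum>e\<in>B1. (G (h d) \<bullet> G (h e)) * (h e \<bullet> A c)))"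
      by (simp add: ex[OF bc(2)] inner_sum_right mult.commute inner_commute[of "A c"])
    finally show "G (A b) \<bullet> G (A c) = (\<Sum>d\<in>B1. (A b \<bullet> h d) * (\<Sum>e\<in>B1. (G (h d) \<bullet> G (h e)) * (h e \<bullet> A c)))" .
  qed
  also have "\<dots> = set_det B1 (\<lambda>b d. A b \<bullet> h d) * (set_det B1 (\<lambda>d e. G (h d) \<bullet> G (h e)) * set_det B1 (\<lambda>e c. h e \<bullet> A c))"
    by (simp only: set_det_mult[OF fin cle])
  also have "set_det B1 (\<lambda>b d. A b \<bullet> h d) = set_det B1 (\<lambda>b c. h b \<bullet> A c)"
    by (subst set_det_transpose[OF fin, symmetric]) (simp add: inner_commute)
  also have "set_det B1 (\<lambda>d e. G (h d) \<bullet> G (h e)) = set_det B2 (\<lambda>b c. G b \<bullet> G c)"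
    by (rule set_det_reindex[OF fin h, symmetric])
  finally show ?thesis by (simp add: power2_eq_square)
qed

lemma set_det_one: "finite B \<Longrightarrow> set_det B (\<lambda>b c. if b = c then 1 else 0) = 1"
  using set_det_block[of B "{}" "\<lambda>b c. if b = c then 1 else 0"] by simp

lemma set_det_orthonormal:
  "orthonormal B \<Longrightarrow> set_det B (\<lambda>b c. b \<bullet> c) = 1"
  using set_det_one[OF orthonormal_finite] by (subst set_det_cong[of B _ "\<lambda>b c. if b = c then 1 else 0"]) (auto simp: orthonormal_inner)

text \<open>Frees \<open>endo_det\<close> from the basis selected by choice. The two matrices of the
  change of basis multiply to the Gram matrix of an orthonormal basis, so their determinants
  cancel.\<close>

lemma endo_det_orthonormal:
  fixes B :: "'v::euclidean_space set"
  assumes S: "subspace S" and B: "orthonormal B" "span B = S"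
    and L: "linear L" "\<And>x. x \<in> S \<Longrightarrow> L x \<in> S"
  shows "endo_det S L = set_det B (\<lambda>b c. b \<bullet> L c)"
proof -
  let ?C = "onb S"
  note C = onb[OF S]
  note fin = orthonormal_finite[OF B(1)] and cle = orthonormal_card_le[OF B(1)]
  have "card B = card ?C" by (simp add: orthonormal_card B C)
  then obtain h where h: "bij_betw h B ?C"
    using finite_same_card_bij[OF orthonormal_finite[OF B(1)] orthonormal_finite[OF C(1)]] by auto
  have hS: "h b \<in> S" if "b \<in> B" for b
    using h that onb_subset[OF S] by (auto simp: bij_betw_def)
  have ex: "x \<bullet> y = (\<Sum>d\<in>B. (x \<bullet> d) * (d \<bullet> y))" if "x \<in> S" for x y
    using orthonormal_inner_expand[OF B(1)] that B(2) by auto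
  have exL: "x \<bullet> L y = (\<Sum>e\<in>B. (x \<bullet> L e) * (e \<bullet> y))" if "y \<in> S" for x y
  proof -
    have "x \<bullet> L y = x \<bullet> L (\<Sum>e\<in>B. (y \<bullet> e) *\<^sub>R e)" using orthonormal_expand[OF B(1)] that B(2) by simp
    then show ?thesis by (simp add: linear_sum[OF L(1)] linear_scale[OF L(1)] inner_sum_right inner_commute mult_ac)
  qed
  have one: "set_det B (\<lambda>b d. h b \<bullet> d) * set_det B (\<lambda>d c. d \<bullet> h c) = 1"
  proof -
    have "set_det B (\<lambda>b d. h b \<bullet> d) * set_det B (\<lambda>d c. d \<bullet> h c) = set_det B (\<lambda>b c. \<Sum>d\<in>B. (h b \<bullet> d) * (d \<bullet> h c))"
      by (simp only: set_det_mult[OF fin cle])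
    also have "\<dots> = set_det B (\<lambda>b c. h b \<bullet> h c)" by (rule set_det_cong) (simp add: ex[symmetric] hS)
    also have "\<dots> = set_det ?C (\<lambda>b c. b \<bullet> c)" by (rule set_det_reindex[OF fin h, symmetric])
    finally show ?thesis by (simp add: set_det_orthonormal C)
  qed
  have "endo_det S L = set_det B (\<lambda>b c. h b \<bullet> L (h c))"
    unfolding endo_det_def by (rule set_det_reindex[OF fin h])
  also have "\<dots> = set_det B (\<lambda>b c. \<Sum>d\<in>B. (h b \<bullet> d) * (\<Sum>e\<in>B. (d \<bullet> L e) * (e \<bullet> h c)))"
  proof (rule set_det_cong)
    fix b c assume bc: "b \<in> B" "c \<in> B"
    show "h b \<bullet> L (h c) = (\<Sum>d\<in>B. (h b \<bullet> d) * (\<Sum>e\<in>B. (d \<bullet> L e) * (e \<bullet> h c)))"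
      unfolding exL[OF hS[OF bc(2)], symmetric] by (rule ex[OF hS[OF bc(1)]])
  qed
  also have "\<dots> = set_det B (\<lambda>b d. h b \<bullet> d) * (set_det B (\<lambda>b c. b \<bullet> L c) * set_det B (\<lambda>d c. d \<bullet> h c))"
    by (simp only: set_det_mult[OF fin cle])
  finally show ?thesis using one by (simp add: mult_ac)
qed

section \<open>Change of variables between subspaces\<close>

text \<open>The set is exhausted by bounded pieces on which the Jacobian is bounded, hence
  integrable, so that \<open>has_measure_differentiable_image\<close> applies to each piece.
  Monotone convergence on both sides gives the formula with values in the extended reals.\<close>

lemma emeasure_differentiable_image:
  fixes g :: "real^'d::{finite,wellorder} \<Rightarrow> real^'d::_"
  assumes E: "E \<in> sets lebesgue" and der: "\<And>x. x \<in> E \<Longrightarrow> (g has_derivative g' x) (at x within E)"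
    and inj: "inj_on g E"
  shows "emeasure lebesgue (g ` E) = (\<integral>\<^sup>+x. ennreal \<bar>det (matrix (g' x))\<bar> * indicator E x \<partial>lebesgue)"
proof -
  define D where "D x = \<bar>det (matrix (g' x))\<bar>" for x
  define Ek where "Ek k = {x \<in> E. D x \<le> real k \<and> norm x \<le> real k}" for k :: nat
  have Dm: "D \<in> borel_measurable (lebesgue_on E)"
    unfolding D_def using borel_measurable_det_Jacobian[OF E der] by (intro borel_measurable_abs) auto
  have Ek_on: "Ek k \<in> sets (lebesgue_on E)" for k
  proof -
    have [measurable]: "norm \<in> borel_measurable (lebesgue_on E)"
      by (rule measurable_restrict_space1) (simp add: borel_measurable_norm measurable_completion)
    note Dm[measurable]
    have "{x \<in> space (lebesgue_on E). D x \<le> real k \<and> norm x \<le> real k} \<in> sets (lebesgue_on E)"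
      by measurable
    then show ?thesis by (simp add: Ek_def)
  qed
  have Ek: "Ek k \<in> sets lebesgue" for k
    using Ek_on[of k] E by (auto simp: sets_restrict_space_iff)
  have sub: "Ek k \<subseteq> E" for k by (auto simp: Ek_def)
  have bounded: "Ek k \<subseteq> cball 0 (real k)" for k by (auto simp: Ek_def)
  have Ekl: "Ek k \<in> lmeasurable" for k
    using bounded_set_imp_lmeasurable[OF bounded_subset[OF bounded_cball bounded[of k]] Ek] .
  have incE: "incseq Ek" by (auto simp: incseq_def Ek_def intro: order_trans)
  have unE: "(\<Union>k. Ek k) = E"
  proof
    show "E \<subseteq> (\<Union>k. Ek k)"
    proof
      fix x assume "x \<in> E"
      obtain k :: nat where "max (D x) (norm x) \<le> real k" using real_arch_simple by blast
      then show "x \<in> (\<Union>k. Ek k)" using \<open>x \<in> E\<close> by (auto simp: Ek_def)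
    qed
  qed (use sub in auto)
  have main: "emeasure lebesgue (g ` Ek k) = (\<integral>\<^sup>+x. ennreal (D x) * indicator (Ek k) x \<partial>lebesgue)"
    and img: "g ` Ek k \<in> sets lebesgue" for k
  proof -
    have Dmk: "D \<in> borel_measurable (lebesgue_on (Ek k))"
      using measurable_restrict_mono[OF Dm sub[of k]] by simp
    have Dint: "D integrable_on Ek k"
      by (rule measurable_bounded_by_integrable_imp_integrable[OF Dmk, of "\<lambda>_. real k"])
         (use Ekl Ek in \<open>auto simp: Ek_def D_def integrable_on_const\<close>)
    then have "(D has_integral integral (Ek k) D) (Ek k)" by (rule integrable_integral)
    moreover have "D = (\<lambda>x. \<bar>det (matrix (g' x))\<bar>)" by (simp add: D_def fun_eq_iff)
    ultimately have int: "((\<lambda>x. \<bar>det (matrix (g' x))\<bar>) has_integral integral (Ek k) D) (Ek k)"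
      by metis
    have derk: "x \<in> Ek k \<Longrightarrow> (g has_derivative g' x) (at x within Ek k)" for x
      using der[of x] sub[of k] by (auto intro: has_derivative_subset)
    have "g ` Ek k \<in> lmeasurable \<and> measure lebesgue (g ` Ek k) = integral (Ek k) D"
      using has_measure_differentiable_image[OF Ek derk inj_on_subset[OF inj sub]] int by blast
    then have 1: "emeasure lebesgue (g ` Ek k) = ennreal (integral (Ek k) D)" and 2: "g ` Ek k \<in> sets lebesgue"
      by (metis emeasure_eq_measure2) (use \<open>g ` Ek k \<in> lmeasurable \<and> _\<close> in auto)
    show "g ` Ek k \<in> sets lebesgue" by (rule 2)
    have "((\<lambda>x. indicator (Ek k) x * D x) has_integral integral (Ek k) D) UNIV"
    proof -
      have "(\<lambda>x. indicator (Ek k) x * D x) = (\<lambda>x. if x \<in> Ek k then D x else 0)"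
        by (auto simp: indicator_def)
      then show ?thesis
        using int unfolding has_integral_restrict_UNIV[symmetric, where s="Ek k"] by (simp add: D_def cong: if_cong)
    qed
    then have "(\<integral>\<^sup>+x. ennreal (indicator (Ek k) x * D x) \<partial>lebesgue) = ennreal (integral (Ek k) D)"
      by (subst (asm) has_integral_iff_nn_integral_lebesgue) (auto simp: D_def)
    also have "(\<lambda>x. ennreal (indicator (Ek k) x * D x)) = (\<lambda>x. ennreal (D x) * indicator (Ek k) x)"
      by (auto simp: indicator_def)
    finally show "emeasure lebesgue (g ` Ek k) = (\<integral>\<^sup>+x. ennreal (D x) * indicator (Ek k) x \<partial>lebesgue)"
      using 1 by simp
  qed
  have "g ` E = (\<Union>k. g ` Ek k)" using unE by auto
  then have "emeasure lebesgue (g ` E) = (SUP k. emeasure lebesgue (g ` Ek k))"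
    using img incE by (subst SUP_emeasure_incseq) (auto simp: incseq_def image_mono)
  also have "\<dots> = (SUP k. \<integral>\<^sup>+x. ennreal (D x) * indicator (Ek k) x \<partial>lebesgue)"
    by (simp add: main)
  also have "\<dots> = (\<integral>\<^sup>+x. (SUP k. ennreal (D x) * indicator (Ek k) x) \<partial>lebesgue)"
  proof (rule nn_integral_monotone_convergence_SUP[symmetric])
    show "incseq (\<lambda>k x. ennreal (D x) * indicator (Ek k) x)"
      using incE by (auto simp: incseq_def le_fun_def indicator_def)
    show "(\<lambda>x. ennreal (D x) * indicator (Ek k) x) \<in> borel_measurable lebesgue" for k
    proof -
      have "(\<lambda>x. D x * indicator (Ek k) x) \<in> borel_measurable lebesgue"
        using measurable_restrict_mono[OF Dm sub[of k]] Ek[of k]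
        by (subst (asm) borel_measurable_restrict_space_iff) (auto simp: mult.commute)
      then have "(\<lambda>x. ennreal (D x * indicator (Ek k) x)) \<in> borel_measurable lebesgue" by measurable
      also have "(\<lambda>x. ennreal (D x * indicator (Ek k) x)) = (\<lambda>x. ennreal (D x) * indicator (Ek k) x)"
        by (auto simp: indicator_def)
      finally show ?thesis .
    qed
  qed
  also have "(\<lambda>x. SUP k. ennreal (D x) * indicator (Ek k) x) = (\<lambda>x. ennreal (D x) * indicator E x)"
  proof
    fix x
    have "(SUP k. ennreal (D x) * indicator (Ek k) x) = ennreal (D x) * (SUP k. indicator (Ek k) x)"
      by (rule SUP_mult_left_ennreal[symmetric])
    also have "(SUP k. indicator (Ek k) x :: ennreal) = indicator E x"
    proof (cases "x \<in> E")
      case True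
      then obtain k where "x \<in> Ek k" using unE by auto
      then have "(SUP k. indicator (Ek k) x :: ennreal) \<ge> 1"
        by (intro SUP_upper2[of k]) auto
      moreover have "(SUP k. indicator (Ek k) x :: ennreal) \<le> 1"
        by (intro SUP_least) (auto simp: indicator_def)
      ultimately show ?thesis using True by (auto intro: antisym)
    next
      case False
      then have "x \<notin> Ek k" for k using sub[of k] by blast
      then have "indicator (Ek k) x = (0 :: ennreal)" for k by simp
      then show ?thesis using False by simp
    qed
    finally show "(SUP k. ennreal (D x) * indicator (Ek k) x) = ennreal (D x) * indicator E x" .
  qed
  finally show ?thesis by (simp add: D_def)
qed

lemma coord_lborel_UNIV:
  assumes "orthonormal B" "span B = UNIV" shows "coord_lborel B = lborel"
proof -
  have "coord_lborel B = coord_lborel Basis"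
    by (rule coord_lborel_cong) (use assms in \<open>auto simp: orthonormal_def pairwise_def orthogonal_Basis orthogonal_def inner_Basis\<close>)
  then show ?thesis by (simp add: coord_lborel_Basis)
qed

text \<open>Source and target carry separate orthonormal bases, matched by \<open>h\<close>, because
  each will be adapted to a different subspace. Coordinates in both reduce the claim to
  \<open>real^'d\<close>.\<close>

lemma emeasure_differentiable_image_orthonormal:
  fixes g :: "'v::euclidean_space \<Rightarrow> 'v"
  assumes B: "orthonormal B" "span B = UNIV" and h: "bij_betw h B C" and C: "orthonormal C"
    and E[measurable]: "E \<in> sets borel" and gE[measurable]: "g ` E \<in> sets borel"
    and der: "\<And>x. x \<in> E \<Longrightarrow> (g has_derivative g' x) (at x within E)" and inj: "inj_on g E"
    and Dm[measurable]: "(\<lambda>x. ennreal \<bar>set_det B (\<lambda>b c. h b \<bullet> g' x c)\<bar> * indicator E x) \<in> borel_measurable borel"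
  shows "emeasure lborel (g ` E) = (\<integral>\<^sup>+x. ennreal \<bar>set_det B (\<lambda>b c. h b \<bullet> g' x c)\<bar> * indicator E x \<partial>lborel)"
proof -
  note fin = orthonormal_finite[OF B(1)]
  have cardB: "card B = DIM('v)" using orthonormal_card[OF B(1)] B(2) by simp
  have cardC: "card C = DIM('v)" using bij_betw_same_card[OF h] cardB by simp
  have spanC: "span C = UNIV"
    using card_eq_dim[of C UNIV] orthonormal_indep[OF C] cardC orthonormal_finite[OF C] by auto
  obtain e :: "'v coord_index \<Rightarrow> 'v" where e: "bij_betw e UNIV B"
    using finite_same_card_bij[of "UNIV :: 'v coord_index set" B] fin cardB card_coord_index[where 'v='v] by auto
  \<comment> \<open>\<open>T f\<close> rebuilds a vector from its coordinates along the family
    \<open>f\<close>. It preserves Lebesgue measure whenever \<open>f\<close> enumerates an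
    orthonormal basis.\<close>
  define T where "T f x = (\<Sum>i\<in>UNIV. x $ i *\<^sub>R f i)" for f :: "'v coord_index \<Rightarrow> 'v" and x :: "real^'v coord_index"
  have linT: "linear (T f)" for f
    unfolding T_def by (rule linearI) (simp_all add: scaleR_add_left sum.distrib scaleR_sum_right)
  have Tax: "T f (axis i 1) = f i" for f i
  proof -
    have "T f (axis i 1) = (\<Sum>j\<in>UNIV. if j = i then f j else 0)"
      unfolding T_def by (intro sum.cong refl) (auto simp: axis_def)
    then show ?thesis by simp
  qed
  have distrT: "distr lborel borel (T f) = lborel" and Tinv: "T f (\<chi> i. y \<bullet> f i) = y"
    and Tinv2: "(\<chi> i. T f x \<bullet> f i) = x"
    if f: "bij_betw f UNIV F" "orthonormal F" "span F = UNIV" for f F y x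
  proof -
    have BB: "(Basis :: (real^'v coord_index) set) = range (\<lambda>i. axis i 1)"
      by (auto simp: Basis_vec_def)
    have im: "T f ` Basis = F" using f(1) by (auto simp: BB Tax bij_betw_def image_image)
    have injb: "inj_on (T f) Basis" using f(1) by (auto simp: BB Tax bij_betw_def inj_on_def)
    have ob: "orthonormal (Basis :: (real^'v coord_index) set)"
      by (auto simp: orthonormal_def pairwise_def orthogonal_def inner_Basis)
    show "distr lborel borel (T f) = lborel"
      using distr_coord_lborel[OF ob linT injb] coord_lborel_UNIV[OF f(2,3)] by (simp add: coord_lborel_Basis im)
    have "T f (\<chi> i. y \<bullet> f i) = (\<Sum>b\<in>F. (y \<bullet> b) *\<^sub>R b)"
      unfolding T_def using sum.reindex_bij_betw[OF f(1), of "\<lambda>b. (y \<bullet> b) *\<^sub>R b"] by simp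
    then show "T f (\<chi> i. y \<bullet> f i) = y" using orthonormal_expand[OF f(2)] f(3) by simp
    have ff: "f i \<bullet> f j = (if i = j then 1 else 0)" for i j
      using orthonormal_inner[OF f(2), of "f i" "f j"] f(1) by (auto simp: bij_betw_def inj_on_def)
    show "(\<chi> i. T f x \<bullet> f i) = x"
    proof (rule vec_eq_iff[THEN iffD2], intro allI)
      fix i
      have "(\<Sum>j\<in>UNIV. x $ j *\<^sub>R f j) \<bullet> f i = (\<Sum>j\<in>UNIV. if j = i then x $ j else 0)"
        unfolding inner_sum_left by (intro sum.cong refl) (auto simp: ff)
      then show "(\<chi> i. T f x \<bullet> f i) $ i = x $ i" by (simp add: T_def)
    qed
  qed
  have he: "bij_betw (h \<circ> e) UNIV C" using e h by (rule bij_betw_trans)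
  define G where "G x = (\<chi> i. g (T e x) \<bullet> h (e i))" for x
  define G' where "G' x y = (\<chi> i. g' (T e x) (T e y) \<bullet> h (e i))" for x y
  define E2 where "E2 = T e -` E"
  have Tm[measurable]: "T f \<in> borel \<rightarrow>\<^sub>M borel" for f by (rule linear_measurable[OF linT])
  have E2[measurable]: "E2 \<in> sets borel" using measurable_sets[OF Tm E, of e] by (simp add: E2_def)
  have TG: "T (h \<circ> e) (G x) = g (T e x)" for x
    using Tinv[OF he C spanC, of "g (T e x)"] by (simp add: G_def)
  have imG: "T (h \<circ> e) -` (g ` E) = G ` E2"
  proof safe
    fix x y assume xy: "T (h \<circ> e) x = g y" "y \<in> E"
    define w where "w = (\<chi> i. y \<bullet> e i)"
    have w: "T e w = y" unfolding w_def by (rule Tinv[OF e B])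
    have "G w = (\<chi> i. T (h \<circ> e) x \<bullet> (h \<circ> e) i)" by (simp add: G_def w xy)
    also have "\<dots> = x" by (rule Tinv2[OF he C spanC])
    finally show "x \<in> G ` E2" using xy w by (auto simp: E2_def intro!: image_eqI[of _ _ w])
  qed (auto simp: TG E2_def)
  have derG: "(G has_derivative G' x) (at x within E2)" if "x \<in> E2" for x
  proof -
    have "(T e has_derivative T e) (at x within E2)"
      by (rule bounded_linear_imp_has_derivative) (simp add: linT linear_conv_bounded_linear[symmetric])
    moreover have "(g has_derivative g' (T e x)) (at (T e x) within T e ` E2)"
      by (rule has_derivative_subset[OF der]) (use that in \<open>auto simp: E2_def\<close>)
    ultimately have "((\<lambda>x. g (T e x)) has_derivative (\<lambda>y. g' (T e x) (T e y))) (at x within E2)"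
      by (rule has_derivative_in_compose)
    then have "((\<lambda>x. g (T e x) \<bullet> h (e i)) has_derivative (\<lambda>y. g' (T e x) (T e y) \<bullet> h (e i))) (at x within E2)" for i
      by (rule has_derivative_inner_left)
    then show ?thesis unfolding G_def G'_def
      by (subst has_derivative_componentwise_within) (auto simp: Basis_vec_def inner_axis)
  qed
  have injG: "inj_on G E2"
  proof (rule inj_onI)
    fix x y assume xy: "x \<in> E2" "y \<in> E2" "G x = G y"
    then have "g (T e x) = g (T e y)" using TG by metis
    then have "T e x = T e y" using inj xy by (auto simp: E2_def inj_on_def)
    then show "x = y" using Tinv2[OF e B] by metis
  qed
  have detG: "\<bar>det (matrix (G' x))\<bar> = \<bar>set_det B (\<lambda>b c. h b \<bullet> g' (T e x) c)\<bar>" for x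
  proof -
    have "det (matrix (G' x)) = set_det UNIV (\<lambda>i j. h (e i) \<bullet> g' (T e x) (e j))"
      by (simp add: det_eq_set_det matrix_def G'_def Tax inner_commute)
    also have "\<dots> = set_det B (\<lambda>b c. h b \<bullet> g' (T e x) c)"
      by (rule set_det_reindex[OF finite e, symmetric])
    finally show ?thesis by simp
  qed
  have "emeasure lborel (g ` E) = emeasure (distr lborel borel (T (h \<circ> e))) (g ` E)"
    by (simp add: distrT[OF he C spanC])
  also have "\<dots> = emeasure lborel (G ` E2)"
    by (subst emeasure_distr) (auto simp: imG)
  also have "\<dots> = emeasure lebesgue (G ` E2)"
  proof -
    have "G ` E2 \<in> sets lborel" using measurable_sets[OF Tm gE, of "h \<circ> e"] by (simp add: imG)
    then show ?thesis by simp
  qed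
  also have "\<dots> = (\<integral>\<^sup>+x. ennreal \<bar>det (matrix (G' x))\<bar> * indicator E2 x \<partial>lebesgue)"
    by (rule emeasure_differentiable_image[OF _ derG injG]) auto
  also have "\<dots> = (\<integral>\<^sup>+x. ennreal \<bar>set_det B (\<lambda>b c. h b \<bullet> g' (T e x) c)\<bar> * indicator E (T e x) \<partial>lebesgue)"
    by (simp add: detG E2_def indicator_def)
  also have "\<dots> = (\<integral>\<^sup>+x. ennreal \<bar>set_det B (\<lambda>b c. h b \<bullet> g' (T e x) c)\<bar> * indicator E (T e x) \<partial>lborel)"
    by (rule nn_integral_completion)
  also have "\<dots> = (\<integral>\<^sup>+x. ennreal \<bar>set_det B (\<lambda>b c. h b \<bullet> g' x c)\<bar> * indicator E x \<partial>distr lborel borel (T e))"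
    by (subst nn_integral_distr) auto
  finally show ?thesis by (simp add: distrT[OF e B])
qed

text \<open>A slab that is bounded only along \<open>C\<close>. When \<open>C\<close> completes a
  basis \<open>B\<close>, every fibre over the span of \<open>B\<close> is a unit cube, so integrals
  over a subspace become integrals over the whole space without a constant.\<close>

definition cube_over :: "'v::euclidean_space set \<Rightarrow> 'v set" where
  "cube_over C = {x. \<forall>c\<in>C. 0 \<le> x \<bullet> c \<and> x \<bullet> c \<le> 1}"

definition coord_proj :: "'v::euclidean_space set \<Rightarrow> 'v \<Rightarrow> 'v" where
  "coord_proj B x = (\<Sum>b\<in>B. (x \<bullet> b) *\<^sub>R b)"

lemma linear_coord_proj: "linear (coord_proj B)"
  unfolding coord_proj_def by (rule linearI) (simp_all add: inner_add_left scaleR_add_left sum.distrib scaleR_sum_right)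

lemma coord_proj_span: "coord_proj B x \<in> span B"
  unfolding coord_proj_def by (intro span_sum span_scale span_base)

lemma coord_proj_id: "orthonormal B \<Longrightarrow> x \<in> span B \<Longrightarrow> coord_proj B x = x"
  unfolding coord_proj_def by (rule orthonormal_expand)

lemma span_inner_zero:
  assumes "x \<in> span B" "\<And>b. b \<in> B \<Longrightarrow> b \<bullet> c = 0" shows "x \<bullet> c = 0"
  using assms(1) by (induction rule: span_induct_alt) (auto simp: inner_add_left assms(2))

lemma closed_cube_over: "closed (cube_over C)"
proof -
  have "cube_over C = (\<Inter>c\<in>C. {x. 0 \<le> x \<bullet> c} \<inter> {x. x \<bullet> c \<le> 1})" by (auto simp: cube_over_def)
  then show ?thesis
    by (auto intro!: closed_INT closed_Int closed_Collect_le continuous_intros)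
qed

text \<open>Fubini along the two spans: the integrand depends on the first component only, and the
  unit cube in the second has measure one.\<close>

lemma nn_integral_cube_over:
  assumes BC: "orthonormal (B \<union> C)" "B \<inter> C = {}" "span (B \<union> C) = UNIV"
    and [measurable]: "f \<in> borel_measurable borel"
  shows "(\<integral>\<^sup>+x. f (coord_proj B x) * indicator (cube_over C) x \<partial>lborel) = (\<integral>\<^sup>+x. f x \<partial>coord_lborel B)"
proof -
  have B: "orthonormal B" and C: "orthonormal C" using BC(1) by (auto intro: orthonormal_subset)
  note finC = orthonormal_finite[OF C]
  interpret m: sigma_finite_measure "coord_lborel B" by (rule sigma_finite_coord_lborel[OF B])
  interpret n: sigma_finite_measure "coord_lborel C" by (rule sigma_finite_coord_lborel[OF C])
  interpret mn: pair_sigma_finite "coord_lborel B" "coord_lborel C" ..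
  have [measurable]: "coord_proj B \<in> borel \<rightarrow>\<^sub>M borel" by (rule linear_measurable[OF linear_coord_proj])
  have [measurable]: "cube_over C \<in> sets borel" by (rule borel_closed[OF closed_cube_over])
  have ortho: "b \<bullet> c = 0" if "b \<in> B" "c \<in> C" for b c
    using orthonormal_inner[OF BC(1), of b c] that BC(2) by auto
  have eq: "f (coord_proj B (x + y)) * indicator (cube_over C) (x + y) = f x * indicator (cube_over C) y"
    if "x \<in> span B" "y \<in> span C" for x y
  proof -
    have "y \<bullet> b = 0" if "b \<in> B" for b
      using span_inner_zero[OF \<open>y \<in> span C\<close>] ortho that by (metis inner_commute)
    then have "coord_proj B y = 0" by (simp add: coord_proj_def)
    then have "coord_proj B (x + y) = x"
      using that by (simp add: linear_add[OF linear_coord_proj] coord_proj_id[OF B])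
    moreover have "x \<bullet> c = 0" if "c \<in> C" for c
      using span_inner_zero[OF \<open>x \<in> span B\<close>] ortho that by auto
    then have "x + y \<in> cube_over C \<longleftrightarrow> y \<in> cube_over C" by (simp add: cube_over_def inner_add_left)
    ultimately show ?thesis by (simp add: indicator_def)
  qed
  have one: "emeasure (coord_lborel C) (cube_over C) = 1"
  proof -
    have "{c \<in> space (\<Pi>\<^sub>M b\<in>C. (lborel :: real measure)). (\<Sum>b\<in>C. c b *\<^sub>R b) \<in> cube_over C} = Pi\<^sub>E C (\<lambda>_. {0..1})"
      by (auto simp: space_PiM PiE_iff cube_over_def orthonormal_sum_inner[OF C] extensional_def)
    then show ?thesis
      using lb.emeasure_PiM[OF finC, of "\<lambda>_. {0..1::real}"] by (subst emeasure_coord_lborel) auto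
  qed
  have "(\<integral>\<^sup>+x. f (coord_proj B x) * indicator (cube_over C) x \<partial>lborel) =
    (\<integral>\<^sup>+z. f (coord_proj B (fst z + snd z)) * indicator (cube_over C) (fst z + snd z) \<partial>(coord_lborel B \<Otimes>\<^sub>M coord_lborel C))"
    unfolding coord_lborel_UNIV[OF BC(1,3), symmetric] coord_lborel_Un[OF BC(1,2)]
    by (subst nn_integral_distr) (auto simp: case_prod_beta')
  also have "\<dots> = (\<integral>\<^sup>+x. \<integral>\<^sup>+y. f (coord_proj B (x + y)) * indicator (cube_over C) (x + y) \<partial>coord_lborel C \<partial>coord_lborel B)"
    by (subst n.nn_integral_fst[symmetric]) auto
  also have "\<dots> = (\<integral>\<^sup>+x. \<integral>\<^sup>+y. f x * indicator (cube_over C) y \<partial>coord_lborel C \<partial>coord_lborel B)"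
  proof (rule nn_integral_cong_AE, use coord_lborel_AE_span in eventually_elim)
    fix x assume x: "x \<in> span B"
    show "(\<integral>\<^sup>+y. f (coord_proj B (x + y)) * indicator (cube_over C) (x + y) \<partial>coord_lborel C) =
      (\<integral>\<^sup>+y. f x * indicator (cube_over C) y \<partial>coord_lborel C)"
      by (rule nn_integral_cong_AE, use coord_lborel_AE_span in eventually_elim) (rule eq[OF x])
  qed
  also have "\<dots> = (\<integral>\<^sup>+x. f x \<partial>coord_lborel B)"
    by (simp add: nn_integral_cmult one)
  finally show ?thesis .
qed

lemma orthonormal_complement:
  assumes B: "orthonormal (B :: 'v::euclidean_space set)"
  obtains C where "orthonormal (B \<union> C)" "B \<inter> C = {}" "span (B \<union> C) = UNIV"
proof -
  define S where "S = {y. \<forall>x\<in>span B. orthogonal x y}"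
  have S: "subspace S" unfolding S_def by (rule subspace_orthogonal_to_vectors)
  note C = onb[OF S] and sub = onb_subset[OF S]
  have ortho: "b \<bullet> c = 0" if "b \<in> B" "c \<in> onb S" for b c
    using that sub by (auto simp: S_def orthogonal_def span_base)
  then have ortho': "c \<bullet> b = 0" if "b \<in> B" "c \<in> onb S" for b c
    using that by (simp add: inner_commute)
  show ?thesis
  proof (rule that)
    show "orthonormal (B \<union> onb S)"
      using B C(1) by (auto simp: orthonormal_def pairwise_def orthogonal_def ortho ortho')
    show "B \<inter> onb S = {}"
    proof (rule ccontr)
      assume "B \<inter> onb S \<noteq> {}"
      then obtain b where b: "b \<in> B" "b \<in> onb S" by auto
      then have "b \<bullet> b = 0" using ortho by auto
      then show False using b B by (auto simp: orthonormal_def)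
    qed
    show "span (B \<union> onb S) = UNIV"
    proof safe
      fix x :: 'v
      obtain y z where yz: "y \<in> span B" "\<And>w. w \<in> span B \<Longrightarrow> orthogonal z w" "x = y + z"
        using orthogonal_subspace_decomp_exists by metis
      then have "z \<in> span (onb S)" unfolding C(2) by (auto simp: S_def orthogonal_commute)
      then show "x \<in> span (B \<union> onb S)"
        using yz by (metis Un_upper1 Un_upper2 span_add span_mono subsetD)
    qed simp
  qed
qed

text \<open>The map is suspended to the whole space by \<open>g x = \<phi> (P x) + Q x\<close>,
  where \<open>Q\<close> carries the complement of \<open>W1\<close> isometrically to that of
  \<open>W2\<close>. It maps the unit slab over \<open>E\<close> bijectively onto the unit slab over
  the image. Its Jacobian matrix has an identity block in the complementary rows, so the full
  determinant is that of \<open>\<phi>'\<close> between the subspaces.\<close>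

theorem emeasure_subspace_differentiable_image:
  fixes \<phi> :: "'v::euclidean_space \<Rightarrow> 'v"
  assumes W1: "subspace W1" and W2: "subspace W2" and h: "bij_betw h (onb W1) (onb W2)"
    and E[measurable]: "E \<in> sets borel" and EW: "E \<subseteq> W1"
    and im[measurable]: "\<phi> ` E \<in> sets borel" and imW: "\<phi> ` E \<subseteq> W2"
    and der: "\<And>x. x \<in> E \<Longrightarrow> (\<phi> has_derivative \<phi>' x) (at x within E)" and inj: "inj_on \<phi> E"
    and der_W: "\<And>x y. x \<in> E \<Longrightarrow> y \<in> W1 \<Longrightarrow> \<phi>' x y \<in> W2"
    and Dm[measurable]: "(\<lambda>x. ennreal \<bar>set_det (onb W1) (\<lambda>b c. h b \<bullet> \<phi>' x c)\<bar> * indicator E x) \<in> borel_measurable borel"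
  shows "emeasure (subspace_lborel W2) (\<phi> ` E) =
    (\<integral>\<^sup>+x. ennreal \<bar>set_det (onb W1) (\<lambda>b c. h b \<bullet> \<phi>' x c)\<bar> * indicator E x \<partial>subspace_lborel W1)"
proof -
  define B1 B2 where B_def: "B1 = onb W1" "B2 = onb W2"
  have B1: "orthonormal B1" "span B1 = W1" and B2: "orthonormal B2" "span B2 = W2"
    using onb W1 W2 by (auto simp: B_def)
  obtain C1 where C1: "orthonormal (B1 \<union> C1)" "B1 \<inter> C1 = {}" "span (B1 \<union> C1) = UNIV"
    using orthonormal_complement[OF B1(1)] .
  obtain C2 where C2: "orthonormal (B2 \<union> C2)" "B2 \<inter> C2 = {}" "span (B2 \<union> C2) = UNIV"
    using orthonormal_complement[OF B2(1)] .
  note fin = orthonormal_finite[OF C1(1)] orthonormal_finite[OF C2(1)]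
  have hB: "bij_betw h B1 B2" using h by (simp add: B_def)
  have "card (B1 \<union> C1) = card (B2 \<union> C2)"
    using orthonormal_card[OF C1(1)] orthonormal_card[OF C2(1)] C1(3) C2(3) by simp
  then have "card C1 = card C2"
    using bij_betw_same_card[OF hB] fin C1(2) C2(2) by (simp add: card_Un_disjoint)
  then obtain k where k: "bij_betw k C1 C2"
    using finite_same_card_bij[of C1 C2] fin by auto
  define h2 where "h2 b = (if b \<in> B1 then h b else k b)" for b
  have h2B: "b \<in> B1 \<Longrightarrow> h2 b = h b" and h2C: "b \<in> C1 \<Longrightarrow> h2 b = k b" for b
    using C1(2) by (auto simp: h2_def)
  have h2: "bij_betw h2 (B1 \<union> C1) (B2 \<union> C2)"
    by (rule bij_betw_combine) (use hB k C2(2) h2B h2C in \<open>auto cong: bij_betw_cong\<close>)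
  have kC: "c \<in> C1 \<Longrightarrow> k c \<in> C2" for c using k by (auto simp: bij_betw_def)
  have hB2: "b \<in> B1 \<Longrightarrow> h b \<in> B2" for b using hB by (auto simp: bij_betw_def)
  have C1o: "orthonormal C1" and C2o: "orthonormal C2" using C1(1) C2(1) by (auto intro: orthonormal_subset)
  have ortho1: "b \<bullet> c = 0" if "b \<in> W1" "c \<in> C1" for b c
    using span_inner_zero[of b B1 c] that B1(2) orthonormal_inner[OF C1(1)] C1(2) by fastforce
  have ortho2: "b \<bullet> c = 0" if "b \<in> W2" "c \<in> C2" for b c
    using span_inner_zero[of b B2 c] that B2(2) orthonormal_inner[OF C2(1)] C2(2) by fastforce
  \<comment> \<open>\<open>Q\<close> reads the coordinates along \<open>C1\<close> and writes them
    along the matched vectors of \<open>C2\<close>.\<close>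
  define Q where "Q x = (\<Sum>c\<in>C1. (x \<bullet> c) *\<^sub>R k c)" for x
  have linQ: "linear Q" unfolding Q_def
    by (rule linearI) (simp_all add: inner_add_left scaleR_add_left sum.distrib scaleR_sum_right)
  have Qb: "Q x \<bullet> b = 0" if "b \<in> W2" for x b
    unfolding Q_def inner_sum_left using ortho2[OF that kC] by (intro sum.neutral) (simp add: inner_commute)
  have Qk: "Q x \<bullet> k c = x \<bullet> c" if "c \<in> C1" for x c
  proof -
    have "Q x \<bullet> k c = (\<Sum>d\<in>C1. if d = c then x \<bullet> d else 0)"
      unfolding Q_def inner_sum_left
    proof (intro sum.cong refl)
      fix d assume d: "d \<in> C1"
      have "k d \<bullet> k c = (if d = c then 1 else 0)"
        using orthonormal_inner[OF C2o kC[OF d] kC[OF that]] k d that by (auto simp: bij_betw_def inj_on_def)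
      then show "(x \<bullet> d) *\<^sub>R k d \<bullet> k c = (if d = c then x \<bullet> d else 0)" by simp
    qed
    then show ?thesis using that fin by simp
  qed
  define P where "P = coord_proj B1"
  have linP: "linear P" unfolding P_def by (rule linear_coord_proj)
  have PW: "P x \<in> W1" for x using coord_proj_span[of B1 x] B1(2) by (simp add: P_def)
  have Pid: "x \<in> W1 \<Longrightarrow> P x = x" for x using coord_proj_id[OF B1(1)] B1(2) by (simp add: P_def)
  define g where "g x = \<phi> (P x) + Q x" for x
  define g' where "g' x y = \<phi>' (P x) (P y) + Q y" for x y
  define E2 where "E2 = P -` E \<inter> cube_over C1"
  have Pm[measurable]: "P \<in> borel \<rightarrow>\<^sub>M borel" by (rule linear_measurable[OF linP])
  have P2m[measurable]: "coord_proj B2 \<in> borel \<rightarrow>\<^sub>M borel" by (rule linear_measurable[OF linear_coord_proj])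
  have cm[measurable]: "cube_over C1 \<in> sets borel" "cube_over C2 \<in> sets borel"
    by (auto intro: borel_closed[OF closed_cube_over])
  have E2[measurable]: "E2 \<in> sets borel" using measurable_sets[OF Pm E] by (simp add: E2_def)
  have P2g: "coord_proj B2 (g x) = \<phi> (P x)" if "P x \<in> E" for x
  proof -
    have "\<phi> (P x) \<in> W2" using imW that by auto
    moreover have "coord_proj B2 (Q x) = 0"
      using Qb span_base[of _ B2] B2(2) unfolding coord_proj_def by (intro sum.neutral) auto
    ultimately show ?thesis
      unfolding g_def by (simp add: linear_add[OF linear_coord_proj] coord_proj_id[OF B2(1)] B2(2))
  qed
  have gk: "g x \<bullet> k c = x \<bullet> c" if "P x \<in> E" "c \<in> C1" for x c
    using ortho2[of "\<phi> (P x)", OF _ kC[OF that(2)]] imW that by (auto simp: g_def inner_add_left Qk)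
  have imE2: "g ` E2 = coord_proj B2 -` (\<phi> ` E) \<inter> cube_over C2"
  proof (intro equalityI subsetI)
    fix z assume "z \<in> g ` E2"
    then obtain x where z: "z = g x" and x: "x \<in> E2" by auto
    then have PE: "P x \<in> E" by (simp add: E2_def)
    have C2k: "C2 = k ` C1" using k by (auto simp: bij_betw_def)
    have "g x \<in> cube_over C2" using x gk[OF PE] by (auto simp: cube_over_def E2_def C2k)
    then show "z \<in> coord_proj B2 -` (\<phi> ` E) \<inter> cube_over C2" using PE P2g by (auto simp: z)
  next
    fix y assume "y \<in> coord_proj B2 -` (\<phi> ` E) \<inter> cube_over C2"
    then obtain u where y: "y \<in> cube_over C2" and u: "coord_proj B2 y = \<phi> u" "u \<in> E" by auto
    \<comment> \<open>The preimage combines the base point \<open>u\<close> with the complementary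
      coordinates of \<open>y\<close>, pulled back along \<open>k\<close>.\<close>
    define x where "x = u + (\<Sum>c\<in>C1. (y \<bullet> k c) *\<^sub>R c)"
    have uW: "u \<in> W1" using u EW by auto
    have "P (\<Sum>c\<in>C1. (y \<bullet> k c) *\<^sub>R c) = 0"
    proof -
      have "(\<Sum>c\<in>C1. (y \<bullet> k c) *\<^sub>R c) \<bullet> b = 0" if "b \<in> B1" for b
        unfolding inner_sum_left using ortho1[of b] that B1(2) span_base[of b B1]
        by (intro sum.neutral) (auto simp: inner_commute)
      then show ?thesis by (simp add: P_def coord_proj_def)
    qed
    then have Px: "P x = u" by (simp add: x_def linear_add[OF linP] Pid[OF uW])
    have xc: "x \<bullet> c = y \<bullet> k c" if "c \<in> C1" for c
      using orthonormal_sum_inner[OF C1o that] ortho1[OF uW that] by (simp add: x_def inner_add_left)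
    have "x \<in> E2" using y Px u kC by (auto simp: E2_def cube_over_def xc)
    moreover have "g x = y"
    proof -
      have "g x = coord_proj B2 y + (\<Sum>c\<in>C1. (y \<bullet> k c) *\<^sub>R k c)"
        by (simp add: g_def Px u Q_def xc)
      also have "(\<Sum>c\<in>C1. (y \<bullet> k c) *\<^sub>R k c) = (\<Sum>c\<in>C2. (y \<bullet> c) *\<^sub>R c)"
        using sum.reindex_bij_betw[OF k, of "\<lambda>c. (y \<bullet> c) *\<^sub>R c"] .
      also have "coord_proj B2 y + (\<Sum>c\<in>C2. (y \<bullet> c) *\<^sub>R c) = (\<Sum>c\<in>B2 \<union> C2. (y \<bullet> c) *\<^sub>R c)"
        unfolding coord_proj_def using fin C2(2) by (subst sum.union_disjoint) auto
      also have "\<dots> = y" using orthonormal_expand[OF C2(1)] C2(3) by auto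
      finally show ?thesis .
    qed
    ultimately show "y \<in> g ` E2" by auto
  qed
  have "g ` E2 \<in> sets borel" using measurable_sets[OF P2m im] by (simp add: imE2)
  have derg: "(g has_derivative g' x) (at x within E2)" if "x \<in> E2" for x
  proof -
    have "(P has_derivative P) (at x within E2)"
      by (rule bounded_linear_imp_has_derivative) (simp add: linP linear_conv_bounded_linear[symmetric])
    moreover have "(\<phi> has_derivative \<phi>' (P x)) (at (P x) within P ` E2)"
      by (rule has_derivative_subset[OF der]) (use that in \<open>auto simp: E2_def\<close>)
    ultimately have "((\<lambda>x. \<phi> (P x)) has_derivative (\<lambda>y. \<phi>' (P x) (P y))) (at x within E2)"
      by (rule has_derivative_in_compose)
    moreover have "(Q has_derivative Q) (at x within E2)"
      by (rule bounded_linear_imp_has_derivative) (simp add: linQ linear_conv_bounded_linear[symmetric])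
    ultimately show ?thesis unfolding g_def g'_def by (rule has_derivative_add)
  qed
  have injg: "inj_on g E2"
  proof (rule inj_onI)
    fix x y assume xy: "x \<in> E2" "y \<in> E2" "g x = g y"
    then have "P x \<in> E" "P y \<in> E" by (auto simp: E2_def)
    then have "P x = P y" using P2g inj xy(3) by (metis inj_onD)
    moreover have "x \<bullet> c = y \<bullet> c" if "c \<in> C1" for c
      using gk[OF \<open>P x \<in> E\<close> that] gk[OF \<open>P y \<in> E\<close> that] xy(3) by simp
    ultimately have "(\<Sum>c\<in>B1 \<union> C1. (x \<bullet> c) *\<^sub>R c) = (\<Sum>c\<in>B1 \<union> C1. (y \<bullet> c) *\<^sub>R c)"
      using fin C1(2) by (simp add: sum.union_disjoint P_def coord_proj_def)
    then show "x = y" using orthonormal_expand[OF C1(1)] C1(3) by auto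
  qed
  have det: "set_det (B1 \<union> C1) (\<lambda>b c. h2 b \<bullet> g' x c) = set_det B1 (\<lambda>b c. h b \<bullet> \<phi>' (P x) c)" if x: "x \<in> E2" for x
  proof -
    have PE: "P x \<in> E" using x by (simp add: E2_def)
    have row: "k b \<bullet> g' x c = (if b = c then 1 else 0)" if "b \<in> C1" "c \<in> B1 \<union> C1" for b c
    proof -
      have "\<phi>' (P x) (P c) \<bullet> k b = 0"
        by (rule ortho2[OF der_W[OF PE PW] kC[OF that(1)]])
      then have "k b \<bullet> g' x c = c \<bullet> b"
        using Qk[OF that(1), of c] by (simp add: g'_def inner_commute[of "k b"] inner_add_left)
      also have "\<dots> = (if b = c then 1 else 0)" using orthonormal_inner[OF C1(1), of c b] that by auto
      finally show ?thesis .
    qed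
    have "set_det (B1 \<union> C1) (\<lambda>b c. h2 b \<bullet> g' x c) =
      (\<Prod>b\<in>(B1 \<union> C1) - B1. h2 b \<bullet> g' x b) * set_det B1 (\<lambda>b c. h2 b \<bullet> g' x c)"
      by (rule set_det_block) (use fin row h2C in auto)
    also have "(\<Prod>b\<in>(B1 \<union> C1) - B1. h2 b \<bullet> g' x b) = 1"
      by (rule prod.neutral) (use row h2C in auto)
    also have "set_det B1 (\<lambda>b c. h2 b \<bullet> g' x c) = set_det B1 (\<lambda>b c. h b \<bullet> \<phi>' (P x) c)"
    proof (rule set_det_cong)
      fix b c assume bc: "b \<in> B1" "c \<in> B1"
      have "Q c \<bullet> h b = 0" using Qb[of "h b" c] hB2[OF bc(1)] span_base[of "h b" B2] B2(2) by auto
      then show "h2 b \<bullet> g' x c = h b \<bullet> \<phi>' (P x) c"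
        using Pid[of c] bc span_base[of c B1] B1(2) by (simp add: h2B g'_def inner_add_right inner_commute)
    qed
    finally show ?thesis by simp
  qed
  have Df: "(\<lambda>x. ennreal \<bar>set_det (B1 \<union> C1) (\<lambda>b c. h2 b \<bullet> g' x c)\<bar> * indicator E2 x) =
      (\<lambda>x. (ennreal \<bar>set_det (onb W1) (\<lambda>b c. h b \<bullet> \<phi>' (P x) c)\<bar> * indicator E (P x)) * indicator (cube_over C1) x)"
    unfolding B_def(1)[symmetric] by (auto simp: fun_eq_iff det indicator_def E2_def)
  have "emeasure (subspace_lborel W2) (\<phi> ` E) = (\<integral>\<^sup>+x. indicator (\<phi> ` E) x \<partial>coord_lborel B2)"
    by (simp add: subspace_lborel_eq B_def)
  also have "\<dots> = (\<integral>\<^sup>+x. indicator (\<phi> ` E) (coord_proj B2 x) * indicator (cube_over C2) x \<partial>lborel)"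
    by (rule nn_integral_cube_over[OF C2, symmetric]) measurable
  also have "\<dots> = (\<integral>\<^sup>+x. indicator (g ` E2) x \<partial>lborel)"
    by (intro nn_integral_cong) (auto simp: imE2 indicator_def)
  also have "\<dots> = emeasure lborel (g ` E2)" using \<open>g ` E2 \<in> sets borel\<close> by simp
  also have "\<dots> = (\<integral>\<^sup>+x. ennreal \<bar>set_det (B1 \<union> C1) (\<lambda>b c. h2 b \<bullet> g' x c)\<bar> * indicator E2 x \<partial>lborel)"
    by (rule emeasure_differentiable_image_orthonormal[OF C1(1,3) h2 C2(1) E2 \<open>g ` E2 \<in> sets borel\<close> derg injg])
       (auto simp: Df)
  also have "\<dots> = (\<integral>\<^sup>+x. ennreal \<bar>set_det (onb W1) (\<lambda>b c. h b \<bullet> \<phi>' x c)\<bar> * indicator E x \<partial>coord_lborel B1)"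
    unfolding Df P_def by (rule nn_integral_cube_over[OF C1]) measurable
  finally show ?thesis by (simp add: subspace_lborel_eq B_def)
qed

section \<open>Differential calculus on relatively open sets\<close>

abbreviation fd :: "'e::real_normed_vector set \<Rightarrow> ('e \<Rightarrow> 'v::real_normed_vector) \<Rightarrow> 'e \<Rightarrow> 'e \<Rightarrow> 'v" where
  "fd D G u \<equiv> frechet_derivative G (at u within D)"

definition rel_open :: "'e::euclidean_space set \<Rightarrow> 'e set \<Rightarrow> bool" where
  "rel_open W D \<longleftrightarrow> subspace W \<and> openin (top_of_set W) D"

lemma rel_openD: "rel_open W D \<Longrightarrow> subspace W" "rel_open W D \<Longrightarrow> openin (top_of_set W) D" "rel_open W D \<Longrightarrow> D \<subseteq> W"
  by (auto simp: rel_open_def dest: openin_imp_subset)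

lemma rel_open_borel: assumes "rel_open W D" shows "D \<in> sets borel"
proof -
  obtain T where T: "open T" "D = W \<inter> T" using rel_openD(2)[OF assms] by (auto simp: openin_open)
  have "closed W" using rel_openD(1)[OF assms] by (rule closed_subspace)
  then show ?thesis using T by (auto intro: borel_closed borel_open)
qed

lemma rel_open_Int_open: "rel_open W D \<Longrightarrow> open T \<Longrightarrow> rel_open W (D \<inter> T)"
  by (auto simp: rel_open_def openin_open)

lemma rel_open_vimage:
  assumes "rel_open W D" "continuous_on D g" "g ` D \<subseteq> S" "openin (top_of_set S) T"
  shows "rel_open W (D \<inter> g -` T)"
proof -
  have "openin (top_of_set D) (D \<inter> g -` T)"
    using continuous_openin_preimage_gen[OF assms(2)] assms(3,4)
    by (meson continuous_on_open_gen continuous_openin_preimage assms(2) image_subset_iff_funcset)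
  then show ?thesis using assms(1) by (auto simp: rel_open_def intro: openin_trans)
qed

lemma rel_open_segment:
  assumes D: "rel_open W D" and u: "u \<in> D" and x: "x \<in> W"
  obtains e where "e > 0" "\<And>t. \<bar>t\<bar> < e \<Longrightarrow> u + t *\<^sub>R x \<in> D"
proof -
  obtain T where T: "open T" "D = W \<inter> T" using rel_openD(2)[OF D] by (auto simp: openin_open)
  then obtain r where r: "r > 0" "ball u r \<subseteq> T" using u by (auto simp: open_contains_ball)
  show ?thesis
  proof (rule that)
    show "r / (norm x + 1) > 0" using r by (simp add: add_nonneg_pos)
    fix t assume t: "\<bar>t\<bar> < r / (norm x + 1)"
    have "\<bar>t\<bar> * norm x \<le> \<bar>t\<bar> * (norm x + 1)" by (simp add: mult_left_mono)
    also have "\<dots> < r" using t by (simp add: pos_less_divide_eq add_nonneg_pos)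
    finally have "u + t *\<^sub>R x \<in> ball u r" by (simp add: dist_norm)
    moreover have "u + t *\<^sub>R x \<in> W"
      using u x rel_openD[OF D] by (auto intro: subspace_add subspace_scale)
    ultimately show "u + t *\<^sub>R x \<in> D" using r T by auto
  qed
qed

text \<open>A short segment through \<open>u\<close> in a direction of \<open>W\<close> stays inside
  \<open>D\<close>, so the claim follows from uniqueness of the derivative of a curve. In directions
  outside \<open>W\<close> nothing is determined.\<close>

lemma has_derivative_unique_rel_open:
  assumes D: "rel_open W D" and u: "u \<in> D" and x: "x \<in> W"
    and A: "(G has_derivative A) (at u within D)" and B: "(G has_derivative B) (at u within D)"
  shows "A x = B x"
proof -
  obtain e where e: "e > 0" "\<And>t. \<bar>t\<bar> < e \<Longrightarrow> u + t *\<^sub>R x \<in> D" using rel_open_segment[OF D u x] by blast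
  let ?S = "ball (0::real) e" and ?g = "\<lambda>t::real. u + t *\<^sub>R x"
  have g: "(?g has_derivative (\<lambda>t. t *\<^sub>R x)) (at 0 within ?S)"
    by (auto intro!: derivative_eq_intros)
  have im: "?g ` ?S \<subseteq> D" using e by auto
  have comp: "((\<lambda>t. G (?g t)) has_derivative (\<lambda>t. L (t *\<^sub>R x))) (at 0)"
    if "(G has_derivative L) (at u within D)" for L
  proof -
    have "(G has_derivative L) (at (?g 0) within ?g ` ?S)" using has_derivative_subset[OF that im] by simp
    from has_derivative_in_compose[OF g this]
    have "((\<lambda>t. G (?g t)) has_derivative (\<lambda>t. L (t *\<^sub>R x))) (at 0 within ?S)" .
    moreover have "at (0::real) within ?S = at 0" by (rule at_within_open) (use e(1) in auto)
    ultimately show ?thesis by (simp only:)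
  qed
  have "(\<lambda>t. A (t *\<^sub>R x)) = (\<lambda>t. B (t *\<^sub>R x))" by (rule has_derivative_unique[OF comp[OF A] comp[OF B]])
  from fun_cong[OF this, of 1] show ?thesis by simp
qed

lemma fd_eq:
  assumes "rel_open W D" "u \<in> D" "x \<in> W" "(G has_derivative A) (at u within D)"
  shows "fd D G u x = A x"
proof -
  have "(G has_derivative fd D G u) (at u within D)"
    using assms(4) unfolding frechet_derivative_works[symmetric] by (auto simp: differentiable_def)
  then show ?thesis by (rule has_derivative_unique_rel_open[OF assms(1,2,3) _ assms(4)])
qed

lemma at_within_rel_open:
  assumes "openin (top_of_set W) D'" "u \<in> D'" "D' \<subseteq> D" "D \<subseteq> W"
  shows "at u within D' = at u within D"
proof -
  obtain T where "open T" "D' = W \<inter> T" using assms(1) by (auto simp: openin_open)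
  then show ?thesis using assms by (intro at_within_nhd[of u T]) auto
qed

section \<open>Calculus of iterated differentiability\<close>

lemma Ck_SucD:
  assumes "Ck_on (Suc k) W D G"
  shows "u \<in> D \<Longrightarrow> (G has_derivative fd D G u) (at u within D)"
    and "x \<in> W \<Longrightarrow> Ck_on k W D (\<lambda>u. fd D G u x)"
  using assms by (auto simp: frechet_derivative_works)

lemma Ck_cong:
  assumes D: "rel_open W D" and eq: "\<And>u. u \<in> D \<Longrightarrow> G u = H u" and G: "Ck_on k W D G"
  shows "Ck_on k W D H"
  using eq G
proof (induction k arbitrary: G H)
  case 0
  then show ?case using continuous_on_cong[of D D G H] by simp
next
  case (Suc k)
  have d: "(H has_derivative fd D G u) (at u within D)" if "u \<in> D" for u
    using Ck_SucD(1)[OF Suc.prems(2) that] Suc.prems(1) that by (rule_tac has_derivative_transform) auto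
  have "Ck_on k W D (\<lambda>u. fd D H u x)" if "x \<in> W" for x
    by (rule Suc.IH[OF _ Ck_SucD(2)[OF Suc.prems(2) that]]) (use fd_eq[OF D _ that d] in auto)
  then show ?case using d by (auto simp: differentiable_def)
qed

text \<open>Any explicit derivative may replace the chosen \<open>frechet_derivative\<close>, since
  both agree on vectors of \<open>W\<close>. The closure rules below proceed by induction through
  this lemma.\<close>

lemma Ck_SucI:
  assumes D: "rel_open W D" and d: "\<And>u. u \<in> D \<Longrightarrow> (G has_derivative G' u) (at u within D)"
    and k: "\<And>x. x \<in> W \<Longrightarrow> Ck_on k W D (\<lambda>u. G' u x)"
  shows "Ck_on (Suc k) W D G"
proof -
  have "Ck_on k W D (\<lambda>u. fd D G u x)" if "x \<in> W" for x
    by (rule Ck_cong[OF D _ k[OF that]]) (use fd_eq[OF D _ that d] in auto)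
  then show ?thesis using d by (auto simp: differentiable_def)
qed

lemma Ck_lower: "Ck_on (Suc k) W D G \<Longrightarrow> Ck_on k W D G"
proof (induction k arbitrary: G)
  case 0
  then show ?case by (auto simp: continuous_on_eq_continuous_within differentiable_imp_continuous_within)
next
  case (Suc k)
  from Suc.prems have "\<forall>u\<in>D. G differentiable (at u within D)" "\<forall>x\<in>W. Ck_on (Suc k) W D (\<lambda>u. fd D G u x)"
    by (auto simp only: Ck_on.simps)
  then show ?case using Suc.IH by simp
qed

lemma Ck_const: "rel_open W D \<Longrightarrow> Ck_on k W D (\<lambda>_. c)"
proof (induction k arbitrary: c)
  case (Suc k)
  then show ?case by (intro Ck_SucI[where G'="\<lambda>_ _. 0"]) auto
qed auto

lemma Ck_bounded_linear:
  assumes D: "rel_open W D" and L: "bounded_linear L" shows "Ck_on k W D G \<Longrightarrow> Ck_on k W D (\<lambda>u. L (G u))"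
proof (induction k arbitrary: G)
  case 0 then show ?case using L by (simp add: bounded_linear.continuous_on)
next
  case (Suc k)
  show ?case
    by (rule Ck_SucI[OF D, where G'="\<lambda>u x. L (fd D G u x)"])
       (rule bounded_linear.has_derivative[OF L Ck_SucD(1)[OF Suc.prems]] Suc.IH[OF Ck_SucD(2)[OF Suc.prems]], assumption)+
qed

lemma Ck_id: assumes "rel_open W D" shows "Ck_on k W D (\<lambda>u. u)"
proof (cases k)
  case (Suc j)
  show ?thesis unfolding Suc
    by (rule Ck_SucI[OF assms, where G'="\<lambda>u x. x"]) (auto intro: Ck_const[OF assms])
qed (auto intro: continuous_intros)

lemma Ck_linear:
  assumes "rel_open W D" "linear (L :: 'e::euclidean_space \<Rightarrow> 'v::real_normed_vector)" shows "Ck_on k W D L"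
  using Ck_bounded_linear[OF assms(1) _ Ck_id[OF assms(1)], of L k] assms(2) by (simp add: linear_conv_bounded_linear)

lemma Ck_add:
  assumes D: "rel_open W D" shows "Ck_on k W D G \<Longrightarrow> Ck_on k W D H \<Longrightarrow> Ck_on k W D (\<lambda>u. G u + H u)"
proof (induction k arbitrary: G H)
  case 0 then show ?case by (auto intro: continuous_intros)
next
  case (Suc k)
  show ?case
    by (rule Ck_SucI[OF D, where G'="\<lambda>u x. fd D G u x + fd D H u x"])
       (use Ck_SucD[OF Suc.prems(1)] Ck_SucD[OF Suc.prems(2)] Suc.IH in \<open>auto intro: has_derivative_add\<close>)
qed

lemma Ck_bilinear:
  assumes D: "rel_open W D" and p: "bounded_bilinear p"
  shows "Ck_on k W D G \<Longrightarrow> Ck_on k W D H \<Longrightarrow> Ck_on k W D (\<lambda>u. p (G u) (H u))"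
proof (induction k arbitrary: G H)
  case 0 then show ?case using bounded_bilinear.continuous_on[OF p] by auto
next
  case (Suc k)
  note l = Ck_lower[OF Suc.prems(1)] Ck_lower[OF Suc.prems(2)]
  show ?case
    by (rule Ck_SucI[OF D, where G'="\<lambda>u x. p (G u) (fd D H u x) + p (fd D G u x) (H u)"])
       (use Ck_SucD[OF Suc.prems(1)] Ck_SucD[OF Suc.prems(2)] Suc.IH l in
         \<open>auto intro: bounded_bilinear.FDERIV[OF p] Ck_add[OF D]\<close>)
qed

lemma Ck_uminus: "rel_open W D \<Longrightarrow> Ck_on k W D G \<Longrightarrow> Ck_on k W D (\<lambda>u. - G u)"
  by (rule Ck_bounded_linear) (auto intro: bounded_linear_minus bounded_linear_ident)

lemma Ck_diff: "rel_open W D \<Longrightarrow> Ck_on k W D G \<Longrightarrow> Ck_on k W D H \<Longrightarrow> Ck_on k W D (\<lambda>u. G u - H u)"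
  using Ck_add[of W D k G "\<lambda>u. - H u"] Ck_uminus[of W D k H] by simp

lemmas Ck_mult = Ck_bilinear[OF _ bounded_bilinear_mult]
lemmas Ck_scaleR = Ck_bilinear[OF _ bounded_bilinear_scaleR]
lemmas Ck_inner = Ck_bilinear[OF _ bounded_bilinear_inner]

lemma Ck_inverse:
  fixes g :: "'e::euclidean_space \<Rightarrow> real"
  assumes D: "rel_open W D" shows "Ck_on k W D g \<Longrightarrow> (\<And>u. u \<in> D \<Longrightarrow> g u \<noteq> 0) \<Longrightarrow> Ck_on k W D (\<lambda>u. inverse (g u))"
proof (induction k)
  case 0 then show ?case by (auto intro: continuous_on_inverse)
next
  case (Suc k)
  have IH: "Ck_on k W D (\<lambda>u. inverse (g u))" using Suc Ck_lower by blast
  show ?case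
  proof (rule Ck_SucI[OF D, where G'="\<lambda>u x. - (inverse (g u) * fd D g u x * inverse (g u))"])
    show "((\<lambda>u. inverse (g u)) has_derivative (\<lambda>x. - (inverse (g u) * fd D g u x * inverse (g u)))) (at u within D)"
      if "u \<in> D" for u
      by (rule Deriv.has_derivative_inverse[OF Suc.prems(2)[OF that] Ck_SucD(1)[OF Suc.prems(1) that]])
    show "Ck_on k W D (\<lambda>u. - (inverse (g u) * fd D g u x * inverse (g u)))" if "x \<in> W" for x
      using Ck_SucD(2)[OF Suc.prems(1) that] IH by (intro Ck_uminus[OF D] Ck_mult[OF D]) auto
  qed
qed

lemma Ck_sqrt:
  assumes D: "rel_open W D" shows "Ck_on k W D g \<Longrightarrow> (\<And>u. u \<in> D \<Longrightarrow> g u > 0) \<Longrightarrow> Ck_on k W D (\<lambda>u. sqrt (g u))"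
proof (induction k)
  case 0 then show ?case by (auto intro: continuous_intros)
next
  case (Suc k)
  have IH: "Ck_on k W D (\<lambda>u. sqrt (g u))" using Suc Ck_lower by blast
  show ?case
  proof (rule Ck_SucI[OF D, where G'="\<lambda>u x. (inverse (sqrt (g u)) * (1/2)) * fd D g u x"])
    show "((\<lambda>u. sqrt (g u)) has_derivative (\<lambda>x. (inverse (sqrt (g u)) * (1/2)) * fd D g u x)) (at u within D)"
      if "u \<in> D" for u
      using Ck_SucD(1)[OF Suc.prems(1) that] Suc.prems(2)[OF that]
      by (auto intro!: derivative_eq_intros simp: field_simps)
    show "Ck_on k W D (\<lambda>u. (inverse (sqrt (g u)) * (1/2)) * fd D g u x)" if "x \<in> W" for x
    proof -
      have "sqrt (g u) \<noteq> 0" if "u \<in> D" for u using Suc.prems(2)[OF that] by simp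
      then show ?thesis
        by (intro Ck_mult[OF D] Ck_inverse[OF D IH] Ck_const[OF D] Ck_SucD(2)[OF Suc.prems(1) that])
    qed
  qed
qed

lemma Ck_norm:
  fixes G :: "'e::euclidean_space \<Rightarrow> 'v::real_inner"
  assumes D: "rel_open W D" and G: "Ck_on k W D G" and "\<And>u. u \<in> D \<Longrightarrow> G u \<noteq> 0"
  shows "Ck_on k W D (\<lambda>u. norm (G u))"
  unfolding norm_eq_sqrt_inner using assms by (intro Ck_sqrt Ck_inner) auto

lemma Ck_cos_sin:
  assumes D: "rel_open W D"
  shows "Ck_on k W D g \<Longrightarrow> Ck_on k W D (\<lambda>u. cos (g u :: real)) \<and> Ck_on k W D (\<lambda>u. sin (g u))"
proof (induction k)
  case 0 then show ?case by (auto intro: continuous_intros)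
next
  case (Suc k)
  have IH: "Ck_on k W D (\<lambda>u. cos (g u))" "Ck_on k W D (\<lambda>u. sin (g u))" using Suc Ck_lower by blast+
  note d = Ck_SucD[OF Suc.prems]
  show ?case
  proof
    show "Ck_on (Suc k) W D (\<lambda>u. cos (g u))"
      by (rule Ck_SucI[OF D, where G'="\<lambda>u x. - (sin (g u) * fd D g u x)"])
         (use d IH in \<open>auto intro!: derivative_eq_intros Ck_uminus[OF D] Ck_mult[OF D]\<close>)
    show "Ck_on (Suc k) W D (\<lambda>u. sin (g u))"
      by (rule Ck_SucI[OF D, where G'="\<lambda>u x. cos (g u) * fd D g u x"])
         (use d IH in \<open>auto intro!: derivative_eq_intros Ck_mult[OF D]\<close>)
  qed
qed

lemma Ck_restrict:
  assumes D: "rel_open W D" and D': "rel_open W D'" "D' \<subseteq> D"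
  shows "Ck_on k W D G \<Longrightarrow> Ck_on k W D' G"
proof (induction k arbitrary: G)
  case 0 then show ?case using D'(2) by (auto intro: continuous_on_subset)
next
  case (Suc k)
  show ?case
  proof (rule Ck_SucI[OF D'(1), where G'="fd D G"])
    show "(G has_derivative fd D G u) (at u within D')" if "u \<in> D'" for u
      by (rule has_derivative_subset[OF Ck_SucD(1)[OF Suc.prems] D'(2)]) (use that D'(2) in auto)
    show "Ck_on k W D' (\<lambda>u. fd D G u x)" if "x \<in> W" for x
      by (rule Suc.IH[OF Ck_SucD(2)[OF Suc.prems that]])
  qed
qed

lemma fd_rel_open:
  assumes "rel_open W D" "rel_open W D'" "D' \<subseteq> D" "u \<in> D'"
  shows "fd D' G u = fd D G u"
  using at_within_rel_open[OF rel_openD(2)[OF assms(2)] assms(4,3) rel_openD(3)[OF assms(1)]] by simp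

text \<open>On a relatively open part the filter within \<open>D'\<close> equals the filter within
  \<open>D\<close>, so derivatives do not notice the restriction. A holomorphic immersion provides
  homogeneous coordinates only locally, which makes this gluing necessary.\<close>

lemma Ck_local:
  assumes D: "rel_open W D"
  shows "(\<And>u. u \<in> D \<Longrightarrow> \<exists>D'. rel_open W D' \<and> u \<in> D' \<and> D' \<subseteq> D \<and> Ck_on k W D' G) \<Longrightarrow> Ck_on k W D G"
proof (induction k arbitrary: G)
  case (0 G)
  have "continuous (at u within D) G" if uD: "u \<in> D" for u
  proof -
    obtain D' where D': "rel_open W D'" "u \<in> D'" "D' \<subseteq> D" "continuous_on D' G"
      using 0[OF uD] by auto
    then have "continuous (at u within D') G" by (simp add: continuous_on_eq_continuous_within)
    then show ?thesis using at_within_rel_open[OF rel_openD(2)[OF D'(1)] D'(2,3) rel_openD(3)[OF D]] by simp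
  qed
  then show ?case by (simp add: continuous_on_eq_continuous_within)
next
  case (Suc k)
  have d: "(G has_derivative fd D G u) (at u within D)" if "u \<in> D" for u
  proof -
    obtain D' where D': "rel_open W D'" "u \<in> D'" "D' \<subseteq> D" "Ck_on (Suc k) W D' G" using Suc.prems[OF \<open>u \<in> D\<close>] by auto
    show ?thesis using Ck_SucD(1)[OF D'(4,2)]
      using at_within_rel_open[OF rel_openD(2)[OF D'(1)] D'(2,3) rel_openD(3)[OF D]] by simp
  qed
  show ?case
  proof (rule Ck_SucI[OF D d], assumption)
    fix x assume x: "x \<in> W"
    show "Ck_on k W D (\<lambda>u. fd D G u x)"
    proof (rule Suc.IH)
      fix u assume "u \<in> D"
      then obtain D' where D': "rel_open W D'" "u \<in> D'" "D' \<subseteq> D" "Ck_on (Suc k) W D' G" using Suc.prems[OF \<open>u \<in> D\<close>] by auto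
      have "Ck_on k W D' (\<lambda>u. fd D G u x)"
        by (rule Ck_cong[OF D'(1) _ Ck_SucD(2)[OF D'(4) x]]) (simp add: fd_rel_open[OF D D'(1,3)])
      then show "\<exists>D'. rel_open W D' \<and> u \<in> D' \<and> D' \<subseteq> D \<and> Ck_on k W D' (\<lambda>u. fd D G u x)" using D' by auto
    qed
  qed
qed

text \<open>For linear \<open>T\<close> a directional derivative of the composition is again a
  composition with \<open>T\<close>, in the direction \<open>T x\<close>. The induction therefore
  closes without a general chain rule for higher derivatives.\<close>

lemma Ck_reparam:
  fixes T :: "'a::euclidean_space \<Rightarrow> 'e::euclidean_space"
  assumes D: "rel_open W D" and D': "rel_open W' D'" and T: "linear T" "T ` W' \<subseteq> W" "T ` D' \<subseteq> D"
  shows "Ck_on k W D G \<Longrightarrow> Ck_on k W' D' (\<lambda>u. G (T u))"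
proof (induction k arbitrary: G)
  case 0
  have "continuous_on D' T" using T(1) by (simp add: linear_continuous_on linear_conv_bounded_linear)
  then show ?case using 0 T(3) by (auto intro: continuous_on_compose2)
next
  case (Suc k)
  have TT: "(T has_derivative T) (at u within D')" for u
    using T(1) by (intro bounded_linear_imp_has_derivative) (simp add: linear_conv_bounded_linear)
  show ?case
  proof (rule Ck_SucI[OF D', where G'="\<lambda>u x. fd D G (T u) (T x)"])
    show "((\<lambda>u. G (T u)) has_derivative (\<lambda>x. fd D G (T u) (T x))) (at u within D')" if "u \<in> D'" for u
      by (rule has_derivative_in_compose[OF TT has_derivative_subset[OF Ck_SucD(1)[OF Suc.prems]]])
         (use that T in auto)
    show "Ck_on k W' D' (\<lambda>u. fd D G (T u) (T x))" if "x \<in> W'" for x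
      by (rule Suc.IH[OF Ck_SucD(2)[OF Suc.prems]]) (use that T in auto)
  qed
qed

lemma smooth_has_derivative: "smooth_map_on W D G \<Longrightarrow> u \<in> D \<Longrightarrow> (G has_derivative fd D G u) (at u within D)"
  using Ck_SucD(1)[of 0 W D G u] by (auto simp: smooth_map_on_def)

lemma smooth_continuous: "smooth_map_on W D G \<Longrightarrow> continuous_on D G"
  unfolding smooth_map_on_def using Ck_on.simps(1)[of W D G] by blast

lemma smooth_fd:
  assumes "smooth_map_on W D G" "x \<in> W" shows "smooth_map_on W D (\<lambda>u. fd D G u x)"
  unfolding smooth_map_on_def
proof
  fix k
  have "Ck_on (Suc k) W D G" using assms by (simp only: smooth_map_on_def)
  then show "Ck_on k W D (\<lambda>u. fd D G u x)" using assms by simp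
qed

lemma smooth_cong: "rel_open W D \<Longrightarrow> (\<And>u. u \<in> D \<Longrightarrow> G u = H u) \<Longrightarrow> smooth_map_on W D G \<Longrightarrow> smooth_map_on W D H"
  unfolding smooth_map_on_def using Ck_cong[of W D G H] by blast

lemma smooth_restrict: "rel_open W D \<Longrightarrow> rel_open W D' \<Longrightarrow> D' \<subseteq> D \<Longrightarrow> smooth_map_on W D G \<Longrightarrow> smooth_map_on W D' G"
  unfolding smooth_map_on_def using Ck_restrict[of W D D'] by blast

lemma linear_fd: "smooth_map_on W D G \<Longrightarrow> u \<in> D \<Longrightarrow> linear (fd D G u)"
  using smooth_has_derivative has_derivative_linear by blast

section \<open>Orthogonal projections\<close>

lemma orth_proj_unique:
  assumes S: "subspace S" and y: "y \<in> S" "\<And>s. s \<in> S \<Longrightarrow> (x - y) \<bullet> s = 0" shows "orth_proj S x = y"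
  unfolding orth_proj_def
proof (rule the_equality)
  show "y \<in> S \<and> (\<forall>s\<in>S. (x - y) \<bullet> s = 0)" using y by auto
  fix z assume z: "z \<in> S \<and> (\<forall>s\<in>S. (x - z) \<bullet> s = 0)"
  have d: "y - z \<in> S" using S y z by (auto intro: subspace_diff)
  have "(y - z) \<bullet> (y - z) = (x - z) \<bullet> (y - z) - (x - y) \<bullet> (y - z)" by (simp add: inner_diff_left)
  also have "\<dots> = 0" using d y z by auto
  finally show "z = y" by simp
qed

lemma orth_proj:
  assumes S: "subspace S" shows "orth_proj S x \<in> S" "s \<in> S \<Longrightarrow> (x - orth_proj S x) \<bullet> s = 0"
proof -
  obtain y z where "y \<in> span S" "\<And>w. w \<in> span S \<Longrightarrow> orthogonal z w" "x = y + z"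
    using orthogonal_subspace_decomp_exists by metis
  then have y: "y \<in> S" "\<And>s. s \<in> S \<Longrightarrow> (x - y) \<bullet> s = 0"
    using S by (auto simp: orthogonal_def span_eq_iff[THEN iffD2, OF S])
  then have "orth_proj S x = y" by (rule orth_proj_unique[OF S])
  then show "orth_proj S x \<in> S" "s \<in> S \<Longrightarrow> (x - orth_proj S x) \<bullet> s = 0" using y by auto
qed

lemma orth_proj_inner: "subspace S \<Longrightarrow> s \<in> S \<Longrightarrow> orth_proj S x \<bullet> s = x \<bullet> s"
  using orth_proj(2)[of S s x] by (simp add: inner_diff_left)

lemma orth_proj_orth_proj:
  assumes "subspace S" "subspace T" "S \<subseteq> T" shows "orth_proj S (orth_proj T x) = orth_proj S x"
proof (rule orth_proj_unique[OF assms(1) orth_proj(1)[OF assms(1)]])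
  fix s assume "s \<in> S"
  then show "(orth_proj T x - orth_proj S x) \<bullet> s = 0"
    using assms by (simp add: inner_diff_left orth_proj_inner subset_iff)
qed

text \<open>Gram-Schmidt, one vector at a time.\<close>

lemma smooth_orth_proj_frame:
  fixes e :: "'i \<Rightarrow> 'e::euclidean_space \<Rightarrow> 'v::euclidean_space"
  assumes D: "rel_open W D"
  shows "finite I \<Longrightarrow> (\<And>i. i \<in> I \<Longrightarrow> smooth_map_on W D (e i)) \<Longrightarrow>
     (\<And>i u. i \<in> I \<Longrightarrow> u \<in> D \<Longrightarrow> e i u \<notin> span ((\<lambda>j. e j u) ` (I - {i}))) \<Longrightarrow> smooth_map_on W D v \<Longrightarrow>
     smooth_map_on W D (\<lambda>u. orth_proj (span ((\<lambda>j. e j u) ` I)) (v u))"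
proof (induction I arbitrary: v rule: finite_induct)
  case empty
  have "orth_proj {0::'v} x = 0" for x by (rule orth_proj_unique) auto
  then show ?case using Ck_const[OF D, of _ "0::'v"] unfolding smooth_map_on_def by simp
next
  case (insert i I)
  let ?S = "\<lambda>u. span ((\<lambda>j. e j u) ` I)"
  have IH: "smooth_map_on W D (\<lambda>u. orth_proj (?S u) (v u))" if "smooth_map_on W D v" for v
  proof (rule insert.IH[OF _ _ that])
    fix j u assume j: "j \<in> I" and u: "u \<in> D"
    have "span ((\<lambda>j. e j u) ` (I - {j})) \<subseteq> span ((\<lambda>j. e j u) ` (insert i I - {j}))"
      by (intro span_mono image_mono) auto
    then show "e j u \<notin> span ((\<lambda>j. e j u) ` (I - {j}))"
      using insert.prems(2)[of j u] j u by auto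
  qed (use insert.prems in auto)
  define w where "w u = e i u - orth_proj (?S u) (e i u)" for u
  have ws: "smooth_map_on W D w"
    using IH[OF insert.prems(1)[of i]] insert.prems(1)[of i] unfolding w_def smooth_map_on_def
    by (auto intro!: Ck_diff[OF D])
  have w0: "w u \<noteq> 0" if "u \<in> D" for u
  proof
    assume "w u = 0"
    then have "e i u \<in> ?S u" using orth_proj(1)[OF subspace_span, of "(\<lambda>j. e j u) ` I" "e i u"] by (simp add: w_def)
    moreover have "insert i I - {i} = I" using insert.hyps by auto
    ultimately show False using insert.prems(2)[of i u] that by auto
  qed
  \<comment> \<open>Since \<open>w u\<close> is nonzero and orthogonal to the earlier span,
    projecting onto the enlarged span adds only the component along \<open>w u\<close>.\<close>
  define P where "P u = orth_proj (?S u) (v u) + ((v u \<bullet> w u) * inverse (w u \<bullet> w u)) *\<^sub>R w u" for u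
  have "smooth_map_on W D P"
    using IH[OF insert.prems(3)] ws insert.prems(3) w0 unfolding P_def smooth_map_on_def
    by (auto intro!: Ck_add[OF D] Ck_scaleR[OF D] Ck_mult[OF D] Ck_inner[OF D] Ck_inverse[OF D])
  moreover have "P u = orth_proj (span ((\<lambda>j. e j u) ` insert i I)) (v u)" if u: "u \<in> D" for u
  proof (rule orth_proj_unique[symmetric, OF subspace_span])
    let ?E = "(\<lambda>j. e j u) ` I"
    have sub: "span ?E \<subseteq> span ((\<lambda>j. e j u) ` insert i I)" by (intro span_mono) auto
    have p1: "orth_proj (?S u) x \<in> span ((\<lambda>j. e j u) ` insert i I)" for x
      using orth_proj(1)[OF subspace_span, of ?E x] sub by auto
    have wi: "w u \<in> span ((\<lambda>j. e j u) ` insert i I)"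
      unfolding w_def by (intro span_diff p1 span_base) auto
    show "P u \<in> span ((\<lambda>j. e j u) ` insert i I)"
      unfolding P_def by (intro span_add p1 span_scale wi)
    have ww: "w u \<bullet> s = 0" if "s \<in> ?S u" for s
      using orth_proj(2)[OF subspace_span that] by (simp add: w_def)
    have Ps: "(v u - P u) \<bullet> s = 0" if "s \<in> ?S u" for s
      using orth_proj(2)[OF subspace_span that, of "v u"] ww[OF that] by (simp add: P_def inner_diff_left inner_add_left)
    have Pw: "(v u - P u) \<bullet> w u = 0"
    proof -
      have "orth_proj (?S u) (v u) \<bullet> w u = 0"
        using ww[OF orth_proj(1)[OF subspace_span]] by (simp add: inner_commute)
      then show ?thesis using w0[OF u] by (simp add: P_def inner_diff_left inner_add_left)
    qed
    fix s assume "s \<in> span ((\<lambda>j. e j u) ` insert i I)"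
    then show "(v u - P u) \<bullet> s = 0"
    proof (induction rule: span_induct_alt)
      case (step c x y)
      have "(v u - P u) \<bullet> x = 0"
      proof (cases "x = e i u")
        case True
        have "(v u - P u) \<bullet> x = (v u - P u) \<bullet> w u + (v u - P u) \<bullet> orth_proj (?S u) (e i u)"
          by (simp add: True w_def inner_diff_right)
        then show ?thesis using Pw Ps[OF orth_proj(1)[OF subspace_span]] by simp
      next
        case False
        then show ?thesis using step by (intro Ps span_base) auto
      qed
      then show ?case using step by (simp add: inner_add_right)
    qed simp
  qed
  ultimately show ?case by (rule smooth_cong[OF D, rotated])
qed

section \<open>Regular parametrizations\<close>

lemma regular_paramsD:
  assumes "(W, D, \<psi>) \<in> regular_params n X F"
  shows "subspace W" "dim W = n" "rel_open W D" "openin (top_of_set X) (\<psi> ` D)" "\<exists>g. homeomorphism D (\<psi> ` D) \<psi> g"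
    "smooth_map_on W D (F \<circ> \<psi>)" "\<And>u x. u \<in> D \<Longrightarrow> x \<in> W \<Longrightarrow> fd D (F \<circ> \<psi>) u x = 0 \<Longrightarrow> x = 0"
    "continuous_on D \<psi>" "inj_on \<psi> D" "\<psi> ` D \<subseteq> X"
  using assms by (auto simp: regular_params_def local_param_def rel_open_def homeomorphism_def inj_on_def
      dest: openin_imp_subset) metis

lemma regular_params_restrict:
  assumes p: "(W, D, \<psi>) \<in> regular_params n X F" and D': "rel_open W D'" "D' \<subseteq> D"
  shows "(W, D', \<psi>) \<in> regular_params n X F"
proof -
  note r = regular_paramsD[OF p]
  obtain g where g: "homeomorphism D (\<psi> ` D) \<psi> g" using r(5) by auto
  have "openin (top_of_set D) D'"
    using D' rel_openD[OF r(3)] rel_openD[OF D'(1)] by (meson openin_subset_trans)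
  then have "openin (top_of_set (\<psi> ` D)) (\<psi> ` D')" by (rule homeomorphism_imp_open_map[OF g])
  then have o: "openin (top_of_set X) (\<psi> ` D')" using r(4) openin_trans by blast
  have "homeomorphism D' (\<psi> ` D') \<psi> g" by (rule homeomorphism_of_subsets[OF g D'(2)]) auto
  moreover have "fd D' (F \<circ> \<psi>) u = fd D (F \<circ> \<psi>) u" if "u \<in> D'" for u
    by (rule fd_rel_open[OF r(3) D' that])
  ultimately show ?thesis
    using r o D' smooth_restrict[OF r(3) D' r(6)] rel_openD[OF D'(1)]
    unfolding regular_params_def local_param_def by auto
qed

text \<open>A linear left inverse \<open>L\<close> of \<open>B\<close> turns
  \<open>G (\<phi> x) = H x\<close> into a formula for the increment of \<open>\<phi>\<close>. One
  remainder is small relative to that increment itself. This first bounds the increment linearly and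
  then shows that \<open>L \<circ> C\<close> is the derivative. Only continuity of
  \<open>\<phi>\<close> is assumed, which suits chart transitions: they are a priori just
  homeomorphisms.\<close>

lemma has_derivative_lift:
  fixes \<phi> :: "'a::euclidean_space \<Rightarrow> 'b::euclidean_space" and G :: "'b \<Rightarrow> 'v::euclidean_space"
  assumes W: "subspace W" "D \<subseteq> W" and u: "u \<in> S" and im: "\<phi> ` S \<subseteq> D"
    and cont: "continuous (at u within S) \<phi>"
    and G: "(G has_derivative B) (at (\<phi> u) within D)" and inj: "\<And>x. x \<in> W \<Longrightarrow> B x = 0 \<Longrightarrow> x = 0"
    and H: "(H has_derivative C) (at u within S)" and eq: "\<And>x. x \<in> S \<Longrightarrow> G (\<phi> x) = H x"
  obtains A where "(\<phi> has_derivative A) (at u within S)" "\<And>x. A x \<in> W"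
proof -
  have Bl: "linear B" and Cl: "bounded_linear C" using G H by (auto intro: has_derivative_linear has_derivative_bounded_linear)
  have "inj_on B W" using inj by (subst linear_inj_on_iff_eq_0[OF Bl W(1)]) auto
  then obtain L where L: "range L \<subseteq> W" "linear L" "\<And>x. x \<in> W \<Longrightarrow> L (B x) = x"
    using linear_exists_left_inverse_on[OF Bl W(1)] by auto
  have Lb: "bounded_linear L" using L(2) by (simp add: linear_conv_bounded_linear)
  obtain K where K: "K > 0" "\<And>x. norm (L x) \<le> norm x * K" using bounded_linear.pos_bounded[OF Lb] by auto
  obtain M where M: "M > 0" "\<And>x. norm (C x) \<le> norm x * M" using bounded_linear.pos_bounded[OF Cl] by auto
  have Wd: "\<phi> y - \<phi> u \<in> W" if "y \<in> S" for y
    using that u im W by (intro subspace_diff) auto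
  show ?thesis
  proof (rule that)
    show "L (C x) \<in> W" for x using L(1) by auto
    show "(\<phi> has_derivative (\<lambda>x. L (C x))) (at u within S)"
      unfolding has_derivative_within_alt
    proof (intro conjI allI impI)
      show "bounded_linear (\<lambda>x. L (C x))" by (rule bounded_linear_compose[OF Lb Cl])
      fix e :: real assume e: "e > 0"
      \<comment> \<open>The first bound gives \<open>K * q \<le> 1/2\<close>, so the remainder
        involving \<open>a\<close> can be absorbed. The second is chosen so that the final constant
        \<open>K * q * (2 * K * M + 2)\<close> is at most \<open>e\<close>.\<close>
      define q where "q = min (1 / (2 * K)) (e / (K * (2 * K * M + 2)))"
      have KM: "K * (2 * K * M + 2) > 0" using K(1) M(1) by (simp add: add_pos_pos)
      have q: "q > 0" "K * q \<le> 1/2" "K * q * (2 * K * M + 2) \<le> e"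
      proof -
        show "q > 0" using e K KM by (simp add: q_def)
        have "K * q \<le> K * (1 / (2 * K))" using K by (intro mult_left_mono) (auto simp: q_def)
        then show "K * q \<le> 1/2" using K by simp
        have "q * (K * (2 * K * M + 2)) \<le> e / (K * (2 * K * M + 2)) * (K * (2 * K * M + 2))"
          using KM by (intro mult_right_mono) (auto simp: q_def)
        also have "e / (K * (2 * K * M + 2)) * (K * (2 * K * M + 2)) = e" using KM by (metis less_irrefl nonzero_eq_divide_eq)
        finally show "K * q * (2 * K * M + 2) \<le> e" by (simp only: mult_ac)
      qed
      obtain d1 where d1: "d1 > 0" "\<And>y. y \<in> S \<Longrightarrow> norm (y - u) < d1 \<Longrightarrow> norm (H y - H u - C (y - u)) \<le> q * norm (y - u)"
        using H q(1) unfolding has_derivative_within_alt by metis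
      obtain d2 where d2: "d2 > 0" "\<And>y. y \<in> D \<Longrightarrow> norm (y - \<phi> u) < d2 \<Longrightarrow> norm (G y - G (\<phi> u) - B (y - \<phi> u)) \<le> q * norm (y - \<phi> u)"
        using G q(1) unfolding has_derivative_within_alt by metis
      obtain d3 where d3: "d3 > 0" "\<And>y. y \<in> S \<Longrightarrow> norm (y - u) < d3 \<Longrightarrow> norm (\<phi> y - \<phi> u) < d2"
        using cont d2(1) unfolding continuous_within_eps_delta dist_norm by metis
      show "\<exists>d>0. \<forall>y\<in>S. norm (y - u) < d \<longrightarrow> norm (\<phi> y - \<phi> u - L (C (y - u))) \<le> e * norm (y - u)"
      proof (intro exI[of _ "min d1 d3"] conjI ballI impI)
        show "min d1 d3 > 0" using d1 d3 by simp
        fix y assume y: "y \<in> S" "norm (y - u) < min d1 d3"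
        define R1 where "R1 = H y - H u - C (y - u)"
        define R2 where "R2 = G (\<phi> y) - G (\<phi> u) - B (\<phi> y - \<phi> u)"
        define a where "a = norm (\<phi> y - \<phi> u)"
        define b where "b = norm (y - u)"
        have R1: "norm R1 \<le> q * b" using d1(2)[of y] y by (simp add: R1_def b_def)
        have R2: "norm R2 \<le> q * a"
          unfolding R2_def a_def by (rule d2(2)) (use y im d3(2)[of y] in auto)
        have "B (\<phi> y - \<phi> u) = C (y - u) + R1 - R2"
          using eq[OF y(1)] eq[OF u] by (simp add: R1_def R2_def)
        then have "\<phi> y - \<phi> u = L (C (y - u) + R1 - R2)" using L(3)[OF Wd[OF y(1)]] by simp
        then have E: "\<phi> y - \<phi> u - L (C (y - u)) = L (R1 - R2)"
          by (simp add: linear_add[OF L(2)] linear_diff[OF L(2)])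
        have "norm (L (R1 - R2)) \<le> norm (R1 - R2) * K" by (rule K(2))
        also have "\<dots> \<le> (q * b + q * a) * K"
          using R1 R2 norm_triangle_ineq4[of R1 R2] K(1) by (intro mult_right_mono) auto
        finally have LR: "norm (L (R1 - R2)) \<le> K * q * b + K * q * a" by (simp add: algebra_simps)
        have LC: "norm (L (C (y - u))) \<le> K * M * b"
        proof -
          have "norm (L (C (y - u))) \<le> norm (C (y - u)) * K" by (rule K(2))
          also have "\<dots> \<le> (b * M) * K" using M(2)[of "y - u"] K(1) by (intro mult_right_mono) (auto simp: b_def)
          finally show ?thesis by (simp add: mult_ac)
        qed
        have "a \<le> norm (L (C (y - u))) + norm (L (R1 - R2))"
          unfolding a_def E[symmetric] by (metis add.commute diff_add_cancel norm_triangle_ineq)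
        also have "\<dots> \<le> K * M * b + (K * q * b + K * q * a)" using LR LC by simp
        also have "\<dots> \<le> K * M * b + (1/2 * b + 1/2 * a)"
          using q(2) by (intro add_left_mono add_mono mult_right_mono) (auto simp: a_def b_def)
        \<comment> \<open>Half of \<open>a\<close> has been moved to the left side; the increment of
          \<open>\<phi>\<close> is now bounded linearly.\<close>
        finally have ab: "a \<le> (2 * K * M + 1) * b" by (simp add: algebra_simps)
        have "norm (\<phi> y - \<phi> u - L (C (y - u))) \<le> K * q * b + K * q * a" using LR E by simp
        also have "\<dots> \<le> K * q * b + K * q * ((2 * K * M + 1) * b)"
          using ab K q by (intro add_left_mono mult_left_mono) auto
        also have "\<dots> = K * q * (2 * K * M + 2) * b" by (simp add: algebra_simps)
        also have "\<dots> \<le> e * b" using q(3) by (intro mult_right_mono) (auto simp: b_def)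
        finally show "norm (\<phi> y - \<phi> u - L (C (y - u))) \<le> e * norm (y - u)" by (simp add: b_def)
      qed
    qed
  qed
qed

lemma fd_transition:
  assumes D1: "rel_open W1 D1" and S: "rel_open W1 S" "S \<subseteq> D1" and u: "u \<in> S" and x: "x \<in> W1"
    and \<phi>: "(\<phi> has_derivative A) (at u within S)" "\<phi> ` S \<subseteq> D2" and eq: "\<And>w. w \<in> S \<Longrightarrow> H (\<phi> w) = G w"
    and H: "H differentiable (at (\<phi> u) within D2)"
  shows "fd D1 G u x = fd D2 H (\<phi> u) (A x)"
proof -
  have "(H has_derivative fd D2 H (\<phi> u)) (at (\<phi> u) within \<phi> ` S)"
    by (rule has_derivative_subset[OF H[unfolded frechet_derivative_works] \<phi>(2)])
  from has_derivative_in_compose[OF \<phi>(1) this]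
  have "(G has_derivative (\<lambda>x. fd D2 H (\<phi> u) (A x))) (at u within S)"
    by (rule has_derivative_transform[OF u, rotated]) (use eq in auto)
  from fd_eq[OF S(1) u x this] show ?thesis using fd_rel_open[OF D1 S u, of G] by auto
qed


text \<open>The identity of \<open>F \<circ> \<psi>2 \<circ> \<phi>\<close> with
  \<open>F \<circ> \<psi>1\<close> and the injectivity of the differential of
  \<open>F \<circ> \<psi>2\<close> make the transition differentiable. First derivatives are what
  tangent spaces, derivatives along the manifold and volume densities require.\<close>

lemma regular_params_transition:
  fixes F :: "'x::topological_space \<Rightarrow> 'v::euclidean_space"
  assumes p1: "(W1, D1, \<psi>1) \<in> regular_params n X F" and p2: "(W2, D2, \<psi>2) \<in> regular_params n X F"
  obtains \<phi> \<phi>' where "rel_open W1 (D1 \<inter> \<psi>1 -` (\<psi>2 ` D2))"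
    "\<And>u. u \<in> D1 \<inter> \<psi>1 -` (\<psi>2 ` D2) \<Longrightarrow> \<phi> u \<in> D2 \<and> \<psi>2 (\<phi> u) = \<psi>1 u"
    "continuous_on (D1 \<inter> \<psi>1 -` (\<psi>2 ` D2)) \<phi>"
    "inj_on \<phi> (D1 \<inter> \<psi>1 -` (\<psi>2 ` D2))"
    "\<And>u. u \<in> D1 \<inter> \<psi>1 -` (\<psi>2 ` D2) \<Longrightarrow> (\<phi> has_derivative \<phi>' u) (at u within D1 \<inter> \<psi>1 -` (\<psi>2 ` D2))"
    "\<And>u x. u \<in> D1 \<inter> \<psi>1 -` (\<psi>2 ` D2) \<Longrightarrow> \<phi>' u x \<in> W2"
    "\<And>u x. u \<in> D1 \<inter> \<psi>1 -` (\<psi>2 ` D2) \<Longrightarrow> x \<in> W1 \<Longrightarrow>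
        fd D1 (F \<circ> \<psi>1) u x = fd D2 (F \<circ> \<psi>2) (\<phi> u) (\<phi>' u x)"
proof -
  note r1 = regular_paramsD[OF p1] and r2 = regular_paramsD[OF p2]
  obtain g where g: "homeomorphism D2 (\<psi>2 ` D2) \<psi>2 g" using r2(5) by auto
  let ?S = "D1 \<inter> \<psi>1 -` (\<psi>2 ` D2)"
  define \<phi> where "\<phi> = g \<circ> \<psi>1"
  have S: "rel_open W1 ?S" by (rule rel_open_vimage[OF r1(3,8,10) r2(4)])
  have \<phi>D: "\<phi> u \<in> D2" "\<psi>2 (\<phi> u) = \<psi>1 u" if "u \<in> ?S" for u
    using that g by (auto simp: \<phi>_def homeomorphism_def)
  have c: "continuous_on ?S \<phi>"
    unfolding \<phi>_def
    by (rule continuous_on_compose[OF continuous_on_subset[OF r1(8)]])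
       (use g in \<open>auto simp: homeomorphism_def intro: continuous_on_subset\<close>)
  have inj: "inj_on \<phi> ?S"
  proof (rule inj_onI)
    fix u v assume uv: "u \<in> ?S" "v \<in> ?S" "\<phi> u = \<phi> v"
    then have "\<psi>1 u = \<psi>1 v" using \<phi>D(2)[OF uv(1)] \<phi>D(2)[OF uv(2)] by simp
    then show "u = v" using r1(9) uv by (auto simp: inj_on_def)
  qed
  have "\<exists>A. (\<phi> has_derivative A) (at u within ?S) \<and> (\<forall>x. A x \<in> W2)" if u: "u \<in> ?S" for u
  proof -
    have "continuous (at u within ?S) \<phi>" using c u by (auto simp: continuous_on_eq_continuous_within)
    moreover have "((F \<circ> \<psi>1) has_derivative fd D1 (F \<circ> \<psi>1) u) (at u within ?S)"
      by (rule has_derivative_subset[OF smooth_has_derivative[OF r1(6)]]) (use u in auto)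
    moreover have "((F \<circ> \<psi>2) has_derivative fd D2 (F \<circ> \<psi>2) (\<phi> u)) (at (\<phi> u) within D2)"
      by (rule smooth_has_derivative[OF r2(6) \<phi>D(1)[OF u]])
    ultimately show ?thesis
      using has_derivative_lift[OF r2(1) rel_openD(3)[OF r2(3)] u, of \<phi> "F \<circ> \<psi>2" "fd D2 (F \<circ> \<psi>2) (\<phi> u)" "F \<circ> \<psi>1" "fd D1 (F \<circ> \<psi>1) u"]
        \<phi>D r2(7)[OF \<phi>D(1)[OF u]] by (auto simp: image_subset_iff) metis
  qed
  then obtain \<phi>' where \<phi>': "\<And>u. u \<in> ?S \<Longrightarrow> (\<phi> has_derivative \<phi>' u) (at u within ?S)" "\<And>u x. u \<in> ?S \<Longrightarrow> \<phi>' u x \<in> W2"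
    by metis
  show ?thesis
  proof (rule that[OF S _ c inj \<phi>'])
    fix u x assume u: "u \<in> ?S" and x: "x \<in> W1"
    have "(F \<circ> \<psi>2) differentiable (at (\<phi> u) within D2)"
      using smooth_has_derivative[OF r2(6) \<phi>D(1)[OF u]] by (auto simp: differentiable_def)
    then show "fd D1 (F \<circ> \<psi>1) u x = fd D2 (F \<circ> \<psi>2) (\<phi> u) (\<phi>' u x)"
      using fd_transition[OF r1(3) S _ u x \<phi>'(1)[OF u], of D2 "F \<circ> \<psi>2" "F \<circ> \<psi>1"] \<phi>D by auto
  qed (use \<phi>D in auto)
qed

section \<open>Tangent spaces and shape operators\<close>

text \<open>The derivative of a transition takes values in the model space of the target chart, so
  another chart at the same point contributes no new vectors.\<close>

lemma tangent_space_eq: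
  assumes p: "(W, D, \<psi>) \<in> regular_params n X F" and u: "u \<in> D"
  shows "tangent_space n X F (\<psi> u) = fd D (F \<circ> \<psi>) u ` W"
proof
  show "fd D (F \<circ> \<psi>) u ` W \<subseteq> tangent_space n X F (\<psi> u)"
    unfolding tangent_space_def using p u by blast
  show "tangent_space n X F (\<psi> u) \<subseteq> fd D (F \<circ> \<psi>) u ` W"
  proof
    fix y assume "y \<in> tangent_space n X F (\<psi> u)"
    then obtain W2 D2 \<psi>2 u2 x where 2: "(W2, D2, \<psi>2) \<in> regular_params n X F" "u2 \<in> D2" "\<psi>2 u2 = \<psi> u" "x \<in> W2"
      and y: "y = fd D2 (F \<circ> \<psi>2) u2 x" unfolding tangent_space_def by blast
    obtain \<phi> \<phi>' where \<phi>:
      "\<And>u. u \<in> D2 \<inter> \<psi>2 -` (\<psi> ` D) \<Longrightarrow> \<phi> u \<in> D \<and> \<psi> (\<phi> u) = \<psi>2 u"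
      "\<And>u x. u \<in> D2 \<inter> \<psi>2 -` (\<psi> ` D) \<Longrightarrow> \<phi>' u x \<in> W"
      "\<And>u x. u \<in> D2 \<inter> \<psi>2 -` (\<psi> ` D) \<Longrightarrow> x \<in> W2 \<Longrightarrow>
        fd D2 (F \<circ> \<psi>2) u x = fd D (F \<circ> \<psi>) (\<phi> u) (\<phi>' u x)"
  proof (rule regular_params_transition[OF 2(1) p], goal_cases)
    case (1 \<phi> \<phi>')
    show ?case by (rule that[of \<phi> \<phi>']) (use 1 in blast)+
  qed
    have u2: "u2 \<in> D2 \<inter> \<psi>2 -` (\<psi> ` D)" using 2 u by auto
    have "\<phi> u2 = u" using \<phi>(1)[OF u2] regular_paramsD(9)[OF p] 2(3) u by (auto simp: inj_on_def)
    then show "y \<in> fd D (F \<circ> \<psi>) u ` W" using \<phi>(2)[OF u2] \<phi>(3)[OF u2 2(4)] y by auto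
  qed
qed

lemma linear_fd_param:
  assumes "(W, D, \<psi>) \<in> regular_params n X F" "u \<in> D" shows "linear (fd D (F \<circ> \<psi>) u)"
  using linear_fd[OF regular_paramsD(6)[OF assms(1)] assms(2)] .

lemma inj_on_fd_param:
  assumes "(W, D, \<psi>) \<in> regular_params n X F" "u \<in> D" shows "inj_on (fd D (F \<circ> \<psi>) u) W"
  using linear_inj_on_iff_eq_0[OF linear_fd_param[OF assms] regular_paramsD(1)[OF assms(1)]]
    regular_paramsD(7)[OF assms] by auto

lemma tangent_space_subspace:
  assumes p: "(W, D, \<psi>) \<in> regular_params n X F" and u: "u \<in> D"
  shows "subspace (tangent_space n X F (\<psi> u))" "dim (tangent_space n X F (\<psi> u)) = n"
proof -
  show "subspace (tangent_space n X F (\<psi> u))"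
    unfolding tangent_space_eq[OF p u]
    by (rule linear_subspace_image[OF linear_fd_param[OF p u] regular_paramsD(1)[OF p]])
  show "dim (tangent_space n X F (\<psi> u)) = n"
    unfolding tangent_space_eq[OF p u]
    using dim_image_eq[OF linear_fd_param[OF p u], of W] inj_on_fd_param[OF p u] regular_paramsD(1,2)[OF p]
    by (simp add: span_eq_iff[THEN iffD2])
qed

text \<open>Well-definedness of the description in \<open>deriv_along\<close>: by injectivity of the
  differential, the transition must send any other coordinate direction of the same tangent vector
  to \<open>\<xi>\<close>, and then the chain rule applies to \<open>V\<close>.\<close>

lemma deriv_along_eq:
  assumes p: "(W, D, \<psi>) \<in> regular_params n X F" and u: "u \<in> D" and \<xi>: "\<xi> \<in> W"
    and V: "(V \<circ> \<psi>) differentiable (at u within D)"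
  shows "deriv_along n X F V (\<psi> u) (fd D (F \<circ> \<psi>) u \<xi>) = fd D (V \<circ> \<psi>) u \<xi>"
  unfolding deriv_along_def
proof (rule the_equality)
  show "\<exists>W' D' \<psi>' u' \<xi>'. (W', D', \<psi>') \<in> regular_params n X F \<and> u' \<in> D' \<and> \<psi>' u' = \<psi> u \<and> \<xi>' \<in> W' \<and>
     fd D' (F \<circ> \<psi>') u' \<xi>' = fd D (F \<circ> \<psi>) u \<xi> \<and> fd D (V \<circ> \<psi>) u \<xi> = fd D' (V \<circ> \<psi>') u' \<xi>'"
    using p u \<xi> by blast
  fix d assume "\<exists>W' D' \<psi>' u' \<xi>'. (W', D', \<psi>') \<in> regular_params n X F \<and> u' \<in> D' \<and> \<psi>' u' = \<psi> u \<and> \<xi>' \<in> W' \<and>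
     fd D' (F \<circ> \<psi>') u' \<xi>' = fd D (F \<circ> \<psi>) u \<xi> \<and> d = fd D' (V \<circ> \<psi>') u' \<xi>'"
  then obtain W2 D2 \<psi>2 u2 x where 2: "(W2, D2, \<psi>2) \<in> regular_params n X F" "u2 \<in> D2" "\<psi>2 u2 = \<psi> u" "x \<in> W2"
      "fd D2 (F \<circ> \<psi>2) u2 x = fd D (F \<circ> \<psi>) u \<xi>" and d: "d = fd D2 (V \<circ> \<psi>2) u2 x" by blast
  let ?S = "D2 \<inter> \<psi>2 -` (\<psi> ` D)"
  obtain \<phi> \<phi>' where S: "rel_open W2 ?S" and \<phi>:
      "\<And>u. u \<in> ?S \<Longrightarrow> \<phi> u \<in> D \<and> \<psi> (\<phi> u) = \<psi>2 u"
      "\<And>u x. u \<in> ?S \<Longrightarrow> \<phi>' u x \<in> W"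
      "\<And>u x. u \<in> ?S \<Longrightarrow> x \<in> W2 \<Longrightarrow> fd D2 (F \<circ> \<psi>2) u x = fd D (F \<circ> \<psi>) (\<phi> u) (\<phi>' u x)"
      "\<And>u. u \<in> ?S \<Longrightarrow> (\<phi> has_derivative \<phi>' u) (at u within ?S)"
  proof (rule regular_params_transition[OF 2(1) p], goal_cases)
    case (1 \<phi> \<phi>')
    show ?case by (rule that[of \<phi> \<phi>']) (use 1 in blast)+
  qed
  have u2: "u2 \<in> D2 \<inter> \<psi>2 -` (\<psi> ` D)" using 2 u by auto
  have eu: "\<phi> u2 = u" using \<phi>(1)[OF u2] regular_paramsD(9)[OF p] 2(3) u by (auto simp: inj_on_def)
  have "fd D (F \<circ> \<psi>) u (\<phi>' u2 x) = fd D (F \<circ> \<psi>) u \<xi>" using \<phi>(3)[OF u2 2(4)] 2(5) eu by simp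
  then have "\<phi>' u2 x = \<xi>" using inj_on_fd_param[OF p u] \<phi>(2)[OF u2] \<xi> by (auto simp: inj_on_def)
  then show "d = fd D (V \<circ> \<psi>) u \<xi>"
    using fd_transition[OF regular_paramsD(3)[OF 2(1)] S _ u2 2(4) \<phi>(4)[OF u2], of D "V \<circ> \<psi>" "V \<circ> \<psi>2"] \<phi>(1) V eu d
    by auto
qed

section \<open>Second derivatives and shape operators\<close>

definition hess :: "'e::euclidean_space set \<Rightarrow> ('e \<Rightarrow> 'v::real_normed_vector) \<Rightarrow> 'e \<Rightarrow> 'e \<Rightarrow> 'e \<Rightarrow> 'v" where
  "hess D G u \<xi> \<eta> = fd D (\<lambda>u. fd D G u \<eta>) u \<xi>"

lemma hess_has_derivative:
  assumes "smooth_map_on W D G" "u \<in> D" "\<eta> \<in> W"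
  shows "((\<lambda>u. fd D G u \<eta>) has_derivative (\<lambda>\<xi>. hess D G u \<xi> \<eta>)) (at u within D)"
  unfolding hess_def by (rule smooth_has_derivative[OF smooth_fd[OF assms(1,3)] assms(2)])

lemma hess_restrict:
  assumes D: "rel_open W D" and D': "rel_open W D'" "D' \<subseteq> D" "u \<in> D'" and G: "smooth_map_on W D G"
    and \<xi>: "\<xi> \<in> W" "\<eta> \<in> W"
  shows "hess D' G u \<xi> \<eta> = hess D G u \<xi> \<eta>"
proof -
  have "((\<lambda>u. fd D G u \<eta>) has_derivative (\<lambda>\<xi>. hess D G u \<xi> \<eta>)) (at u within D')"
    by (rule has_derivative_subset[OF hess_has_derivative[OF G _ \<xi>(2)] D'(2)]) (use D' in auto)
  then have "((\<lambda>u. fd D' G u \<eta>) has_derivative (\<lambda>\<xi>. hess D G u \<xi> \<eta>)) (at u within D')"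
    by (rule has_derivative_transform[OF D'(3), rotated]) (simp add: fd_rel_open[OF D D'(1,2)])
  then show ?thesis unfolding hess_def[of D'] by (rule fd_eq[OF D'(1,3) \<xi>(1)])
qed

text \<open>The Weingarten relation, obtained by differentiating the constant zero function
  \<open>V w \<bullet> fd D G w \<eta>\<close>.\<close>

lemma normal_derivative:
  assumes D: "rel_open W D" and G: "smooth_map_on W D G" and V: "smooth_map_on W D V"
    and u: "u \<in> D" and \<xi>: "\<xi> \<in> W" "\<eta> \<in> W" and orth: "\<And>w. w \<in> D \<Longrightarrow> V w \<bullet> fd D G w \<eta> = 0"
  shows "fd D V u \<xi> \<bullet> fd D G u \<eta> = - (V u \<bullet> hess D G u \<xi> \<eta>)"
proof -
  have 1: "((\<lambda>w. V w \<bullet> fd D G w \<eta>) has_derivative (\<lambda>\<xi>. V u \<bullet> hess D G u \<xi> \<eta> + fd D V u \<xi> \<bullet> fd D G u \<eta>)) (at u within D)"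
    by (rule has_derivative_inner[OF smooth_has_derivative[OF V u] hess_has_derivative[OF G u \<xi>(2)]])
  have "((\<lambda>w. 0::real) has_derivative (\<lambda>\<xi>. V u \<bullet> hess D G u \<xi> \<eta> + fd D V u \<xi> \<bullet> fd D G u \<eta>)) (at u within D)"
    by (rule has_derivative_transform[OF u _ 1]) (simp add: orth)
  then have "0 = V u \<bullet> hess D G u \<xi> \<eta> + fd D V u \<xi> \<bullet> fd D G u \<eta>"
    using has_derivative_unique_rel_open[OF D u \<xi>(1), of "\<lambda>_. 0::real" "\<lambda>_. 0"] by simp
  then show ?thesis by simp
qed

lemma subspace_eqI_inner:
  assumes "subspace S" "a \<in> S" "b \<in> S" "\<And>s. s \<in> S \<Longrightarrow> a \<bullet> s = b \<bullet> s" shows "a = b"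
proof -
  have "(a - b) \<bullet> (a - b) = 0" using assms by (simp add: inner_diff_left subspace_diff)
  then show ?thesis by simp
qed

text \<open>Every normal extension of \<open>v\<close> gives the same operator, because its inner
  products with tangent vectors are second derivatives of \<open>F\<close> paired with
  \<open>v\<close> alone. This resolves the description in \<open>shape_operator\<close>, provided
  that some extension exists. The ambient manifold drops out: projecting to its tangent space first
  does not change the projection to the smaller one.\<close>

lemma shape_operator_hess:
  assumes p: "(W, D, \<psi>) \<in> regular_params n X F" and u: "u \<in> D" and \<xi>: "\<xi> \<in> W"
    and Y: "subspace (tangent_space k Y id (F (\<psi> u)))" "tangent_space n X F (\<psi> u) \<subseteq> tangent_space k Y id (F (\<psi> u))"
    and ex: "\<exists>U V. \<psi> u \<in> U \<and> normal_field k Y n X F U V \<and> V (\<psi> u) = v"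
  shows "shape_operator k Y n X F (\<psi> u) v (fd D (F \<circ> \<psi>) u \<xi>) \<in> tangent_space n X F (\<psi> u)"
    and "\<eta> \<in> W \<Longrightarrow> shape_operator k Y n X F (\<psi> u) v (fd D (F \<circ> \<psi>) u \<xi>) \<bullet> fd D (F \<circ> \<psi>) u \<eta> = v \<bullet> hess D (F \<circ> \<psi>) u \<xi> \<eta>"
proof -
  note r = regular_paramsD[OF p]
  let ?T = "tangent_space n X F (\<psi> u)"
  let ?x = "fd D (F \<circ> \<psi>) u \<xi>"
  let ?A = "\<lambda>V. - orth_proj ?T (cov_deriv k Y n X F V (\<psi> u) ?x)"
  note T = tangent_space_subspace(1)[OF p u]
  have key: "?A V \<in> ?T \<and> (\<forall>\<eta>\<in>W. ?A V \<bullet> fd D (F \<circ> \<psi>) u \<eta> = v \<bullet> hess D (F \<circ> \<psi>) u \<xi> \<eta>)"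
    if pU: "\<psi> u \<in> U" and V: "normal_field k Y n X F U V" and Vp: "V (\<psi> u) = v" for U V
  proof -
    define D' where "D' = D \<inter> \<psi> -` U"
    have D': "rel_open W D'" "D' \<subseteq> D" "u \<in> D'"
      using rel_open_vimage[OF r(3,8,10), of U] V pU u by (auto simp: D'_def normal_field_def)
    note p' = regular_params_restrict[OF p D'(1,2)]
    have im: "\<psi> ` D' \<subseteq> U" by (auto simp: D'_def)
    then have Vs: "smooth_map_on W D' (V \<circ> \<psi>)" using V p' by (auto simp: normal_field_def)
    have Vn: "(V \<circ> \<psi>) w \<bullet> fd D' (F \<circ> \<psi>) w \<eta> = 0" if "w \<in> D'" "\<eta> \<in> W" for w \<eta>
    proof -
      have "V (\<psi> w) \<in> normal_space k Y n X F (\<psi> w)" using V im that by (auto simp: normal_field_def)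
      then show ?thesis using tangent_space_eq[OF p' that(1)] that(2) by (auto simp: normal_space_def)
    qed
    have eqd: "fd D' (F \<circ> \<psi>) u = fd D (F \<circ> \<psi>) u" by (rule fd_rel_open[OF r(3) D'])
    have da: "deriv_along n X F V (\<psi> u) ?x = fd D' (V \<circ> \<psi>) u \<xi>"
      using deriv_along_eq[OF p' D'(3) \<xi>, of V] smooth_has_derivative[OF Vs D'(3)] eqd
      by (auto simp: differentiable_def)
    have A: "?A V = - orth_proj ?T (fd D' (V \<circ> \<psi>) u \<xi>)"
      unfolding cov_deriv_def da by (simp add: orth_proj_orth_proj[OF T Y])
    show ?thesis
    proof (intro conjI ballI)
      show "?A V \<in> ?T" unfolding A using T orth_proj(1)[OF T] by (intro subspace_neg) auto
      fix \<eta> assume \<eta>: "\<eta> \<in> W"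
      have "fd D (F \<circ> \<psi>) u \<eta> \<in> ?T" using tangent_space_eq[OF p u] \<eta> by auto
      then have "?A V \<bullet> fd D (F \<circ> \<psi>) u \<eta> = - (fd D' (V \<circ> \<psi>) u \<xi> \<bullet> fd D' (F \<circ> \<psi>) u \<eta>)"
        unfolding A by (simp add: orth_proj_inner[OF T] eqd)
      also have "\<dots> = (V \<circ> \<psi>) u \<bullet> hess D' (F \<circ> \<psi>) u \<xi> \<eta>"
      proof -
        have "fd D' (V \<circ> \<psi>) u \<xi> \<bullet> fd D' (F \<circ> \<psi>) u \<eta> = - ((V \<circ> \<psi>) u \<bullet> hess D' (F \<circ> \<psi>) u \<xi> \<eta>)"
          by (rule normal_derivative[OF D'(1) regular_paramsD(6)[OF p'] Vs D'(3) \<xi> \<eta>]) (rule Vn[OF _ \<eta>])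
        then show ?thesis by simp
      qed
      also have "\<dots> = v \<bullet> hess D (F \<circ> \<psi>) u \<xi> \<eta>"
        using hess_restrict[OF r(3) D' r(6) \<xi> \<eta>] Vp by simp
      finally show "?A V \<bullet> fd D (F \<circ> \<psi>) u \<eta> = v \<bullet> hess D (F \<circ> \<psi>) u \<xi> \<eta>" .
    qed
  qed
  obtain U V where UV: "\<psi> u \<in> U" "normal_field k Y n X F U V" "V (\<psi> u) = v" using ex by blast
  have "shape_operator k Y n X F (\<psi> u) v ?x = ?A V"
    unfolding shape_operator_def
  proof (rule the_equality)
    show "\<exists>U V'. \<psi> u \<in> U \<and> normal_field k Y n X F U V' \<and> V' (\<psi> u) = v \<and> ?A V = ?A V'" using UV by blast
    fix a assume "\<exists>U V'. \<psi> u \<in> U \<and> normal_field k Y n X F U V' \<and> V' (\<psi> u) = v \<and> a = ?A V'"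
    then obtain U' V' where UV': "\<psi> u \<in> U'" "normal_field k Y n X F U' V'" "V' (\<psi> u) = v" "a = ?A V'" by blast
    show "a = ?A V"
    proof (rule subspace_eqI_inner[OF T])
      show "a \<in> ?T" "?A V \<in> ?T" using key[OF UV] key[OF UV'(1-3)] UV'(4) by auto
      fix s assume "s \<in> ?T"
      then obtain \<eta> where \<eta>: "\<eta> \<in> W" "s = fd D (F \<circ> \<psi>) u \<eta>" using tangent_space_eq[OF p u] by auto
      have "?A V' \<bullet> s = v \<bullet> hess D (F \<circ> \<psi>) u \<xi> \<eta>" "?A V \<bullet> s = v \<bullet> hess D (F \<circ> \<psi>) u \<xi> \<eta>"
        unfolding \<eta>(2) using key[OF UV] key[OF UV'(1-3)] \<eta>(1) by blast+
      then show "a \<bullet> s = ?A V \<bullet> s" by (simp only: UV'(4))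
    qed
  qed
  then show "shape_operator k Y n X F (\<psi> u) v ?x \<in> ?T"
    "\<eta> \<in> W \<Longrightarrow> shape_operator k Y n X F (\<psi> u) v ?x \<bullet> fd D (F \<circ> \<psi>) u \<eta> = v \<bullet> hess D (F \<circ> \<psi>) u \<xi> \<eta>"
    using key[OF UV] by auto
qed

definition params_cover :: "nat \<Rightarrow> 'x::topological_space set \<Rightarrow> ('x \<Rightarrow> 'v::euclidean_space) \<Rightarrow> bool" where
  "params_cover n X F \<longleftrightarrow> (\<forall>p\<in>X. \<exists>W D \<psi> u. (W, D, \<psi>) \<in> regular_params n X F \<and> u \<in> D \<and> \<psi> u = p)"

lemma params_cover_subspace:
  assumes "params_cover n X F" "p \<in> X"
  shows "subspace (tangent_space n X F p)" "dim (tangent_space n X F p) = n"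
  using assms tangent_space_subspace unfolding params_cover_def by metis+

text \<open>The tangential part of a smooth ambient tangent field \<open>V0\<close> is subtracted.
  Nothing changes at \<open>p\<close>, where the value is already normal. Smoothness in a chart
  follows by projecting onto its coordinate frame.\<close>

lemma normal_field_exists:
  assumes cov: "params_cover n X F" and U: "openin (top_of_set X) U" and p: "p \<in> U"
    and Y: "\<And>q. q \<in> U \<Longrightarrow> subspace (tangent_space k Y id (F q))"
      "\<And>q. q \<in> U \<Longrightarrow> tangent_space n X F q \<subseteq> tangent_space k Y id (F q)"
    and V0: "\<And>q. q \<in> U \<Longrightarrow> V0 q \<in> tangent_space k Y id (F q)"
      "\<And>W D \<psi>. (W, D, \<psi>) \<in> regular_params n X F \<Longrightarrow> \<psi> ` D \<subseteq> U \<Longrightarrow> smooth_map_on W D (V0 \<circ> \<psi>)"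
    and v: "V0 p = v" "v \<in> normal_space k Y n X F p"
  shows "\<exists>U V. p \<in> U \<and> normal_field k Y n X F U V \<and> V p = v"
proof -
  let ?T = "tangent_space n X F"
  define V where "V q = V0 q - orth_proj (?T q) (V0 q)" for q
  have UX: "U \<subseteq> X" using U by (rule openin_imp_subset)
  have T: "subspace (?T q)" if "q \<in> U" for q using params_cover_subspace(1)[OF cov] that UX by auto
  have "V p = v"
  proof -
    have "orth_proj (?T p) v = 0"
      by (rule orth_proj_unique[OF T[OF p]]) (use T[OF p] v(2) in \<open>auto simp: normal_space_def subspace_0\<close>)
    then show ?thesis by (simp add: V_def v)
  qed
  moreover have "normal_field k Y n X F U V"
    unfolding normal_field_def
  proof (intro conjI ballI U)
    fix q assume q: "q \<in> U"
    have "orth_proj (?T q) (V0 q) \<in> tangent_space k Y id (F q)" using orth_proj(1)[OF T[OF q]] Y(2)[OF q] by auto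
    then have "V q \<in> tangent_space k Y id (F q)" unfolding V_def by (intro subspace_diff Y V0 q)
    then show "V q \<in> normal_space k Y n X F q"
      using orth_proj(2)[OF T[OF q]] by (auto simp: normal_space_def V_def)
  next
    fix c assume "c \<in> regular_params n X F"
    moreover obtain W D \<psi> where c: "c = (W, D, \<psi>)" by (cases c)
    ultimately have p: "(W, D, \<psi>) \<in> regular_params n X F" by simp
    note r = regular_paramsD[OF p]
    have "smooth_map_on W D (V \<circ> \<psi>)" if im: "\<psi> ` D \<subseteq> U"
    proof -
      let ?e = "\<lambda>b u. fd D (F \<circ> \<psi>) u b"
      note B = onb[OF r(1)]
      have frame: "smooth_map_on W D (\<lambda>u. orth_proj (span ((\<lambda>b. ?e b u) ` onb W)) ((V0 \<circ> \<psi>) u))"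
      proof (rule smooth_orth_proj_frame[OF r(3) onb_finite[OF r(1)] _ _ V0(2)[OF p im]])
        show "smooth_map_on W D (?e b)" if "b \<in> onb W" for b
          by (rule smooth_fd[OF r(6)]) (use that onb_subset[OF r(1)] in auto)
        fix b u assume b: "b \<in> onb W" and u: "u \<in> D"
        show "?e b u \<notin> span ((\<lambda>j. ?e j u) ` (onb W - {b}))"
        proof
          assume "?e b u \<in> span ((\<lambda>j. ?e j u) ` (onb W - {b}))"
          then have "?e b u \<in> (\<lambda>j. ?e j u) ` span (onb W - {b})"
            using linear_span_image[OF linear_fd_param[OF p u]] by auto
          then obtain c where c: "c \<in> span (onb W - {b})" "?e b u = ?e c u" by auto
          have "span (onb W - {b}) \<subseteq> W" using span_mono[of "onb W - {b}" "onb W"] B by auto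
          then have "b = c" using inj_on_fd_param[OF p u] c b onb_subset[OF r(1)] by (auto simp: inj_on_def)
          then show False using c(1) b orthonormal_indep[OF B(1)] by (auto simp: dependent_def)
        qed
      qed
      have "span ((\<lambda>b. ?e b u) ` onb W) = ?T (\<psi> u)" if "u \<in> D" for u
        using linear_span_image[OF linear_fd_param[OF p that], of "onb W"] B(2) tangent_space_eq[OF p that] by simp
      then have "smooth_map_on W D (\<lambda>u. orth_proj (?T (\<psi> u)) (V0 (\<psi> u)))"
        using smooth_cong[OF r(3) _ frame, of "\<lambda>u. orth_proj (?T (\<psi> u)) (V0 (\<psi> u))"] by simp
      then have "smooth_map_on W D (\<lambda>u. V0 (\<psi> u) - orth_proj (?T (\<psi> u)) (V0 (\<psi> u)))"
        using V0(2)[OF p im] unfolding smooth_map_on_def comp_def by (auto intro!: Ck_diff[OF r(3)])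
      then show ?thesis by (simp add: V_def comp_def)
    qed
    then show "case c of (W, D, \<psi>) \<Rightarrow> \<psi> ` D \<subseteq> U \<longrightarrow> smooth_map_on W D (V \<circ> \<psi>)" by (simp add: c)
  qed
  ultimately show ?thesis using p by blast
qed

section \<open>Existence and uniqueness of the Riemannian volume\<close>

text \<open>The defining property inside \<open>riemannian_volume\<close>, named separately so that
  existence and uniqueness can be proved for it.\<close>

definition is_rvol :: "nat \<Rightarrow> 'x::topological_space set \<Rightarrow> ('x \<Rightarrow> 'v::euclidean_space) \<Rightarrow> 'x measure \<Rightarrow> bool" where
  "is_rvol n X F \<mu> \<longleftrightarrow> sets \<mu> = sets (restrict_space borel X) \<and>
     (\<forall>(W, D, \<psi>) \<in> regular_params n X F. \<forall>E\<in>sets borel. E \<subseteq> D \<longrightarrow>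
        emeasure \<mu> (\<psi> ` E) =
          (\<integral>\<^sup>+u\<in>E. ennreal (volume_density W D (F \<circ> \<psi>) u) \<partial>subspace_lborel W))"

lemma is_rvol_sets: "is_rvol n X F \<mu> \<Longrightarrow> sets \<mu> = sets (restrict_space borel X)"
  and is_rvol_space: "is_rvol n X F \<mu> \<Longrightarrow> space \<mu> = X"
  and is_rvol_emeasure: "is_rvol n X F \<mu> \<Longrightarrow> (W, D, \<psi>) \<in> regular_params n X F \<Longrightarrow> E \<in> sets borel \<Longrightarrow> E \<subseteq> D \<Longrightarrow>
     emeasure \<mu> (\<psi> ` E) = (\<integral>\<^sup>+u\<in>E. ennreal (volume_density W D (F \<circ> \<psi>) u) \<partial>subspace_lborel W)"
  by (auto simp: is_rvol_def space_restrict_space dest: sets_eq_imp_space_eq)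

section \<open>Measurability and change of variables in charts\<close>

lemma regular_params_borel:
  assumes p: "(W, D, \<psi>) \<in> regular_params n X F"
  shows "D \<in> sets borel" "\<psi> \<in> restrict_space borel D \<rightarrow>\<^sub>M restrict_space borel X"
    "B \<in> sets (restrict_space borel X) \<Longrightarrow> D \<inter> \<psi> -` B \<in> sets borel"
    "E \<in> sets borel \<Longrightarrow> E \<subseteq> D \<Longrightarrow> \<psi> ` E \<in> sets (restrict_space borel X)"
proof -
  note r = regular_paramsD[OF p]
  show D: "D \<in> sets borel" by (rule rel_open_borel[OF r(3)])
  show m: "\<psi> \<in> restrict_space borel D \<rightarrow>\<^sub>M restrict_space borel X"
    by (rule measurable_restrict_space2)
       (use r(10) borel_measurable_continuous_on_restrict[OF r(8)] in \<open>auto simp: space_restrict_space\<close>)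
  show "D \<inter> \<psi> -` B \<in> sets borel" if "B \<in> sets (restrict_space borel X)"
  proof -
    have "\<psi> -` B \<inter> space (restrict_space borel D) \<in> sets (restrict_space borel D)"
      by (rule measurable_sets[OF m that])
    then show ?thesis using D by (auto simp: sets_restrict_space_iff space_restrict_space Int_commute)
  qed
  assume E: "E \<in> sets borel" "E \<subseteq> D"
  obtain g where g: "homeomorphism D (\<psi> ` D) \<psi> g" using r(5) by auto
  obtain T where T: "open T" "\<psi> ` D = X \<inter> T" using r(4) by (auto simp: openin_open)
  have gm: "g \<in> borel_measurable (restrict_space borel (\<psi> ` D))"
    by (rule borel_measurable_continuous_on_restrict) (use g in \<open>auto simp: homeomorphism_def\<close>)
  have "\<psi> ` E = g -` E \<inter> space (restrict_space borel (\<psi> ` D))"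
    using g E(2) by (auto simp: homeomorphism_def space_restrict_space image_iff subset_iff)
  also have "\<dots> \<in> sets (restrict_space borel (\<psi> ` D))" by (rule measurable_sets[OF gm E(1)])
  also have "sets (restrict_space borel (\<psi> ` D)) \<subseteq> sets (restrict_space borel X)"
  proof
    fix A assume "A \<in> sets (restrict_space borel (\<psi> ` D))"
    then obtain A' where "A' \<in> sets borel" "A = \<psi> ` D \<inter> A'" by (auto simp: sets_restrict_space)
    then have "A = X \<inter> (A' \<inter> T)" "A' \<inter> T \<in> sets borel" using T by auto
    then show "A \<in> sets (restrict_space borel X)" by (auto simp: sets_restrict_space)
  qed
  finally show "\<psi> ` E \<in> sets (restrict_space borel X)" .
qed

text \<open>The indicator confines the statement to \<open>D\<close>, where the coordinate
  derivatives are continuous; outside, the chosen derivative is unspecified.\<close>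

lemma volume_density_measurable:
  assumes p: "(W, D, \<psi>) \<in> regular_params n X F"
  shows "(\<lambda>u. ennreal (volume_density W D (F \<circ> \<psi>) u) * indicator D u) \<in> borel_measurable borel"
proof -
  note r = regular_paramsD[OF p]
  note D[measurable] = regular_params_borel(1)[OF p]
  let ?e = "\<lambda>b u. indicator D u *\<^sub>R fd D (F \<circ> \<psi>) u b"
  have "?e b \<in> borel_measurable borel" if "b \<in> onb W" for b
    by (rule borel_measurable_continuous_on_indicator[OF D])
       (use smooth_continuous[OF smooth_fd[OF r(6)]] that onb_subset[OF r(1)] in auto)
  note this[measurable]
  have inn: "(\<lambda>u. ?e b u \<bullet> ?e c u) \<in> borel_measurable borel" if "b \<in> onb W" "c \<in> onb W" for b c
    using that by measurable
  have "(\<lambda>u. set_det (onb W) (\<lambda>b c. ?e b u \<bullet> ?e c u)) \<in> borel_measurable borel"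
    unfolding set_det_def
    by (intro borel_measurable_sum borel_measurable_times borel_measurable_const borel_measurable_prod inn)
       (auto simp: permutes_in_image)
  from measurable_compose[OF this borel_measurable_continuous_onI[OF continuous_on_real_sqrt[OF continuous_on_id]]]
  have [measurable]: "(\<lambda>u. ennreal (sqrt (set_det (onb W) (\<lambda>b c. ?e b u \<bullet> ?e c u)))) \<in> borel_measurable borel" by measurable
  have eqf: "(\<lambda>u. ennreal (volume_density W D (F \<circ> \<psi>) u) * indicator D u) =
    (\<lambda>u. ennreal (sqrt (set_det (onb W) (\<lambda>b c. ?e b u \<bullet> ?e c u))) * indicator D u)"
    by (auto simp: fun_eq_iff volume_density_def indicator_def)
  show ?thesis unfolding eqf by measurable
qed

text \<open>Transition maps are only known to be continuous and differentiable, so their derivatives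
  are treated as pointwise limits of difference quotients.\<close>

lemma borel_measurable_derivative:
  fixes \<phi> :: "'e::euclidean_space \<Rightarrow> 'v::euclidean_space"
  assumes S: "rel_open W S" and c: "continuous_on S \<phi>" and x: "x \<in> W"
    and d: "\<And>u. u \<in> S \<Longrightarrow> (\<phi> has_derivative \<phi>' u) (at u within S)"
  shows "(\<lambda>u. indicator S u *\<^sub>R \<phi>' u x) \<in> borel_measurable borel"
proof -
  note Sb[measurable] = rel_open_borel[OF S]
  define \<phi>0 where "\<phi>0 u = indicator S u *\<^sub>R \<phi> u" for u
  have [measurable]: "\<phi>0 \<in> borel_measurable borel"
    unfolding \<phi>0_def by (rule borel_measurable_continuous_on_indicator[OF Sb c])
  \<comment> \<open>The second indicator sets the quotient to zero when the shifted point leaves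
    \<open>S\<close>. For each fixed \<open>u\<close> in \<open>S\<close> this stops happening for
    large \<open>n\<close>.\<close>
  define q where "q n u = (indicator S u * indicator S (u + (1 / real (Suc n)) *\<^sub>R x)) *\<^sub>R
      (real (Suc n) *\<^sub>R (\<phi>0 (u + (1 / real (Suc n)) *\<^sub>R x) - \<phi>0 u))" for n u
  have qm: "q n \<in> borel_measurable borel" for n unfolding q_def by measurable
  show ?thesis
  proof (rule borel_measurable_LIMSEQ_metric[OF qm])
    fix u :: 'e
    show "(\<lambda>n. q n u) \<longlonglongrightarrow> indicator S u *\<^sub>R \<phi>' u x"
    proof (cases "u \<in> S")
      case False then show ?thesis by (simp add: q_def)
    next
      case True
      obtain e where e: "e > 0" "\<And>t. \<bar>t\<bar> < e \<Longrightarrow> u + t *\<^sub>R x \<in> S" using rel_open_segment[OF S True x] by blast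
      let ?B = "ball (0::real) e"
      have g: "((\<lambda>t. u + t *\<^sub>R x) has_derivative (\<lambda>t. t *\<^sub>R x)) (at 0 within ?B)"
        by (auto intro!: derivative_eq_intros)
      have "(\<phi> has_derivative \<phi>' u) (at (u + 0 *\<^sub>R x) within (\<lambda>t. u + t *\<^sub>R x) ` ?B)"
      proof -
        have "(\<lambda>t. u + t *\<^sub>R x) ` ?B \<subseteq> S" using e by auto
        from has_derivative_subset[OF d[OF True] this] show ?thesis by simp
      qed
      from has_derivative_in_compose[OF g this]
      have 1: "((\<lambda>t. \<phi> (u + t *\<^sub>R x)) has_derivative (\<lambda>t. \<phi>' u (t *\<^sub>R x))) (at 0 within ?B)" .
      have 2: "at (0::real) within ?B = at 0" by (rule at_within_open) (use e in auto)
      have lin: "linear (\<phi>' u)" using d[OF True] by (rule has_derivative_linear)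
      have "((\<lambda>t. \<phi> (u + t *\<^sub>R x)) has_vector_derivative \<phi>' u x) (at 0)"
        unfolding has_vector_derivative_def using 1 unfolding 2 by (simp add: linear_scale[OF lin])
      then have "((\<lambda>t. (\<phi> (u + t *\<^sub>R x) - \<phi> u) /\<^sub>R t) \<longlongrightarrow> \<phi>' u x) (at 0)"
      proof -
        assume "((\<lambda>t. \<phi> (u + t *\<^sub>R x)) has_vector_derivative \<phi>' u x) (at 0)"
        then have "((\<lambda>h. norm (\<phi> (u + h *\<^sub>R x) - \<phi> u - h *\<^sub>R \<phi>' u x) / norm h) \<longlongrightarrow> 0) (at 0)"
          by (simp add: has_vector_derivative_def has_derivative_at)
        then have "((\<lambda>t. norm ((\<phi> (u + t *\<^sub>R x) - \<phi> u) /\<^sub>R t - \<phi>' u x)) \<longlongrightarrow> 0) (at 0)"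
        proof (rule Lim_transform_eventually)
          have "norm (\<phi> (u + h *\<^sub>R x) - \<phi> u - h *\<^sub>R \<phi>' u x) / norm h = norm ((\<phi> (u + h *\<^sub>R x) - \<phi> u) /\<^sub>R h - \<phi>' u x)"
            if "h \<noteq> 0" for h
          proof -
            have "(\<phi> (u + h *\<^sub>R x) - \<phi> u) /\<^sub>R h - \<phi>' u x = inverse h *\<^sub>R (\<phi> (u + h *\<^sub>R x) - \<phi> u - h *\<^sub>R \<phi>' u x)"
              using that by (simp add: scaleR_diff_right)
            then show ?thesis by (simp add: divide_inverse mult.commute)
          qed
          then show "\<forall>\<^sub>F h in at 0. norm (\<phi> (u + h *\<^sub>R x) - \<phi> u - h *\<^sub>R \<phi>' u x) / norm h = norm ((\<phi> (u + h *\<^sub>R x) - \<phi> u) /\<^sub>R h - \<phi>' u x)"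
            by (auto simp: eventually_at intro!: exI[of _ 1])
        qed
        from tendsto_norm_zero_cancel[OF this] show ?thesis by (subst Lim_null)
      qed
      then have "(\<lambda>n. (\<phi> (u + (1 / real (Suc n)) *\<^sub>R x) - \<phi> u) /\<^sub>R (1 / real (Suc n))) \<longlonglongrightarrow> \<phi>' u x"
        by (rule filterlim_compose)
           (use LIMSEQ_Suc[OF lim_1_over_n] in \<open>auto simp: filterlim_at intro!: always_eventually\<close>)
      moreover have "eventually (\<lambda>n. (\<phi> (u + (1 / real (Suc n)) *\<^sub>R x) - \<phi> u) /\<^sub>R (1 / real (Suc n)) = q n u) sequentially"
      proof -
        have "eventually (\<lambda>n. 1 / real (Suc n) < e) sequentially"
          using order_tendstoD(2)[OF LIMSEQ_Suc[OF lim_1_over_n] e(1)] by simp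
        then show ?thesis
          by eventually_elim (use e True in \<open>auto simp: q_def \<phi>0_def\<close>)
      qed
      ultimately show ?thesis using True by (auto simp: Lim_transform_eventually)
    qed
  qed
qed

text \<open>The Gram determinants in the two charts differ by the square of the transition
  determinant \<open>J\<close>, so the densities differ by its absolute value. This is exactly the
  factor in the change of variables formula.\<close>

lemma volume_change_of_params:
  assumes p1: "(W1, D1, \<psi>1) \<in> regular_params n X F" and p2: "(W2, D2, \<psi>2) \<in> regular_params n X F"
    and E1[measurable]: "E1 \<in> sets borel" and E1D: "E1 \<subseteq> D1"
    and E2[measurable]: "E2 \<in> sets borel" and E2D: "E2 \<subseteq> D2" and eq: "\<psi>1 ` E1 = \<psi>2 ` E2"
  shows "(\<integral>\<^sup>+u\<in>E1. ennreal (volume_density W1 D1 (F \<circ> \<psi>1) u) \<partial>subspace_lborel W1) =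
    (\<integral>\<^sup>+u\<in>E2. ennreal (volume_density W2 D2 (F \<circ> \<psi>2) u) \<partial>subspace_lborel W2)"
proof -
  note r1 = regular_paramsD[OF p1] and r2 = regular_paramsD[OF p2]
  let ?S = "D1 \<inter> \<psi>1 -` (\<psi>2 ` D2)"
  obtain \<phi> \<phi>' where S: "rel_open W1 ?S"
    and \<phi>D: "\<And>u. u \<in> ?S \<Longrightarrow> \<phi> u \<in> D2 \<and> \<psi>2 (\<phi> u) = \<psi>1 u"
    and \<phi>c: "continuous_on ?S \<phi>" and \<phi>i: "inj_on \<phi> ?S"
    and \<phi>d: "\<And>u. u \<in> ?S \<Longrightarrow> (\<phi> has_derivative \<phi>' u) (at u within ?S)"
    and \<phi>W: "\<And>u x. u \<in> ?S \<Longrightarrow> \<phi>' u x \<in> W2"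
    and \<phi>f: "\<And>u x. u \<in> ?S \<Longrightarrow> x \<in> W1 \<Longrightarrow> fd D1 (F \<circ> \<psi>1) u x = fd D2 (F \<circ> \<psi>2) (\<phi> u) (\<phi>' u x)"
  proof (rule regular_params_transition[OF p1 p2], goal_cases)
    case (1 \<phi> \<phi>')
    show ?case by (rule that[of \<phi> \<phi>']) (use 1 in blast)+
  qed
  note Sb[measurable] = rel_open_borel[OF S]
  have E1S: "E1 \<subseteq> ?S"
  proof
    fix x assume x: "x \<in> E1"
    from imageI[OF x, of \<psi>1] have "\<psi>1 x \<in> \<psi>2 ` E2" unfolding eq .
    then show "x \<in> ?S" using x E1D E2D by auto
  qed
  have \<phi>E: "\<phi> ` E1 = E2"
  proof -
    have *: "\<phi> u = w" if "u \<in> E1" "w \<in> E2" "\<psi>1 u = \<psi>2 w" for u w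
      by (rule inj_onD[OF r2(9)]) (use \<phi>D[of u] that E1S E2D in auto)
    show ?thesis
    proof (intro equalityI subsetI)
      fix w assume "w \<in> \<phi> ` E1"
      then obtain u where u: "u \<in> E1" "w = \<phi> u" by auto
      then have "\<psi>1 u \<in> \<psi>2 ` E2" using imageI[OF u(1), of \<psi>1] unfolding eq by simp
      then show "w \<in> E2" using * u by auto
    next
      fix w assume w: "w \<in> E2"
      then have "\<psi>2 w \<in> \<psi>1 ` E1" using imageI[OF w, of \<psi>2] unfolding eq by simp
      then show "w \<in> \<phi> ` E1" using * w by force
    qed
  qed
  have dims: "card (onb W1) = card (onb W2)"
    using card_onb[OF r1(1)] card_onb[OF r2(1)] r1(2) r2(2) by simp
  obtain h where h: "bij_betw h (onb W1) (onb W2)"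
    using finite_same_card_bij[OF onb_finite[OF r1(1)] onb_finite[OF r2(1)] dims] by auto
  define J where "J u = set_det (onb W1) (\<lambda>b c. h b \<bullet> \<phi>' u c)" for u
  have Jm[measurable]: "(\<lambda>u. ennreal \<bar>J u\<bar> * indicator ?S u) \<in> borel_measurable borel"
  proof -
    have e[measurable]: "(\<lambda>u. indicator ?S u *\<^sub>R \<phi>' u c) \<in> borel_measurable borel" if "c \<in> onb W1" for c
      by (rule borel_measurable_derivative[OF S \<phi>c _ \<phi>d]) (use that onb_subset[OF r1(1)] in auto)
    have "(\<lambda>u. set_det (onb W1) (\<lambda>b c. h b \<bullet> (indicator ?S u *\<^sub>R \<phi>' u c))) \<in> borel_measurable borel"
      unfolding set_det_def
      by (intro borel_measurable_sum borel_measurable_times borel_measurable_const borel_measurable_prod borel_measurable_inner e)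
         (auto simp: permutes_in_image)
    then have [measurable]: "(\<lambda>u. ennreal \<bar>set_det (onb W1) (\<lambda>b c. h b \<bullet> (indicator ?S u *\<^sub>R \<phi>' u c))\<bar>) \<in> borel_measurable borel" by measurable
    have eqf: "(\<lambda>u. ennreal \<bar>J u\<bar> * indicator ?S u) =
      (\<lambda>u. ennreal \<bar>set_det (onb W1) (\<lambda>b c. h b \<bullet> (indicator ?S u *\<^sub>R \<phi>' u c))\<bar> * indicator ?S u)"
      by (auto simp: fun_eq_iff J_def indicator_def)
    show ?thesis unfolding eqf by measurable
  qed
  have dens: "volume_density W1 D1 (F \<circ> \<psi>1) u = \<bar>J u\<bar> * volume_density W2 D2 (F \<circ> \<psi>2) (\<phi> u)" if u: "u \<in> ?S" for u
  proof -
    have "set_det (onb W1) (\<lambda>b c. fd D1 (F \<circ> \<psi>1) u b \<bullet> fd D1 (F \<circ> \<psi>1) u c) =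
       set_det (onb W1) (\<lambda>b c. fd D2 (F \<circ> \<psi>2) (\<phi> u) (\<phi>' u b) \<bullet> fd D2 (F \<circ> \<psi>2) (\<phi> u) (\<phi>' u c))"
      by (rule set_det_cong) (use \<phi>f[OF u] subsetD[OF onb_subset[OF r1(1)]] in simp)
    also have "\<dots> = (J u)\<^sup>2 * set_det (onb W2) (\<lambda>b c. fd D2 (F \<circ> \<psi>2) (\<phi> u) b \<bullet> fd D2 (F \<circ> \<psi>2) (\<phi> u) c)"
      unfolding J_def
      by (rule set_det_gram_mult[OF onb(1)[OF r1(1)] onb(1)[OF r2(1)] h])
         (use \<phi>W[OF u] onb(2)[OF r2(1)] linear_fd_param[OF p2, of "\<phi> u"] \<phi>D[OF u] in \<open>auto simp: comp_def\<close>)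
    finally show ?thesis by (simp add: volume_density_def real_sqrt_mult)
  qed
  have \<phi>m: "\<phi> \<in> restrict_space borel ?S \<rightarrow>\<^sub>M borel"
    by (rule borel_measurable_continuous_on_restrict[OF \<phi>c])
  \<comment> \<open>The formula is first put as an equality of measures: weight
    \<open>\<bar>J\<bar>\<close> on \<open>E1\<close>, transported by \<open>\<phi>\<close>, is
    Lebesgue measure restricted to \<open>E2\<close>. Integrating the second density against
    \<open>N\<close> then gives the claim.\<close>
  define N where "N = distr (density (restrict_space (subspace_lborel W1) E1) (\<lambda>u. ennreal \<bar>J u\<bar> * indicator ?S u)) borel \<phi>"
  have sE: "sets (restrict_space (subspace_lborel W1) E1) = sets (restrict_space borel E1)"
    by (simp add: sets_restrict_space)
  have \<phi>m1: "\<phi> \<in> restrict_space (subspace_lborel W1) E1 \<rightarrow>\<^sub>M borel"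
    using measurable_restrict_mono[OF \<phi>m E1S] measurable_cong_sets[OF sE refl] by blast
  have Jm1: "(\<lambda>u. ennreal \<bar>J u\<bar> * indicator ?S u) \<in> borel_measurable (restrict_space (subspace_lborel W1) E1)"
    by (rule measurable_restrict_space1) measurable
  have Neq: "N = density (subspace_lborel W2) (indicator E2)"
  proof (rule measure_eqI)
    fix A assume "A \<in> sets N"
    then have A[measurable]: "A \<in> sets borel" by (simp add: N_def)
    define EA where "EA = E1 \<inter> \<phi> -` A"
    have EA[measurable]: "EA \<in> sets borel"
      using measurable_sets[OF \<phi>m1 A] E1 by (auto simp: EA_def sets_restrict_space_iff space_restrict_space Int_commute)
    have im: "\<phi> ` EA = E2 \<inter> A" using \<phi>E by (auto simp: EA_def)
    have "emeasure N A = emeasure (density (restrict_space (subspace_lborel W1) E1) (\<lambda>u. ennreal \<bar>J u\<bar> * indicator ?S u)) EA"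
      unfolding N_def using \<phi>m1 by (subst emeasure_distr) (auto simp: EA_def space_restrict_space Int_commute)
    also have "\<dots> = (\<integral>\<^sup>+u. ennreal \<bar>J u\<bar> * indicator ?S u * indicator EA u \<partial>restrict_space (subspace_lborel W1) E1)"
      by (rule emeasure_density[OF Jm1]) (auto simp: sets_restrict_space_iff EA_def[symmetric], auto simp: EA_def)
    also have "\<dots> = (\<integral>\<^sup>+u. ennreal \<bar>J u\<bar> * indicator ?S u * indicator EA u * indicator E1 u \<partial>subspace_lborel W1)"
      by (subst nn_integral_restrict_space) auto
    also have "\<dots> = (\<integral>\<^sup>+u. ennreal \<bar>J u\<bar> * indicator EA u \<partial>subspace_lborel W1)"
      by (intro nn_integral_cong) (use E1S in \<open>auto simp: indicator_def EA_def\<close>)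
    also have "\<dots> = emeasure (subspace_lborel W2) (\<phi> ` EA)"
      unfolding J_def
    proof (rule emeasure_subspace_differentiable_image[OF r1(1) r2(1) h EA, symmetric])
      show "EA \<subseteq> W1" using E1D rel_openD(3)[OF r1(3)] by (auto simp: EA_def)
      show "\<phi> ` EA \<in> sets borel" unfolding im by measurable
      show "\<phi> ` EA \<subseteq> W2" using im E2D rel_openD(3)[OF r2(3)] by auto
      show "inj_on \<phi> EA" by (rule inj_on_subset[OF \<phi>i]) (use E1S in \<open>auto simp: EA_def\<close>)
      have EAS: "EA \<subseteq> ?S" using E1S by (auto simp: EA_def)
      show "(\<phi> has_derivative \<phi>' x) (at x within EA)" if "x \<in> EA" for x
        by (rule has_derivative_subset[OF \<phi>d EAS]) (use that EAS in auto)
      show "\<phi>' x y \<in> W2" if "x \<in> EA" for x y using \<phi>W that EAS by blast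
      have "(\<lambda>x. ennreal \<bar>J x\<bar> * indicator EA x) = (\<lambda>x. ennreal \<bar>J x\<bar> * indicator ?S x * indicator EA x)"
        using EAS by (auto simp: indicator_def fun_eq_iff)
      then show "(\<lambda>x. ennreal \<bar>set_det (onb W1) (\<lambda>b c. h b \<bullet> \<phi>' x c)\<bar> * indicator EA x) \<in> borel_measurable borel"
        unfolding J_def[symmetric] by simp
    qed
    also have "\<dots> = emeasure (density (subspace_lborel W2) (indicator E2)) A"
      unfolding im by (subst emeasure_density) (auto simp: indicator_inter_arith[symmetric])
    finally show "emeasure N A = emeasure (density (subspace_lborel W2) (indicator E2)) A" .
  qed (simp add: N_def)
  note vm[measurable] = volume_density_measurable[OF p2]
  have "(\<integral>\<^sup>+u\<in>E2. ennreal (volume_density W2 D2 (F \<circ> \<psi>2) u) \<partial>subspace_lborel W2) =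
    (\<integral>\<^sup>+u. indicator E2 u * (ennreal (volume_density W2 D2 (F \<circ> \<psi>2) u) * indicator D2 u) \<partial>subspace_lborel W2)"
    by (intro nn_integral_cong) (use E2D in \<open>auto simp: indicator_def\<close>)
  also have "\<dots> = (\<integral>\<^sup>+u. ennreal (volume_density W2 D2 (F \<circ> \<psi>2) u) * indicator D2 u \<partial>N)"
    unfolding Neq by (subst nn_integral_density) auto
  also have "\<dots> = (\<integral>\<^sup>+u. ennreal \<bar>J u\<bar> * indicator ?S u * (ennreal (volume_density W2 D2 (F \<circ> \<psi>2) (\<phi> u)) * indicator D2 (\<phi> u))
      \<partial>restrict_space (subspace_lborel W1) E1)"
    unfolding N_def using \<phi>m1 Jm1 by (subst nn_integral_distr) (auto simp: nn_integral_density)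
  also have "\<dots> = (\<integral>\<^sup>+u. ennreal \<bar>J u\<bar> * indicator ?S u * (ennreal (volume_density W2 D2 (F \<circ> \<psi>2) (\<phi> u)) * indicator D2 (\<phi> u)) * indicator E1 u
      \<partial>subspace_lborel W1)"
    by (subst nn_integral_restrict_space) auto
  also have "\<dots> = (\<integral>\<^sup>+u\<in>E1. ennreal (volume_density W1 D1 (F \<circ> \<psi>1) u) \<partial>subspace_lborel W1)"
  proof (intro nn_integral_cong)
    fix u
    show "ennreal \<bar>J u\<bar> * indicator ?S u * (ennreal (volume_density W2 D2 (F \<circ> \<psi>2) (\<phi> u)) * indicator D2 (\<phi> u)) * indicator E1 u =
      ennreal (volume_density W1 D1 (F \<circ> \<psi>1) u) * indicator E1 u"
    proof (cases "u \<in> E1")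
      case True
      then have "u \<in> ?S" using E1S by auto
      then show ?thesis using True \<phi>D[of u] dens[of u] by (simp add: ennreal_mult')
    qed simp
  qed
  finally show ?thesis by simp
qed

text \<open>A measurable set is cut along finitely many chart images, one chart at a time; each
  piece is the image of a Borel subset of that chart's domain.\<close>

lemma is_rvol_unique:
  assumes P: "finite P" "P \<subseteq> regular_params n X F" and cov: "(\<Union>(W, D, \<psi>)\<in>P. \<psi> ` D) = X"
    and s: "sets \<mu> = sets (restrict_space borel X)" "sets \<nu> = sets (restrict_space borel X)"
    and eq: "\<And>W D \<psi> E. (W, D, \<psi>) \<in> P \<Longrightarrow> E \<in> sets borel \<Longrightarrow> E \<subseteq> D \<Longrightarrow> emeasure \<mu> (\<psi> ` E) = emeasure \<nu> (\<psi> ` E)"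
  shows "\<mu> = \<nu>"
proof (rule measure_eqI)
  show "sets \<mu> = sets \<nu>" using s by simp
  have main: "emeasure \<mu> B = emeasure \<nu> B" if "finite Q" "Q \<subseteq> P" "B \<in> sets \<mu>" "B \<subseteq> (\<Union>(W, D, \<psi>)\<in>Q. \<psi> ` D)" for Q B
    using that
  proof (induction Q arbitrary: B rule: finite_induct)
    case empty then show ?case by simp
  next
    case (insert q Q)
    obtain W D \<psi> where q: "q = (W, D, \<psi>)" by (cases q)
    then have pP: "(W, D, \<psi>) \<in> P" using insert.prems by auto
    then have p: "(W, D, \<psi>) \<in> regular_params n X F" using P by auto
    have B: "B \<in> sets (restrict_space borel X)" using insert.prems s by simp
    let ?E = "D \<inter> \<psi> -` B"
    have E: "?E \<in> sets borel" by (rule regular_params_borel(3)[OF p B])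
    have im: "\<psi> ` ?E = B \<inter> \<psi> ` D" by auto
    have B1: "B \<inter> \<psi> ` D \<in> sets (restrict_space borel X)" using regular_params_borel(4)[OF p E] im by auto
    have B2: "B - \<psi> ` D \<in> sets (restrict_space borel X)"
    proof -
      have "B - \<psi> ` D = B - (B \<inter> \<psi> ` D)" by auto
      then show ?thesis using sets.Diff[OF B B1] by simp
    qed
    have B2s: "B - \<psi> ` D \<subseteq> (\<Union>(W, D, \<psi>)\<in>Q. \<psi> ` D)" using insert.prems q by auto
    have e1: "emeasure \<mu> (B \<inter> \<psi> ` D) = emeasure \<nu> (B \<inter> \<psi> ` D)" using eq[OF pP E] im by auto
    have e2: "emeasure \<mu> (B - \<psi> ` D) = emeasure \<nu> (B - \<psi> ` D)"
      by (rule insert.IH) (use insert.prems B2 B2s s in auto)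
    have u: "B = (B \<inter> \<psi> ` D) \<union> (B - \<psi> ` D)" by auto
    have "emeasure M B = emeasure M (B \<inter> \<psi> ` D) + emeasure M (B - \<psi> ` D)"
      if "sets M = sets (restrict_space borel X)" for M
      by (subst u, rule plus_emeasure[symmetric]) (use B1 B2 that in auto)
    then show ?case using e1 e2 s by simp
  qed
  fix A assume "A \<in> sets \<mu>"
  moreover have "A \<subseteq> X" using sets.sets_into_space[OF \<open>A \<in> sets \<mu>\<close>] sets_eq_imp_space_eq[OF s(1)]
    by (simp add: space_restrict_space)
  ultimately show "emeasure \<mu> A = emeasure \<nu> A" using main[OF P(1) order_refl] cov by simp
qed

section \<open>Construction of the volume from finitely many charts\<close>

lemma measure_sum_exists:
  assumes "sets M = sets N"
  shows "\<exists>L. sets L = sets M \<and> (\<forall>A\<in>sets M. emeasure L A = emeasure M A + emeasure N A)"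
proof (intro exI[of _ "measure_of (space M) (sets M) (\<lambda>A. emeasure M A + emeasure N A)"] conjI ballI)
  show "sets (measure_of (space M) (sets M) (\<lambda>A. emeasure M A + emeasure N A)) = sets M" by simp
  fix A assume A: "A \<in> sets M"
  show "emeasure (measure_of (space M) (sets M) (\<lambda>A. emeasure M A + emeasure N A)) A = emeasure M A + emeasure N A"
  proof (rule emeasure_measure_of_sigma[OF _ _ _ A])
    show "sigma_algebra (space M) (sets M)" ..
    show "positive (sets M) (\<lambda>A. emeasure M A + emeasure N A)" by (simp add: positive_def)
    show "countably_additive (sets M) (\<lambda>A. emeasure M A + emeasure N A)"
      unfolding countably_additive_def
    proof (intro allI impI)
      fix B :: "nat \<Rightarrow> 'a set" assume B: "range B \<subseteq> sets M" "disjoint_family B" "\<Union> (range B) \<in> sets M"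
      have "(\<Sum>i. emeasure M (B i) + emeasure N (B i)) = (\<Sum>i. emeasure M (B i)) + (\<Sum>i. emeasure N (B i))"
        by (rule suminf_add[symmetric]) auto
      also have "(\<Sum>i. emeasure M (B i)) = emeasure M (\<Union> (range B))" by (rule suminf_emeasure[OF B(1,2)])
      also have "(\<Sum>i. emeasure N (B i)) = emeasure N (\<Union> (range B))" using B assms by (intro suminf_emeasure) auto
      finally show "(\<Sum>i. emeasure M (B i) + emeasure N (B i)) = emeasure M (\<Union> (range B)) + emeasure N (\<Union> (range B))" .
    qed
  qed
qed

definition chart_measure :: "'x::topological_space set \<Rightarrow> ('x \<Rightarrow> 'v::euclidean_space) \<Rightarrow> 'v set \<Rightarrow> 'v set \<Rightarrow> ('v \<Rightarrow> 'x) \<Rightarrow> 'x measure" where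
  "chart_measure X F W D \<psi> = distr (density (restrict_space (subspace_lborel W) D)
      (\<lambda>u. ennreal (volume_density W D (F \<circ> \<psi>) u) * indicator D u)) (restrict_space borel X) \<psi>"

lemma sets_chart_measure [simp]: "sets (chart_measure X F W D \<psi>) = sets (restrict_space borel X)"
  by (simp add: chart_measure_def)

lemma nn_integral_chart_measure:
  assumes p: "(W, D, \<psi>) \<in> regular_params n X F" and k: "k \<in> borel_measurable (restrict_space borel X)"
  shows "(\<integral>\<^sup>+x. k x \<partial>chart_measure X F W D \<psi>) =
    (\<integral>\<^sup>+u\<in>D. k (\<psi> u) * ennreal (volume_density W D (F \<circ> \<psi>) u) \<partial>subspace_lborel W)"
proof -
  note b[measurable] = regular_params_borel(1)[OF p]
  note [measurable] = volume_density_measurable[OF p]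
  have sE: "sets (restrict_space (subspace_lborel W) D) = sets (restrict_space borel D)"
    by (simp add: sets_restrict_space)
  have m: "\<psi> \<in> restrict_space (subspace_lborel W) D \<rightarrow>\<^sub>M restrict_space borel X"
    using regular_params_borel(2)[OF p] measurable_cong_sets[OF sE refl] by blast
  have v: "(\<lambda>u. ennreal (volume_density W D (F \<circ> \<psi>) u) * indicator D u) \<in> borel_measurable (restrict_space (subspace_lborel W) D)"
    by (rule measurable_restrict_space1) measurable
  have "(\<integral>\<^sup>+x. k x \<partial>chart_measure X F W D \<psi>) =
    (\<integral>\<^sup>+u. ennreal (volume_density W D (F \<circ> \<psi>) u) * indicator D u * k (\<psi> u) \<partial>restrict_space (subspace_lborel W) D)"
    unfolding chart_measure_def using m v measurable_compose[OF m k] k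
    by (subst nn_integral_distr) (auto simp: nn_integral_density)
  also have "\<dots> = (\<integral>\<^sup>+u. ennreal (volume_density W D (F \<circ> \<psi>) u) * indicator D u * k (\<psi> u) * indicator D u \<partial>subspace_lborel W)"
    by (subst nn_integral_restrict_space) auto
  also have "\<dots> = (\<integral>\<^sup>+u\<in>D. k (\<psi> u) * ennreal (volume_density W D (F \<circ> \<psi>) u) \<partial>subspace_lborel W)"
    by (intro nn_integral_cong) (auto simp: indicator_def mult.commute)
  finally show ?thesis .
qed

lemma emeasure_chart_measure:
  assumes p: "(W, D, \<psi>) \<in> regular_params n X F" and B: "B \<in> sets (restrict_space borel X)"
  shows "emeasure (chart_measure X F W D \<psi>) B =
    (\<integral>\<^sup>+u\<in>D \<inter> \<psi> -` B. ennreal (volume_density W D (F \<circ> \<psi>) u) \<partial>subspace_lborel W)"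
proof -
  have "emeasure (chart_measure X F W D \<psi>) B = (\<integral>\<^sup>+x. indicator B x \<partial>chart_measure X F W D \<psi>)" using B by simp
  also have "\<dots> = (\<integral>\<^sup>+u\<in>D. indicator B (\<psi> u) * ennreal (volume_density W D (F \<circ> \<psi>) u) \<partial>subspace_lborel W)"
    by (rule nn_integral_chart_measure[OF p]) (use B in auto)
  also have "\<dots> = (\<integral>\<^sup>+u\<in>D \<inter> \<psi> -` B. ennreal (volume_density W D (F \<circ> \<psi>) u) \<partial>subspace_lborel W)"
    by (intro nn_integral_cong) (auto simp: indicator_def)
  finally show ?thesis .
qed

text \<open>The volume is built up over a finite set of charts. A new chart contributes only outside
  the region already covered, and \<open>volume_change_of_params\<close> makes the contribution
  correct for every regular chart, not just for those in the cover.\<close>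

lemma is_rvol_exists:
  fixes F :: "'x::topological_space \<Rightarrow> 'v::euclidean_space"
  assumes P: "finite P" "P \<subseteq> regular_params n X F" and cov: "(\<Union>(W, D, \<psi>)\<in>P. \<psi> ` D) = X"
  shows "\<exists>\<mu>. is_rvol n X F \<mu>"
proof -
  define im :: "('v, 'x) param set \<Rightarrow> 'x set" where "im Q = (\<Union>(W, D, \<psi>)\<in>Q. \<psi> ` D)" for Q
  \<comment> \<open>The invariant asks for the volume formula in all regular charts, but counts only
    the part of each set that lies in the region covered by \<open>Q\<close>.\<close>
  define R where "R \<mu> Q \<longleftrightarrow> sets \<mu> = sets (restrict_space borel X) \<and> im Q \<in> sets (restrict_space borel X) \<and>
     (\<forall>W D \<psi> E. (W, D, \<psi>) \<in> regular_params n X F \<longrightarrow> E\<in>sets borel \<longrightarrow> E \<subseteq> D \<longrightarrow>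
        emeasure \<mu> (\<psi> ` E) =
          (\<integral>\<^sup>+u\<in>E \<inter> \<psi> -` im Q. ennreal (volume_density W D (F \<circ> \<psi>) u) \<partial>subspace_lborel W))" for \<mu> Q
  have "\<exists>\<mu>. R \<mu> Q" if "finite Q" "Q \<subseteq> P" for Q using that
  proof (induction Q rule: finite_induct)
    case empty
    show ?case by (rule exI[of _ "null_measure (restrict_space borel X)"]) (auto simp: im_def R_def)
  next
    case (insert q Q)
    obtain W D \<psi> where q: "q = (W, D, \<psi>)" by (cases q)
    then have p: "(W, D, \<psi>) \<in> regular_params n X F" using P insert.prems by auto
    obtain \<mu> where "R \<mu> Q" using insert.IH insert.prems by auto
    then have \<mu>: "sets \<mu> = sets (restrict_space borel X)" and imQ: "im Q \<in> sets (restrict_space borel X)"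
      and \<mu>e: "\<And>W D \<psi> E. (W, D, \<psi>) \<in> regular_params n X F \<Longrightarrow> E \<in> sets borel \<Longrightarrow> E \<subseteq> D \<Longrightarrow>
        emeasure \<mu> (\<psi> ` E) = (\<integral>\<^sup>+u\<in>E \<inter> \<psi> -` im Q. ennreal (volume_density W D (F \<circ> \<psi>) u) \<partial>subspace_lborel W)"
      by (simp_all only: R_def)
    \<comment> \<open>Removing \<open>im Q\<close> avoids counting overlaps twice.\<close>
    define \<kappa> where "\<kappa> = density (chart_measure X F W D \<psi>) (indicator (X - im Q))"
    have \<kappa>s: "sets \<kappa> = sets (restrict_space borel X)" by (simp add: \<kappa>_def)
    have XQ: "X - im Q \<in> sets (restrict_space borel X)"
      using sets.compl_sets[OF imQ] by (simp add: space_restrict_space)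
    have \<kappa>e: "emeasure \<kappa> B = (\<integral>\<^sup>+u\<in>D \<inter> \<psi> -` (B - im Q). ennreal (volume_density W D (F \<circ> \<psi>) u) \<partial>subspace_lborel W)"
      if B: "B \<in> sets (restrict_space borel X)" for B
    proof -
      have BX: "B \<subseteq> X" using sets.sets_into_space[OF B] by (simp add: space_restrict_space)
      have BQ: "B - im Q \<in> sets (restrict_space borel X)" using B imQ by (rule sets.Diff)
      have "emeasure \<kappa> B = (\<integral>\<^sup>+x. indicator (X - im Q) x * indicator B x \<partial>chart_measure X F W D \<psi>)"
        unfolding \<kappa>_def using XQ B by (intro emeasure_density borel_measurable_indicator) simp_all
      also have "\<dots> = (\<integral>\<^sup>+x. indicator (B - im Q) x \<partial>chart_measure X F W D \<psi>)"
        by (intro nn_integral_cong) (use BX in \<open>auto simp: indicator_def\<close>)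
      also have "\<dots> = emeasure (chart_measure X F W D \<psi>) (B - im Q)" using BQ by simp
      finally show ?thesis by (simp add: emeasure_chart_measure[OF p BQ])
    qed
    obtain L where L: "sets L = sets \<mu>" "\<And>A. A \<in> sets \<mu> \<Longrightarrow> emeasure L A = emeasure \<mu> A + emeasure \<kappa> A"
      using measure_sum_exists[of \<mu> \<kappa>] \<mu> \<kappa>s by auto
    have \<psi>D: "\<psi> ` D \<in> sets (restrict_space borel X)"
      by (rule regular_params_borel(4)[OF p regular_params_borel(1)[OF p]]) simp
    have imi: "im (insert q Q) = \<psi> ` D \<union> im Q" by (simp add: im_def q)
    show ?case
      unfolding R_def
    proof (intro exI[of _ L] conjI)
      show "sets L = sets (restrict_space borel X)" using L \<mu> by simp
      show "im (insert q Q) \<in> sets (restrict_space borel X)" unfolding imi using \<psi>D imQ by (rule sets.Un)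
      have "emeasure L (\<psi>2 ` E) = (\<integral>\<^sup>+u\<in>E \<inter> \<psi>2 -` im (insert q Q). ennreal (volume_density W2 D2 (F \<circ> \<psi>2) u) \<partial>subspace_lborel W2)"
        if p2: "(W2, D2, \<psi>2) \<in> regular_params n X F" and E[measurable]: "E \<in> sets borel" and ED: "E \<subseteq> D2" for W2 D2 \<psi>2 E
      proof -
        have E2: "\<psi>2 ` E \<in> sets (restrict_space borel X)" by (rule regular_params_borel(4)[OF p2 E ED])
        let ?E1 = "D \<inter> \<psi> -` (\<psi>2 ` E - im Q)" and ?E2 = "D2 \<inter> \<psi>2 -` (\<psi>2 ` E \<inter> \<psi> ` D - im Q)"
        have s1: "\<psi>2 ` E - im Q \<in> sets (restrict_space borel X)" using E2 imQ by (rule sets.Diff)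
        have s2: "\<psi>2 ` E \<inter> \<psi> ` D - im Q \<in> sets (restrict_space borel X)" using E2 imQ \<psi>D by auto
        have E1b: "?E1 \<in> sets borel" and E2b[measurable]: "?E2 \<in> sets borel"
          by (rule regular_params_borel(3)[OF p s1], rule regular_params_borel(3)[OF p2 s2])
        have inj: "x \<in> D2 \<Longrightarrow> \<psi>2 x \<in> \<psi>2 ` E \<longleftrightarrow> x \<in> E" for x
          using regular_paramsD(9)[OF p2] ED by (auto simp: inj_on_def subset_iff)
        have "emeasure \<kappa> (\<psi>2 ` E) = (\<integral>\<^sup>+u\<in>?E2. ennreal (volume_density W2 D2 (F \<circ> \<psi>2) u) \<partial>subspace_lborel W2)"
          unfolding \<kappa>e[OF E2]
        proof (rule volume_change_of_params[OF p p2 E1b _ E2b])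
          have *: "f ` (A \<inter> f -` S) = S" if "S \<subseteq> f ` A" for f :: "'v \<Rightarrow> 'x" and A S
            using that by auto
          have "?E1 = D \<inter> \<psi> -` (\<psi>2 ` E \<inter> \<psi> ` D - im Q)" by auto
          then have "\<psi> ` ?E1 = \<psi>2 ` E \<inter> \<psi> ` D - im Q" by (simp only:) (rule *, auto)
          also have "\<dots> = \<psi>2 ` ?E2" using image_mono[OF ED, of \<psi>2] by (intro *[symmetric]) auto
          finally show "\<psi> ` ?E1 = \<psi>2 ` ?E2" .
        qed auto
        then have "emeasure L (\<psi>2 ` E) =
          (\<integral>\<^sup>+u\<in>E \<inter> \<psi>2 -` im Q. ennreal (volume_density W2 D2 (F \<circ> \<psi>2) u) \<partial>subspace_lborel W2) +
          (\<integral>\<^sup>+u\<in>?E2. ennreal (volume_density W2 D2 (F \<circ> \<psi>2) u) \<partial>subspace_lborel W2)"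
          using L(2)[of "\<psi>2 ` E"] E2 \<mu> \<mu>e[OF p2 E ED] by simp
        also have "\<dots> = (\<integral>\<^sup>+u. ennreal (volume_density W2 D2 (F \<circ> \<psi>2) u) * indicator D2 u * indicator (D2 \<inter> \<psi>2 -` (\<psi>2 ` E \<inter> im Q)) u +
            ennreal (volume_density W2 D2 (F \<circ> \<psi>2) u) * indicator D2 u * indicator ?E2 u \<partial>subspace_lborel W2)"
        proof (subst nn_integral_add)
          note [measurable] = volume_density_measurable[OF p2]
          have [measurable]: "D2 \<inter> \<psi>2 -` (\<psi>2 ` E \<inter> im Q) \<in> sets borel"
            by (rule regular_params_borel(3)[OF p2 sets.Int[OF E2 imQ]])
          show "(\<lambda>u. ennreal (volume_density W2 D2 (F \<circ> \<psi>2) u) * indicator D2 u * indicator (D2 \<inter> \<psi>2 -` (\<psi>2 ` E \<inter> im Q)) u) \<in> borel_measurable (subspace_lborel W2)"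
            "(\<lambda>u. ennreal (volume_density W2 D2 (F \<circ> \<psi>2) u) * indicator D2 u * indicator ?E2 u) \<in> borel_measurable (subspace_lborel W2)"
            by measurable
          have "(\<integral>\<^sup>+u\<in>E \<inter> \<psi>2 -` im Q. ennreal (volume_density W2 D2 (F \<circ> \<psi>2) u) \<partial>subspace_lborel W2) =
            (\<integral>\<^sup>+u. ennreal (volume_density W2 D2 (F \<circ> \<psi>2) u) * indicator D2 u * indicator (D2 \<inter> \<psi>2 -` (\<psi>2 ` E \<inter> im Q)) u \<partial>subspace_lborel W2)"
            by (intro nn_integral_cong) (use inj ED in \<open>auto simp: indicator_def\<close>)
          moreover have "(\<integral>\<^sup>+u\<in>?E2. ennreal (volume_density W2 D2 (F \<circ> \<psi>2) u) \<partial>subspace_lborel W2) =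
            (\<integral>\<^sup>+u. ennreal (volume_density W2 D2 (F \<circ> \<psi>2) u) * indicator D2 u * indicator ?E2 u \<partial>subspace_lborel W2)"
            by (intro nn_integral_cong) (auto simp: indicator_def)
          ultimately show "(\<integral>\<^sup>+u\<in>E \<inter> \<psi>2 -` im Q. ennreal (volume_density W2 D2 (F \<circ> \<psi>2) u) \<partial>subspace_lborel W2) +
            (\<integral>\<^sup>+u\<in>?E2. ennreal (volume_density W2 D2 (F \<circ> \<psi>2) u) \<partial>subspace_lborel W2) =
            (\<integral>\<^sup>+u. ennreal (volume_density W2 D2 (F \<circ> \<psi>2) u) * indicator D2 u * indicator (D2 \<inter> \<psi>2 -` (\<psi>2 ` E \<inter> im Q)) u \<partial>subspace_lborel W2) +
            (\<integral>\<^sup>+u. ennreal (volume_density W2 D2 (F \<circ> \<psi>2) u) * indicator D2 u * indicator ?E2 u \<partial>subspace_lborel W2)" by simp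
        qed
        also have "\<dots> = (\<integral>\<^sup>+u\<in>E \<inter> \<psi>2 -` im (insert q Q). ennreal (volume_density W2 D2 (F \<circ> \<psi>2) u) \<partial>subspace_lborel W2)"
          by (intro nn_integral_cong) (use inj ED in \<open>auto simp: indicator_def imi\<close>)
        finally show ?thesis .
      qed
      then show "\<forall>W D \<psi> E. (W, D, \<psi>) \<in> regular_params n X F \<longrightarrow> E\<in>sets borel \<longrightarrow> E \<subseteq> D \<longrightarrow>
          emeasure L (\<psi> ` E) = (\<integral>\<^sup>+u\<in>E \<inter> \<psi> -` im (insert q Q). ennreal (volume_density W D (F \<circ> \<psi>) u) \<partial>subspace_lborel W)"
        by blast
    qed
  qed
  from this[OF P(1) order_refl] obtain \<mu> where "R \<mu> P" by auto
  then have \<mu>: "sets \<mu> = sets (restrict_space borel X)"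
    and e: "\<And>W D \<psi> E. (W, D, \<psi>) \<in> regular_params n X F \<Longrightarrow> E \<in> sets borel \<Longrightarrow> E \<subseteq> D \<Longrightarrow>
        emeasure \<mu> (\<psi> ` E) = (\<integral>\<^sup>+u\<in>E \<inter> \<psi> -` im P. ennreal (volume_density W D (F \<circ> \<psi>) u) \<partial>subspace_lborel W)"
    by (simp_all only: R_def)
  have "is_rvol n X F \<mu>"
    unfolding is_rvol_def
  proof (intro conjI \<mu> ballI)
    fix c assume c: "c \<in> regular_params n X F"
    obtain W D \<psi> where ceq: "c = (W, D, \<psi>)" by (cases c)
    have p: "(W, D, \<psi>) \<in> regular_params n X F" using c ceq by simp
    have imP: "im P = X" using cov by (simp add: im_def)
    have "E \<inter> \<psi> -` im P = E" if "E \<subseteq> D" for E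
      using that regular_paramsD(10)[OF p] unfolding imP by auto
    then show "case c of (W, D, \<psi>) \<Rightarrow> \<forall>E\<in>sets borel. E \<subseteq> D \<longrightarrow>
        emeasure \<mu> (\<psi> ` E) = (\<integral>\<^sup>+u\<in>E. ennreal (volume_density W D (F \<circ> \<psi>) u) \<partial>subspace_lborel W)"
      using e[OF p] by (simp add: ceq)
  qed
  then show ?thesis by blast
qed

lemma riemannian_volume_eqI:
  assumes P: "finite P" "P \<subseteq> regular_params n X F" and cov: "(\<Union>(W, D, \<psi>)\<in>P. \<psi> ` D) = X"
    and \<mu>: "is_rvol n X F \<mu>"
  shows "riemannian_volume n X F = \<mu>"
  unfolding riemannian_volume_def
proof (rule the_equality)
  show "sets \<mu> = sets (restrict_space borel X) \<and>
     (\<forall>(W, D, \<psi>) \<in> regular_params n X F. \<forall>E\<in>sets borel. E \<subseteq> D \<longrightarrow>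
        emeasure \<mu> (\<psi> ` E) = (\<integral>\<^sup>+u\<in>E. ennreal (volume_density W D (F \<circ> \<psi>) u) \<partial>subspace_lborel W))"
    using \<mu> by (simp add: is_rvol_def)
  fix \<nu> assume "sets \<nu> = sets (restrict_space borel X) \<and>
     (\<forall>(W, D, \<psi>) \<in> regular_params n X F. \<forall>E\<in>sets borel. E \<subseteq> D \<longrightarrow>
        emeasure \<nu> (\<psi> ` E) = (\<integral>\<^sup>+u\<in>E. ennreal (volume_density W D (F \<circ> \<psi>) u) \<partial>subspace_lborel W))"
  then have \<nu>: "is_rvol n X F \<nu>" by (simp add: is_rvol_def)
  show "\<nu> = \<mu>"
  proof (rule is_rvol_unique[OF P cov is_rvol_sets[OF \<nu>] is_rvol_sets[OF \<mu>]])
    fix W D \<psi> E assume a: "(W, D, \<psi>) \<in> P" "E \<in> sets borel" "E \<subseteq> D"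
    then have "(W, D, \<psi>) \<in> regular_params n X F" using P by auto
    from is_rvol_emeasure[OF \<nu> this a(2,3)] is_rvol_emeasure[OF \<mu> this a(2,3)]
    show "emeasure \<nu> (\<psi> ` E) = emeasure \<mu> (\<psi> ` E)" by simp
  qed
qed

lemma is_rvol_riemannian_volume:
  assumes P: "finite P" "P \<subseteq> regular_params n X F" and cov: "(\<Union>(W, D, \<psi>)\<in>P. \<psi> ` D) = X"
  shows "is_rvol n X F (riemannian_volume n X F)"
  using is_rvol_exists[OF assms] riemannian_volume_eqI[OF assms] by auto

lemma nn_integral_is_rvol:
  assumes \<mu>: "is_rvol n X F \<mu>" and p: "(W, D, \<psi>) \<in> regular_params n X F"
    and k: "k \<in> borel_measurable (restrict_space borel X)" and supp: "\<And>x. x \<in> X \<Longrightarrow> x \<notin> \<psi> ` D \<Longrightarrow> k x = 0"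
  shows "(\<integral>\<^sup>+x. k x \<partial>\<mu>) = (\<integral>\<^sup>+u\<in>D. k (\<psi> u) * ennreal (volume_density W D (F \<circ> \<psi>) u) \<partial>subspace_lborel W)"
proof -
  have \<psi>D: "\<psi> ` D \<in> sets \<mu>" unfolding is_rvol_sets[OF \<mu>]
    by (rule regular_params_borel(4)[OF p regular_params_borel(1)[OF p]]) simp
  have "chart_measure X F W D \<psi> = density \<mu> (indicator (\<psi> ` D))"
  proof (rule measure_eqI)
    fix B assume "B \<in> sets (chart_measure X F W D \<psi>)"
    then have B: "B \<in> sets (restrict_space borel X)" by simp
    then have BM: "B \<in> sets \<mu>" using is_rvol_sets[OF \<mu>] by simp
    have "emeasure (chart_measure X F W D \<psi>) B = emeasure \<mu> (\<psi> ` (D \<inter> \<psi> -` B))"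
      unfolding emeasure_chart_measure[OF p B]
      by (rule is_rvol_emeasure[OF \<mu> p regular_params_borel(3)[OF p B], symmetric]) auto
    also have "\<psi> ` (D \<inter> \<psi> -` B) = \<psi> ` D \<inter> B" by auto
    also have "emeasure \<mu> (\<psi> ` D \<inter> B) = emeasure (density \<mu> (indicator (\<psi> ` D))) B"
      using \<psi>D BM by (subst emeasure_density) (auto simp: indicator_inter_arith[symmetric] nn_integral_indicator)
    finally show "emeasure (chart_measure X F W D \<psi>) B = emeasure (density \<mu> (indicator (\<psi> ` D))) B" .
  qed (simp add: is_rvol_sets[OF \<mu>])
  moreover have km: "k \<in> borel_measurable \<mu>" using k measurable_cong_sets[OF is_rvol_sets[OF \<mu>] refl] by blast
  ultimately have "(\<integral>\<^sup>+x. k x \<partial>chart_measure X F W D \<psi>) = (\<integral>\<^sup>+x. indicator (\<psi> ` D) x * k x \<partial>\<mu>)"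
    using \<psi>D by (simp add: nn_integral_density)
  also have "\<dots> = (\<integral>\<^sup>+x. k x \<partial>\<mu>)"
    by (intro nn_integral_cong) (use supp is_rvol_space[OF \<mu>] in \<open>auto simp: indicator_def\<close>)
  finally show ?thesis by (simp add: nn_integral_chart_measure[OF p k])
qed

section \<open>Polar coordinates in a subspace\<close>

lemma nn_integral_subspace_scale:
  assumes S: "subspace S" and s: "s > 0" and h: "h \<in> borel_measurable borel"
  shows "(\<integral>\<^sup>+x. h x \<partial>subspace_lborel S) = ennreal (s ^ dim S) * (\<integral>\<^sup>+x. h (s *\<^sub>R x) \<partial>subspace_lborel S)"
  using nn_integral_coord_affine[OF onb(1)[OF S], of s 0 h] s h card_onb[OF S]
  by (simp add: subspace_lborel_eq span_zero)

lemma nn_integral_subspace_uminus: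
  assumes S: "subspace S" and h: "h \<in> borel_measurable borel"
  shows "(\<integral>\<^sup>+x. h (- x) \<partial>subspace_lborel S) = (\<integral>\<^sup>+x. h x \<partial>subspace_lborel S)"
  using nn_integral_coord_affine[OF onb(1)[OF S], of "-1" 0 h] h
  by (simp add: subspace_lborel_eq span_zero)

lemma emeasure_subspace_cball: "subspace S \<Longrightarrow> emeasure (subspace_lborel S) (cball 0 r) < \<infinity>"
  using emeasure_coord_lborel_cball(1)[OF onb(1)] by (simp add: subspace_lborel_eq)

text \<open>The apex is left out because the zero vector has no direction.\<close>

definition direction_cone :: "'v::euclidean_space set \<Rightarrow> real \<Rightarrow> 'v set" where
  "direction_cone B a = {v. 0 < norm v \<and> norm v \<le> a \<and> v /\<^sub>R norm v \<in> B}"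

lemma direction_cone_borel [measurable]: "B \<in> sets borel \<Longrightarrow> direction_cone B a \<in> sets borel"
proof -
  assume [measurable]: "B \<in> sets borel"
  have "direction_cone B a = {v \<in> space borel. 0 < norm v \<and> norm v \<le> a \<and> v /\<^sub>R norm v \<in> B}"
    by (simp add: direction_cone_def)
  also have "\<dots> \<in> sets borel" by measurable
  finally show ?thesis .
qed

lemma emeasure_direction_cone:
  assumes S: "subspace S" and a: "a > 0" and B[measurable]: "B \<in> sets borel"
  shows "emeasure (subspace_lborel S) (direction_cone B a) = ennreal (a ^ dim S) * emeasure (subspace_lborel S) (direction_cone B 1)"
proof -
  have "emeasure (subspace_lborel S) (direction_cone B a) = (\<integral>\<^sup>+x. indicator (direction_cone B a) x \<partial>subspace_lborel S)" by simp
  also have "\<dots> = ennreal (a ^ dim S) * (\<integral>\<^sup>+x. indicator (direction_cone B a) (a *\<^sub>R x) \<partial>subspace_lborel S)"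
    by (rule nn_integral_subspace_scale[OF S a]) measurable
  also have "(\<lambda>x. indicator (direction_cone B a) (a *\<^sub>R x) :: ennreal) = indicator (direction_cone B 1)"
    using a by (auto simp: fun_eq_iff direction_cone_def indicator_def mult_le_cancel_left1 field_simps)
  finally show ?thesis by simp
qed

lemma emeasure_direction_cone_finite:
  assumes S: "subspace S" shows "emeasure (subspace_lborel S) (direction_cone B a) < \<infinity>"
proof -
  have "emeasure (subspace_lborel S) (direction_cone B a) \<le> emeasure (subspace_lborel S) (cball 0 a)"
    by (rule emeasure_mono) (auto simp: direction_cone_def)
  then show ?thesis using emeasure_subspace_cball[OF S, of a] by (rule le_less_trans)
qed

text \<open>Surface measure of the unit sphere of \<open>S\<close>, obtained from cones: the cone of
  radius one over a piece of the sphere has volume equal to the area of that piece divided by the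
  dimension.\<close>

definition direction_measure :: "'v::euclidean_space set \<Rightarrow> 'v measure" where
  "direction_measure S = distr (density (subspace_lborel S) (\<lambda>v. ennreal (real (dim S)) * indicator (direction_cone UNIV 1) v)) borel (\<lambda>v. v /\<^sub>R norm v)"

lemma sets_direction_measure [simp, measurable_cong]: "sets (direction_measure S) = sets borel"
  and space_direction_measure [simp]: "space (direction_measure S) = UNIV"
  by (simp_all add: direction_measure_def)

lemma nn_integral_direction_measure:
  assumes [measurable]: "h \<in> borel_measurable borel"
  shows "(\<integral>\<^sup>+u. h u \<partial>direction_measure S) =
    (\<integral>\<^sup>+v. ennreal (real (dim S)) * indicator (direction_cone UNIV 1) v * h (v /\<^sub>R norm v) \<partial>subspace_lborel S)"
proof -
  have [measurable]: "direction_cone UNIV 1 \<in> sets (borel :: 'a measure)" by (rule direction_cone_borel) simp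
  show ?thesis unfolding direction_measure_def
    by (subst nn_integral_distr) (auto simp: nn_integral_density)
qed

lemma emeasure_direction_measure:
  assumes B[measurable]: "B \<in> sets borel"
  shows "emeasure (direction_measure S) B = ennreal (real (dim S)) * emeasure (subspace_lborel S) (direction_cone B 1)"
proof -
  have "emeasure (direction_measure S) B = (\<integral>\<^sup>+u. indicator B u \<partial>direction_measure S)" by simp
  also have "\<dots> = (\<integral>\<^sup>+v. ennreal (real (dim S)) * indicator (direction_cone UNIV 1) v * indicator B (v /\<^sub>R norm v) \<partial>subspace_lborel S)"
    by (rule nn_integral_direction_measure) measurable
  also have "\<dots> = (\<integral>\<^sup>+v. ennreal (real (dim S)) * indicator (direction_cone B 1) v \<partial>subspace_lborel S)"
    by (intro nn_integral_cong) (auto simp: direction_cone_def indicator_def)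
  also have "\<dots> = ennreal (real (dim S)) * emeasure (subspace_lborel S) (direction_cone B 1)"
    by (subst nn_integral_cmult) auto
  finally show ?thesis .
qed

lemma finite_direction_measure:
  assumes S: "subspace S" shows "finite_measure (direction_measure S)"
proof
  show "emeasure (direction_measure S) (space (direction_measure S)) \<noteq> \<infinity>"
    using emeasure_direction_cone_finite[OF S, of UNIV 1]
    by (simp add: emeasure_direction_measure ennreal_mult_eq_top_iff less_top)
qed

definition radial_measure :: "nat \<Rightarrow> real \<Rightarrow> real measure" where
  "radial_measure d R = density lborel (\<lambda>r. ennreal (r ^ (d - 1)) * indicator {0<..R} r)"

lemma sets_radial_measure [simp, measurable_cong]: "sets (radial_measure d R) = sets borel"
  and space_radial_measure [simp]: "space (radial_measure d R) = UNIV"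
  by (simp_all add: radial_measure_def)

lemma emeasure_radial_measure:
  assumes d: "d \<ge> 1" and x: "0 \<le> x" "x \<le> R"
  shows "emeasure (radial_measure d R) {x<..} = ennreal ((R ^ d - x ^ d) / real d)"
proof -
  have "emeasure (radial_measure d R) {x<..} = (\<integral>\<^sup>+r. ennreal (r ^ (d - 1)) * indicator {0<..R} r * indicator {x<..} r \<partial>lborel)"
    unfolding radial_measure_def by (subst emeasure_density) auto
  also have "\<dots> = (\<integral>\<^sup>+r. ennreal (r ^ (d - 1)) * indicator {x..R} r \<partial>lborel)"
  proof (rule nn_integral_cong_AE)
    show "AE r in lborel. ennreal (r ^ (d - 1)) * indicator {0<..R} r * indicator {x<..} r = ennreal (r ^ (d - 1)) * indicator {x..R} r"
      using AE_lborel_singleton[of x] by eventually_elim (use x in \<open>auto simp: indicator_def\<close>)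
  qed
  also have "\<dots> = ennreal (R ^ d / real d - x ^ d / real d)"
  proof (rule nn_integral_FTC_Icc)
    show "((\<lambda>r. r ^ d / real d) has_real_derivative r ^ (d - 1)) (at r)" for r
      using d by (auto intro!: derivative_eq_intros)
    show "0 \<le> r ^ (d - 1)" if "r \<in> {x..R}" for r using x that by simp
  qed (use x in auto)
  finally show ?thesis by (simp add: diff_divide_distrib)
qed

lemma finite_radial_measure:
  assumes d: "d \<ge> 1" and R: "R > 0" shows "finite_measure (radial_measure d R)"
proof
  have "emeasure (radial_measure d R) UNIV = emeasure (radial_measure d R) {0<..}"
    unfolding radial_measure_def
    by (subst (1 2) emeasure_density) (auto intro!: nn_integral_cong simp: indicator_def)
  then show "emeasure (radial_measure d R) (space (radial_measure d R)) \<noteq> \<infinity>"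
    using emeasure_radial_measure[OF d, of 0 R] R by simp
qed

text \<open>Equality is tested on rectangles. For a fixed set \<open>B\<close> of directions both
  sides become measures on the line, compared on open half-lines: there the homogeneity of cones
  produces the difference of powers that also comes from integrating
  \<open>r ^ (dim S - 1)\<close>.\<close>

lemma polar_coordinates:
  assumes S: "subspace S" and d: "dim S \<ge> 1" and R: "R > 0"
  shows "radial_measure (dim S) R \<Otimes>\<^sub>M direction_measure S =
    distr (density (subspace_lborel S) (indicator (direction_cone UNIV R))) (borel \<Otimes>\<^sub>M borel) (\<lambda>v. (norm v, v /\<^sub>R norm v))"
proof (rule pair_measure_eqI)
  interpret r: finite_measure "radial_measure (dim S) R" by (rule finite_radial_measure[OF d R])
  interpret s: finite_measure "direction_measure S" by (rule finite_direction_measure[OF S])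
  show "sigma_finite_measure (radial_measure (dim S) R)" "sigma_finite_measure (direction_measure S)" ..
  have UC[measurable]: "direction_cone UNIV R \<in> sets (borel :: 'a measure)" by (rule direction_cone_borel) simp
  let ?\<mu> = "subspace_lborel S"
  let ?N = "distr (density ?\<mu> (indicator (direction_cone UNIV R))) (borel \<Otimes>\<^sub>M borel) (\<lambda>v. (norm v, v /\<^sub>R norm v))"
  fix A B assume "A \<in> sets (radial_measure (dim S) R)" "B \<in> sets (direction_measure S)"
  then have A[measurable]: "A \<in> sets borel" and B[measurable]: "B \<in> sets borel" by auto
  define M1 where "M1 = density (radial_measure (dim S) R) (\<lambda>_. emeasure (direction_measure S) B)"
  define M2 where "M2 = distr (density ?\<mu> (indicator (direction_cone B R))) borel norm"
  have M2e: "emeasure M2 C = emeasure ?\<mu> (direction_cone B R \<inter> norm -` C)" if [measurable]: "C \<in> sets borel" for C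
  proof -
    have [measurable]: "norm -` C \<in> sets (borel :: 'a measure)"
      using measurable_sets[of norm borel borel C] that by simp
    have "emeasure M2 C = emeasure (density ?\<mu> (indicator (direction_cone B R))) (norm -` C)"
      unfolding M2_def by (subst emeasure_distr) auto
    also have "\<dots> = emeasure ?\<mu> (direction_cone B R \<inter> norm -` C)"
      by (subst emeasure_density) (auto simp: indicator_inter_arith[symmetric])
    finally show ?thesis .
  qed
  have "M1 = M2"
  proof (rule measure_eqI_lessThan)
    have M1e: "emeasure M1 C = emeasure (radial_measure (dim S) R) C * emeasure (direction_measure S) B" if "C \<in> sets borel" for C
      unfolding M1_def using that by (subst emeasure_density_const) (auto simp: mult.commute)
    show "emeasure M1 {x<..} < \<infinity>" for x
      using r.emeasure_finite s.emeasure_finite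
      by (simp add: M1e less_top[symmetric] ennreal_mult_eq_top_iff)
    show "emeasure M1 {x<..} = emeasure M2 {x<..}" for x
    proof -
      \<comment> \<open>Both measures live on radii between \<open>0\<close> and \<open>R\<close>,
        so the endpoint may be clamped to that interval.\<close>
      define y where "y = min R (max 0 x)"
      have y: "0 \<le> y" "y \<le> R" using R by (auto simp: y_def)
      have e1: "emeasure (radial_measure (dim S) R) {x<..} = emeasure (radial_measure (dim S) R) {y<..}"
        unfolding radial_measure_def using R
        by (subst (1 2) emeasure_density) (auto intro!: nn_integral_cong simp: indicator_def y_def)
      have e2: "direction_cone B R \<inter> norm -` {x<..} = direction_cone B R - direction_cone B y"
        using R by (auto simp: direction_cone_def y_def max_def split: if_splits) (smt (verit) norm_ge_zero)
      have cy: "emeasure ?\<mu> (direction_cone B y) = ennreal (y ^ dim S) * emeasure ?\<mu> (direction_cone B 1)"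
      proof (cases "y = 0")
        case True
        then have "direction_cone B y = {}" by (auto simp: direction_cone_def)
        then show ?thesis using True d by simp
      qed (use y emeasure_direction_cone[OF S, of y B] in auto)
      have fin: "emeasure ?\<mu> (direction_cone B 1) \<noteq> \<infinity>" using emeasure_direction_cone_finite[OF S, of B 1] by simp
      then obtain c where c: "emeasure ?\<mu> (direction_cone B 1) = ennreal c" "c \<ge> 0"
        by (cases "emeasure ?\<mu> (direction_cone B 1)") auto
      have pw: "y ^ dim S \<le> R ^ dim S" using y by (intro power_mono) auto
      have "emeasure M2 {x<..} = emeasure ?\<mu> (direction_cone B R) - emeasure ?\<mu> (direction_cone B y)"
        unfolding M2e[OF borel_open[OF open_greaterThan]] e2
        using emeasure_direction_cone_finite[OF S, of B y] y
        by (intro emeasure_Diff) (auto simp: direction_cone_def)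
      also have "\<dots> = ennreal (R ^ dim S * c) - ennreal (y ^ dim S * c)"
        using c R y by (simp add: cy emeasure_direction_cone[OF S R B] ennreal_mult)
      also have "\<dots> = ennreal ((R ^ dim S - y ^ dim S) * c)"
        using y c by (subst ennreal_minus) (auto simp: left_diff_distrib)
      also have "\<dots> = ennreal ((R ^ dim S - y ^ dim S) / real (dim S)) * (ennreal (real (dim S)) * ennreal c)"
        using d c pw by (simp add: ennreal_mult[symmetric] del: dim_eq_0)
      also have "\<dots> = emeasure M1 {x<..}"
        by (simp add: M1e e1 emeasure_radial_measure[OF d y] emeasure_direction_measure c)
      finally show ?thesis by simp
    qed
  qed (simp_all add: M1_def M2_def)
  then have "emeasure M1 A = emeasure M2 A" by simp
  also have "\<dots> = emeasure ?N (A \<times> B)"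
  proof -
    have pm: "(\<lambda>v::'a. (norm v, v /\<^sub>R norm v)) \<in> borel \<rightarrow>\<^sub>M borel \<Otimes>\<^sub>M borel" by measurable
    have AB: "A \<times> B \<in> sets (borel \<Otimes>\<^sub>M borel)" by measurable
    have V: "(\<lambda>v::'a. (norm v, v /\<^sub>R norm v)) -` (A \<times> B) \<in> sets borel"
      using measurable_sets[OF pm AB] by simp
    have "emeasure ?N (A \<times> B) = emeasure (density ?\<mu> (indicator (direction_cone UNIV R))) ((\<lambda>v. (norm v, v /\<^sub>R norm v)) -` (A \<times> B))"
      using pm AB by (subst emeasure_distr) auto
    also have "\<dots> = emeasure ?\<mu> (direction_cone UNIV R \<inter> (\<lambda>v. (norm v, v /\<^sub>R norm v)) -` (A \<times> B))"
      using V by (subst emeasure_density) (auto simp: indicator_inter_arith[symmetric])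
    also have "direction_cone UNIV R \<inter> (\<lambda>v. (norm v, v /\<^sub>R norm v)) -` (A \<times> B) = direction_cone B R \<inter> norm -` A"
      by (auto simp: direction_cone_def)
    finally show ?thesis by (simp add: M2e)
  qed
  finally show "emeasure (radial_measure (dim S) R) A * emeasure (direction_measure S) B = emeasure ?N (A \<times> B)"
    unfolding M1_def by (subst (asm) emeasure_density_const) (auto simp: mult.commute)
qed (simp add: sets_pair_measure_cong[OF sets_radial_measure sets_direction_measure])

text \<open>\<open>Q\<close> is the integrand with the Jacobian factor
  \<open>r ^ (dim S - 1)\<close> already absorbed. This matters for the application, where the
  factor turns \<open>sinc\<close> into \<open>sin\<close> and makes a reflection symmetry
  visible.\<close>

lemma nn_integral_polar:
  assumes S: "subspace S" and d: "dim S \<ge> 1" and R: "R > 0"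
    and Q[measurable]: "(\<lambda>(r, u). Q r u) \<in> borel_measurable (borel \<Otimes>\<^sub>M borel)"
    and q: "\<And>v. v \<in> S \<Longrightarrow> 0 < norm v \<Longrightarrow> norm v < R \<Longrightarrow> Q (norm v) (v /\<^sub>R norm v) = ennreal (norm v ^ (dim S - 1)) * q v"
  shows "(\<integral>\<^sup>+v\<in>{v \<in> S. norm v < R}. q v \<partial>subspace_lborel S) =
    (\<integral>\<^sup>+r. indicator {0<..<R} r * (\<integral>\<^sup>+u. Q r u \<partial>direction_measure S) \<partial>lborel)"
proof -
  interpret r: finite_measure "radial_measure (dim S) R" by (rule finite_radial_measure[OF d R])
  interpret s: finite_measure "direction_measure S" by (rule finite_direction_measure[OF S])
  have UC[measurable]: "direction_cone UNIV R \<in> sets (borel :: 'a measure)" by (rule direction_cone_borel) simp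
  let ?\<mu> = "subspace_lborel S"
  have zero: "AE v in ?\<mu>. v \<noteq> 0"
  proof -
    \<comment> \<open>Scaling by two fixes the origin but multiplies its finite measure by a number
      greater than one, so the origin is null.\<close>
    have "emeasure ?\<mu> {0} = ennreal (2 ^ dim S) * emeasure ?\<mu> {0}"
    proof -
      have "emeasure ?\<mu> {0} = ennreal (2 ^ dim S) * (\<integral>\<^sup>+x. indicator {0} (2 *\<^sub>R x) \<partial>?\<mu>)"
        using nn_integral_subspace_scale[OF S, of 2 "indicator {0}"] by simp
      also have "(\<lambda>x. indicator {0} (2 *\<^sub>R x) :: ennreal) = indicator {0::'a}" by (auto simp: indicator_def)
      finally show ?thesis by simp
    qed
    moreover have "emeasure ?\<mu> {0} \<noteq> \<infinity>"
      using emeasure_subspace_cball[OF S, of 0] by simp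
    ultimately have "emeasure ?\<mu> {0} = 0"
    proof (cases "emeasure ?\<mu> {0}")
      case (real c)
      then have "ennreal c = ennreal (2 ^ dim S * c)" using \<open>emeasure ?\<mu> {0} = ennreal _ * _\<close> by (simp add: ennreal_mult)
      then have "c = 2 ^ dim S * c" using real by simp
      moreover have "(2::real) ^ dim S > 1" using d by (intro one_less_power) auto
      ultimately have "c = 0" by simp
      then show ?thesis using real by simp
    qed simp
    then show ?thesis by (intro AE_I[of _ _ "{0}"]) auto
  qed
  \<comment> \<open>\<open>radial_measure\<close> supplies the power of \<open>r\<close> itself, so
    that power is divided out of \<open>Q\<close> here and restored after Fubini.\<close>
  define G where "G r u = ennreal (inverse (r ^ (dim S - 1))) * Q r u * indicator {0<..<R} r" for r u
  have Gm[measurable]: "(\<lambda>(r, u). G r u) \<in> borel_measurable (borel \<Otimes>\<^sub>M borel)"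
  proof -
    have [measurable]: "(\<lambda>x. Q (fst x) (snd x)) \<in> borel_measurable (borel \<Otimes>\<^sub>M borel)" using Q by (simp add: case_prod_beta')
    show ?thesis unfolding G_def case_prod_beta' by measurable
  qed
  have "(\<integral>\<^sup>+v\<in>{v \<in> S. norm v < R}. q v \<partial>?\<mu>) = (\<integral>\<^sup>+v. indicator (direction_cone UNIV R) v * G (norm v) (v /\<^sub>R norm v) \<partial>?\<mu>)"
  proof (rule nn_integral_cong_AE, use zero subspace_lborel_AE[OF S] in eventually_elim)
    fix v :: 'a assume v: "v \<noteq> 0" "v \<in> S"
    show "q v * indicator {v \<in> S. norm v < R} v = indicator (direction_cone UNIV R) v * G (norm v) (v /\<^sub>R norm v)"
    proof (cases "norm v < R")
      case True
      have "ennreal (inverse (norm v ^ (dim S - 1))) * (ennreal (norm v ^ (dim S - 1)) * q v) = q v"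
        using v by (simp add: mult.assoc[symmetric] ennreal_mult[symmetric])
      then show ?thesis using q[of v] v True by (simp add: G_def direction_cone_def)
    qed (simp add: G_def)
  qed
  also have "\<dots> = (\<integral>\<^sup>+v. G (norm v) (v /\<^sub>R norm v) \<partial>density ?\<mu> (indicator (direction_cone UNIV R)))"
    using Gm by (subst nn_integral_density) (auto simp: case_prod_beta')
  also have "\<dots> = (\<integral>\<^sup>+x. G (fst x) (snd x) \<partial>distr (density ?\<mu> (indicator (direction_cone UNIV R))) (borel \<Otimes>\<^sub>M borel) (\<lambda>v. (norm v, v /\<^sub>R norm v)))"
    using Gm by (subst nn_integral_distr) (auto simp: case_prod_beta')
  also have "\<dots> = (\<integral>\<^sup>+r. \<integral>\<^sup>+u. G r u \<partial>direction_measure S \<partial>radial_measure (dim S) R)"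
    unfolding polar_coordinates[OF S d R, symmetric]
    using Gm by (subst s.nn_integral_fst[symmetric]) (auto simp: case_prod_beta')
  also have "\<dots> = (\<integral>\<^sup>+r. ennreal (r ^ (dim S - 1)) * indicator {0<..R} r * (\<integral>\<^sup>+u. G r u \<partial>direction_measure S) \<partial>lborel)"
    unfolding radial_measure_def
  proof (subst nn_integral_density)
    have "(\<lambda>r. \<integral>\<^sup>+u. G r u \<partial>direction_measure S) \<in> borel_measurable borel"
      using Gm by (intro s.borel_measurable_nn_integral) (simp cong: measurable_cong_sets)
    then show "(\<lambda>r. \<integral>\<^sup>+u. G r u \<partial>direction_measure S) \<in> borel_measurable lborel" by simp
  qed auto
  also have "\<dots> = (\<integral>\<^sup>+r. indicator {0<..<R} r * (\<integral>\<^sup>+u. Q r u \<partial>direction_measure S) \<partial>lborel)"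
  proof (intro nn_integral_cong)
    fix r :: real
    show "ennreal (r ^ (dim S - 1)) * indicator {0<..R} r * (\<integral>\<^sup>+u. G r u \<partial>direction_measure S) =
      indicator {0<..<R} r * (\<integral>\<^sup>+u. Q r u \<partial>direction_measure S)"
    proof (cases "0 < r \<and> r < R")
      case True
      have Qr: "(\<lambda>u. Q r u) \<in> borel_measurable (direction_measure S)"
        using measurable_compose[OF measurable_Pair1'[of r borel borel] Q] by simp
      have "(\<integral>\<^sup>+u. G r u \<partial>direction_measure S) = (\<integral>\<^sup>+u. ennreal (inverse (r ^ (dim S - 1))) * Q r u \<partial>direction_measure S)"
        using True by (simp add: G_def)
      also have "\<dots> = ennreal (inverse (r ^ (dim S - 1))) * (\<integral>\<^sup>+u. Q r u \<partial>direction_measure S)"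
        by (rule nn_integral_cmult[OF Qr])
      finally show ?thesis using True by (simp add: mult.assoc[symmetric] ennreal_mult[symmetric])
    qed (auto simp: G_def indicator_def)
  qed
  finally show ?thesis .
qed

text \<open>The reflection \<open>r \<mapsto> \<pi> - r, u \<mapsto> - u\<close> exchanges the two halves of the ball of radius \<open>\<pi>\<close>.\<close>

lemma nn_integral_reflect_radius:
  assumes S: "subspace S" and d: "dim S \<ge> 1"
    and Q[measurable]: "(\<lambda>(r, u). Q r u) \<in> borel_measurable (borel \<Otimes>\<^sub>M borel)"
    and q: "\<And>v. v \<in> S \<Longrightarrow> 0 < norm v \<Longrightarrow> norm v < pi \<Longrightarrow> Q (norm v) (v /\<^sub>R norm v) = ennreal (norm v ^ (dim S - 1)) * q v"
    and sym: "\<And>r u. 0 < r \<Longrightarrow> r < pi \<Longrightarrow> Q (pi - r) (- u) = Q r u"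
  shows "(\<integral>\<^sup>+v\<in>{v \<in> S. norm v < pi}. q v \<partial>subspace_lborel S) = 2 * (\<integral>\<^sup>+v\<in>{v \<in> S. norm v < pi / 2}. q v \<partial>subspace_lborel S)"
proof -
  interpret s: finite_measure "direction_measure S" by (rule finite_direction_measure[OF S])
  define K where "K r = (\<integral>\<^sup>+u. Q r u \<partial>direction_measure S)" for r
  have Km[measurable]: "K \<in> borel_measurable borel"
    unfolding K_def using Q by (intro s.borel_measurable_nn_integral) (simp cong: measurable_cong_sets)
  have Qr[measurable]: "(\<lambda>u. Q r u) \<in> borel_measurable borel" for r
    using measurable_compose[OF measurable_Pair1'[of r borel borel] Q] by simp
  have Ksym: "K (pi - r) = K r" if r: "0 < r" "r < pi" for r
  proof -
    have [measurable]: "direction_cone UNIV 1 \<in> sets (borel :: 'a measure)" by (rule direction_cone_borel) simp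
    have um[measurable]: "(\<lambda>v. Q (pi - r) (v /\<^sub>R norm v)) \<in> borel_measurable borel"
      by (rule measurable_compose[OF _ Qr]) measurable
    have "K (pi - r) = (\<integral>\<^sup>+v. ennreal (real (dim S)) * indicator (direction_cone UNIV 1) v * Q (pi - r) (v /\<^sub>R norm v) \<partial>subspace_lborel S)"
      unfolding K_def by (rule nn_integral_direction_measure[OF Qr])
    also have "\<dots> = (\<integral>\<^sup>+v. ennreal (real (dim S)) * indicator (direction_cone UNIV 1) (- v) * Q (pi - r) ((- v) /\<^sub>R norm (- v)) \<partial>subspace_lborel S)"
      by (rule nn_integral_subspace_uminus[OF S, symmetric]) measurable
    also have "\<dots> = (\<integral>\<^sup>+v. ennreal (real (dim S)) * indicator (direction_cone UNIV 1) v * Q r (v /\<^sub>R norm v) \<partial>subspace_lborel S)"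
      using sym[OF r] by (intro nn_integral_cong) (auto simp: direction_cone_def indicator_def)
    also have "\<dots> = K r" unfolding K_def by (rule nn_integral_direction_measure[OF Qr, symmetric])
    finally show ?thesis .
  qed
  have "(\<integral>\<^sup>+v\<in>{v \<in> S. norm v < pi}. q v \<partial>subspace_lborel S) = (\<integral>\<^sup>+r. indicator {0<..<pi} r * K r \<partial>lborel)"
    unfolding K_def by (rule nn_integral_polar[OF S d _ Q q]) auto
  also have "\<dots> = (\<integral>\<^sup>+r. indicator {0<..<pi/2} r * K r + indicator {pi/2<..<pi} r * K r \<partial>lborel)"
    by (rule nn_integral_cong_AE, use AE_lborel_singleton[of "pi/2"] in eventually_elim)
       (auto simp: indicator_def)
  also have "\<dots> = (\<integral>\<^sup>+r. indicator {0<..<pi/2} r * K r \<partial>lborel) + (\<integral>\<^sup>+r. indicator {pi/2<..<pi} r * K r \<partial>lborel)"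
    by (rule nn_integral_add) auto
  also have "(\<integral>\<^sup>+r. indicator {pi/2<..<pi} r * K r \<partial>lborel) = (\<integral>\<^sup>+r. indicator {pi/2<..<pi} (pi + -1 * r) * K (pi + -1 * r) \<partial>lborel)"
    by (subst nn_integral_real_affine[of _ "-1" pi]) auto
  also have "\<dots> = (\<integral>\<^sup>+r. indicator {0<..<pi/2} r * K r \<partial>lborel)"
    using Ksym by (intro nn_integral_cong) (auto simp: indicator_def)
  also have "(\<integral>\<^sup>+r. indicator {0<..<pi/2} r * K r \<partial>lborel) = (\<integral>\<^sup>+v\<in>{v \<in> S. norm v < pi / 2}. q v \<partial>subspace_lborel S)"
  proof -
    have lt: "norm v < pi" if "norm v < pi / 2" for v :: 'a using that norm_ge_zero[of v] pi_gt_zero by linarith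
    show ?thesis unfolding K_def by (rule nn_integral_polar[OF S d _ Q q, symmetric]) (simp, assumption, assumption, rule lt)
  qed
  finally show ?thesis by (simp add: mult_2)
qed

section \<open>The Hopf map\<close>

definition hinner :: "complex^'n \<Rightarrow> complex^'n \<Rightarrow> complex" where
  "hinner a b = (\<Sum>i\<in>UNIV. a $ i * cnj (b $ i))"

lemma Re_hinner: "Re (hinner a b) = a \<bullet> b"
  by (simp add: hinner_def inner_vec_def inner_complex_def)

lemma hinner_cnj: "cnj (hinner a b) = hinner b a"
  by (simp add: hinner_def mult.commute)

lemma hinner_add_left: "hinner (a + b) c = hinner a c + hinner b c"
  and hinner_diff_left: "hinner (a - b) c = hinner a c - hinner b c"
  and hinner_scale_left: "hinner (k *s a) c = k * hinner a c"
  and hinner_scaleR_left: "hinner (r *\<^sub>R a) c = of_real r * hinner a c"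
  and hinner_zero_left [simp]: "hinner 0 c = 0"
  by (simp_all add: hinner_def algebra_simps sum.distrib sum_subtractf sum_distrib_left scaleR_conv_of_real[where 'a=complex])

lemma hinner_add_right: "hinner c (a + b) = hinner c a + hinner c b"
  and hinner_scale_right: "hinner c (k *s a) = cnj k * hinner c a"
  and hinner_scaleR_right: "hinner c (r *\<^sub>R a) = of_real r * hinner c a"
  and hinner_zero_right [simp]: "hinner c 0 = 0"
  by (simp_all add: hinner_def algebra_simps sum.distrib sum_subtractf sum_distrib_left scaleR_conv_of_real[where 'a=complex])

lemma hinner_self: "hinner a a = of_real ((norm a)\<^sup>2)"
proof (rule complex_eqI)
  show "Re (hinner a a) = Re (of_real ((norm a)\<^sup>2))" by (simp add: Re_hinner dot_square_norm)
  have "cnj (hinner a a) = hinner a a" by (rule hinner_cnj)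
  then show "Im (hinner a a) = Im (of_real ((norm a)\<^sup>2))" by (simp add: complex_eq_iff)
qed

lemma Im_hinner: "Im (hinner a b) = a \<bullet> (\<i> *s b)"
  by (simp add: Re_hinner[symmetric] hinner_scale_right)

lemma hinner_eq_0_iff: "hinner a b = 0 \<longleftrightarrow> a \<bullet> b = 0 \<and> a \<bullet> (\<i> *s b) = 0"
  by (simp add: complex_eq_iff Re_hinner Im_hinner)

lemma inner_scale_unit:
  fixes a b :: "complex^'n"
  assumes "norm c = 1" shows "(c *s a) \<bullet> (c *s b) = a \<bullet> b"
proof -
  have "c * cnj c = 1" "cnj c * c = 1" using assms by (simp_all add: complex_norm_square[symmetric] mult.commute[of "cnj c"])
  then have "hinner (c *s a) (c *s b) = hinner a b"
    by (simp add: hinner_scale_left hinner_scale_right mult.assoc[symmetric])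
  then show ?thesis by (metis Re_hinner)
qed

lemma norm_scale_complex: "norm (c *s a) = norm c * norm (a :: complex^'n)"
proof -
  have "hinner (c *s a) (c *s a) = (c * cnj c) * hinner a a"
    by (simp only: hinner_scale_left hinner_scale_right mult_ac)
  also have "\<dots> = of_real ((norm c)\<^sup>2 * (norm a)\<^sup>2)"
    by (simp add: hinner_self complex_norm_square[symmetric])
  finally have "hinner (c *s a) (c *s a) = of_real ((norm c)\<^sup>2 * (norm a)\<^sup>2)" .
  then have "Re (hinner (c *s a) (c *s a)) = (norm c)\<^sup>2 * (norm a)\<^sup>2" by (simp only: Re_complex_of_real)
  then have "(norm (c *s a))\<^sup>2 = (norm c * norm a)\<^sup>2" by (simp add: Re_hinner dot_square_norm power_mult_distrib)
  then show ?thesis by (simp add: power2_eq_iff_nonneg)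
qed

lemma scaleR_eq_scale: "r *\<^sub>R a = of_real r *s (a :: complex^'n)"
  by (simp add: vec_eq_iff scaleR_conv_of_real[where 'a=complex])

lemma linear_scale_complex: "linear ((*s) c :: complex^'n \<Rightarrow> complex^'n)"
  by (rule linearI) (simp_all add: vec_eq_iff algebra_simps)

lemma hopf_deriv_add_left: "hopf_deriv (a + b) h = hopf_deriv a h + hopf_deriv b h"
  and hopf_deriv_add_right: "hopf_deriv a (h + k) = hopf_deriv a h + hopf_deriv a k"
  and hopf_deriv_scaleR_left: "hopf_deriv (r *\<^sub>R a) h = r *\<^sub>R hopf_deriv a h"
  and hopf_deriv_scaleR_right: "hopf_deriv a (r *\<^sub>R h) = r *\<^sub>R hopf_deriv a h"
  by (simp_all add: hopf_deriv_def vec_eq_iff algebra_simps add_divide_distrib scaleR_conv_of_real[where 'a=complex])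

lemma linear_hopf_deriv: "linear (hopf_deriv z)"
  by (rule linearI) (simp_all add: hopf_deriv_add_right hopf_deriv_scaleR_right)

lemma bounded_bilinear_hopf_deriv: "bounded_bilinear (hopf_deriv :: complex^'n \<Rightarrow> _)"
  unfolding bilinear_conv_bounded_bilinear[symmetric] bilinear_def
  by (auto intro!: linearI simp: hopf_deriv_add_left hopf_deriv_add_right hopf_deriv_scaleR_left hopf_deriv_scaleR_right)

lemma hopf_eq_deriv: "hopf z = (1/2) *\<^sub>R hopf_deriv z z"
  by (simp add: hopf_def hopf_deriv_def vec_eq_iff scaleR_conv_of_real[where 'a=complex])

lemma hopf_deriv_unit:
  assumes "norm c = 1" shows "hopf_deriv (c *s z) (c *s h) = hopf_deriv z h"
proof -
  have "c * cnj c = 1" using assms by (simp add: complex_norm_square[symmetric])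
  then have "c * a * (cnj c * cnj b) = a * cnj b" for a b
    by (metis (no_types, opaque_lifting) mult.assoc mult.left_commute mult_1)
  then have "hopf_deriv (c *s z) (c *s h) $ i $ j = hopf_deriv z h $ i $ j" for i j
    by (simp only: hopf_deriv_def vec_lambda_beta vector_smult_component complex_cnj_mult)
  then show ?thesis by (simp add: vec_eq_iff)
qed

lemma hopf_unit: "norm c = 1 \<Longrightarrow> hopf (c *s z) = hopf z"
  by (simp add: hopf_eq_deriv hopf_deriv_unit)

text \<open>Four independent vectors are allowed because the second derivative of
  \<open>hopf \<circ> s\<close> contains \<open>hopf_deriv\<close> of two first derivatives of the
  section, paired with \<open>hopf_deriv\<close> at the base vector.\<close>

lemma hopf_deriv_inner:
  "hopf_deriv a b \<bullet> hopf_deriv c d =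
     Re (hinner b d * hinner c a + hinner b c * hinner d a + hinner a d * hinner c b + hinner a c * hinner d b) / 2"
proof -
  have s2: "complex_of_real (sqrt 2) * complex_of_real (sqrt 2) = 2"
    by (simp flip: of_real_mult)
  have "hopf_deriv a b \<bullet> hopf_deriv c d =
        Re (\<Sum>i\<in>UNIV. \<Sum>j\<in>UNIV. hopf_deriv a b $ i $ j * cnj (hopf_deriv c d $ i $ j))"
    by (simp add: inner_vec_def inner_complex_def)
  also have "(\<Sum>i\<in>UNIV. \<Sum>j\<in>UNIV. hopf_deriv a b $ i $ j * cnj (hopf_deriv c d $ i $ j)) =
        (\<Sum>i\<in>UNIV. \<Sum>j\<in>UNIV. ((b $ i * cnj (d $ i)) * (c $ j * cnj (a $ j))
           + (b $ i * cnj (c $ i)) * (d $ j * cnj (a $ j))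
           + (a $ i * cnj (d $ i)) * (c $ j * cnj (b $ j))
           + (a $ i * cnj (c $ i)) * (d $ j * cnj (b $ j))) / 2)"
    by (intro sum.cong refl) (simp add: hopf_deriv_def s2 algebra_simps)
  also have "\<dots> = (hinner b d * hinner c a + hinner b c * hinner d a + hinner a d * hinner c b + hinner a c * hinner d b) / 2"
    by (simp only: hinner_def sum_product sum.distrib[symmetric] sum_divide_distrib)
  finally show ?thesis by simp
qed

text \<open>It suffices that one argument is horizontal: the component of \<open>w\<close> along the
  complex line of \<open>z\<close> enters only multiplied by Hermitian products of \<open>v\<close>
  with \<open>z\<close>. Hence second derivatives, which need not be horizontal, may stand on the
  right.\<close>

lemma hopf_deriv_inner_horizontal:
  assumes z: "norm z = 1" and v: "hinner v z = 0"
  shows "hopf_deriv z v \<bullet> hopf_deriv z w = v \<bullet> w"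
proof -
  have "hinner z v = 0" using v hinner_cnj[of v z] by simp
  moreover have "hinner z z = 1" using z by (simp add: hinner_self)
  ultimately have "hopf_deriv z v \<bullet> hopf_deriv z w = Re (hinner v w + hinner w v) / 2"
    by (simp add: hopf_deriv_inner v)
  then show ?thesis by (simp add: Re_hinner inner_commute)
qed

text \<open>Each of the four products contains a Hermitian product of \<open>v\<close> with
  \<open>a\<close> or \<open>b\<close>. Real orthogonality alone would not be enough.\<close>

lemma hopf_deriv_inner_zero:
  assumes "hinner v a = 0" "hinner v b = 0"
  shows "hopf_deriv z v \<bullet> hopf_deriv a b = 0"
  using assms hinner_cnj[of v a] hinner_cnj[of v b] by (simp add: hopf_deriv_inner)

section \<open>Horizontal and vertical components\<close>

definition horiz :: "complex^'n \<Rightarrow> complex^'n \<Rightarrow> complex^'n" where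
  "horiz z h = h - hinner h z *s z"

lemma hinner_horiz: "norm z = 1 \<Longrightarrow> hinner (horiz z h) z = 0"
  by (simp add: horiz_def hinner_diff_left hinner_scale_left hinner_self)

lemma horiz_id: "hinner h z = 0 \<Longrightarrow> horiz z h = h"
  by (simp add: horiz_def)

lemma linear_horiz: "linear (horiz z)"
  by (rule linearI) (simp_all add: horiz_def hinner_add_left hinner_scaleR_left vec_eq_iff algebra_simps scaleR_conv_of_real[where 'a=complex])

lemma horiz_scale: "horiz z (c *s h) = c *s horiz z h"
  by (simp add: horiz_def hinner_scale_left vec_eq_iff algebra_simps)

lemma horiz_self: "norm z = 1 \<Longrightarrow> horiz z z = 0"
  by (simp add: horiz_def hinner_self)

text \<open>Tangency to the sphere makes the Hermitian product with \<open>z\<close> purely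
  imaginary, so the part removed by \<open>horiz\<close> is a real multiple of the vertical
  direction.\<close>

lemma horiz_decomp:
  assumes "h \<bullet> z = 0" shows "h = horiz z h + (h \<bullet> (\<i> *s z)) *\<^sub>R (\<i> *s z)"
proof -
  have "hinner h z = \<i> * of_real (h \<bullet> (\<i> *s z))"
    using assms by (simp add: complex_eq_iff Re_hinner Im_hinner)
  then show ?thesis by (simp add: horiz_def vec_eq_iff scaleR_conv_of_real[where 'a=complex] mult_ac)
qed

lemma hopf_deriv_horiz:
  assumes "h \<bullet> z = 0" shows "hopf_deriv z h = hopf_deriv z (horiz z h)"
  by (subst horiz_decomp[OF assms]) (simp add: hopf_deriv_add_right hopf_deriv_scaleR_right hopf_vertical)

lemma hopf_deriv_inj_horizontal:
  assumes z: "norm z = 1" and h: "hinner h z = 0" "hinner h' z = 0" and eq: "hopf_deriv z h = hopf_deriv z h'"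
  shows "h = h'"
proof -
  have "hinner (h - h') z = 0" by (simp add: hinner_diff_left h)
  then have "(h - h') \<bullet> (h - h') = hopf_deriv z (h - h') \<bullet> hopf_deriv z (h - h')"
    using hopf_deriv_inner_horizontal[OF z] by metis
  also have "hopf_deriv z (h - h') = 0" using eq by (simp add: linear_diff[OF linear_hopf_deriv])
  finally show ?thesis by simp
qed

lemma hopf_deriv_kernel:
  assumes z: "norm z = 1" and h: "h \<bullet> z = 0" and k: "hopf_deriv z h = 0"
  shows "h = (h \<bullet> (\<i> *s z)) *\<^sub>R (\<i> *s z)"
proof -
  have "horiz z h = 0"
    by (rule hopf_deriv_inj_horizontal[OF z hinner_horiz[OF z]]) (use k hopf_deriv_horiz[OF h] in \<open>auto simp: linear_0[OF linear_hopf_deriv]\<close>)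
  then show ?thesis using horiz_decomp[OF h] by simp
qed

lemma CP_iff: "q \<in> CP \<longleftrightarrow> (\<exists>z. norm z = 1 \<and> q = hopf z)"
  by (auto simp: CP_def)

text \<open>The matrix \<open>\<surd>2 q\<close> is the projection onto the line \<open>q\<close>; normalizing its value at \<open>z0\<close> gives a
  local section of the Hopf fibration through \<open>z0\<close>.\<close>

definition line_proj :: "complex^'n \<Rightarrow> complex^'n^'n \<Rightarrow> complex^'n" where
  "line_proj z0 q = (\<chi> i. complex_of_real (sqrt 2) * (\<Sum>k\<in>UNIV. q $ i $ k * z0 $ k))"

definition hopf_section :: "complex^'n \<Rightarrow> complex^'n^'n \<Rightarrow> complex^'n" where
  "hopf_section z0 q = line_proj z0 q /\<^sub>R norm (line_proj z0 q)"

lemma linear_line_proj: "linear (line_proj z0)"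
  by (rule linearI) (simp_all add: line_proj_def vec_eq_iff algebra_simps sum.distrib sum_distrib_left scaleR_conv_of_real[where 'a=complex])

lemma line_proj_hopf: "line_proj z0 (hopf z) = hinner z0 z *s z"
  by (simp add: line_proj_def hopf_def hinner_def vec_eq_iff sum_distrib_left sum_distrib_right mult_ac)

lemma line_proj_hopf_eq_0: "norm z = 1 \<Longrightarrow> line_proj z0 (hopf z) = 0 \<longleftrightarrow> hinner z z0 = 0"
proof -
  assume z: "norm z = 1"
  have "norm (line_proj z0 (hopf z)) = norm (hinner z0 z)" by (simp add: line_proj_hopf norm_scale_complex z)
  then have "line_proj z0 (hopf z) = 0 \<longleftrightarrow> hinner z0 z = 0" by (metis norm_eq_zero)
  then show ?thesis using hinner_cnj[of z z0] by (metis complex_cnj_zero_iff)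
qed

lemma hopf_section_hopf:
  assumes "norm z = 1" shows "hopf_section z0 (hopf z) = sgn (hinner z0 z) *s z"
  by (simp add: hopf_section_def line_proj_hopf norm_scale_complex assms scaleR_eq_scale vec_eq_iff sgn_eq mult_ac divide_inverse)

lemma hopf_section_id: "norm z = 1 \<Longrightarrow> hopf_section z (hopf z) = z"
  by (simp add: hopf_section_hopf hinner_self vec_eq_iff)

lemma hopf_section_props:
  assumes z: "norm z = 1" and n0: "hinner z z0 \<noteq> 0"
  shows "norm (hopf_section z0 (hopf z)) = 1" "hopf (hopf_section z0 (hopf z)) = hopf z"
    "hinner (hopf_section z0 (hopf z)) z0 = of_real (norm (hinner z z0))"
    "z = sgn (hinner z z0) *s hopf_section z0 (hopf z)"
proof -
  have c: "hinner z0 z = cnj (hinner z z0)" by (simp add: hinner_cnj)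
  have n: "norm (sgn (hinner z0 z)) = 1" using n0 by (simp add: c norm_sgn)
  show "norm (hopf_section z0 (hopf z)) = 1" by (simp add: hopf_section_hopf[OF z] norm_scale_complex n z)
  show "hopf (hopf_section z0 (hopf z)) = hopf z" by (simp add: hopf_section_hopf[OF z] hopf_unit[OF n])
  have "sgn (hinner z0 z) * hinner z z0 = of_real (norm (hinner z z0))"
    using n0 by (simp add: c sgn_eq complex_norm_square[symmetric] power2_eq_square mult.commute)
  then show "hinner (hopf_section z0 (hopf z)) z0 = of_real (norm (hinner z z0))"
    by (simp add: hopf_section_hopf[OF z] hinner_scale_left)
  have "sgn (hinner z z0) * sgn (hinner z0 z) = 1"
    using n0 by (simp add: c sgn_eq complex_norm_square[symmetric] power2_eq_square)
  then show "z = sgn (hinner z z0) *s hopf_section z0 (hopf z)"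
    by (simp add: hopf_section_hopf[OF z] vec_eq_iff mult.assoc[symmetric])
qed

section \<open>Smooth sections and derivatives of projective maps\<close>

lemma smooth_hopf_section:
  assumes D: "rel_open W D" and g: "smooth_map_on W D g" and n0: "\<And>u. u \<in> D \<Longrightarrow> line_proj z0 (g u) \<noteq> 0"
  shows "smooth_map_on W D (\<lambda>u. hopf_section z0 (g u))"
proof -
  have l: "Ck_on k W D (\<lambda>u. line_proj z0 (g u))" for k
    using g linear_line_proj by (rule_tac Ck_bounded_linear[OF D, where L="line_proj z0"]) (auto simp: smooth_map_on_def linear_conv_bounded_linear)
  show ?thesis unfolding smooth_map_on_def hopf_section_def
    using n0 by (intro allI Ck_scaleR[OF D] Ck_inverse[OF D] Ck_norm[OF D] l) auto
qed

lemma smooth_hopf: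
  assumes D: "rel_open W D" and g: "smooth_map_on W D g"
  shows "smooth_map_on W D (\<lambda>u. hopf (g u))"
  using g unfolding smooth_map_on_def hopf_eq_deriv
  by (intro allI Ck_scaleR[OF D] Ck_const[OF D] Ck_bilinear[OF D bounded_bilinear_hopf_deriv]) auto

lemma smooth_proj_point:
  assumes D: "rel_open W D" and G: "smooth_map_on W D G" and n0: "\<And>u. u \<in> D \<Longrightarrow> G u \<noteq> 0"
  shows "smooth_map_on W D (\<lambda>u. proj_point (G u))"
  unfolding proj_point_def
proof (rule smooth_hopf[OF D])
  show "smooth_map_on W D (\<lambda>u. G u /\<^sub>R norm (G u))"
    using G n0 unfolding smooth_map_on_def by (intro allI Ck_scaleR[OF D] Ck_inverse[OF D] Ck_norm[OF D]) auto
qed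

lemma unit_field_derivative:
  assumes D: "rel_open W D" and s: "smooth_map_on W D s" and n: "\<And>u. u \<in> D \<Longrightarrow> norm (s u) = 1"
    and u: "u \<in> D" and x: "x \<in> W"
  shows "fd D s u x \<bullet> s u = 0"
proof -
  note d = smooth_has_derivative[OF s u]
  have 1: "((\<lambda>u. s u \<bullet> s u) has_derivative (\<lambda>x. s u \<bullet> fd D s u x + fd D s u x \<bullet> s u)) (at u within D)"
    by (rule has_derivative_inner[OF d d])
  have "((\<lambda>u. 1::real) has_derivative (\<lambda>x. s u \<bullet> fd D s u x + fd D s u x \<bullet> s u)) (at u within D)"
    by (rule has_derivative_transform[OF u _ 1]) (simp add: n dot_square_norm)
  from has_derivative_unique_rel_open[OF D u x this has_derivative_const] show ?thesis by (simp add: inner_commute)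
qed

lemma fd_hopf:
  assumes D: "rel_open W D" and s: "smooth_map_on W D s" and u: "u \<in> D" and x: "x \<in> W"
    and eq: "\<And>w. w \<in> D \<Longrightarrow> g w = hopf (s w)"
  shows "fd D g u x = hopf_deriv (s u) (fd D s u x)"
proof (rule fd_eq[OF D u x])
  have "((\<lambda>w. hopf (s w)) has_derivative (\<lambda>x. hopf_deriv (s u) (fd D s u x))) (at u within D)"
    by (rule has_derivative_compose[OF smooth_has_derivative[OF s u] hopf_has_derivative])
  then show "(g has_derivative (\<lambda>x. hopf_deriv (s u) (fd D s u x))) (at u within D)"
    by (rule has_derivative_transform[OF u, rotated]) (simp add: eq)
qed

text \<open>The derivative of the normalizing factor contributes a multiple of \<open>G u\<close>,
  which the horizontal projection kills; it never has to be computed. The resulting formula is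
  complex linear before \<open>hopf_deriv\<close> is applied whenever the derivative of
  \<open>G\<close> is.\<close>

lemma fd_proj_point:
  assumes D: "rel_open W D" and G: "smooth_map_on W D G" and u: "u \<in> D" and x: "x \<in> W"
    and n0: "\<And>w. w \<in> D \<Longrightarrow> G w \<noteq> 0" and eq: "\<And>w. w \<in> D \<Longrightarrow> g w = proj_point (G w)"
  shows "fd D g u x = hopf_deriv (G u /\<^sub>R norm (G u)) (inverse (norm (G u)) *\<^sub>R horiz (G u /\<^sub>R norm (G u)) (fd D G u x))"
proof -
  let ?s = "\<lambda>u. G u /\<^sub>R norm (G u)"
  define z where "z = ?s u"
  have z: "norm z = 1" using n0[OF u] by (simp add: z_def)
  have in_s: "smooth_map_on W D (\<lambda>u. inverse (norm (G u)))"
    using G n0 unfolding smooth_map_on_def by (intro allI Ck_inverse[OF D] Ck_norm[OF D]) auto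
  have s: "smooth_map_on W D ?s"
    using G in_s unfolding smooth_map_on_def by (intro allI Ck_scaleR[OF D]) auto
  have "(?s has_derivative (\<lambda>x. inverse (norm (G u)) *\<^sub>R fd D G u x + fd D (\<lambda>u. inverse (norm (G u))) u x *\<^sub>R G u)) (at u within D)"
    by (rule has_derivative_scaleR[OF smooth_has_derivative[OF in_s u] smooth_has_derivative[OF G u]])
  from fd_eq[OF D u x this] have ds: "fd D ?s u x = inverse (norm (G u)) *\<^sub>R fd D G u x + fd D (\<lambda>u. inverse (norm (G u))) u x *\<^sub>R G u" .
  have Gz: "G u = norm (G u) *\<^sub>R z" using n0[OF u] by (simp add: z_def)
  have "horiz z (G u) = 0" by (subst Gz) (simp add: linear_scale[OF linear_horiz] horiz_self[OF z])
  then have hs: "horiz z (fd D ?s u x) = inverse (norm (G u)) *\<^sub>R horiz z (fd D G u x)"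
    by (simp add: ds linear_add[OF linear_horiz] linear_scale[OF linear_horiz])
  have "fd D ?s u x \<bullet> z = 0" unfolding z_def by (rule unit_field_derivative[OF D s _ u x]) (use n0 in simp)
  then have "hopf_deriv z (fd D ?s u x) = hopf_deriv z (horiz z (fd D ?s u x))" by (rule hopf_deriv_horiz)
  moreover have "fd D g u x = hopf_deriv z (fd D ?s u x)"
    unfolding z_def by (rule fd_hopf[OF D s u x]) (simp add: eq proj_point_def)
  ultimately show ?thesis by (simp add: hs z_def[symmetric])
qed

section \<open>Circle bundles\<close>

text \<open>Regular charts must have their model space inside the Euclidean type of the immersion,
  which consists of matrices for the base and vectors for the total space. \<open>L\<close> copies
  the base coordinates isometrically, the orthogonal unit vector \<open>e\<close> carries the angle,
  and \<open>R\<close> recovers the base coordinates and forgets the angle.\<close>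

definition line_embedding ::
  "'a::euclidean_space set \<Rightarrow> ('a \<Rightarrow> 'b::euclidean_space) \<Rightarrow> 'b \<Rightarrow> ('b \<Rightarrow> 'a) \<Rightarrow> bool" where
  "line_embedding W L e R \<longleftrightarrow> isometric_on W L \<and> norm e = 1 \<and> (\<forall>x\<in>W. L x \<bullet> e = 0) \<and>
    linear R \<and> (\<forall>x\<in>W. R (L x) = x) \<and> R e = 0 \<and> (\<forall>y. R y \<in> W)"

lemma line_embedding_exists:
  fixes W :: "'a::euclidean_space set"
  assumes W: "subspace W" and d: "dim W < DIM('b::euclidean_space)"
  shows "\<exists>(L :: 'a \<Rightarrow> 'b) e R. line_embedding W L e R"
proof -
  let ?B = "onb W"
  note B = onb[OF W] and fin = onb_finite[OF W] and sub = onb_subset[OF W]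
  have "card ?B < card (Basis :: 'b set)" using d card_onb[OF W] by simp
  then obtain i where i: "inj_on i ?B" "i ` ?B \<subseteq> (Basis :: 'b set)"
    using card_le_inj[OF fin, of "Basis :: 'b set"] by auto
  then have "i ` ?B \<noteq> Basis" using \<open>card ?B < _\<close> card_image[OF i(1)] by auto
  then obtain e where e: "e \<in> Basis" "e \<notin> i ` ?B" using i by auto
  have ii: "i b \<bullet> i c = (if b = c then 1 else 0)" if "b \<in> ?B" "c \<in> ?B" for b c
  proof -
    have "i b \<in> Basis" "i c \<in> Basis" using i that by auto
    then show ?thesis using inj_on_eq_iff[OF i(1) that] by (simp add: inner_Basis)
  qed
  define L where "L x = (\<Sum>b\<in>?B. (x \<bullet> b) *\<^sub>R i b)" for x
  define R where "R y = (\<Sum>b\<in>?B. (y \<bullet> i b) *\<^sub>R b)" for y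
  have linL: "linear L" unfolding L_def
    by (rule linearI) (simp_all add: inner_add_left scaleR_add_left sum.distrib scaleR_sum_right)
  have linR: "linear R" unfolding R_def
    by (rule linearI) (simp_all add: inner_add_left scaleR_add_left sum.distrib scaleR_sum_right)
  have Li: "L x \<bullet> i c = x \<bullet> c" if "c \<in> ?B" for x c
  proof -
    have "L x \<bullet> i c = (\<Sum>b\<in>?B. if b = c then x \<bullet> b else 0)"
      unfolding L_def inner_sum_left by (intro sum.cong refl) (simp add: ii that)
    then show ?thesis using that fin by simp
  qed
  have RL: "R (L x) = x" if "x \<in> W" for x
  proof -
    have "R (L x) = (\<Sum>b\<in>?B. (x \<bullet> b) *\<^sub>R b)" unfolding R_def by (intro sum.cong refl) (simp add: Li)
    then show ?thesis using orthonormal_expand[OF B(1)] B(2) that by simp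
  qed
  have iso: "isometric_on W L"
    unfolding isometric_on_def
  proof (intro conjI linL ballI)
    fix x y assume xy: "x \<in> W" "y \<in> W"
    have "L x \<bullet> L y = (\<Sum>b\<in>?B. (y \<bullet> b) * (L x \<bullet> i b))" by (subst L_def[of y]) (simp add: inner_sum_right)
    also have "\<dots> = (\<Sum>b\<in>?B. (y \<bullet> b) * (b \<bullet> x))" by (intro sum.cong refl) (simp add: Li inner_commute)
    also have "\<dots> = y \<bullet> x" using orthonormal_inner_expand[OF B(1)] B(2) xy by simp
    finally show "L x \<bullet> L y = x \<bullet> y" by (simp add: inner_commute)
  qed
  have ie: "i b \<bullet> e = 0" if "b \<in> ?B" for b
  proof -
    have "i b \<in> Basis" "i b \<noteq> e" using i e that by auto
    then show ?thesis using e by (simp add: inner_Basis)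
  qed
  have "L x \<bullet> e = 0" for x unfolding L_def inner_sum_left by (intro sum.neutral) (simp add: ie)
  moreover have "R e = 0" unfolding R_def by (intro sum.neutral) (simp add: ie inner_commute[of e])
  moreover have "R y \<in> W" for y unfolding R_def using sub by (intro subspace_sum[OF W] subspace_scale[OF W]) auto
  ultimately show ?thesis using iso linR RL e by (intro exI[of _ L] exI[of _ e] exI[of _ R]) (auto simp: line_embedding_def)
qed

lemma cis_scale: "cis t *s a = cos t *\<^sub>R a + sin t *\<^sub>R (\<i> *s (a :: complex^'n))"
  by (simp add: vec_eq_iff cis_conv_exp Euler scaleR_conv_of_real[where 'a=complex] algebra_simps flip: cis_conv_exp)
     (simp add: complex_eq_iff)

text \<open>Besides the given immersion this is also used for the identity of projective space itself, whose
  circle bundle is the sphere.\<close>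

locale hopf_base =
  fixes X :: "'x::topological_space set" and f :: "'x \<Rightarrow> complex^'n^'n" and m :: nat
  assumes cover: "\<exists>P. finite P \<and> P \<subseteq> regular_params (2 * m) X f \<and> (\<Union>(W, D, \<psi>)\<in>P. \<psi> ` D) = X"
    and f_CP: "\<And>p. p \<in> X \<Longrightarrow> f p \<in> CP"
    and complex_tangent: "\<And>p z h. p \<in> X \<Longrightarrow> norm z = 1 \<Longrightarrow> f p = hopf z \<Longrightarrow> hinner h z = 0 \<Longrightarrow>
      hopf_deriv z h \<in> tangent_space (2 * m) X f p \<Longrightarrow> hopf_deriv z (\<i> *s h) \<in> tangent_space (2 * m) X f p"
    and dim_less: "m < CARD('n)"
begin

lemma params_cover_base: "params_cover (2 * m) X f"
proof -
  obtain P where P: "P \<subseteq> regular_params (2 * m) X f" "(\<Union>(W, D, \<psi>)\<in>P. \<psi> ` D) = X" using cover by auto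
  then show ?thesis unfolding params_cover_def by fastforce
qed

lemma base_chart: "p \<in> X \<Longrightarrow> \<exists>W D \<psi> u. (W, D, \<psi>) \<in> regular_params (2 * m) X f \<and> u \<in> D \<and> \<psi> u = p"
  using params_cover_base by (auto simp: params_cover_def)

end

text \<open>The total space is given only up to a homeomorphism with the circle bundle. In this way
  the sphere itself, with the Hopf map as projection, is an instance and not merely homeomorphic to
  one.\<close>

locale hopf_bundle = hopf_base X f m
  for X :: "'x::topological_space set" and f :: "'x \<Rightarrow> complex^'n^'n" and m :: nat +
  fixes Xt :: "'y::topological_space set" and F :: "'y \<Rightarrow> complex^'n" and \<rho> :: "'y \<Rightarrow> 'x"
    and \<kappa> :: "'x \<times> (complex^'n) \<Rightarrow> 'y"
  assumes homeo: "homeomorphism Xt (circle_bundle X f) (\<lambda>y. (\<rho> y, F y)) \<kappa>"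
begin

lemma total_space:
  assumes "y \<in> Xt" shows "\<rho> y \<in> X" "norm (F y) = 1" "f (\<rho> y) = hopf (F y)" "\<kappa> (\<rho> y, F y) = y"
proof -
  have "(\<rho> y, F y) \<in> circle_bundle X f" using homeo assms by (auto simp: homeomorphism_def)
  then show "\<rho> y \<in> X" "norm (F y) = 1" "f (\<rho> y) = hopf (F y)" by (auto simp: circle_bundle_def)
  show "\<kappa> (\<rho> y, F y) = y" using homeo assms by (auto simp: homeomorphism_def)
qed

lemma total_point:
  assumes "p \<in> X" "norm z = 1" "f p = hopf z"
  shows "\<kappa> (p, z) \<in> Xt" "\<rho> (\<kappa> (p, z)) = p" "F (\<kappa> (p, z)) = z"
proof -
  have pz: "(p, z) \<in> circle_bundle X f" using assms by (auto simp: circle_bundle_def)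
  then show "\<kappa> (p, z) \<in> Xt" using homeo by (auto simp: homeomorphism_def)
  have "(\<rho> (\<kappa> (p, z)), F (\<kappa> (p, z))) = (p, z)" using homeo pz by (auto simp: homeomorphism_def)
  then show "\<rho> (\<kappa> (p, z)) = p" "F (\<kappa> (p, z)) = z" by auto
qed

lemma continuous_total: "continuous_on Xt \<rho>" "continuous_on Xt F"
proof -
  have c: "continuous_on Xt (\<lambda>y. (\<rho> y, F y))" using homeo by (simp add: homeomorphism_def)
  show "continuous_on Xt \<rho>" using continuous_on_fst[OF c] by simp
  show "continuous_on Xt F" using continuous_on_snd[OF c] by simp
qed

end

text \<open>A chart of the total space has the base coordinates and an angle as coordinates, with model space
  \<open>L W \<oplus> \<real> e\<close>; angle \<open>0\<close> is the section on which the Hermitian product with \<open>z0\<close> is positive.\<close>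

locale lift_chart = hopf_bundle X f m Xt F \<rho> \<kappa>
  for X :: "'x::topological_space set" and f :: "'x \<Rightarrow> complex^'n^'n" and m :: nat
    and Xt :: "'y::topological_space set" and F :: "'y \<Rightarrow> complex^'n" and \<rho> :: "'y \<Rightarrow> 'x"
    and \<kappa> :: "'x \<times> (complex^'n) \<Rightarrow> 'y" +
  fixes W D :: "(complex^'n^'n) set" and \<psi> :: "complex^'n^'n \<Rightarrow> 'x" and z0 :: "complex^'n"
    and L :: "complex^'n^'n \<Rightarrow> complex^'n" and e :: "complex^'n" and R :: "complex^'n \<Rightarrow> complex^'n^'n"
  assumes p: "(W, D, \<psi>) \<in> regular_params (2 * m) X f"
    and embedding: "line_embedding W L e R"
begin

lemma L: "isometric_on W L" and e: "norm e = 1" and Le: "\<And>x. x \<in> W \<Longrightarrow> L x \<bullet> e = 0"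
  and R: "linear R" and RL: "\<And>x. x \<in> W \<Longrightarrow> R (L x) = x" and Re: "R e = 0" and RW: "\<And>y. R y \<in> W"
  using embedding by (auto simp: line_embedding_def)

lemmas r = regular_paramsD[OF p]

definition "Wt = {y. \<exists>x\<in>W. \<exists>t. y = L x + t *\<^sub>R e}"
definition "Bt = insert e (L ` onb W)"
definition "D0 = D \<inter> (\<lambda>u. line_proj z0 (f (\<psi> u))) -` (- {0})"
definition "s u = hopf_section z0 (f (\<psi> u))"
definition "Dt = {y \<in> Wt. R y \<in> D0 \<and> - pi < y \<bullet> e \<and> y \<bullet> e < pi}"
definition "Ft y = cis (y \<bullet> e) *s s (R y)"
definition "\<Psi> y = \<kappa> (\<psi> (R y), Ft y)"

lemma linL: "linear L" using L by (simp add: isometric_on_def)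

lemma coord: "x \<in> W \<Longrightarrow> R (L x + t *\<^sub>R e) = x" "x \<in> W \<Longrightarrow> (L x + t *\<^sub>R e) \<bullet> e = t"
  using e by (simp_all add: linear_add[OF R] linear_scale[OF R] RL Re inner_add_left Le norm_eq_1)

lemma coord_Wt: "y \<in> Wt \<Longrightarrow> L (R y) + (y \<bullet> e) *\<^sub>R e = y"
  by (auto simp: Wt_def coord)

lemma Wt_I: "x \<in> W \<Longrightarrow> L x + t *\<^sub>R e \<in> Wt" by (auto simp: Wt_def)

lemma Bt_props: "orthonormal Bt" "e \<notin> L ` onb W" "span Bt = Wt"
proof -
  note B = onb[OF r(1)] and sub = onb_subset[OF r(1)]
  note i = isometric_on_orthonormal[OF L B(1) sub]
  have oe: "b \<bullet> e = 0" "e \<bullet> b = 0" if "b \<in> L ` onb W" for b using that sub Le by (auto simp: inner_commute)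
  show ne: "e \<notin> L ` onb W" using oe e by (auto simp: norm_eq_1)
  show "orthonormal Bt"
    using i(1) oe e unfolding Bt_def by (auto simp: orthonormal_def pairwise_insert orthogonal_def)
  show "span Bt = Wt"
  proof -
    have "span (L ` onb W) = L ` W" using linear_span_image[OF linL, of "onb W"] B(2) by simp
    then have "span Bt = {x. \<exists>k. x - k *\<^sub>R e \<in> L ` W}" by (simp add: Bt_def span_insert)
    also have "\<dots> = Wt"
      by (auto simp: Wt_def image_iff algebra_simps)
    finally show ?thesis .
  qed
qed

lemma subspace_Wt: "subspace Wt" "dim Wt = 2 * m + 1"
proof -
  show "subspace Wt" using Bt_props(3) subspace_span by metis
  have "card Bt = dim Wt" using orthonormal_card[OF Bt_props(1)] Bt_props(3) by simp
  moreover have "card Bt = Suc (card (L ` onb W))"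
    unfolding Bt_def using Bt_props(2) onb_finite[OF r(1)] by simp
  ultimately show "dim Wt = 2 * m + 1"
    using isometric_on_orthonormal(3)[OF L onb(1)[OF r(1)] onb_subset[OF r(1)]] card_onb[OF r(1)] r(2) by simp
qed

lemma D0: "rel_open W D0" "D0 \<subseteq> D"
proof -
  have "continuous_on D (\<lambda>u. line_proj z0 (f (\<psi> u)))"
  proof -
    have "continuous_on D (f \<circ> \<psi>)" by (rule smooth_continuous[OF r(6)])
    moreover have "continuous_on UNIV (line_proj z0)"
      by (rule linear_continuous_on) (simp add: linear_line_proj linear_conv_bounded_linear[symmetric])
    ultimately show ?thesis by (auto simp: comp_def intro: continuous_on_compose2)
  qed
  then show "rel_open W D0" unfolding D0_def
    by (rule rel_open_vimage[OF r(3), where S=UNIV]) (auto simp: open_Compl)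
qed (auto simp: D0_def)

lemma s_props:
  assumes u: "u \<in> D0"
  shows "norm (s u) = 1" "hopf (s u) = f (\<psi> u)" "\<exists>a>0. hinner (s u) z0 = of_real a" "\<psi> u \<in> X"
proof -
  show "\<psi> u \<in> X" using u r(10) by (auto simp: D0_def)
  then obtain z where z: "norm z = 1" "f (\<psi> u) = hopf z" using f_CP CP_iff by blast
  have n0: "hinner z z0 \<noteq> 0" using u line_proj_hopf_eq_0[OF z(1), of z0] z(2) by (auto simp: D0_def)
  show "norm (s u) = 1" "hopf (s u) = f (\<psi> u)" "\<exists>a>0. hinner (s u) z0 = of_real a"
    using hopf_section_props[OF z(1) n0] n0 by (auto simp: s_def z(2) intro!: exI[of _ "norm (hinner z z0)"])
qed

lemma smooth_s: "smooth_map_on W D0 s"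
proof -
  have "smooth_map_on W D0 (f \<circ> \<psi>)" by (rule smooth_restrict[OF r(3) D0 r(6)])
  from smooth_hopf_section[OF D0(1) this, of z0] show ?thesis by (simp add: s_def[abs_def] D0_def)
qed

lemma fd_s:
  assumes u: "u \<in> D0" and x: "x \<in> W"
  shows "fd D (f \<circ> \<psi>) u x = hopf_deriv (s u) (fd D0 s u x)" "fd D0 s u x \<bullet> s u = 0"
proof -
  have "fd D0 (f \<circ> \<psi>) u x = hopf_deriv (s u) (fd D0 s u x)"
    by (rule fd_hopf[OF D0(1) smooth_s u x]) (simp add: s_props)
  then show "fd D (f \<circ> \<psi>) u x = hopf_deriv (s u) (fd D0 s u x)" using fd_rel_open[OF r(3) D0 u, of "f \<circ> \<psi>"] by simp
  show "fd D0 s u x \<bullet> s u = 0" by (rule unit_field_derivative[OF D0(1) smooth_s _ u x]) (rule s_props)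
qed

section \<open>The lifted parametrization and its derivatives\<close>

lemma Dt: "rel_open Wt Dt"
proof -
  have c: "continuous_on Wt R" by (rule linear_continuous_on) (simp add: R linear_conv_bounded_linear[symmetric])
  have w: "rel_open Wt Wt" using subspace_Wt by (simp add: rel_open_def)
  have "rel_open Wt (Wt \<inter> R -` D0)"
    by (rule rel_open_vimage[OF w c, where S=W]) (use RW rel_openD[OF D0(1)] in auto)
  moreover have "open {y. - pi < y \<bullet> e \<and> y \<bullet> e < pi}"
    by (auto intro!: open_Collect_conj open_Collect_less continuous_intros)
  ultimately have "rel_open Wt (Wt \<inter> R -` D0 \<inter> {y. - pi < y \<bullet> e \<and> y \<bullet> e < pi})" by (rule rel_open_Int_open)
  also have "Wt \<inter> R -` D0 \<inter> {y. - pi < y \<bullet> e \<and> y \<bullet> e < pi} = Dt" by (auto simp: Dt_def)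
  finally show ?thesis .
qed

lemma DtD: "w \<in> Dt \<Longrightarrow> R w \<in> D0" "w \<in> Dt \<Longrightarrow> w \<in> Wt" "w \<in> Dt \<Longrightarrow> - pi < w \<bullet> e" "w \<in> Dt \<Longrightarrow> w \<bullet> e < pi"
  by (auto simp: Dt_def)

lemma Dt_I: "u \<in> D0 \<Longrightarrow> - pi < t \<Longrightarrow> t < pi \<Longrightarrow> L u + t *\<^sub>R e \<in> Dt"
  using rel_openD(3)[OF D0(1)] by (auto simp: Dt_def coord Wt_I)

lemma smooth_Ft: "smooth_map_on Wt Dt Ft"
proof -
  have lin: "linear (\<lambda>y. y \<bullet> e)" by (rule linearI) (simp_all add: inner_add_left)
  have sR: "Ck_on k Wt Dt (\<lambda>y. s (R y))" for k
    by (rule Ck_reparam[OF D0(1) Dt R]) (use RW DtD smooth_s in \<open>auto simp: smooth_map_on_def\<close>)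
  have "Ck_on k Wt Dt (\<lambda>y. \<i> *s s (R y))" for k
    by (rule Ck_bounded_linear[OF Dt _ sR]) (simp add: linear_scale_complex linear_conv_bounded_linear[symmetric])
  then show ?thesis
    unfolding smooth_map_on_def Ft_def[abs_def] cis_scale
    using Ck_cos_sin[OF Dt Ck_linear[OF Dt lin]] sR by (intro allI Ck_add[OF Dt] Ck_scaleR[OF Dt]) auto
qed

lemma Ft_props:
  assumes w: "w \<in> Dt"
  shows "norm (Ft w) = 1" "f (\<psi> (R w)) = hopf (Ft w)" "\<psi> (R w) \<in> X"
    "\<Psi> w \<in> Xt" "\<rho> (\<Psi> w) = \<psi> (R w)" "F (\<Psi> w) = Ft w"
proof -
  note sp = s_props[OF DtD(1)[OF w]]
  show n: "norm (Ft w) = 1" by (simp add: Ft_def norm_scale_complex sp)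
  show h: "f (\<psi> (R w)) = hopf (Ft w)" unfolding Ft_def by (subst hopf_unit) (simp_all add: sp)
  show x: "\<psi> (R w) \<in> X" by (rule sp)
  show "\<Psi> w \<in> Xt" "\<rho> (\<Psi> w) = \<psi> (R w)" "F (\<Psi> w) = Ft w"
    unfolding \<Psi>_def using total_point[OF x n h] by auto
qed

text \<open>The function \<open>g\<close> is arbitrary because the rule is used twice: for the
  section, giving first derivatives of the lift, and for a derivative of the section, giving second
  ones.\<close>

lemma cis_rotation_derivative:
  assumes w: "w \<in> Dt" and g: "(g has_derivative g') (at (R w) within D0)"
  shows "((\<lambda>w. cis (w \<bullet> e) *s g (R w)) has_derivative
    (\<lambda>y. cis (w \<bullet> e) *s g' (R y) + (y \<bullet> e) *\<^sub>R (\<i> *s (cis (w \<bullet> e) *s (g (R w) :: complex^'n))))) (at w within Dt)"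
proof -
  have dR: "(R has_derivative R) (at w within Dt)"
    using R by (intro bounded_linear_imp_has_derivative) (simp add: linear_conv_bounded_linear)
  have "(g has_derivative g') (at (R w) within R ` Dt)"
    by (rule has_derivative_subset[OF g]) (use DtD in auto)
  from has_derivative_in_compose[OF dR this]
  have dg: "((\<lambda>w. g (R w)) has_derivative (\<lambda>y. g' (R y))) (at w within Dt)" .
  have di: "((\<lambda>w. \<i> *s g (R w)) has_derivative (\<lambda>y. \<i> *s g' (R y))) (at w within Dt)"
    by (rule bounded_linear.has_derivative[OF _ dg]) (simp add: linear_scale_complex linear_conv_bounded_linear[symmetric])
  have dc: "((\<lambda>w. cos (w \<bullet> e)) has_derivative (\<lambda>y. - sin (w \<bullet> e) * (y \<bullet> e))) (at w within Dt)"
    and dsn: "((\<lambda>w. sin (w \<bullet> e)) has_derivative (\<lambda>y. cos (w \<bullet> e) * (y \<bullet> e))) (at w within Dt)"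
    by (auto intro!: derivative_eq_intros)
  have "((\<lambda>w. cis (w \<bullet> e) *s g (R w)) has_derivative
    (\<lambda>y. (cos (w \<bullet> e) *\<^sub>R g' (R y) + (- sin (w \<bullet> e) * (y \<bullet> e)) *\<^sub>R g (R w)) +
     (sin (w \<bullet> e) *\<^sub>R (\<i> *s g' (R y)) + (cos (w \<bullet> e) * (y \<bullet> e)) *\<^sub>R (\<i> *s g (R w))))) (at w within Dt)"
    unfolding cis_scale by (intro has_derivative_add has_derivative_scaleR dg di dc dsn)
  then show ?thesis
    by (rule has_derivative_eq_rhs)
       (auto simp: fun_eq_iff cis_scale vec_eq_iff scaleR_conv_of_real[where 'a=complex] algebra_simps)
qed

lemma fd_Ft:
  assumes w: "w \<in> Dt" and x: "x \<in> W"
  shows "fd Dt (F \<circ> \<Psi>) w (L x + \<tau> *\<^sub>R e) = cis (w \<bullet> e) *s fd D0 s (R w) x + \<tau> *\<^sub>R (\<i> *s Ft w)"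
proof -
  have "((F \<circ> \<Psi>) has_derivative (\<lambda>y. cis (w \<bullet> e) *s fd D0 s (R w) (R y) + (y \<bullet> e) *\<^sub>R (\<i> *s Ft w))) (at w within Dt)"
    unfolding Ft_def using cis_rotation_derivative[OF w smooth_has_derivative[OF smooth_s DtD(1)[OF w]]]
    by (rule has_derivative_transform[OF w, rotated]) (simp add: Ft_props Ft_def)
  from fd_eq[OF Dt w Wt_I[OF x] this, of \<tau>] show ?thesis by (simp add: coord[OF x])
qed

lemma hopf_deriv_fd_Ft:
  assumes w: "w \<in> Dt" and x: "x \<in> W"
  shows "hopf_deriv (Ft w) (fd Dt (F \<circ> \<Psi>) w (L x + \<tau> *\<^sub>R e)) = fd D (f \<circ> \<psi>) (R w) x"
    "fd Dt (F \<circ> \<Psi>) w (L x + \<tau> *\<^sub>R e) \<bullet> Ft w = 0"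
proof -
  note sd = fd_s[OF DtD(1)[OF w] x]
  have "hopf_deriv (Ft w) (cis (w \<bullet> e) *s fd D0 s (R w) x) = fd D (f \<circ> \<psi>) (R w) x"
    unfolding Ft_def sd(1) by (rule hopf_deriv_unit) simp
  then show "hopf_deriv (Ft w) (fd Dt (F \<circ> \<Psi>) w (L x + \<tau> *\<^sub>R e)) = fd D (f \<circ> \<psi>) (R w) x"
    by (simp add: fd_Ft[OF w x] hopf_deriv_add_right hopf_deriv_scaleR_right hopf_vertical)
  have "(cis (w \<bullet> e) *s fd D0 s (R w) x) \<bullet> Ft w = 0"
    unfolding Ft_def by (subst inner_scale_unit) (simp_all add: sd(2))
  moreover have "(\<i> *s Ft w) \<bullet> Ft w = 0"
    by (simp add: Re_hinner[symmetric] hinner_scale_left hinner_self)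
  ultimately show "fd Dt (F \<circ> \<Psi>) w (L x + \<tau> *\<^sub>R e) \<bullet> Ft w = 0"
    by (simp add: fd_Ft[OF w x] inner_add_left)
qed

lemma angle:
  assumes "a > 0" "- pi < t" "t < pi"
  shows "Arg (cis t * of_real a) = t" "cis t * of_real a \<notin> \<real>\<^sub>\<le>\<^sub>0"
proof -
  show A: "Arg (cis t * of_real a) = t"
    using assms by (simp add: Arg_cis)
  show "cis t * of_real a \<notin> \<real>\<^sub>\<le>\<^sub>0"
  proof
    assume "cis t * of_real a \<in> \<real>\<^sub>\<le>\<^sub>0"
    then have "Im (cis t * of_real a) = 0" "Re (cis t * of_real a) \<le> 0" by (auto simp: complex_nonpos_Reals_iff)
    moreover have "cis t * of_real a \<noteq> 0" using assms by simp
    ultimately have "Re (cis t * of_real a) < 0" by (metis complex_eqI less_le zero_complex.simps)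
    then have "Arg (cis t * of_real a) = pi" using \<open>Im _ = 0\<close> by (simp add: Arg_eq_pi)
    then show False using A assms by simp
  qed
qed

lemma hinner_Ft:
  assumes w: "w \<in> Dt"
  shows "hinner (Ft w) z0 \<notin> \<real>\<^sub>\<le>\<^sub>0" "Arg (hinner (Ft w) z0) = w \<bullet> e"
proof -
  obtain a where a: "a > 0" "hinner (s (R w)) z0 = of_real a" using s_props(3)[OF DtD(1)[OF w]] by auto
  have "hinner (Ft w) z0 = cis (w \<bullet> e) * of_real a" by (simp add: Ft_def hinner_scale_left a)
  then show "hinner (Ft w) z0 \<notin> \<real>\<^sub>\<le>\<^sub>0" "Arg (hinner (Ft w) z0) = w \<bullet> e"
    using angle[OF a(1) DtD(3,4)[OF w]] by auto
qed

lemma Psi_surj: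
  assumes y: "y \<in> Xt" and u: "u \<in> D" "\<rho> y = \<psi> u" and n: "hinner (F y) z0 \<notin> \<real>\<^sub>\<le>\<^sub>0"
  shows "L u + Arg (hinner (F y) z0) *\<^sub>R e \<in> Dt" "\<Psi> (L u + Arg (hinner (F y) z0) *\<^sub>R e) = y"
proof -
  note ty = total_space[OF y]
  let ?t = "Arg (hinner (F y) z0)"
  have n0: "hinner (F y) z0 \<noteq> 0" using n by auto
  have uD0: "u \<in> D0" using u line_proj_hopf_eq_0[OF ty(2), of z0] n0 ty(3) by (auto simp: D0_def)
  have uW: "u \<in> W" using u rel_openD(3)[OF r(3)] by auto
  have "?t \<noteq> pi" using n by (auto simp: Arg_eq_pi complex_nonpos_Reals_iff)
  then have t: "- pi < ?t" "?t < pi" using Arg_bounded[of "hinner (F y) z0"] by auto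
  show "L u + ?t *\<^sub>R e \<in> Dt" by (rule Dt_I[OF uD0 t])
  have "F y = cis ?t *s s u"
    using hopf_section_props(4)[OF ty(2) n0] ty(3) u(2) by (simp add: s_def cis_Arg[OF n0])
  then have "Ft (L u + ?t *\<^sub>R e) = F y" by (simp add: Ft_def coord[OF uW])
  then show "\<Psi> (L u + ?t *\<^sub>R e) = y" using ty(4) u(2) by (simp add: \<Psi>_def coord[OF uW])
qed

lemma Psi_image: "\<Psi> ` Dt = {y \<in> Xt. \<rho> y \<in> \<psi> ` D \<and> hinner (F y) z0 \<notin> \<real>\<^sub>\<le>\<^sub>0}"
proof (intro equalityI subsetI)
  fix y assume "y \<in> \<Psi> ` Dt"
  then obtain w where w: "w \<in> Dt" "y = \<Psi> w" by auto
  then show "y \<in> {y \<in> Xt. \<rho> y \<in> \<psi> ` D \<and> hinner (F y) z0 \<notin> \<real>\<^sub>\<le>\<^sub>0}"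
    using Ft_props[OF w(1)] hinner_Ft(1)[OF w(1)] DtD(1)[OF w(1)] D0(2) by auto
next
  fix y assume y: "y \<in> {y \<in> Xt. \<rho> y \<in> \<psi> ` D \<and> hinner (F y) z0 \<notin> \<real>\<^sub>\<le>\<^sub>0}"
  then obtain u where "u \<in> D" "\<rho> y = \<psi> u" by auto
  then show "y \<in> \<Psi> ` Dt" using Psi_surj[of y u] y by (metis (lifting) image_eqI mem_Collect_eq)
qed

lemma continuous_hinner: "continuous_on UNIV (\<lambda>a. hinner a b)"
  unfolding hinner_def by (intro continuous_intros)

lemma lift_local_param: "local_param Xt Wt Dt \<Psi>"
proof -
  obtain g where g: "homeomorphism D (\<psi> ` D) \<psi> g" using r(5) by auto
  \<comment> \<open>Inverse chart: the base part inverts \<open>\<psi>\<close>, and the angle is the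
    principal argument, which is continuous away from the nonpositive real axis.\<close>
  define gt where "gt y = L (g (\<rho> y)) + Arg (hinner (F y) z0) *\<^sub>R e" for y
  let ?U = "{y \<in> Xt. \<rho> y \<in> \<psi> ` D \<and> hinner (F y) z0 \<notin> \<real>\<^sub>\<le>\<^sub>0}"
  note ct = continuous_total
  have ch: "continuous_on Xt (\<lambda>y. hinner (F y) z0)"
    by (rule continuous_on_compose2[OF continuous_hinner ct(2)]) auto
  have "openin (top_of_set Xt) (Xt \<inter> \<rho> -` (\<psi> ` D))"
    by (rule continuous_openin_preimage[OF ct(1) _ r(4)]) (use total_space(1) in auto)
  moreover have "openin (top_of_set Xt) (Xt \<inter> (\<lambda>y. hinner (F y) z0) -` (- \<real>\<^sub>\<le>\<^sub>0))"
    by (rule continuous_openin_preimage_gen[OF ch]) (simp add: open_Compl closed_nonpos_Reals_complex)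
  ultimately have "openin (top_of_set Xt) ((Xt \<inter> \<rho> -` (\<psi> ` D)) \<inter> (Xt \<inter> (\<lambda>y. hinner (F y) z0) -` (- \<real>\<^sub>\<le>\<^sub>0)))"
    by (rule openin_Int)
  also have "(Xt \<inter> \<rho> -` (\<psi> ` D)) \<inter> (Xt \<inter> (\<lambda>y. hinner (F y) z0) -` (- \<real>\<^sub>\<le>\<^sub>0)) = \<Psi> ` Dt"
    unfolding Psi_image by auto
  finally have o: "openin (top_of_set Xt) (\<Psi> ` Dt)" .
  have UX: "\<Psi> ` Dt \<subseteq> Xt" unfolding Psi_image by auto
  have "homeomorphism Dt (\<Psi> ` Dt) \<Psi> gt"
  proof (rule homeomorphismI)
    have cR: "continuous_on Dt (\<lambda>w. \<psi> (R w))"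
    proof (rule continuous_on_compose2[OF r(8)])
      show "continuous_on Dt R" by (rule linear_continuous_on) (simp add: R linear_conv_bounded_linear[symmetric])
    qed (use DtD(1) D0(2) in auto)
    have ck: "continuous_on (circle_bundle X f) \<kappa>" using homeo by (simp add: homeomorphism_def)
    show "continuous_on Dt \<Psi>"
      unfolding \<Psi>_def[abs_def]
      by (rule continuous_on_compose2[OF ck continuous_on_Pair[OF cR smooth_continuous[OF smooth_Ft]]])
         (use Ft_props(1-3) in \<open>auto simp: circle_bundle_def\<close>)
    have "continuous_on (\<Psi> ` Dt) (\<lambda>y. L (g (\<rho> y)))"
    proof (rule continuous_on_compose2[of UNIV L])
      show "continuous_on UNIV L" by (rule linear_continuous_on) (simp add: linL linear_conv_bounded_linear[symmetric])
      have cg: "continuous_on (\<psi> ` D) g" using g by (simp add: homeomorphism_def)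
      show "continuous_on (\<Psi> ` Dt) (\<lambda>y. g (\<rho> y))"
        by (rule continuous_on_compose2[OF cg continuous_on_subset[OF ct(1) UX]]) (auto simp: Psi_image)
    qed auto
    moreover have "continuous_on (\<Psi> ` Dt) (\<lambda>y. Arg (hinner (F y) z0))"
    proof (rule continuous_on_compose2[of "- \<real>\<^sub>\<le>\<^sub>0" Arg])
      show "continuous_on (- \<real>\<^sub>\<le>\<^sub>0) Arg"
        by (auto intro!: continuous_at_imp_continuous_on continuous_at_Arg)
      show "continuous_on (\<Psi> ` Dt) (\<lambda>y. hinner (F y) z0)" by (rule continuous_on_subset[OF ch UX])
    qed (auto simp: Psi_image)
    ultimately show "continuous_on (\<Psi> ` Dt) gt" unfolding gt_def[abs_def]
      by (intro continuous_on_add continuous_on_scaleR continuous_on_const)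
    have inv: "gt (\<Psi> w) = w" if w: "w \<in> Dt" for w
    proof -
      have "g (\<psi> (R w)) = R w" using g DtD(1)[OF w] D0(2) by (auto simp: homeomorphism_def)
      then show ?thesis
        using Ft_props(5,6)[OF w] hinner_Ft(2)[OF w] coord_Wt[OF DtD(2)[OF w]] by (simp add: gt_def)
    qed
    then show "gt (\<Psi> w) = w" if "w \<in> Dt" for w using that .
    show "\<Psi> (gt y) = y" if "y \<in> \<Psi> ` Dt" for y using that inv by auto
    show "gt ` \<Psi> ` Dt \<subseteq> Dt" using inv by auto
  qed auto
  then show ?thesis unfolding local_param_def using o rel_openD(2)[OF Dt] by auto
qed

lemma fd_base_inj: "u \<in> D0 \<Longrightarrow> x \<in> W \<Longrightarrow> fd D (f \<circ> \<psi>) u x = 0 \<Longrightarrow> x = 0"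
  using r(7) D0(2) by auto

text \<open>If the differential of the lift kills \<open>L x + t *\<^sub>R e\<close>, applying
  \<open>hopf_deriv\<close> forces \<open>x = 0\<close> because the base map is an immersion. What
  remains is \<open>t\<close> times a unit vertical vector, so \<open>t = 0\<close>.\<close>

lemma lift_regular: "(Wt, Dt, \<Psi>) \<in> regular_params (2 * m + 1) Xt F"
proof -
  have "smooth_map_on Wt Dt (F \<circ> \<Psi>)"
    by (rule smooth_cong[OF Dt _ smooth_Ft]) (simp add: Ft_props)
  moreover have "y = 0" if w: "w \<in> Dt" and y: "y \<in> Wt" and 0: "fd Dt (F \<circ> \<Psi>) w y = 0" for w y
  proof -
    obtain x t where yx: "x \<in> W" "y = L x + t *\<^sub>R e" using y by (auto simp: Wt_def)
    have "fd D (f \<circ> \<psi>) (R w) x = hopf_deriv (Ft w) 0" using hopf_deriv_fd_Ft(1)[OF w yx(1), of t] 0 yx(2) by simp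
    also have "\<dots> = 0" by (rule linear_0[OF linear_hopf_deriv])
    finally have x0: "x = 0" by (rule fd_base_inj[OF DtD(1)[OF w] yx(1)])
    have "fd D0 s (R w) 0 = 0" by (rule linear_0[OF linear_fd[OF smooth_s DtD(1)[OF w]]])
    then have "t *\<^sub>R (\<i> *s Ft w) = 0" using fd_Ft[OF w yx(1), of t] 0 yx(2) x0 by simp
    then have "norm (t *\<^sub>R (\<i> *s Ft w)) = 0" by simp
    then have "t = 0" by (simp add: norm_scale_complex Ft_props(1)[OF w])
    then show ?thesis using yx(2) x0 by (simp add: linear_0[OF linL])
  qed
  ultimately show ?thesis
    using lift_local_param subspace_Wt by (auto simp: regular_params_def)
qed

text \<open>The derivative of the lift along a base direction is a horizontal vector plus a vertical
  one. A shear \<open>A\<close> with determinant one absorbs the vertical part. Then the fibre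
  direction maps to a unit vector orthogonal to the horizontal images, and those have the same Gram
  matrix as the base chart.\<close>

lemma lift_volume_density:
  assumes w: "w \<in> Dt" shows "volume_density Wt Dt (F \<circ> \<Psi>) w = volume_density W D (f \<circ> \<psi>) (R w)"
proof -
  note u = DtD(1)[OF w] and B = onb[OF r(1)] and sub = onb_subset[OF r(1)]
  note iB = isometric_on_orthonormal[OF L B(1) sub]
  let ?z = "Ft w"
  have z: "norm ?z = 1" by (rule Ft_props(1)[OF w])
  let ?g = "fd Dt (F \<circ> \<Psi>) w"
  note ling = linear_fd_param[OF lift_regular w]
  have finB: "finite (onb W)" and finBt: "finite Bt" using onb_finite[OF r(1)] by (auto simp: Bt_def)
  \<comment> \<open>Replaces the chosen basis of \<open>Wt\<close> by the adapted basis
    \<open>Bt\<close>. That the transition determinant squares to one follows from the same identity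
    applied to \<open>id\<close>.\<close>
  have gram_cong: "set_det B1 (\<lambda>b c. G b \<bullet> G c) = set_det B2 (\<lambda>b c. G b \<bullet> G c)"
    if B12: "orthonormal B1" "orthonormal B2" "span B1 = span B2" and G: "linear G"
    for B1 B2 and G :: "complex^'n \<Rightarrow> complex^'n"
  proof -
    have "card B1 = card B2" using orthonormal_card[OF B12(1)] orthonormal_card[OF B12(2)] B12(3) by simp
    then obtain h where h: "bij_betw h B1 B2"
      using finite_same_card_bij[OF orthonormal_finite[OF B12(1)] orthonormal_finite[OF B12(2)]] by auto
    have sp: "b \<in> span B2" if "b \<in> B1" for b using that B12(3) span_base by metis
    have g: "set_det B1 (\<lambda>b c. G (id b) \<bullet> G (id c)) = (set_det B1 (\<lambda>b c. h b \<bullet> id c))\<^sup>2 * set_det B2 (\<lambda>b c. G b \<bullet> G c)"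
      if "linear G" for G :: "complex^'n \<Rightarrow> complex^'n"
      by (rule set_det_gram_mult[OF B12(1,2) h _ that]) (simp add: sp)
    from g[OF linear_id] have "(set_det B1 (\<lambda>b c. h b \<bullet> c))\<^sup>2 = 1"
      by (simp add: set_det_orthonormal[OF B12(1)] set_det_orthonormal[OF B12(2)])
    then show ?thesis using g[OF G] by simp
  qed
  \<comment> \<open>\<open>G0\<close> is the derivative with its vertical component on
    \<open>L W\<close> removed; \<open>A\<close> moves that component into the coordinate
    \<open>e\<close>, so that \<open>G0 \<circ> A\<close> is the original derivative on the model
    space.\<close>
  define G0 where "G0 y = horiz ?z (?g (L (R y))) + (y \<bullet> e) *\<^sub>R (\<i> *s ?z)" for y
  define A where "A y = y + ((?g (L (R y))) \<bullet> (\<i> *s ?z)) *\<^sub>R e" for y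
  have linG0: "linear G0"
    unfolding G0_def
    by (rule linearI)
       (simp_all add: linear_add[OF R] linear_add[OF linL] linear_add[OF ling] linear_add[OF linear_horiz]
         linear_scale[OF R] linear_scale[OF linL] linear_scale[OF ling] linear_scale[OF linear_horiz]
         inner_add_left scaleR_add_left scaleR_add_right)
  have gL: "?g (L x) \<bullet> ?z = 0" "hopf_deriv ?z (?g (L x)) = fd D (f \<circ> \<psi>) (R w) x" if "x \<in> W" for x
    using hopf_deriv_fd_Ft[OF w that, of 0] by auto
  have ge: "?g e = \<i> *s ?z"
    using fd_Ft[OF w subspace_0[OF r(1)], of 1] linear_0[OF linear_fd[OF smooth_s u]] by (simp add: linear_0[OF linL])
  have A_L: "A (L x) = L x + (?g (L x) \<bullet> (\<i> *s ?z)) *\<^sub>R e" "G0 (A (L x)) = ?g (L x)" if x: "x \<in> W" for x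
  proof -
    show a: "A (L x) = L x + (?g (L x) \<bullet> (\<i> *s ?z)) *\<^sub>R e" by (simp add: A_def RL[OF x])
    show "G0 (A (L x)) = ?g (L x)"
      unfolding a G0_def coord[OF x] by (rule horiz_decomp[OF gL(1)[OF x], symmetric])
  qed
  have A_e: "A e = e" "G0 (A e) = ?g e"
  proof -
    show a: "A e = e" using ling by (simp add: A_def Re linear_0[OF linL] linear_0)
    show "G0 (A e) = ?g e"
      unfolding a using e by (simp add: G0_def Re ge linear_0[OF linL] linear_0[OF ling] linear_0[OF linear_horiz] norm_eq_1)
  qed
  have "set_det (onb Wt) (\<lambda>b c. ?g b \<bullet> ?g c) = set_det Bt (\<lambda>b c. ?g b \<bullet> ?g c)"
    by (rule gram_cong) (use onb[OF subspace_Wt(1)] Bt_props ling in auto)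
  also have "\<dots> = set_det Bt (\<lambda>b c. G0 (A b) \<bullet> G0 (A c))"
  proof (rule set_det_cong)
    have "G0 (A b) = ?g b" if "b \<in> Bt" for b
      using that A_L(2)[OF subsetD[OF sub]] A_e(2) unfolding Bt_def by blast
    then show "?g b \<bullet> ?g c = G0 (A b) \<bullet> G0 (A c)" if "b \<in> Bt" "c \<in> Bt" for b c
      using that by simp
  qed
  also have "\<dots> = (set_det Bt (\<lambda>b c. id b \<bullet> A c))\<^sup>2 * set_det Bt (\<lambda>b c. G0 b \<bullet> G0 c)"
  proof (rule set_det_gram_mult[OF Bt_props(1) Bt_props(1) bij_betw_id _ linG0])
    fix b assume "b \<in> Bt"
    then show "A b \<in> span Bt" unfolding A_def by (intro span_add span_scale span_base) (auto simp: Bt_def)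
  qed
  also have "set_det Bt (\<lambda>b c. id b \<bullet> A c) = 1"
  proof -
    have off: "b \<bullet> A c = (if b = c then 1 else 0)" if "b \<in> L ` onb W" "c \<in> Bt" for b c
    proof -
      have "b \<bullet> e = 0" using that sub Le by auto
      then have "b \<bullet> A c = b \<bullet> c" by (simp add: A_def inner_add_right)
      then show ?thesis using orthonormal_inner[OF Bt_props(1)] that by (simp add: Bt_def)
    qed
    have d: "Bt - {e} = L ` onb W" using Bt_props(2) by (auto simp: Bt_def)
    have "set_det Bt (\<lambda>b c. id b \<bullet> A c) = (\<Prod>b\<in>Bt - {e}. id b \<bullet> A b) * set_det {e} (\<lambda>b c. id b \<bullet> A c)"
      by (rule set_det_block[OF finBt]) (use off in \<open>auto simp: d Bt_def\<close>)
    also have "(\<Prod>b\<in>Bt - {e}. id b \<bullet> A b) = 1" by (rule prod.neutral) (use off in \<open>auto simp: d Bt_def\<close>)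
    also have "set_det {e} (\<lambda>b c. id b \<bullet> A c) = e \<bullet> A e"
      using set_det_block[of "{e}" "{}" "\<lambda>b c. id b \<bullet> A c"] by simp
    also have "\<dots> = 1" using e by (simp add: A_e norm_eq_1)
    finally show ?thesis by simp
  qed
  also have "set_det Bt (\<lambda>b c. G0 b \<bullet> G0 c) = set_det (L ` onb W) (\<lambda>b c. G0 b \<bullet> G0 c)"
  proof -
    have G0e: "G0 e = \<i> *s ?z" using A_e ge by simp
    have G0L: "G0 (L x) = horiz ?z (?g (L x))" if "x \<in> W" for x by (simp add: G0_def RL that Le)
    have iz: "(\<i> *s ?z) \<bullet> (\<i> *s ?z) = 1" using z by (subst inner_scale_unit) (auto simp: norm_eq_1)
    have row: "G0 e \<bullet> G0 c = 0" if c: "c \<in> L ` onb W" for c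
    proof -
      obtain x where x: "x \<in> W" "c = L x" using c sub by auto
      have "horiz ?z (?g (L x)) \<bullet> (\<i> *s ?z) = 0" using hinner_horiz[OF z] hinner_eq_0_iff by blast
      then show ?thesis by (simp add: G0e G0L x inner_commute)
    qed
    have "set_det Bt (\<lambda>b c. G0 b \<bullet> G0 c) = (\<Prod>b\<in>Bt - L ` onb W. G0 b \<bullet> G0 b) * set_det (L ` onb W) (\<lambda>b c. G0 b \<bullet> G0 c)"
      by (rule set_det_block[OF finBt]) (use row in \<open>auto simp: Bt_def\<close>)
    moreover have "(\<Prod>b\<in>Bt - L ` onb W. G0 b \<bullet> G0 b) = 1"
      by (rule prod.neutral) (auto simp: Bt_def G0e iz)
    ultimately show ?thesis by simp
  qed
  also have "\<dots> = set_det (onb W) (\<lambda>b c. G0 (L b) \<bullet> G0 (L c))"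
    by (rule set_det_reindex[OF finB]) (simp add: bij_betw_def iB(2))
  also have "\<dots> = set_det (onb W) (\<lambda>b c. fd D (f \<circ> \<psi>) (R w) b \<bullet> fd D (f \<circ> \<psi>) (R w) c)"
  proof (rule set_det_cong)
    fix b c assume "b \<in> onb W" "c \<in> onb W"
    then have bc: "b \<in> W" "c \<in> W" using sub by auto
    have h: "hopf_deriv ?z (horiz ?z (?g (L x))) = fd D (f \<circ> \<psi>) (R w) x" if "x \<in> W" for x
      using hopf_deriv_horiz[OF gL(1)[OF that]] gL(2)[OF that] by simp
    have "G0 (L b) \<bullet> G0 (L c) = horiz ?z (?g (L b)) \<bullet> horiz ?z (?g (L c))"
      by (simp add: G0_def RL bc Le)
    also have "\<dots> = fd D (f \<circ> \<psi>) (R w) b \<bullet> fd D (f \<circ> \<psi>) (R w) c"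
      by (simp only: hopf_deriv_inner_horizontal[OF z hinner_horiz[OF z], symmetric] h[OF bc(1)] h[OF bc(2)])
    finally show "G0 (L b) \<bullet> G0 (L c) = fd D (f \<circ> \<psi>) (R w) b \<bullet> fd D (f \<circ> \<psi>) (R w) c" .
  qed
  finally show ?thesis by (simp add: volume_density_def comp_def)
qed

end

context hopf_bundle
begin

lemma lift_chart_exists:
  assumes p: "(W, D, \<psi>) \<in> regular_params (2 * m) X f"
  shows "\<exists>L e R. lift_chart X f m Xt F \<rho> \<kappa> W D \<psi> L e R"
proof -
  note r = regular_paramsD[OF p]
  have "dim W < DIM(complex^'n)" using r(2) dim_less by (simp add: DIM_complex)
  then obtain L :: "complex^'n^'n \<Rightarrow> complex^'n" and e R where "line_embedding W L e R"
    using line_embedding_exists[OF r(1), where 'b="complex^'n"] by auto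
  then have "lift_chart X f m Xt F \<rho> \<kappa> W D \<psi> L e R" using p by unfold_locales
  then show ?thesis by blast
qed

end

section \<open>Tangent spaces and volume of a circle bundle\<close>

context lift_chart
begin

lemma nn_integral_Wt:
  assumes k[measurable]: "k \<in> borel_measurable borel"
  shows "(\<integral>\<^sup>+w. k w \<partial>subspace_lborel Wt) = (\<integral>\<^sup>+u. \<integral>\<^sup>+t. k (L u + t *\<^sub>R e) \<partial>lborel \<partial>subspace_lborel W)"
proof -
  note B = onb[OF r(1)] and sub = onb_subset[OF r(1)]
  note iB = isometric_on_orthonormal[OF L B(1) sub]
  have [measurable]: "L \<in> borel \<rightarrow>\<^sub>M borel" by (rule linear_measurable[OF linL])
  have oe: "orthonormal {e}" using e by (simp add: orthonormal_def)
  have Bt: "Bt = L ` onb W \<union> {e}" by (simp add: Bt_def)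
  interpret l: sigma_finite_measure "coord_lborel {e}" by (rule sigma_finite_coord_lborel[OF oe])
  have "subspace_lborel Wt = coord_lborel (L ` onb W \<union> {e})"
    using coord_lborel_onb[OF Bt_props(1)] Bt_props(3) Bt by simp
  also have "\<dots> = distr (coord_lborel (L ` onb W) \<Otimes>\<^sub>M coord_lborel {e}) borel (\<lambda>(x, y). x + y)"
    by (rule coord_lborel_Un) (use Bt_props(1,2) Bt in auto)
  finally have d: "subspace_lborel Wt = distr (coord_lborel (L ` onb W) \<Otimes>\<^sub>M coord_lborel {e}) borel (\<lambda>(x, y). x + y)" .
  have "(\<integral>\<^sup>+w. k w \<partial>subspace_lborel Wt) = (\<integral>\<^sup>+z. k (fst z + snd z) \<partial>(coord_lborel (L ` onb W) \<Otimes>\<^sub>M coord_lborel {e}))"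
    unfolding d by (subst nn_integral_distr) (auto simp: case_prod_beta')
  also have "\<dots> = (\<integral>\<^sup>+x. \<integral>\<^sup>+y. k (x + y) \<partial>coord_lborel {e} \<partial>coord_lborel (L ` onb W))"
    by (subst l.nn_integral_fst[symmetric]) auto
  also have "\<dots> = (\<integral>\<^sup>+x. \<integral>\<^sup>+t. k (x + t *\<^sub>R e) \<partial>lborel \<partial>coord_lborel (L ` onb W))"
    unfolding coord_lborel_singleton by (subst nn_integral_distr) auto
  also have "coord_lborel (L ` onb W) = distr (coord_lborel (onb W)) borel L"
    by (rule distr_coord_lborel[OF B(1) linL iB(2), symmetric])
  also have "(\<integral>\<^sup>+x. \<integral>\<^sup>+t. k (x + t *\<^sub>R e) \<partial>lborel \<partial>distr (coord_lborel (onb W)) borel L) =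
     (\<integral>\<^sup>+u. \<integral>\<^sup>+t. k (L u + t *\<^sub>R e) \<partial>lborel \<partial>subspace_lborel W)"
  proof -
    have "(\<lambda>x. \<integral>\<^sup>+t. k (x + t *\<^sub>R e) \<partial>lborel) \<in> borel_measurable borel" by measurable
    then show ?thesis by (simp add: nn_integral_distr subspace_lborel_eq)
  qed
  finally show ?thesis .
qed

lemma tangent_space_lift:
  assumes w: "w \<in> Dt"
  shows "tangent_space (2 * m + 1) Xt F (\<Psi> w) =
    {h. h \<bullet> Ft w = 0 \<and> hopf_deriv (Ft w) h \<in> tangent_space (2 * m) X f (\<psi> (R w))}"
proof -
  have uD: "R w \<in> D" using DtD(1)[OF w] D0(2) by auto
  note z = Ft_props(1)[OF w]
  have T: "tangent_space (2 * m) X f (\<psi> (R w)) = fd D (f \<circ> \<psi>) (R w) ` W" by (rule tangent_space_eq[OF p uD])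
  show ?thesis unfolding tangent_space_eq[OF lift_regular w]
  proof (intro equalityI subsetI)
    fix h assume "h \<in> fd Dt (F \<circ> \<Psi>) w ` Wt"
    then obtain x t where x: "x \<in> W" "h = fd Dt (F \<circ> \<Psi>) w (L x + t *\<^sub>R e)" by (auto simp: Wt_def)
    then show "h \<in> {h. h \<bullet> Ft w = 0 \<and> hopf_deriv (Ft w) h \<in> tangent_space (2 * m) X f (\<psi> (R w))}"
      using hopf_deriv_fd_Ft[OF w x(1), of t] T by auto
  next
    fix h assume "h \<in> {h. h \<bullet> Ft w = 0 \<and> hopf_deriv (Ft w) h \<in> tangent_space (2 * m) X f (\<psi> (R w))}"
    then obtain x where h: "h \<bullet> Ft w = 0" and x: "x \<in> W" "hopf_deriv (Ft w) h = fd D (f \<circ> \<psi>) (R w) x" using T by auto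
    \<comment> \<open>Any lift of the same base direction will do: two vectors tangent to the sphere
      with equal images under \<open>hopf_deriv\<close> differ by a vertical vector, which is
      adjusted through the angle coordinate.\<close>
    define h' where "h' = fd Dt (F \<circ> \<Psi>) w (L x + 0 *\<^sub>R e)"
    note h' = hopf_deriv_fd_Ft[OF w x(1), of 0, folded h'_def]
    have "(h - h') \<bullet> Ft w = 0" using h h' by (simp add: inner_diff_left)
    moreover have "hopf_deriv (Ft w) (h - h') = 0" using h' x by (simp add: linear_diff[OF linear_hopf_deriv])
    ultimately obtain t where "h - h' = t *\<^sub>R (\<i> *s Ft w)" using hopf_deriv_kernel[OF z] by blast
    then have "h = fd Dt (F \<circ> \<Psi>) w (L x + t *\<^sub>R e)"
      using fd_Ft[OF w x(1), of t] fd_Ft[OF w x(1), of 0] by (simp add: h'_def algebra_simps)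
    then show "h \<in> fd Dt (F \<circ> \<Psi>) w ` Wt" using Wt_I[OF x(1)] by blast
  qed
qed

text \<open>In the chart, the total space is the product of the base with an interval, and the density does
  not depend on the angle.\<close>

lemma nn_integral_lift_chart:
  assumes \<mu>: "is_rvol (2 * m) X f \<mu>" and \<mu>t: "is_rvol (2 * m + 1) Xt F \<mu>t"
    and g: "g \<in> borel_measurable (restrict_space borel Xt)"
    and A: "A \<in> sets (restrict_space borel X)" and AD: "A \<subseteq> \<psi> ` D0"
  defines "k \<equiv> \<lambda>p. indicator A p * (\<integral>\<^sup>+t. g (\<kappa> (p, cis t *s hopf_section z0 (f p))) * indicator {-pi<..<pi} t \<partial>lborel)"
  shows "k \<in> borel_measurable (restrict_space borel X)"
    and "(\<integral>\<^sup>+y. g y * indicator A (\<rho> y) * indicator (\<Psi> ` Dt) y \<partial>\<mu>t) = (\<integral>\<^sup>+p. k p \<partial>\<mu>)"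
proof -
  note pt = lift_regular
  note bt = regular_params_borel[OF pt] and b = regular_params_borel[OF p]
  have [measurable]: "L \<in> borel \<rightarrow>\<^sub>M borel" by (rule linear_measurable[OF linL])
  have Dtb[measurable]: "Dt \<in> sets borel" and Db[measurable]: "D \<in> sets borel" using bt(1) b(1) by auto
  have Eb[measurable]: "D \<inter> \<psi> -` A \<in> sets borel" by (rule b(3)[OF A])
  have gP[measurable]: "(\<lambda>w. indicator Dt w * g (\<Psi> w)) \<in> borel_measurable borel"
  proof -
    have "(\<lambda>w. g (\<Psi> w)) \<in> borel_measurable (restrict_space borel Dt)"
      by (rule measurable_compose[OF bt(2) g])
    then have "(\<lambda>w. g (\<Psi> w) * indicator Dt w) \<in> borel_measurable borel"
      by (subst (asm) borel_measurable_restrict_space_iff_ennreal) auto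
    then show ?thesis by (simp add: mult.commute)
  qed
  have D0E: "u \<in> D \<inter> \<psi> -` A \<Longrightarrow> u \<in> D0" for u
    using AD D0(2) r(9) by (auto simp: inj_on_def subset_iff image_iff)
  define q where "q u = (\<integral>\<^sup>+t. indicator Dt (L u + t *\<^sub>R e) * g (\<Psi> (L u + t *\<^sub>R e)) \<partial>lborel)" for u
  have q[measurable]: "q \<in> borel_measurable borel"
  proof -
    have "(\<lambda>(u, t). indicator Dt (L u + t *\<^sub>R e) * g (\<Psi> (L u + t *\<^sub>R e))) \<in> borel_measurable (borel \<Otimes>\<^sub>M lborel)"
    proof -
      have "(\<lambda>z. L (fst z) + snd z *\<^sub>R e) \<in> borel \<Otimes>\<^sub>M lborel \<rightarrow>\<^sub>M borel" by measurable
      from measurable_compose[OF this gP] show ?thesis by (simp add: case_prod_beta')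
    qed
    then show ?thesis unfolding q_def by (rule lborel.borel_measurable_nn_integral)
  qed
  have kq: "k (\<psi> u) = indicator (D \<inter> \<psi> -` A) u * q u" if u: "u \<in> D" for u
  proof (cases "\<psi> u \<in> A")
    case True
    then have uD: "u \<in> D0" using D0E u by auto
    then have uW: "u \<in> W" using rel_openD(3)[OF D0(1)] by auto
    have "L u + t *\<^sub>R e \<in> Dt \<longleftrightarrow> t \<in> {-pi<..<pi}" for t
      using uD by (auto simp: Dt_def coord[OF uW] Wt_I[OF uW])
    then have "q u = (\<integral>\<^sup>+t. g (\<kappa> (\<psi> u, cis t *s s u)) * indicator {-pi<..<pi} t \<partial>lborel)"
      unfolding q_def by (intro nn_integral_cong) (simp add: \<Psi>_def Ft_def coord[OF uW] indicator_def)
    then show ?thesis using True u by (simp add: k_def s_def)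
  qed (simp add: k_def)
  have k0: "k x = 0" if "x \<notin> \<psi> ` D" for x
    using that AD D0(2) by (auto simp: k_def indicator_def)
  \<comment> \<open>The function vanishes outside the chart image, and inside it is a Borel function
    of the coordinates. Preimages are therefore images of Borel sets under \<open>\<psi>\<close>, up
    to the complement of the chart.\<close>
  show km: "k \<in> borel_measurable (restrict_space borel X)"
  proof (rule measurableI)
    fix S :: "ennreal set" assume S[measurable]: "S \<in> sets borel"
    let ?V = "{u \<in> D. indicator (D \<inter> \<psi> -` A) u * q u \<in> S}"
    have V: "?V \<in> sets borel" by measurable
    have "k -` S \<inter> space (restrict_space borel X) = \<psi> ` ?V \<union> (if 0 \<in> S then X - \<psi> ` D else {})"
    proof -
      have V': "?V = {u \<in> D. k (\<psi> u) \<in> S}" using kq by auto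
      have "x \<in> X \<and> k x \<in> S \<longleftrightarrow> x \<in> \<psi> ` {u \<in> D. k (\<psi> u) \<in> S} \<union> (if 0 \<in> S then X - \<psi> ` D else {})" for x
      proof (cases "x \<in> \<psi> ` D")
        case True then show ?thesis using r(10) by auto
      next
        case False then show ?thesis using k0[OF False] by auto
      qed
      then show ?thesis unfolding V' by (intro set_eqI) (simp add: space_restrict_space conj_commute)
    qed
    also have "\<dots> \<in> sets (restrict_space borel X)"
    proof -
      have "\<psi> ` ?V \<in> sets (restrict_space borel X)" by (rule b(4)[OF V]) auto
      moreover have "X - \<psi> ` D \<in> sets (restrict_space borel X)"
        using sets.compl_sets[OF b(4)[OF b(1) order_refl]] by (simp add: space_restrict_space)
      ultimately show ?thesis by auto
    qed
    finally show "k -` S \<inter> space (restrict_space borel X) \<in> sets (restrict_space borel X)" .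
  qed simp
  have \<rho>m: "\<rho> \<in> restrict_space borel Xt \<rightarrow>\<^sub>M restrict_space borel X"
    by (rule measurable_restrict_space2)
       (use total_space(1) borel_measurable_continuous_on_restrict[OF continuous_total(1)] in \<open>auto simp: space_restrict_space\<close>)
  have PD: "\<Psi> ` Dt \<in> sets (restrict_space borel Xt)" by (rule bt(4)[OF Dtb]) simp
  have lhs: "(\<lambda>y. g y * indicator A (\<rho> y) * indicator (\<Psi> ` Dt) y) \<in> borel_measurable (restrict_space borel Xt)"
    using g PD measurable_compose[OF \<rho>m borel_measurable_indicator[OF A]] by measurable
  note dm[measurable] = volume_density_measurable[OF pt]
  note dm2[measurable] = volume_density_measurable[OF p]
  have "(\<integral>\<^sup>+y. g y * indicator A (\<rho> y) * indicator (\<Psi> ` Dt) y \<partial>\<mu>t) =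
    (\<integral>\<^sup>+w\<in>Dt. g (\<Psi> w) * indicator A (\<rho> (\<Psi> w)) * indicator (\<Psi> ` Dt) (\<Psi> w) * ennreal (volume_density Wt Dt (F \<circ> \<Psi>) w) \<partial>subspace_lborel Wt)"
    by (rule nn_integral_is_rvol[OF \<mu>t pt lhs]) simp
  also have "\<dots> = (\<integral>\<^sup>+w. indicator (D \<inter> \<psi> -` A) (R w) * (indicator Dt w * g (\<Psi> w)) * (ennreal (volume_density W D (f \<circ> \<psi>) (R w)) * indicator D (R w)) \<partial>subspace_lborel Wt)"
    using DtD(1) D0(2) by (intro nn_integral_cong) (auto simp: indicator_def Ft_props lift_volume_density)
  also have "\<dots> = (\<integral>\<^sup>+u. \<integral>\<^sup>+t. indicator (D \<inter> \<psi> -` A) (R (L u + t *\<^sub>R e)) * (indicator Dt (L u + t *\<^sub>R e) * g (\<Psi> (L u + t *\<^sub>R e))) *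
      (ennreal (volume_density W D (f \<circ> \<psi>) (R (L u + t *\<^sub>R e))) * indicator D (R (L u + t *\<^sub>R e))) \<partial>lborel \<partial>subspace_lborel W)"
  proof (rule nn_integral_Wt)
    have [measurable]: "R \<in> borel \<rightarrow>\<^sub>M borel" by (rule linear_measurable[OF R])
    have [measurable]: "(\<lambda>w. ennreal (volume_density W D (f \<circ> \<psi>) (R w)) * indicator D (R w)) \<in> borel_measurable borel"
      by (rule measurable_compose[OF _ dm2]) measurable
    have [measurable]: "(\<lambda>w. indicator (D \<inter> \<psi> -` A) (R w) :: ennreal) \<in> borel_measurable borel"
      by (rule measurable_compose[OF _ borel_measurable_indicator[OF Eb]]) measurable
    show "(\<lambda>w. indicator (D \<inter> \<psi> -` A) (R w) * (indicator Dt w * g (\<Psi> w)) * (ennreal (volume_density W D (f \<circ> \<psi>) (R w)) * indicator D (R w))) \<in> borel_measurable borel"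
      by measurable
  qed
  also have "\<dots> = (\<integral>\<^sup>+u. indicator (D \<inter> \<psi> -` A) u * (ennreal (volume_density W D (f \<circ> \<psi>) u) * indicator D u) * q u \<partial>subspace_lborel W)"
  proof (rule nn_integral_cong_AE, use subspace_lborel_AE[OF r(1)] in eventually_elim)
    fix u assume u: "u \<in> W"
    have m: "(\<lambda>t. indicator Dt (L u + t *\<^sub>R e) * g (\<Psi> (L u + t *\<^sub>R e))) \<in> borel_measurable lborel"
      by (rule measurable_compose[OF _ gP]) measurable
    show "(\<integral>\<^sup>+t. indicator (D \<inter> \<psi> -` A) (R (L u + t *\<^sub>R e)) * (indicator Dt (L u + t *\<^sub>R e) * g (\<Psi> (L u + t *\<^sub>R e))) *
      (ennreal (volume_density W D (f \<circ> \<psi>) (R (L u + t *\<^sub>R e))) * indicator D (R (L u + t *\<^sub>R e))) \<partial>lborel) =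
      indicator (D \<inter> \<psi> -` A) u * (ennreal (volume_density W D (f \<circ> \<psi>) u) * indicator D u) * q u"
      unfolding coord(1)[OF u] q_def nn_integral_cmult[OF m, symmetric] by (intro nn_integral_cong) (simp add: mult_ac)
  qed
  also have "\<dots> = (\<integral>\<^sup>+u\<in>D. k (\<psi> u) * ennreal (volume_density W D (f \<circ> \<psi>) u) \<partial>subspace_lborel W)"
    using kq by (intro nn_integral_cong) (auto simp: indicator_def mult_ac)
  also have "\<dots> = (\<integral>\<^sup>+p. k p \<partial>\<mu>)"
    by (rule nn_integral_is_rvol[OF \<mu> p km, symmetric]) (use k0 in auto)
  finally show "(\<integral>\<^sup>+y. g y * indicator A (\<rho> y) * indicator (\<Psi> ` Dt) y \<partial>\<mu>t) = (\<integral>\<^sup>+p. k p \<partial>\<mu>)" .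
qed

text \<open>By Fubini: over each base coordinate the slice contains a single angle, which is a null
  set of the line.\<close>

lemma emeasure_zero_slice:
  assumes \<mu>t: "is_rvol (2 * m + 1) Xt F \<mu>t"
  shows "emeasure \<mu>t (\<Psi> ` {w \<in> Dt. w \<bullet> e = 0}) = 0"
proof -
  note pt = lift_regular
  note dm[measurable] = volume_density_measurable[OF pt]
  have Dtb[measurable]: "Dt \<in> sets borel" by (rule regular_params_borel(1)[OF pt])
  have E: "{w \<in> Dt. w \<bullet> e = 0} \<in> sets borel" by measurable
  have "emeasure \<mu>t (\<Psi> ` {w \<in> Dt. w \<bullet> e = 0}) =
     (\<integral>\<^sup>+w\<in>{w \<in> Dt. w \<bullet> e = 0}. ennreal (volume_density Wt Dt (F \<circ> \<Psi>) w) \<partial>subspace_lborel Wt)"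
    by (rule is_rvol_emeasure[OF \<mu>t pt E]) auto
  also have "\<dots> = (\<integral>\<^sup>+w. (ennreal (volume_density Wt Dt (F \<circ> \<Psi>) w) * indicator Dt w) * indicator {0} (w \<bullet> e) \<partial>subspace_lborel Wt)"
    by (intro nn_integral_cong) (auto simp: indicator_def)
  also have "\<dots> = (\<integral>\<^sup>+u. \<integral>\<^sup>+t. (ennreal (volume_density Wt Dt (F \<circ> \<Psi>) (L u + t *\<^sub>R e)) * indicator Dt (L u + t *\<^sub>R e)) *
     indicator {0} ((L u + t *\<^sub>R e) \<bullet> e) \<partial>lborel \<partial>subspace_lborel W)"
    by (rule nn_integral_Wt) measurable
  also have "\<dots> = (\<integral>\<^sup>+u. 0 \<partial>subspace_lborel W)"
  proof (rule nn_integral_cong_AE, use subspace_lborel_AE[OF r(1)] in eventually_elim)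
    fix u assume u: "u \<in> W"
    have "AE t in lborel. (ennreal (volume_density Wt Dt (F \<circ> \<Psi>) (L u + t *\<^sub>R e)) * indicator Dt (L u + t *\<^sub>R e)) *
       indicator {0} ((L u + t *\<^sub>R e) \<bullet> e) = 0"
      using AE_lborel_singleton[of "0::real"] by eventually_elim (simp add: coord[OF u] indicator_def)
    then show "(\<integral>\<^sup>+t. (ennreal (volume_density Wt Dt (F \<circ> \<Psi>) (L u + t *\<^sub>R e)) * indicator Dt (L u + t *\<^sub>R e)) *
       indicator {0} ((L u + t *\<^sub>R e) \<bullet> e) \<partial>lborel) = 0"
      by (subst nn_integral_cong_AE[of _ "\<lambda>_. 0"]) auto
  qed
  finally show ?thesis by simp
qed

end

context hopf_bundle
begin

section \<open>Covering the total space and integrating along the fibres\<close>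

lemma obtain_lift_chart:
  assumes y: "y \<in> Xt"
  obtains W D \<psi> L e R u where "lift_chart X f m Xt F \<rho> \<kappa> W D \<psi> L e R" "u \<in> D" "\<psi> u = \<rho> y"
proof -
  obtain W D \<psi> u where p: "(W, D, \<psi>) \<in> regular_params (2 * m) X f" "u \<in> D" "\<psi> u = \<rho> y"
    using base_chart[OF total_space(1)[OF y]] by auto
  then show ?thesis using lift_chart_exists[OF p(1)] that by blast
qed

lemma tangent_space_total:
  assumes y: "y \<in> Xt"
  shows "tangent_space (2 * m + 1) Xt F y = {h. h \<bullet> F y = 0 \<and> hopf_deriv (F y) h \<in> tangent_space (2 * m) X f (\<rho> y)}"
proof -
  obtain W D \<psi> L e R u where lc: "lift_chart X f m Xt F \<rho> \<kappa> W D \<psi> L e R" "u \<in> D" "\<psi> u = \<rho> y"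
    using obtain_lift_chart[OF y] .
  \<comment> \<open>Taking \<open>z0 = F y\<close> makes the Hermitian product at \<open>y\<close>
    equal to one, so \<open>y\<close> lies in the chart at angle \<open>0\<close>.\<close>
  interpret lc: lift_chart X f m Xt F \<rho> \<kappa> W D \<psi> "F y" L e R by (rule lc(1))
  have n: "hinner (F y) (F y) \<notin> \<real>\<^sub>\<le>\<^sub>0" by (simp add: hinner_self total_space(2)[OF y])
  let ?w = "L u + Arg (hinner (F y) (F y)) *\<^sub>R e"
  have w: "?w \<in> lc.Dt" "lc.\<Psi> ?w = y" using lc.Psi_surj[OF y lc(2) lc(3)[symmetric] n] by auto
  from lc.tangent_space_lift[OF w(1)] lc.Ft_props(5,6)[OF w(1)] w(2) show ?thesis by simp
qed

text \<open>The vectors \<open>z0\<close> are the standard basis vectors and their negatives. Some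
  coordinate of a unit vector is nonzero, and a nonzero number and its negative cannot both be
  nonpositive reals. Hence finitely many lifted charts suffice.\<close>

lemma section_cover:
  "\<exists>Q. finite Q \<and> (\<forall>(W, D, \<psi>, z0)\<in>Q. (W, D, \<psi>) \<in> regular_params (2 * m) X f) \<and>
    (\<forall>y\<in>Xt. \<exists>(W, D, \<psi>, z0)\<in>Q. \<rho> y \<in> \<psi> ` D \<and> hinner (F y) z0 \<notin> \<real>\<^sub>\<le>\<^sub>0)"
proof -
  obtain P where P: "finite P" "P \<subseteq> regular_params (2 * m) X f" "(\<Union>(W, D, \<psi>)\<in>P. \<psi> ` D) = X" using cover by auto
  define Z where "Z = range (\<lambda>j::'n. axis j (1::complex)) \<union> range (\<lambda>j::'n. axis j (-1::complex))"
  define Q where "Q = (\<lambda>((W, D, \<psi>), z0). (W, D, \<psi>, z0)) ` (P \<times> Z)"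
  have ax: "hinner z (axis j c) = z $ j * cnj c" for z :: "complex^'n" and j c
  proof -
    have "hinner z (axis j c) = (\<Sum>i\<in>UNIV. if i = j then z $ j * cnj c else 0)"
      unfolding hinner_def by (intro sum.cong refl) (auto simp: axis_def)
    then show ?thesis by simp
  qed
  have "finite Q" unfolding Q_def Z_def using P by auto
  moreover have "\<forall>(W, D, \<psi>, z0)\<in>Q. (W, D, \<psi>) \<in> regular_params (2 * m) X f" using P by (auto simp: Q_def)
  moreover have "\<exists>(W, D, \<psi>, z0)\<in>Q. \<rho> y \<in> \<psi> ` D \<and> hinner (F y) z0 \<notin> \<real>\<^sub>\<le>\<^sub>0" if y: "y \<in> Xt" for y
  proof -
    have "F y \<noteq> 0" using total_space(2)[OF y] by auto
    then obtain j where j: "F y $ j \<noteq> 0" by (auto simp: vec_eq_iff)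
    have "F y $ j \<notin> \<real>\<^sub>\<le>\<^sub>0 \<or> - (F y $ j) \<notin> \<real>\<^sub>\<le>\<^sub>0"
      using j by (auto simp: complex_nonpos_Reals_iff complex_eq_iff)
    moreover have "axis j 1 \<in> Z" "axis j (- 1) \<in> Z" by (auto simp: Z_def)
    ultimately obtain z0 where z0: "z0 \<in> Z" "hinner (F y) z0 \<notin> \<real>\<^sub>\<le>\<^sub>0"
      using ax[of "F y" j 1] ax[of "F y" j "-1"] by (metis complex_cnj_minus complex_cnj_one mult_1_right mult_minus_right)
    obtain W D \<psi> where "(W, D, \<psi>) \<in> P" "\<rho> y \<in> \<psi> ` D" using total_space(1)[OF y] P(3) by fastforce
    then have "(W, D, \<psi>, z0) \<in> Q" using z0 by (auto simp: Q_def intro!: image_eqI[of _ _ "((W, D, \<psi>), z0)"])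
    then show ?thesis using z0 \<open>\<rho> y \<in> \<psi> ` D\<close> by (intro bexI[of _ "(W, D, \<psi>, z0)"]) auto
  qed
  ultimately show ?thesis by blast
qed

lemma total_cover: "\<exists>P. finite P \<and> P \<subseteq> regular_params (2 * m + 1) Xt F \<and> (\<Union>(W, D, \<psi>)\<in>P. \<psi> ` D) = Xt"
proof -
  obtain Q where Q: "finite Q" "\<And>W D \<psi> z0. (W, D, \<psi>, z0) \<in> Q \<Longrightarrow> (W, D, \<psi>) \<in> regular_params (2 * m) X f"
    "\<And>y. y \<in> Xt \<Longrightarrow> \<exists>(W, D, \<psi>, z0)\<in>Q. \<rho> y \<in> \<psi> ` D \<and> hinner (F y) z0 \<notin> \<real>\<^sub>\<le>\<^sub>0"
    using section_cover by fast
  have "\<exists>c \<in> regular_params (2 * m + 1) Xt F. (case c of (Wt, Dt, \<Psi>) \<Rightarrow> \<Psi> ` Dt) = {y \<in> Xt. \<rho> y \<in> \<psi> ` D \<and> hinner (F y) z0 \<notin> \<real>\<^sub>\<le>\<^sub>0}"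
    if q: "(W, D, \<psi>, z0) \<in> Q" for W D \<psi> z0
  proof -
    obtain L e R where "lift_chart X f m Xt F \<rho> \<kappa> W D \<psi> L e R" using lift_chart_exists[OF Q(2)[OF q]] by auto
    then interpret lc: lift_chart X f m Xt F \<rho> \<kappa> W D \<psi> z0 L e R .
    show ?thesis using lc.lift_regular lc.Psi_image by (intro bexI[of _ "(lc.Wt, lc.Dt, lc.\<Psi>)"]) auto
  qed
  then have "\<forall>q\<in>Q. \<exists>c. c \<in> regular_params (2 * m + 1) Xt F \<and> (case c of (Wt, Dt, \<Psi>) \<Rightarrow> \<Psi> ` Dt) =
    (case q of (W, D, \<psi>, z0) \<Rightarrow> {y \<in> Xt. \<rho> y \<in> \<psi> ` D \<and> hinner (F y) z0 \<notin> \<real>\<^sub>\<le>\<^sub>0})"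
    unfolding Bex_def by (intro ballI) (case_tac q, simp)
  from bchoice[OF this] obtain C where C: "\<forall>q\<in>Q. C q \<in> regular_params (2 * m + 1) Xt F \<and> (case C q of (Wt, Dt, \<Psi>) \<Rightarrow> \<Psi> ` Dt) =
    (case q of (W, D, \<psi>, z0) \<Rightarrow> {y \<in> Xt. \<rho> y \<in> \<psi> ` D \<and> hinner (F y) z0 \<notin> \<real>\<^sub>\<le>\<^sub>0})"
    by blast
  have "(\<Union>c\<in>C ` Q. case c of (W, D, \<psi>) \<Rightarrow> \<psi> ` D) = (\<Union>q\<in>Q. case q of (W, D, \<psi>, z0) \<Rightarrow> {y \<in> Xt. \<rho> y \<in> \<psi> ` D \<and> hinner (F y) z0 \<notin> \<real>\<^sub>\<le>\<^sub>0})"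
    using C by auto
  also have "\<dots> = Xt" using Q(3) by fastforce
  finally show ?thesis using C Q(1) by (intro exI[of _ "C ` Q"]) auto
qed

lemma params_cover_total: "params_cover (2 * m + 1) Xt F"
proof -
  obtain P where P: "P \<subseteq> regular_params (2 * m + 1) Xt F" "(\<Union>(W, D, \<psi>)\<in>P. \<psi> ` D) = Xt" using total_cover by auto
  then show ?thesis unfolding params_cover_def by fastforce
qed

lemma rvol_base: "is_rvol (2 * m) X f (riemannian_volume (2 * m) X f)"
  using cover is_rvol_riemannian_volume by blast

lemma rvol_total: "is_rvol (2 * m + 1) Xt F (riemannian_volume (2 * m + 1) Xt F)"
  using total_cover is_rvol_riemannian_volume by blast

text \<open>The starting point \<open>z\<close> of the fibre remains an argument;
  \<open>disintegration\<close> asserts its formula for some \<open>z\<close> over each base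
  point.\<close>

definition fibre_integral :: "('y \<Rightarrow> ennreal) \<Rightarrow> 'x \<Rightarrow> complex^'n \<Rightarrow> ennreal" where
  "fibre_integral g p z = (\<integral>\<^sup>+t. g (\<kappa> (p, cis t *s z)) * indicator {-pi<..<pi} t \<partial>lborel)"

text \<open>The base is cut into pieces, each contained in the domain of one local section, and the
  pieces are removed by induction. On each piece the chart formula integrates over all angles except
  one, which is a null set upstairs.\<close>

lemma disintegration:
  assumes \<mu>: "is_rvol (2 * m) X f \<mu>" and \<mu>t: "is_rvol (2 * m + 1) Xt F \<mu>t"
    and g: "g \<in> borel_measurable (restrict_space borel Xt)"
  shows "\<exists>k \<in> borel_measurable (restrict_space borel X). (\<integral>\<^sup>+y. g y \<partial>\<mu>t) = (\<integral>\<^sup>+p. k p \<partial>\<mu>) \<and>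
    (\<forall>p\<in>X. \<exists>z. norm z = 1 \<and> f p = hopf z \<and> k p = fibre_integral g p z)"
proof -
  obtain Q where Q: "finite Q" "\<And>W D \<psi> z0. (W, D, \<psi>, z0) \<in> Q \<Longrightarrow> (W, D, \<psi>) \<in> regular_params (2 * m) X f"
    "\<And>y. y \<in> Xt \<Longrightarrow> \<exists>(W, D, \<psi>, z0)\<in>Q. \<rho> y \<in> \<psi> ` D \<and> hinner (F y) z0 \<notin> \<real>\<^sub>\<le>\<^sub>0"
    using section_cover by fast
  define U where "U q = (case q of (W, D, \<psi>, z0) \<Rightarrow> \<psi> ` (D \<inter> (\<lambda>u. line_proj z0 (f (\<psi> u))) -` (- {0})))"
    for q :: "(complex^'n^'n) set \<times> (complex^'n^'n) set \<times> (complex^'n^'n \<Rightarrow> 'x) \<times> (complex^'n)"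
  have \<rho>m: "\<rho> \<in> restrict_space borel Xt \<rightarrow>\<^sub>M restrict_space borel X"
    by (rule measurable_restrict_space2)
       (use total_space(1) borel_measurable_continuous_on_restrict[OF continuous_total(1)] in \<open>auto simp: space_restrict_space\<close>)
  have gm: "g \<in> borel_measurable \<mu>t" using g measurable_cong_sets[OF is_rvol_sets[OF \<mu>t] refl] by blast
  have \<rho>\<mu>: "\<rho> \<in> \<mu>t \<rightarrow>\<^sub>M restrict_space borel X" using \<rho>m measurable_cong_sets[OF is_rvol_sets[OF \<mu>t] refl] by blast
  have main: "\<exists>k \<in> borel_measurable (restrict_space borel X). (\<integral>\<^sup>+y. g y * indicator B (\<rho> y) \<partial>\<mu>t) = (\<integral>\<^sup>+p. k p * indicator B p \<partial>\<mu>) \<and>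
    (\<forall>p\<in>B. \<exists>z. norm z = 1 \<and> f p = hopf z \<and> k p = fibre_integral g p z)"
    if "finite C" "C \<subseteq> Q" "B \<in> sets (restrict_space borel X)" "B \<subseteq> (\<Union>q\<in>C. U q)" for C B
    using that
  proof (induction C arbitrary: B rule: finite_induct)
    case empty
    then show ?case by (intro bexI[of _ "\<lambda>_. 0"]) auto
  next
    case (insert q C)
    obtain W D \<psi> z0 where q: "q = (W, D, \<psi>, z0)" by (cases q)
    have p: "(W, D, \<psi>) \<in> regular_params (2 * m) X f" using Q(2) insert.prems q by auto
    obtain L e R where "lift_chart X f m Xt F \<rho> \<kappa> W D \<psi> L e R" using lift_chart_exists[OF p] by auto
    then interpret lc: lift_chart X f m Xt F \<rho> \<kappa> W D \<psi> z0 L e R .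
    interpret lc': lift_chart X f m Xt F \<rho> \<kappa> W D \<psi> "- z0" L e R by unfold_locales
    have Uq: "U q = \<psi> ` lc.D0" by (simp add: U_def q lc.D0_def)
    have Ub: "U q \<in> sets (restrict_space borel X)" unfolding Uq
      by (rule regular_params_borel(4)[OF p rel_open_borel[OF lc.D0(1)] lc.D0(2)])
    define A where "A = B \<inter> U q"
    have B: "B \<in> sets (restrict_space borel X)" by (rule insert.prems)
    have A: "A \<in> sets (restrict_space borel X)" using B Ub by (auto simp: A_def)
    have BU: "B - U q \<in> sets (restrict_space borel X)" using B Ub by auto
    obtain k2 where k2: "k2 \<in> borel_measurable (restrict_space borel X)"
      "(\<integral>\<^sup>+y. g y * indicator (B - U q) (\<rho> y) \<partial>\<mu>t) = (\<integral>\<^sup>+p. k2 p * indicator (B - U q) p \<partial>\<mu>)"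
      "\<forall>p\<in>B - U q. \<exists>z. norm z = 1 \<and> f p = hopf z \<and> k2 p = fibre_integral g p z"
      using insert.IH[OF _ BU] insert.prems by auto
    define k1 where "k1 p = indicator A p * fibre_integral g p (hopf_section z0 (f p))" for p
    have AD: "A \<subseteq> \<psi> ` lc.D0" using Uq by (auto simp: A_def)
    have k1m: "k1 \<in> borel_measurable (restrict_space borel X)"
      and k1e: "(\<integral>\<^sup>+y. g y * indicator A (\<rho> y) * indicator (lc.\<Psi> ` lc.Dt) y \<partial>\<mu>t) = (\<integral>\<^sup>+p. k1 p \<partial>\<mu>)"
      using lc.nn_integral_lift_chart[OF \<mu> \<mu>t g A AD] unfolding k1_def fibre_integral_def by auto
    text \<open>The part of the fibres missed by the chart of \<open>z0\<close> is the slice of angle \<open>0\<close> in the chart of \<open>- z0\<close>.\<close>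
    have slice: "AE y in \<mu>t. \<rho> y \<in> A \<longrightarrow> y \<in> lc.\<Psi> ` lc.Dt"
    proof (rule AE_I)
      let ?N = "lc'.\<Psi> ` {w \<in> lc'.Dt. w \<bullet> e = 0}"
      show "emeasure \<mu>t ?N = 0" by (rule lc'.emeasure_zero_slice[OF \<mu>t])
      have Db: "lc'.Dt \<in> sets borel" by (rule regular_params_borel(1)[OF lc'.lift_regular])
      then have "{w \<in> lc'.Dt. w \<bullet> e = 0} \<in> sets borel" by measurable
      then show "?N \<in> sets \<mu>t"
        unfolding is_rvol_sets[OF \<mu>t] by (rule regular_params_borel(4)[OF lc'.lift_regular]) auto
      show "{y \<in> space \<mu>t. \<not> (\<rho> y \<in> A \<longrightarrow> y \<in> lc.\<Psi> ` lc.Dt)} \<subseteq> ?N"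
      proof
        fix y assume "y \<in> {y \<in> space \<mu>t. \<not> (\<rho> y \<in> A \<longrightarrow> y \<in> lc.\<Psi> ` lc.Dt)}"
        then have y: "y \<in> Xt" "\<rho> y \<in> A" "y \<notin> lc.\<Psi> ` lc.Dt" using is_rvol_space[OF \<mu>t] by auto
        then obtain u where u: "u \<in> lc.D0" "\<rho> y = \<psi> u" using AD by auto
        have uD: "u \<in> D" using u lc.D0(2) by auto
        have np: "hinner (F y) z0 \<in> \<real>\<^sub>\<le>\<^sub>0" using y uD u by (auto simp: lc.Psi_image)
        have n0: "hinner (F y) z0 \<noteq> 0"
          using u line_proj_hopf_eq_0[OF total_space(2)[OF y(1)], of z0] total_space(3)[OF y(1)] by (auto simp: lc.D0_def)
        have hm: "hinner (F y) (- z0) = - hinner (F y) z0" by (simp add: hinner_def sum_negf)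
        obtain a where a: "a > 0" "hinner (F y) (- z0) = of_real a"
        proof
          show "- Re (hinner (F y) z0) > 0" "hinner (F y) (- z0) = of_real (- Re (hinner (F y) z0))"
            using np n0 by (auto simp: hm complex_nonpos_Reals_iff complex_eq_iff)
        qed
        have n': "hinner (F y) (- z0) \<notin> \<real>\<^sub>\<le>\<^sub>0" "Arg (hinner (F y) (- z0)) = 0" using a by (auto simp: Arg_of_real)
        have uW: "u \<in> W" using uD rel_openD(3)[OF lc.r(3)] by auto
        from lc'.Psi_surj[OF y(1) uD u(2) n'(1)] n'(2)
        show "y \<in> ?N" using lc'.coord(2)[OF uW, of 0] by (intro image_eqI[of _ _ "L u + 0 *\<^sub>R e"]) auto
      qed
    qed
    have i1: "(\<integral>\<^sup>+y. g y * indicator A (\<rho> y) \<partial>\<mu>t) = (\<integral>\<^sup>+p. k1 p \<partial>\<mu>)"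
      unfolding k1e[symmetric] by (rule nn_integral_cong_AE, use slice in eventually_elim) (auto simp: indicator_def)
    define k where "k p = (if p \<in> U q then k1 p else k2 p)" for p
    have km: "k \<in> borel_measurable (restrict_space borel X)"
      unfolding k_def using k1m k2(1) sets.Int_space_eq2[OF Ub] Ub by (intro measurable_If_set) auto
    have k\<mu>: "h \<in> borel_measurable \<mu>" if "h \<in> borel_measurable (restrict_space borel X)" for h :: "'x \<Rightarrow> ennreal"
      using that measurable_cong_sets[OF is_rvol_sets[OF \<mu>] refl] by blast
    have im: "(\<lambda>y. indicator S (\<rho> y) :: ennreal) \<in> borel_measurable \<mu>t" if "S \<in> sets (restrict_space borel X)" for S
      by (rule measurable_compose[OF \<rho>\<mu> borel_measurable_indicator[OF that]])
    have AB: "indicator B x = (indicator A x + indicator (B - U q) x :: ennreal)" for x by (auto simp: A_def indicator_def)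
    have "(\<integral>\<^sup>+y. g y * indicator B (\<rho> y) \<partial>\<mu>t) = (\<integral>\<^sup>+y. g y * indicator A (\<rho> y) + g y * indicator (B - U q) (\<rho> y) \<partial>\<mu>t)"
      unfolding AB by (simp add: distrib_left)
    also have "\<dots> = (\<integral>\<^sup>+y. g y * indicator A (\<rho> y) \<partial>\<mu>t) + (\<integral>\<^sup>+y. g y * indicator (B - U q) (\<rho> y) \<partial>\<mu>t)"
      using gm im[OF A] im[OF BU] by (intro nn_integral_add) auto
    also have "\<dots> = (\<integral>\<^sup>+p. k1 p \<partial>\<mu>) + (\<integral>\<^sup>+p. k2 p * indicator (B - U q) p \<partial>\<mu>)" using i1 k2(2) by simp
    also have "\<dots> = (\<integral>\<^sup>+p. k1 p + k2 p * indicator (B - U q) p \<partial>\<mu>)"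
      using k\<mu>[OF k1m] k\<mu>[OF k2(1)] BU is_rvol_sets[OF \<mu>] by (intro nn_integral_add[symmetric]) auto
    also have "\<dots> = (\<integral>\<^sup>+p. k p * indicator B p \<partial>\<mu>)"
      by (intro nn_integral_cong) (auto simp: k_def k1_def A_def indicator_def)
    finally have ke: "(\<integral>\<^sup>+y. g y * indicator B (\<rho> y) \<partial>\<mu>t) = (\<integral>\<^sup>+p. k p * indicator B p \<partial>\<mu>)" .
    have "\<exists>z. norm z = 1 \<and> f p = hopf z \<and> k p = fibre_integral g p z" if pB: "p \<in> B" for p
    proof (cases "p \<in> U q")
      case True
      then obtain u where u: "u \<in> lc.D0" "p = \<psi> u" using Uq by auto
      have "k p = fibre_integral g p (lc.s u)" using True pB by (simp add: k_def k1_def A_def lc.s_def u(2))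
      then show ?thesis using lc.s_props(1,2)[OF u(1)] u(2) by (intro exI[of _ "lc.s u"]) simp
    next
      case False
      then show ?thesis using k2(3) pB by (simp add: k_def)
    qed
    then show ?case using km ke by (intro bexI[of _ k]) auto
  qed
  have XX: "X \<in> sets (restrict_space borel X)" using sets.top[of "restrict_space borel X"] by (simp add: space_restrict_space)
  have "X \<subseteq> (\<Union>q\<in>Q. U q)"
  proof
    fix p assume p: "p \<in> X"
    then obtain z where z: "norm z = 1" "f p = hopf z" using f_CP CP_iff by blast
    note tp = total_point[OF p z]
    obtain W D \<psi> z0 where q: "(W, D, \<psi>, z0) \<in> Q" "p \<in> \<psi> ` D" "hinner z z0 \<notin> \<real>\<^sub>\<le>\<^sub>0" using Q(3)[OF tp(1)] tp by auto
    then have "hinner z z0 \<noteq> 0" by auto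
    then have "line_proj z0 (f p) \<noteq> 0" using line_proj_hopf_eq_0[OF z(1)] z(2) by simp
    then have "p \<in> U (W, D, \<psi>, z0)" using q by (auto simp: U_def)
    then show "p \<in> (\<Union>q\<in>Q. U q)" using q by blast
  qed
  from main[OF Q(1) order_refl XX this] obtain k where k: "k \<in> borel_measurable (restrict_space borel X)"
    "(\<integral>\<^sup>+y. g y * indicator X (\<rho> y) \<partial>\<mu>t) = (\<integral>\<^sup>+p. k p * indicator X p \<partial>\<mu>)"
    "\<forall>p\<in>X. \<exists>z. norm z = 1 \<and> f p = hopf z \<and> k p = fibre_integral g p z" by blast
  have "(\<integral>\<^sup>+y. g y * indicator X (\<rho> y) \<partial>\<mu>t) = (\<integral>\<^sup>+y. g y \<partial>\<mu>t)"
    by (intro nn_integral_cong) (use is_rvol_space[OF \<mu>t] total_space(1) in auto)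
  moreover have "(\<integral>\<^sup>+p. k p * indicator X p \<partial>\<mu>) = (\<integral>\<^sup>+p. k p \<partial>\<mu>)"
    by (intro nn_integral_cong) (use is_rvol_space[OF \<mu>] in auto)
  ultimately show ?thesis using k by (intro bexI[of _ k]) auto
qed

text \<open>For functions constant along the fibres no measurability is needed: a simple function below
  \<open>h \<circ> \<rho>\<close> is averaged over the fibres.\<close>

lemma nn_integral_total:
  assumes \<mu>: "is_rvol (2 * m) X f \<mu>" and \<mu>t: "is_rvol (2 * m + 1) Xt F \<mu>t"
  shows "(\<integral>\<^sup>+y. h (\<rho> y) \<partial>\<mu>t) = (\<integral>\<^sup>+p. ennreal (2 * pi) * h p \<partial>\<mu>)"
proof (rule antisym)
  have lev: "(\<integral>\<^sup>+t. c * indicator {-pi<..<pi} t \<partial>lborel) = c * ennreal (2 * pi)" for c :: ennreal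
    by (simp add: nn_integral_cmult)
  have fp: "\<kappa> (p, cis t *s z) \<in> Xt" "\<rho> (\<kappa> (p, cis t *s z)) = p" if "p \<in> X" "norm z = 1" "f p = hopf z" for p z t
    using total_point[OF that(1), of "cis t *s z"] that by (auto simp: norm_scale_complex hopf_unit)
  show "(\<integral>\<^sup>+y. h (\<rho> y) \<partial>\<mu>t) \<le> (\<integral>\<^sup>+p. ennreal (2 * pi) * h p \<partial>\<mu>)"
    unfolding nn_integral_def[of \<mu>t]
  proof (rule SUP_least)
    fix g assume "g \<in> {g. simple_function \<mu>t g \<and> g \<le> (\<lambda>y. h (\<rho> y))}"
    then have g: "simple_function \<mu>t g" "\<And>y. g y \<le> h (\<rho> y)" by (auto simp: le_fun_def)
    have gm: "g \<in> borel_measurable (restrict_space borel Xt)"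
      using borel_measurable_simple_function[OF g(1)] measurable_cong_sets[OF is_rvol_sets[OF \<mu>t] refl] by blast
    obtain k where k: "(\<integral>\<^sup>+y. g y \<partial>\<mu>t) = (\<integral>\<^sup>+p. k p \<partial>\<mu>)"
      "\<And>p. p \<in> X \<Longrightarrow> \<exists>z. norm z = 1 \<and> f p = hopf z \<and> k p = fibre_integral g p z"
      using disintegration[OF \<mu> \<mu>t gm] by blast
    have "integral\<^sup>S \<mu>t g = (\<integral>\<^sup>+p. k p \<partial>\<mu>)" using nn_integral_eq_simple_integral[OF g(1)] k(1) by simp
    also have "\<dots> \<le> (\<integral>\<^sup>+p. ennreal (2 * pi) * h p \<partial>\<mu>)"
    proof (rule nn_integral_mono)
      fix p assume "p \<in> space \<mu>"
      then have p: "p \<in> X" using is_rvol_space[OF \<mu>] by simp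
      obtain z where z: "norm z = 1" "f p = hopf z" "k p = fibre_integral g p z" using k(2)[OF p] by blast
      have "k p \<le> (\<integral>\<^sup>+t. h p * indicator {-pi<..<pi} t \<partial>lborel)"
        unfolding z(3) fibre_integral_def
        by (intro nn_integral_mono mult_right_mono) (use g(2)[of "\<kappa> (p, cis _ *s z)"] fp(2)[OF p z(1,2)] in auto)
      then show "k p \<le> ennreal (2 * pi) * h p" unfolding lev by (simp add: mult.commute)
    qed
    finally show "integral\<^sup>S \<mu>t g \<le> (\<integral>\<^sup>+p. ennreal (2 * pi) * h p \<partial>\<mu>)" .
  qed
  show "(\<integral>\<^sup>+p. ennreal (2 * pi) * h p \<partial>\<mu>) \<le> (\<integral>\<^sup>+y. h (\<rho> y) \<partial>\<mu>t)"
    unfolding nn_integral_def[of \<mu>]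
  proof (rule SUP_least)
    fix g assume "g \<in> {g. simple_function \<mu> g \<and> g \<le> (\<lambda>p. ennreal (2 * pi) * h p)}"
    then have g: "simple_function \<mu> g" "\<And>p. g p \<le> ennreal (2 * pi) * h p" by (auto simp: le_fun_def)
    have gm: "g \<in> borel_measurable (restrict_space borel X)"
      using borel_measurable_simple_function[OF g(1)] measurable_cong_sets[OF is_rvol_sets[OF \<mu>] refl] by blast
    have \<rho>m: "\<rho> \<in> restrict_space borel Xt \<rightarrow>\<^sub>M restrict_space borel X"
      by (rule measurable_restrict_space2)
         (use total_space(1) borel_measurable_continuous_on_restrict[OF continuous_total(1)] in \<open>auto simp: space_restrict_space\<close>)
    \<comment> \<open>A simple function below the right-hand integrand is pulled back to the total
      space and divided by the length of the fibre, so that integration along the fibre returns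
      it.\<close>
    define g' where "g' y = ennreal (1 / (2 * pi)) * g (\<rho> y)" for y
    have g'm: "g' \<in> borel_measurable (restrict_space borel Xt)"
      unfolding g'_def using measurable_compose[OF \<rho>m gm] by measurable
    obtain k where k: "(\<integral>\<^sup>+y. g' y \<partial>\<mu>t) = (\<integral>\<^sup>+p. k p \<partial>\<mu>)"
      "\<And>p. p \<in> X \<Longrightarrow> \<exists>z. norm z = 1 \<and> f p = hopf z \<and> k p = fibre_integral g' p z"
      using disintegration[OF \<mu> \<mu>t g'm] by blast
    have one: "ennreal (1 / (2 * pi)) * ennreal (2 * pi) = 1" by (simp add: ennreal_mult[symmetric])
    have "integral\<^sup>S \<mu> g = (\<integral>\<^sup>+p. g p \<partial>\<mu>)" using nn_integral_eq_simple_integral[OF g(1)] by simp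
    also have "\<dots> = (\<integral>\<^sup>+p. k p \<partial>\<mu>)"
    proof (rule nn_integral_cong)
      fix p assume "p \<in> space \<mu>"
      then have p: "p \<in> X" using is_rvol_space[OF \<mu>] by simp
      obtain z where z: "norm z = 1" "f p = hopf z" "k p = fibre_integral g' p z" using k(2)[OF p] by blast
      have "k p = (\<integral>\<^sup>+t. (ennreal (1 / (2 * pi)) * g p) * indicator {-pi<..<pi} t \<partial>lborel)"
        unfolding z(3) fibre_integral_def g'_def by (simp add: fp(2)[OF p z(1,2)])
      also have "\<dots> = g p * (ennreal (1 / (2 * pi)) * ennreal (2 * pi))" unfolding lev by (simp only: mult_ac)
      finally show "g p = k p" using one by simp
    qed
    also have "\<dots> = (\<integral>\<^sup>+y. g' y \<partial>\<mu>t)" using k(1) by simp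
    also have "\<dots> \<le> (\<integral>\<^sup>+y. h (\<rho> y) \<partial>\<mu>t)"
    proof (rule nn_integral_mono)
      fix y
      have "g' y \<le> ennreal (1 / (2 * pi)) * (ennreal (2 * pi) * h (\<rho> y))"
        unfolding g'_def by (intro mult_left_mono g) simp
      also have "\<dots> = h (\<rho> y)" using one by (simp add: mult.assoc[symmetric])
      finally show "g' y \<le> h (\<rho> y)" .
    qed
    finally show "integral\<^sup>S \<mu> g \<le> (\<integral>\<^sup>+y. h (\<rho> y) \<partial>\<mu>t)" .
  qed
qed

end

section \<open>Projective space, the sphere, and complex manifolds\<close>

text \<open>Induction over a complex basis: each new vector \<open>b\<close> contributes the two
  real directions \<open>b\<close> and \<open>\<i> *s b\<close>.\<close>

lemma dim_complex_subspace:
  assumes W: "vec.subspace (W :: (complex^'k) set)"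
  shows "subspace W" "dim W = 2 * vec.dim W"
proof -
  have sub: "subspace S" if "vec.subspace S" for S :: "(complex^'k) set"
    using that unfolding subspace_def vec.subspace_def by (auto simp: scaleR_eq_scale)
  show "subspace W" by (rule sub[OF W])
  have "dim (vec.span B) = 2 * card B" if "finite B" "vec.independent B" for B :: "(complex^'k) set"
    using that
  proof (induction B rule: finite_induct)
    case empty
    then show ?case by (simp add: dim_eq_0)
  next
    case (insert b B)
    let ?S = "vec.span B"
    have b: "b \<notin> ?S" and B: "vec.independent B" using insert by (auto simp: vec.independent_insert)
    have S: "subspace ?S" and S': "subspace (vec.span (insert b B))" by (simp_all add: sub)
    \<comment> \<open>A real dependence would put a multiple of \<open>b\<close> with coefficient
      \<open>\<i> - of_real r\<close> into the old complex span. That coefficient is nonzero, hence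
      invertible.\<close>
    have ib: "\<i> *s b \<notin> span (insert b ?S)"
    proof
      assume "\<i> *s b \<in> span (insert b ?S)"
      then obtain r where "\<i> *s b - r *\<^sub>R b \<in> ?S"
        using S by (auto simp: span_breakdown_eq span_eq_iff[THEN iffD2])
      then have "(\<i> - of_real r) *s b \<in> ?S" by (simp add: scaleR_eq_scale vec.scale_left_diff_distrib)
      moreover have nz: "\<i> - of_real r \<noteq> 0" by (simp add: complex_eq_iff)
      have "inverse (\<i> - of_real r) *s ((\<i> - of_real r) *s b) = b"
        unfolding vector_smult_assoc left_inverse[OF nz] by simp
      ultimately show False using b vec.span_scale by metis
    qed
    have "span (insert (\<i> *s b) (insert b ?S)) = vec.span (insert b B)"
    proof (intro equalityI span_minimal S')
      have "b \<in> vec.span (insert b B)" by (simp add: vec.span_base)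
      then show "insert (\<i> *s b) (insert b ?S) \<subseteq> vec.span (insert b B)"
        using vec.span_mono[of B "insert b B"] by (auto intro: vec.span_scale)
      show "vec.span (insert b B) \<subseteq> span (insert (\<i> *s b) (insert b ?S))"
      proof
        fix x assume "x \<in> vec.span (insert b B)"
        then obtain k where k: "x - k *s b \<in> ?S" by (auto simp: vec.span_breakdown_eq)
        have "x = (x - k *s b) + (Re k *\<^sub>R b + Im k *\<^sub>R (\<i> *s b))"
          by (simp add: vec_eq_iff scaleR_conv_of_real[where 'a=complex] complex_eq_iff algebra_simps)
        also have "\<dots> \<in> span (insert (\<i> *s b) (insert b ?S))"
          using k by (intro span_add span_scale span_base) auto
        finally show "x \<in> span (insert (\<i> *s b) (insert b ?S))" .
      qed
    qed
    then have "dim (vec.span (insert b B)) = dim (insert (\<i> *s b) (insert b ?S))"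
      using dim_span by metis
    also have "\<dots> = dim ?S + 2" using b ib S by (simp add: dim_insert span_eq_iff[THEN iffD2])
    finally show ?case using insert B by simp
  qed
  moreover obtain B where B: "B \<subseteq> W" "vec.independent B" "W \<subseteq> vec.span B" "card B = vec.dim W"
    using vec.basis_exists by blast
  moreover have "vec.span B = W" using B vec.span_minimal[OF B(1) W] by auto
  ultimately show "dim W = 2 * vec.dim W" using vec.independent_bound_general[OF B(2)] by (metis vec.finiteI_independent)
qed

text \<open>\<open>regular_params\<close> asks for model spaces inside the type of the target, while
  complex charts live in \<open>complex^'k\<close> and affine charts in \<open>complex^'n\<close>.
  An isometric linear copy of the model space bridges this without altering the image or the tangent
  spaces.\<close>

lemma chart_transfer:
  fixes \<psi> :: "'a::euclidean_space \<Rightarrow> 'x::topological_space" and F :: "'x \<Rightarrow> 'v::euclidean_space"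
  assumes W: "subspace W" "dim W = n" and d: "n < DIM('v)" and lp: "local_param X W D \<psi>"
    and s: "smooth_map_on W D (F \<circ> \<psi>)" and inj: "\<And>u x. u \<in> D \<Longrightarrow> x \<in> W \<Longrightarrow> fd D (F \<circ> \<psi>) u x = 0 \<Longrightarrow> x = 0"
  obtains W' D' \<psi>' where "(W', D', \<psi>') \<in> regular_params n X F" "\<psi>' ` D' = \<psi> ` D"
    "\<And>u. u \<in> D \<Longrightarrow> tangent_space n X F (\<psi> u) = fd D (F \<circ> \<psi>) u ` W"
proof -
  obtain L :: "'a \<Rightarrow> 'v" and e R where LR: "line_embedding W L e R"
    using line_embedding_exists[OF W(1)] d W(2) by auto
  have L: "isometric_on W L" "linear L" and R: "linear R" "\<And>x. x \<in> W \<Longrightarrow> R (L x) = x" "\<And>y. R y \<in> W"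
    using LR by (auto simp: line_embedding_def isometric_on_def)
  obtain g where o: "openin (top_of_set W) D" "openin (top_of_set X) (\<psi> ` D)" and g: "homeomorphism D (\<psi> ` D) \<psi> g"
    using lp by (auto simp: local_param_def)
  have D: "rel_open W D" using W o by (simp add: rel_open_def)
  have DW: "D \<subseteq> W" by (rule rel_openD(3)[OF D])
  let ?W = "L ` W" and ?D = "L ` D" and ?\<psi> = "\<psi> \<circ> R"
  have W': "subspace ?W" by (rule linear_subspace_image[OF L(2) W(1)])
  have dW: "dim ?W = n" using dim_image_eq[OF L(2), of W] isometric_on_inj[OF L(1) W(1)] W by (simp add: span_eq_iff[THEN iffD2])
  have RD: "R ` ?D = D" using R(2) DW by force
  have im: "?\<psi> ` ?D = \<psi> ` D" by (metis RD image_comp)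
  have cR: "continuous_on S R" for S by (rule linear_continuous_on) (simp add: R linear_conv_bounded_linear[symmetric])
  have cL: "continuous_on S L" for S by (rule linear_continuous_on) (simp add: L linear_conv_bounded_linear[symmetric])
  have D': "rel_open ?W ?D"
  proof -
    have "rel_open ?W (?W \<inter> R -` D)"
      by (rule rel_open_vimage[of ?W ?W R W D]) (use W' cR R o in \<open>auto simp: rel_open_def\<close>)
    also have "?W \<inter> R -` D = ?D" using R(2) DW by auto
    finally show ?thesis .
  qed
  have h: "homeomorphism ?D (?\<psi> ` ?D) ?\<psi> (L \<circ> g)"
  proof (rule homeomorphismI)
    have c: "continuous_on D \<psi>" "continuous_on (\<psi> ` D) g" "\<And>x. x \<in> D \<Longrightarrow> g (\<psi> x) = x" using g by (auto simp: homeomorphism_def)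
    show "continuous_on ?D ?\<psi>" by (rule continuous_on_compose[OF cR]) (simp add: RD c)
    show "continuous_on (?\<psi> ` ?D) (L \<circ> g)" unfolding im by (rule continuous_on_compose[OF c(2) cL])
    show "(L \<circ> g) ` ?\<psi> ` ?D \<subseteq> ?D" unfolding im using c by auto
    show "(L \<circ> g) (?\<psi> x) = x" if "x \<in> ?D" for x using that c R(2) DW by auto
    show "?\<psi> ((L \<circ> g) y) = y" if "y \<in> ?\<psi> ` ?D" for y using that c R(2) DW unfolding im by auto
  qed auto
  have sm: "smooth_map_on ?W ?D (F \<circ> ?\<psi>)"
    unfolding smooth_map_on_def
  proof
    fix k
    have "Ck_on k ?W ?D (\<lambda>u. (F \<circ> \<psi>) (R u))"
      by (rule Ck_reparam[OF D D' R(1), where G="F \<circ> \<psi>"]) (use R RD s in \<open>auto simp: smooth_map_on_def\<close>)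
    then show "Ck_on k ?W ?D (F \<circ> ?\<psi>)" by (simp add: comp_def)
  qed
  have fd': "fd ?D (F \<circ> ?\<psi>) (L u) (L x) = fd D (F \<circ> \<psi>) u x" if u: "u \<in> D" and x: "x \<in> W" for u x
  proof -
    have "((F \<circ> \<psi>) \<circ> R has_derivative fd D (F \<circ> \<psi>) (R (L u)) \<circ> R) (at (L u) within ?D)"
    proof (rule diff_chain_within)
      show "(R has_derivative R) (at (L u) within ?D)"
        using R(1) by (simp add: linear_imp_has_derivative)
      show "(F \<circ> \<psi> has_derivative fd D (F \<circ> \<psi>) (R (L u))) (at (R (L u)) within R ` ?D)"
        unfolding RD using smooth_has_derivative[OF s u] R(2) u DW by (simp add: subset_iff)
    qed
    from fd_eq[OF D' _ _ this, of "L x"] show ?thesis using u x DW R(2) by (simp add: comp_assoc subset_iff)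
  qed
  have p: "(?W, ?D, ?\<psi>) \<in> regular_params n X F"
  proof -
    have "openin (top_of_set X) (?\<psi> ` ?D)" unfolding im by (rule o(2))
    moreover have "\<forall>y\<in>?D. \<forall>z\<in>?W. fd ?D (F \<circ> ?\<psi>) y z = 0 \<longrightarrow> z = 0"
    proof (intro ballI impI)
      fix y z assume "y \<in> ?D" "z \<in> ?W" and 0: "fd ?D (F \<circ> ?\<psi>) y z = 0"
      then obtain u x where ux: "u \<in> D" "x \<in> W" "y = L u" "z = L x" by auto
      have "x = 0" using inj[OF ux(1,2)] 0 fd'[OF ux(1,2)] ux(3,4) by simp
      then show "z = 0" using ux(4) by (simp add: linear_0[OF L(2)])
    qed
    ultimately show ?thesis using W' dW rel_openD(2)[OF D'] h sm unfolding regular_params_def local_param_def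
      by (simp only: mem_Collect_eq case_prod_conv) blast
  qed
  have t: "tangent_space n X F (\<psi> u) = fd D (F \<circ> \<psi>) u ` W" if u: "u \<in> D" for u
    using tangent_space_eq[OF p, of "L u"] u R(2) DW fd'[OF u] by (auto simp: image_image subset_iff)
  show thesis by (rule that[OF p im t])
qed

subsection \<open>Projective space\<close>

lemma hinner_scale_unit: "norm c = 1 \<Longrightarrow> hinner (c *s a) (c *s b) = hinner a b"
  using complex_norm_square[of c] by (simp add: hinner_scale_left hinner_scale_right mult.assoc[symmetric] mult.commute[of "cnj c"])

lemma proj_point_scale:
  assumes "c \<noteq> 0" "w \<noteq> (0 :: complex^'n)" shows "proj_point (c *s w) = proj_point w"
proof -
  have "(c *s w) /\<^sub>R norm (c *s w) = (c / of_real (norm c)) *s (w /\<^sub>R norm w)"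
    using assms by (simp add: norm_scale_complex scaleR_eq_scale vec_eq_iff field_simps)
  then show ?thesis using assms by (simp add: proj_point_def hopf_unit norm_divide)
qed

lemma proj_point_unit: "norm z = 1 \<Longrightarrow> proj_point z = hopf z"
  by (simp add: proj_point_def)

lemma proj_point_CP: "w \<noteq> 0 \<Longrightarrow> proj_point w \<in> CP"
  unfolding CP_iff proj_point_def by (intro exI[of _ "w /\<^sub>R norm w"]) simp

definition affine_space :: "'n \<Rightarrow> (complex^'n) set" where "affine_space j = {w. w $ j = 0}"

text \<open>The standard affine chart in which the homogeneous coordinate number \<open>j\<close> is
  normalized to one; the remaining coordinates form the complex hyperplane
  \<open>affine_space j\<close>.\<close>

definition affine_chart :: "'n \<Rightarrow> complex^'n \<Rightarrow> complex^'n^'n" where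
  "affine_chart j w = proj_point (axis j 1 + w)"

lemma affine_space:
  assumes N: "CARD('n) = N + 1"
  shows "subspace (affine_space (j :: 'n::finite))" "dim (affine_space j) = 2 * N"
proof -
  have s: "vec.subspace (affine_space j)" by (auto simp: vec.subspace_def affine_space_def)
  have "affine_space j = {x. \<forall>i. i \<notin> UNIV - {j} \<longrightarrow> x $ i = 0}" by (auto simp: affine_space_def)
  then have "vec.dim (affine_space j) = N" using dim_substandard_cart[of "UNIV - {j}"] N by (simp add: card_Diff_singleton)
  then show "subspace (affine_space j)" "dim (affine_space j) = 2 * N" using dim_complex_subspace[OF s] by auto
qed

lemma affine_chart_nonzero: "w \<in> affine_space j \<Longrightarrow> axis j 1 + w \<noteq> 0" "w \<in> affine_space j \<Longrightarrow> (axis j 1 + w) $ j = 1"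
  unfolding affine_space_def vec_eq_iff by (auto intro!: exI[of _ j])

text \<open>Column \<open>j\<close> of the projection matrix is a multiple of the homogeneous
  coordinate vector, so quotients by its diagonal entry recover that vector. This is the continuous
  inverse of the chart.\<close>

lemma affine_chart_ratio:
  assumes w: "w \<in> affine_space j"
  shows "affine_chart j w $ j $ j \<noteq> 0" "affine_chart j w $ i $ j / affine_chart j w $ j $ j = (axis j 1 + w) $ i"
proof -
  have "norm (axis j 1 + w) \<noteq> 0" using affine_chart_nonzero[OF w] by simp
  then show "affine_chart j w $ j $ j \<noteq> 0" "affine_chart j w $ i $ j / affine_chart j w $ j $ j = (axis j 1 + w) $ i"
    using affine_chart_nonzero(2)[OF w]
    by (simp_all del: norm_eq_zero add: affine_chart_def proj_point_def hopf_def scaleR_conv_of_real[where 'a=complex])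
qed

lemma affine_chart_onto:
  assumes z: "norm z = 1" and j: "z $ j \<noteq> 0"
  shows "inverse (z $ j) *s z - axis j 1 \<in> affine_space j" "affine_chart j (inverse (z $ j) *s z - axis j 1) = hopf z"
proof -
  have "z \<noteq> 0" using z by auto
  then show "inverse (z $ j) *s z - axis j 1 \<in> affine_space j" "affine_chart j (inverse (z $ j) *s z - axis j 1) = hopf z"
    using j z proj_point_scale[of "inverse (z $ j)" z] proj_point_unit[OF z]
    by (auto simp: affine_space_def affine_chart_def)
qed

lemma affine_chart_local_param:
  assumes N: "CARD('n) = N + 1"
  shows "local_param CP (affine_space (j :: 'n::finite)) (affine_space j) (affine_chart j)"
proof -
  let ?g = "\<lambda>q :: complex^'n^'n. (\<chi> i. q $ i $ j / q $ j $ j) - axis j 1"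
  have im: "affine_chart j ` affine_space j = CP \<inter> (\<lambda>q. q $ j $ j) -` (- {0})"
  proof (intro equalityI subsetI)
    fix q assume "q \<in> affine_chart j ` affine_space j"
    then show "q \<in> CP \<inter> (\<lambda>q. q $ j $ j) -` (- {0})"
      using affine_chart_ratio(1) affine_chart_nonzero proj_point_CP by (force simp: affine_chart_def)
  next
    fix q :: "complex^'n^'n" assume q: "q \<in> CP \<inter> (\<lambda>q. q $ j $ j) -` (- {0})"
    then obtain z where z: "norm z = 1" "q = hopf z" by (auto simp: CP_iff)
    then have "z $ j \<noteq> 0" using q by (auto simp: hopf_def)
    then show "q \<in> affine_chart j ` affine_space j" using affine_chart_onto[OF z(1)] z(2) by (metis image_eqI)
  qed
  have cj: "continuous_on S (\<lambda>q :: complex^'n^'n. q $ i $ j)" for S i by (intro continuous_intros)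
  have o: "openin (top_of_set CP) (affine_chart j ` affine_space j)"
    unfolding im by (rule continuous_openin_preimage_gen[OF cj]) (simp add: open_Compl)
  have inv: "?g (affine_chart j w) = w" if "w \<in> affine_space j" for w
    using affine_chart_ratio[OF that] by (simp add: vec_eq_iff)
  have "homeomorphism (affine_space j) (affine_chart j ` affine_space j) (affine_chart j) ?g"
  proof (rule homeomorphismI)
    show "continuous_on (affine_space j) (affine_chart j)"
    proof -
      have w: "rel_open (affine_space j) (affine_space j)" using affine_space[OF N] by (simp add: rel_open_def)
      have "smooth_map_on (affine_space j) (affine_space j) (\<lambda>w. axis j 1 + w)"
        unfolding smooth_map_on_def by (intro allI Ck_add[OF w] Ck_const[OF w] Ck_id[OF w])
      from smooth_continuous[OF smooth_proj_point[OF w this affine_chart_nonzero(1)]] show ?thesis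
        by (simp add: affine_chart_def[abs_def])
    qed
    show "continuous_on (affine_chart j ` affine_space j) ?g"
      by (intro continuous_intros cj) (auto simp: im)
  qed (use inv in auto)
  then show ?thesis unfolding local_param_def using o by auto
qed

lemma smooth_affine_chart:
  assumes N: "CARD('n) = N + 1" and w: "w \<in> affine_space (j :: 'n::finite)" and x: "x \<in> affine_space j"
  shows "smooth_map_on (affine_space j) (affine_space j) (affine_chart j)"
    and "fd (affine_space j) (affine_chart j) w x = hopf_deriv ((axis j 1 + w) /\<^sub>R norm (axis j 1 + w))
      (inverse (norm (axis j 1 + w)) *\<^sub>R horiz ((axis j 1 + w) /\<^sub>R norm (axis j 1 + w)) x)"
proof -
  let ?G = "\<lambda>w. axis j 1 + w"
  have D: "rel_open (affine_space j) (affine_space j)" using affine_space[OF N] by (simp add: rel_open_def)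
  have G: "smooth_map_on (affine_space j) (affine_space j) ?G"
    unfolding smooth_map_on_def by (intro allI Ck_add[OF D] Ck_const[OF D] Ck_id[OF D])
  show "smooth_map_on (affine_space j) (affine_space j) (affine_chart j)"
    using smooth_proj_point[OF D G affine_chart_nonzero(1)] by (simp add: affine_chart_def[abs_def])
  have "(?G has_derivative (\<lambda>x. x)) (at w within affine_space j)" by (auto intro!: derivative_eq_intros)
  from fd_eq[OF D w x this] have f: "fd (affine_space j) ?G w x = x" by simp
  from fd_proj_point[OF D G w x affine_chart_nonzero(1), of "affine_chart j"]
  show "fd (affine_space j) (affine_chart j) w x = hopf_deriv (?G w /\<^sub>R norm (?G w))
      (inverse (norm (?G w)) *\<^sub>R horiz (?G w /\<^sub>R norm (?G w)) x)"
    unfolding f by (simp add: affine_chart_def)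
qed

lemma CP_chart:
  assumes N: "CARD('n) = N + 1"
  obtains W D \<psi> where "(W, D, \<psi>) \<in> regular_params (2 * N) (CP :: (complex^'n^'n) set) id"
    "\<psi> ` D = affine_chart j ` affine_space j"
    "\<And>w. w \<in> affine_space (j :: 'n::finite) \<Longrightarrow> tangent_space (2 * N) CP id (affine_chart j w) =
       fd (affine_space j) (affine_chart j) w ` affine_space j"
proof -
  have d: "2 * N < DIM(complex^'n^'n)" using N by simp
  have inj: "x = 0" if w: "w \<in> affine_space j" and x: "x \<in> affine_space j"
    and 0: "fd (affine_space j) (id \<circ> affine_chart j) w x = 0" for w x
  proof -
    let ?G = "axis j 1 + w" let ?z = "?G /\<^sub>R norm ?G"
    note nz = affine_chart_nonzero[OF w]
    have z: "norm ?z = 1" using nz by simp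
    have "hopf_deriv ?z (inverse (norm ?G) *\<^sub>R horiz ?z x) = hopf_deriv ?z 0"
      using 0 smooth_affine_chart(2)[OF N w x] by (simp add: linear_0[OF linear_hopf_deriv])
    then have "inverse (norm ?G) *\<^sub>R horiz ?z x = 0"
      by (intro hopf_deriv_inj_horizontal[OF z]) (simp_all add: hinner_scaleR_left hinner_horiz[OF z])
    \<comment> \<open>The kernel would be a complex multiple of \<open>?z\<close>. Its entry at
      \<open>j\<close> is zero for \<open>x\<close> but nonzero for \<open>?z\<close>, so the
      multiple vanishes.\<close>
    then have "x = hinner x ?z *s ?z" using nz by (simp add: horiz_def)
    moreover have "?z $ j \<noteq> 0" using nz by simp
    moreover have "x $ j = hinner x ?z * ?z $ j" using calculation(1) by (metis vector_smult_component)
    ultimately show ?thesis using x by (simp add: affine_space_def)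
  qed
  obtain W D \<psi> where "(W, D, \<psi>) \<in> regular_params (2 * N) (CP :: (complex^'n^'n) set) id"
    "\<psi> ` D = affine_chart j ` affine_space j"
    "\<And>w. w \<in> affine_space j \<Longrightarrow> tangent_space (2 * N) CP id (affine_chart j w) = fd (affine_space j) (id \<circ> affine_chart j) w ` affine_space j"
    by (rule chart_transfer[OF affine_space[OF N] d affine_chart_local_param[OF N], where F=id])
       (use inj smooth_affine_chart(1)[OF N, of 0 _ 0] in \<open>auto simp: affine_space_def\<close>)
  then show thesis using that by simp
qed

lemma tangent_space_CP:
  assumes N: "CARD('n) = N + 1" and z: "norm z = 1"
  shows "tangent_space (2 * N) (CP :: (complex^'n^'n) set) id (hopf z) = {hopf_deriv z h | h. hinner h z = 0}"
proof -
  have "z \<noteq> 0" using z by auto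
  then obtain j where j: "z $ j \<noteq> 0" by (auto simp: vec_eq_iff)
  let ?w = "inverse (z $ j) *s z - axis j 1"
  let ?G = "axis j 1 + ?w" let ?z = "?G /\<^sub>R norm ?G"
  \<comment> \<open>The phase that rotates \<open>z\<close> to the unit representative selected by
    the affine chart, whose coordinate \<open>j\<close> is positive.\<close>
  define c where "c = inverse (z $ j) * of_real (norm (z $ j))"
  have c: "norm c = 1" "c \<noteq> 0" using j by (auto simp: c_def norm_mult norm_inverse)
  have zc: "?z = c *s z" using z j by (simp add: c_def norm_scale_complex scaleR_eq_scale norm_inverse mult.commute)
  have nG: "norm ?G \<noteq> 0" using z j by (simp add: norm_scale_complex norm_inverse)
  have nz: "norm (c *s z) = 1" using c z by (simp add: norm_scale_complex)
  note o = affine_chart_onto[OF z j]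
  obtain W D \<psi> where t: "\<And>w. w \<in> affine_space j \<Longrightarrow> tangent_space (2 * N) (CP :: (complex^'n^'n) set) id (affine_chart j w) =
       fd (affine_space j) (affine_chart j) w ` affine_space j" by (rule CP_chart[OF N, of j]) blast
  have T: "tangent_space (2 * N) CP id (hopf z) = (\<lambda>x. hopf_deriv (c *s z) (inverse (norm ?G) *\<^sub>R horiz (c *s z) x)) ` affine_space j"
    using t[OF o(1)] smooth_affine_chart(2)[OF N o(1)] unfolding o(2) zc by (auto cong: image_cong)
  show ?thesis unfolding T
  proof (intro equalityI subsetI)
    fix y assume "y \<in> (\<lambda>x. hopf_deriv (c *s z) (inverse (norm ?G) *\<^sub>R horiz (c *s z) x)) ` affine_space j"
    then obtain x where y: "y = hopf_deriv (c *s z) (inverse (norm ?G) *\<^sub>R horiz (c *s z) x)" by auto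
    let ?k = "inverse (norm ?G) *\<^sub>R horiz (c *s z) x" let ?h = "inverse c *s ?k"
    have k: "?k = c *s ?h" using c by simp
    have "hinner ?k (c *s z) = 0" by (simp only: hinner_scaleR_left hinner_horiz[OF nz]) simp
    then have "hinner ?h z = 0" using hinner_scale_unit[OF c(1), of ?h z] k by simp
    moreover have "y = hopf_deriv z ?h" using hopf_deriv_unit[OF c(1), of z ?h] y k by simp
    ultimately show "y \<in> {hopf_deriv z h | h. hinner h z = 0}" by blast
  next
    fix y assume "y \<in> {hopf_deriv z h | h. hinner h z = 0}"
    then obtain h where h: "y = hopf_deriv z h" "hinner h z = 0" by auto
    \<comment> \<open>The rotated horizontal vector is corrected by a multiple of
      \<open>c *s z\<close> to make its coordinate \<open>j\<close> vanish. The correction is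
      invisible after the horizontal projection.\<close>
    define x where "x = norm ?G *\<^sub>R (c *s h - (h $ j / z $ j) *s (c *s z))"
    have x: "x \<in> affine_space j" using j by (simp add: x_def affine_space_def)
    have "horiz (c *s z) x = norm ?G *\<^sub>R (horiz (c *s z) (c *s h) - (h $ j / z $ j) *s horiz (c *s z) (c *s z))"
      unfolding x_def by (simp only: linear_scale[OF linear_horiz] linear_diff[OF linear_horiz] horiz_scale)
    also have "horiz (c *s z) (c *s z) = 0" by (rule horiz_self[OF nz])
    also have "horiz (c *s z) (c *s h) = c *s h" by (rule horiz_id) (simp add: hinner_scale_unit[OF c(1)] h)
    finally have "inverse (norm ?G) *\<^sub>R horiz (c *s z) x = c *s h" using nG by simp
    then have "y = hopf_deriv (c *s z) (inverse (norm ?G) *\<^sub>R horiz (c *s z) x)" using hopf_deriv_unit[OF c(1), of z h] h by simp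
    then show "y \<in> (\<lambda>x. hopf_deriv (c *s z) (inverse (norm ?G) *\<^sub>R horiz (c *s z) x)) ` affine_space j" using x by blast
  qed
qed

lemma hopf_base_CP:
  assumes N: "CARD('n) = N + 1"
  shows "hopf_base (CP :: (complex^'n^'n) set) id N"
proof
  have "\<exists>c. c \<in> regular_params (2 * N) (CP :: (complex^'n^'n) set) id \<and> (case c of (W, D, \<psi>) \<Rightarrow> \<psi> ` D) = affine_chart j ` affine_space j" for j :: 'n
    by (rule CP_chart[OF N, of j]) blast
  then obtain C where C: "\<And>j. C j \<in> regular_params (2 * N) (CP :: (complex^'n^'n) set) id"
    "\<And>j. (case C j of (W, D, \<psi>) \<Rightarrow> \<psi> ` D) = affine_chart j ` affine_space j" by metis
  have "(\<Union>c\<in>range C. case c of (W, D, \<psi>) \<Rightarrow> \<psi> ` D) = (\<Union>j. affine_chart j ` affine_space j)" using C by auto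
  also have "\<dots> = CP"
  proof (intro equalityI subsetI)
    fix q :: "complex^'n^'n" assume "q \<in> (\<Union>j. affine_chart j ` affine_space j)"
    then show "q \<in> CP" using proj_point_CP affine_chart_nonzero(1) by (auto simp: affine_chart_def)
  next
    fix q :: "complex^'n^'n" assume "q \<in> CP"
    then obtain z where z: "norm z = 1" "q = hopf z" by (auto simp: CP_iff)
    then have "z \<noteq> 0" by auto
    then obtain j where j: "z $ j \<noteq> 0" by (auto simp: vec_eq_iff)
    have "q = affine_chart j (inverse (z $ j) *s z - axis j 1)" using affine_chart_onto(2)[OF z(1) j] z(2) by simp
    then show "q \<in> (\<Union>j. affine_chart j ` affine_space j)" using affine_chart_onto(1)[OF z(1) j] by blast
  qed
  finally show "\<exists>P. finite P \<and> P \<subseteq> regular_params (2 * N) (CP :: (complex^'n^'n) set) id \<and> (\<Union>(W, D, \<psi>)\<in>P. \<psi> ` D) = CP"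
    using C(1) by (intro exI[of _ "range C"]) auto
  show "id p \<in> CP" if "p \<in> CP" for p :: "complex^'n^'n" using that by simp
  show "N < CARD('n)" using N by simp
  fix p :: "complex^'n^'n" and z h
  assume "norm z = 1" "id p = hopf z" "hinner h z = 0"
  then show "hopf_deriv z (\<i> *s h) \<in> tangent_space (2 * N) CP id p"
    using tangent_space_CP[OF N] by (auto simp: hinner_scale_left intro!: exI[of _ "\<i> *s h"])
qed

subsection \<open>The sphere\<close>

lemma hopf_bundle_sphere:
  assumes N: "CARD('n) = N + 1"
  shows "hopf_bundle (CP :: (complex^'n^'n) set) id N (sphere 0 1) id hopf snd"
proof -
  interpret hopf_base "CP :: (complex^'n^'n) set" id N by (rule hopf_base_CP[OF N])
  have c: "continuous_on (sphere 0 1) (hopf :: complex^'n \<Rightarrow> _)"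
    using hopf_has_derivative has_derivative_continuous by (blast intro: continuous_at_imp_continuous_on)
  show ?thesis
  proof
    show "homeomorphism (sphere 0 1) (circle_bundle CP id) (\<lambda>y :: complex^'n. (hopf y, id y)) snd"
      by (rule homeomorphismI) (auto intro!: continuous_on_Pair c continuous_on_id continuous_on_snd simp: circle_bundle_def CP_iff)
  qed
qed

lemma tangent_space_sphere:
  assumes N: "CARD('n) = N + 1" and z: "norm (z :: complex^'n) = 1"
  shows "tangent_space (2 * N + 1) (sphere 0 1) id z = {h. h \<bullet> z = 0}"
proof -
  interpret hopf_bundle "CP :: (complex^'n^'n) set" id N "sphere 0 1" id hopf snd by (rule hopf_bundle_sphere[OF N])
  have "hopf_deriv z h \<in> tangent_space (2 * N) CP id (hopf z)" if "h \<bullet> z = 0" for h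
    using tangent_space_CP[OF N z] hopf_deriv_horiz[OF that] hinner_horiz[OF z] by auto
  then show ?thesis using tangent_space_total[of z] z by auto
qed

lemma volume_sphere:
  assumes N: "CARD('n) = N + 1"
  shows "emeasure (riemannian_volume (2 * N + 1) (sphere (0 :: complex^'n) 1) id) (sphere 0 1) =
    ennreal (2 * pi) * emeasure (riemannian_volume (2 * N) (CP :: (complex^'n^'n) set) id) CP"
proof -
  interpret hopf_bundle "CP :: (complex^'n^'n) set" id N "sphere 0 1" id hopf snd by (rule hopf_bundle_sphere[OF N])
  have "(\<integral>\<^sup>+y. 1 \<partial>riemannian_volume (2 * N + 1) (sphere (0 :: complex^'n) 1) id) =
    (\<integral>\<^sup>+p. ennreal (2 * pi) * 1 \<partial>riemannian_volume (2 * N) (CP :: (complex^'n^'n) set) id)"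
    using nn_integral_total[OF rvol_base rvol_total, of "\<lambda>_. 1"] by simp
  then show ?thesis using is_rvol_space[OF rvol_base] is_rvol_space[OF rvol_total] by (simp del: One_nat_def)
qed

subsection \<open>Complex manifolds\<close>

text \<open>Compactness reduces the atlas to a finite cover. Smoothness of \<open>f\<close> in
  charts is glued from local homogeneous coordinates. Tangent spaces are complex because the
  holomorphic derivative commutes with multiplication by \<open>\<i>\<close>, and so does the
  horizontal projection.\<close>

lemma hopf_base_complex_manifold:
  fixes M :: "'p::t2_space set" and \<A> :: "(complex^'k, 'p) param set" and f :: "'p \<Rightarrow> complex^'n^'n"
  assumes N: "m < CARD('n)" and M: "complex_manifold m M \<A>" "compact M" and f: "holomorphic_immersion \<A> f"
  shows "hopf_base M f m"
proof
  let ?P = "regular_params (2 * m) M f"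
  have d: "2 * m < DIM(complex^'n^'n)" using N by (simp add: less_le_trans[OF N])
  have chart: "vec.subspace W" "subspace W" "dim W = 2 * m" "rel_open W D" "local_param M W D \<psi>"
    "smooth_map_on W D (f \<circ> \<psi>)" "\<And>u x. u \<in> D \<Longrightarrow> x \<in> W \<Longrightarrow> fd D (f \<circ> \<psi>) u x = 0 \<Longrightarrow> x = 0"
    "\<And>u. u \<in> D \<Longrightarrow> \<exists>D' G. rel_open W D' \<and> u \<in> D' \<and> D' \<subseteq> D \<and> holomorphic_map_on W D' (G :: complex^'k \<Rightarrow> complex^'n) \<and>
       (\<forall>w\<in>D'. G w \<noteq> 0 \<and> f (\<psi> w) = proj_point (G w))"
    if c: "(W, D, \<psi>) \<in> \<A>" for W D \<psi>
  proof -
    show v: "vec.subspace W" and lp: "local_param M W D \<psi>" using M(1) c by (auto simp: complex_manifold_def)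
    have "vec.dim W = m" using M(1) c by (auto simp: complex_manifold_def)
    then show W: "subspace W" and "dim W = 2 * m" using dim_complex_subspace[OF v] by auto
    show D: "rel_open W D" using lp W by (auto simp: local_param_def rel_open_def)
    show ex: "\<exists>D' G. rel_open W D' \<and> u \<in> D' \<and> D' \<subseteq> D \<and> holomorphic_map_on W D' (G :: complex^'k \<Rightarrow> complex^'n) \<and>
       (\<forall>w\<in>D'. G w \<noteq> 0 \<and> f (\<psi> w) = proj_point (G w))" if "u \<in> D" for u
      using f c that W unfolding holomorphic_immersion_def rel_open_def by fast
    show "x = 0" if "u \<in> D" "x \<in> W" "fd D (f \<circ> \<psi>) u x = 0" for u x
      using f c that unfolding holomorphic_immersion_def by fast
    show "smooth_map_on W D (f \<circ> \<psi>)"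
      unfolding smooth_map_on_def
    proof (intro allI Ck_local[OF D])
      fix k u assume "u \<in> D"
      then obtain D' and G :: "complex^'k \<Rightarrow> complex^'n" where G: "rel_open W D'" "u \<in> D'" "D' \<subseteq> D" "holomorphic_map_on W D' G"
        "\<forall>w\<in>D'. G w \<noteq> 0 \<and> f (\<psi> w) = proj_point (G w)" using ex by blast
      have "smooth_map_on W D' (\<lambda>w. proj_point (G w))"
        by (rule smooth_proj_point[OF G(1)]) (use G in \<open>auto simp: holomorphic_map_on_def\<close>)
      then have "smooth_map_on W D' (f \<circ> \<psi>)" by (rule smooth_cong[OF G(1), rotated]) (use G(5) in auto)
      then show "\<exists>D'. rel_open W D' \<and> u \<in> D' \<and> D' \<subseteq> D \<and> Ck_on k W D' (f \<circ> \<psi>)"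
        using G by (auto simp: smooth_map_on_def)
    qed
  qed
  have M_cover: "(\<Union>(W, D, \<psi>) \<in> \<A>. \<psi> ` D) = M" using M(1) by (simp add: complex_manifold_def)
  have point: "\<exists>W D \<psi> u. (W, D, \<psi>) \<in> \<A> \<and> u \<in> D \<and> p = \<psi> u" if "p \<in> M" for p
    using that M_cover by fast
  have transfer: "\<exists>c. c \<in> ?P \<and> (case c of (W', D', \<psi>') \<Rightarrow> \<psi>' ` D') = \<psi> ` D \<and>
      (\<forall>u\<in>D. tangent_space (2 * m) M f (\<psi> u) = fd D (f \<circ> \<psi>) u ` W)" if c: "(W, D, \<psi>) \<in> \<A>" for W D \<psi>
    by (rule chart_transfer[OF chart(2,3)[OF c] d chart(5-7)[OF c]]) (assumption | blast)+
  let ?im = "\<lambda>(W, D, \<psi>). \<psi> ` D"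
  have op: "openin (top_of_set M) s" if s: "s \<in> ?im ` \<A>" for s
  proof -
    obtain W D \<psi> where c: "(W, D, \<psi>) \<in> \<A>" "s = \<psi> ` D" using s by (force split: prod.splits)
    then show ?thesis using chart(5)[OF c(1)] by (simp add: local_param_def)
  qed
  define \<U> where "\<U> = ?im ` \<A>"
  have "(\<forall>c\<in>\<U>. openin (top_of_set M) c) \<and> M \<subseteq> \<Union>\<U>" using M_cover op unfolding \<U>_def by simp
  from M(2)[unfolded compact_eq_openin_cover, THEN spec, THEN mp, OF this]
  obtain S where S: "S \<subseteq> \<U>" "finite S" "M \<subseteq> \<Union>S" by blast
  have "\<forall>s\<in>S. \<exists>c. c \<in> ?P \<and> (case c of (W', D', \<psi>') \<Rightarrow> \<psi>' ` D') = s"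
  proof
    fix s assume "s \<in> S"
    then obtain W D \<psi> where c: "(W, D, \<psi>) \<in> \<A>" "s = \<psi> ` D" using S(1) unfolding \<U>_def by (force split: prod.splits)
    show "\<exists>c. c \<in> ?P \<and> (case c of (W', D', \<psi>') \<Rightarrow> \<psi>' ` D') = s" using transfer[OF c(1)] c(2) by blast
  qed
  from bchoice[OF this] obtain C where C: "\<forall>s\<in>S. C s \<in> ?P \<and> (case C s of (W', D', \<psi>') \<Rightarrow> \<psi>' ` D') = s" by blast
  have "(\<Union>c\<in>C ` S. case c of (W, D, \<psi>) \<Rightarrow> \<psi> ` D) = \<Union>S" using C by auto
  also have "\<dots> = M" using S(3) Union_mono[OF S(1)] M_cover unfolding \<U>_def by simp
  finally show "\<exists>P. finite P \<and> P \<subseteq> ?P \<and> (\<Union>(W, D, \<psi>)\<in>P. \<psi> ` D) = M"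
    using S(2) C by (intro exI[of _ "C ` S"]) auto
  show "f p \<in> CP" if p: "p \<in> M" for p
  proof -
    obtain W D \<psi> u where c: "(W, D, \<psi>) \<in> \<A>" "u \<in> D" "p = \<psi> u" using point[OF p] by blast
    from chart(8)[OF c(1,2)] show ?thesis using proj_point_CP c(3) by fastforce
  qed
  show "m < CARD('n)" by (rule N)
  fix p z and h :: "complex^'n"
  assume p: "p \<in> M" and z: "norm z = 1" "f p = hopf z" and h: "hinner h z = 0" and T: "hopf_deriv z h \<in> tangent_space (2 * m) M f p"
  obtain W D \<psi> u where c: "(W, D, \<psi>) \<in> \<A>" "u \<in> D" "p = \<psi> u" using point[OF p] by blast
  note ch = chart[OF c(1)]
  obtain D' and G :: "complex^'k \<Rightarrow> complex^'n" where G: "rel_open W D'" "u \<in> D'" "D' \<subseteq> D" "holomorphic_map_on W D' G"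
        "\<forall>w\<in>D'. G w \<noteq> 0 \<and> f (\<psi> w) = proj_point (G w)" using ch(8)[OF c(2)] by blast
  let ?z = "G u /\<^sub>R norm (G u)"
  \<comment> \<open>\<open>k\<close> is the horizontal lift, at the representative
    \<open>?z\<close>, of the derivative of \<open>f \<circ> \<psi>\<close>. Unlike that derivative,
    it takes values in a complex vector space, where complex linearity can be expressed.\<close>
  define k where "k x = inverse (norm (G u)) *\<^sub>R horiz ?z (fd D' G u x)" for x
  have fdk: "fd D (f \<circ> \<psi>) u x = hopf_deriv ?z (k x)" if "x \<in> W" for x
    using fd_proj_point[OF G(1) _ G(2) that, of G "f \<circ> \<psi>"] G fd_rel_open[OF ch(4) G(1,3,2), of "f \<circ> \<psi>"]
    by (auto simp: k_def holomorphic_map_on_def)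
  have nz: "norm ?z = 1" using G by simp
  have "hopf ?z = hopf z" using G z c by (auto simp: proj_point_def)
  then obtain a where a: "norm a = 1" "z = a *s ?z" using hopf_fibre[OF nz z(1)] by blast
  have a0: "a \<noteq> 0" using a by auto
  have tan: "tangent_space (2 * m) M f p = (\<lambda>x. hopf_deriv ?z (k x)) ` W"
    using transfer[OF c(1)] c(2,3) fdk by (auto cong: image_cong)
  have rot: "hopf_deriv z b = hopf_deriv ?z (inverse a *s b)" for b
    using hopf_deriv_unit[OF a(1), of ?z "inverse a *s b"] a a0 by simp
  obtain x where x: "x \<in> W" "hopf_deriv ?z (inverse a *s h) = hopf_deriv ?z (k x)" using T tan rot by auto
  have kx: "inverse a *s h = k x"
  proof (rule hopf_deriv_inj_horizontal[OF nz _ _ x(2)])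
    show "hinner (inverse a *s h) ?z = 0"
      using hinner_scale_unit[OF a(1), of "inverse a *s h" ?z] h a a0 by simp
    show "hinner (k x) ?z = 0" unfolding k_def hinner_scaleR_left hinner_horiz[OF nz] by simp
  qed
  have "fd D' G u (\<i> *s x) = \<i> *s fd D' G u x" using G x(1) by (auto simp: holomorphic_map_on_def)
  then have "k (\<i> *s x) = \<i> *s k x"
    by (simp only: k_def horiz_scale scaleR_eq_scale vector_smult_assoc mult.commute)
  then have "inverse a *s (\<i> *s h) = k (\<i> *s x)" using kx by (metis vector_smult_assoc mult.commute)
  moreover have "\<i> *s x \<in> W" by (rule vec.subspace_scale[OF ch(1) x(1)])
  ultimately show "hopf_deriv z (\<i> *s h) \<in> tangent_space (2 * m) M f p" using tan rot by auto
qed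

section \<open>Shape operators\<close>

context lift_chart
begin

text \<open>At angle \<open>0\<close> the factor \<open>cis\<close> disappears. Besides the second
  derivative of the section there remain two rotation terms, each of the form \<open>\<i>\<close>
  times a first derivative; a normal vector will annihilate both.\<close>

lemma hess_lift:
  assumes w: "w \<in> Dt" "w \<bullet> e = 0" and x: "\<xi> \<in> W" "\<eta> \<in> W"
  shows "hess Dt (F \<circ> \<Psi>) w (L \<xi> + \<sigma> *\<^sub>R e) (L \<eta> + \<tau> *\<^sub>R e) =
    hess D0 s (R w) \<xi> \<eta> + \<sigma> *\<^sub>R (\<i> *s fd D0 s (R w) \<eta>) + \<tau> *\<^sub>R (\<i> *s fd Dt (F \<circ> \<Psi>) w (L \<xi> + \<sigma> *\<^sub>R e))"
proof -
  have c0: "cis 0 = 1" by simp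
  have dF: "(F \<circ> \<Psi> has_derivative fd Dt (F \<circ> \<Psi>) w) (at w within Dt)"
    by (rule smooth_has_derivative[OF regular_paramsD(6)[OF lift_regular] w(1)])
  have "((\<lambda>w. \<i> *s (F \<circ> \<Psi>) w) has_derivative (\<lambda>y. \<i> *s fd Dt (F \<circ> \<Psi>) w y)) (at w within Dt)"
    by (rule bounded_linear.has_derivative[OF _ dF]) (simp add: linear_scale_complex linear_conv_bounded_linear[symmetric])
  from has_derivative_add[OF cis_rotation_derivative[OF w(1) hess_has_derivative[OF smooth_s DtD(1)[OF w(1)] x(2)]]
      has_derivative_scaleR_right[OF this, of \<tau>]]
  have "((\<lambda>w. fd Dt (F \<circ> \<Psi>) w (L \<eta> + \<tau> *\<^sub>R e)) has_derivative
    (\<lambda>y. hess D0 s (R w) (R y) \<eta> + (y \<bullet> e) *\<^sub>R (\<i> *s fd D0 s (R w) \<eta>) + \<tau> *\<^sub>R (\<i> *s fd Dt (F \<circ> \<Psi>) w y))) (at w within Dt)"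
    unfolding w(2) c0 vector_smult_lid
    by (rule has_derivative_transform[OF w(1), rotated]) (simp add: fd_Ft[OF _ x(2)] Ft_props)
  from fd_eq[OF Dt w(1) Wt_I[OF x(1)] this, of \<sigma>] show ?thesis by (simp add: hess_def coord[OF x(1)])
qed

text \<open>Product rule for the bilinear \<open>hopf_deriv\<close>. The last summand, quadratic in
  first derivatives of the section, vanishes against lifted normal vectors by
  \<open>hopf_deriv_inner_zero\<close>.\<close>

lemma hess_base:
  assumes u: "u \<in> D0" and x: "\<xi> \<in> W" "\<eta> \<in> W"
  shows "hess D (f \<circ> \<psi>) u \<xi> \<eta> = hopf_deriv (s u) (hess D0 s u \<xi> \<eta>) + hopf_deriv (fd D0 s u \<xi>) (fd D0 s u \<eta>)"
proof -
  have "((\<lambda>u. hopf_deriv (s u) (fd D0 s u \<eta>)) has_derivative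
     (\<lambda>\<xi>. hopf_deriv (s u) (hess D0 s u \<xi> \<eta>) + hopf_deriv (fd D0 s u \<xi>) (fd D0 s u \<eta>))) (at u within D0)"
    by (rule bounded_bilinear.FDERIV[OF bounded_bilinear_hopf_deriv smooth_has_derivative[OF smooth_s u] hess_has_derivative[OF smooth_s u x(2)]])
  then have "((\<lambda>u. fd D0 (f \<circ> \<psi>) u \<eta>) has_derivative
     (\<lambda>\<xi>. hopf_deriv (s u) (hess D0 s u \<xi> \<eta>) + hopf_deriv (fd D0 s u \<xi>) (fd D0 s u \<eta>))) (at u within D0)"
    by (rule has_derivative_transform[OF u, rotated]) (simp add: fd_s(1)[OF _ x(2)] fd_rel_open[OF r(3) D0])
  from fd_eq[OF D0(1) u x(1) this] show ?thesis
    using hess_restrict[OF r(3) D0 u r(6) x] by (simp add: hess_def)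
qed

end

text \<open>As a description, \<open>shape_operator\<close> is controlled only for normal
  \<open>v\<close> and tangent \<open>x\<close>. A globally defined \<open>A\<close>, linear in each
  argument, makes the integrand Borel measurable and justifies passing to \<open>- v\<close> and to
  multiples of \<open>v\<close>.\<close>

lemma shape_operator_linear_extension:
  assumes p: "(W, D, \<psi>) \<in> regular_params n X F" and u: "u \<in> D"
    and Y: "subspace (tangent_space k Y id (F (\<psi> u)))" "tangent_space n X F (\<psi> u) \<subseteq> tangent_space k Y id (F (\<psi> u))"
    and ex: "\<And>v. v \<in> normal_space k Y n X F (\<psi> u) \<Longrightarrow> \<exists>U V. \<psi> u \<in> U \<and> normal_field k Y n X F U V \<and> V (\<psi> u) = v"
  shows "\<exists>A. (\<forall>v. linear (A v)) \<and> (\<forall>x. linear (\<lambda>v. A v x)) \<and> (\<forall>v x. A v x \<in> tangent_space n X F (\<psi> u)) \<and>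
    (\<forall>v\<in>normal_space k Y n X F (\<psi> u). \<forall>x\<in>tangent_space n X F (\<psi> u). shape_operator k Y n X F (\<psi> u) v x = A v x)"
proof -
  let ?T = "tangent_space n X F (\<psi> u)" and ?d = "fd D (F \<circ> \<psi>) u"
  note r = regular_paramsD[OF p]
  have T: "subspace ?T" "?T = ?d ` W" using tangent_space_subspace[OF p u] tangent_space_eq[OF p u] by auto
  obtain g where g: "range g \<subseteq> W" "linear g" "\<forall>x\<in>W. g (?d x) = x"
    using linear_exists_left_inverse_on[OF linear_fd_param[OF p u] r(1) inj_on_fd_param[OF p u]] by blast
  have gW: "g x \<in> W" for x using g(1) by auto
  have dg: "?d (g x) = x" if "x \<in> ?T" for x using that T(2) g(3) by auto
  define A where "A v x = (\<Sum>b\<in>onb ?T. (v \<bullet> hess D (F \<circ> \<psi>) u (g x) (g b)) *\<^sub>R b)" for v x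
  have lin_h: "linear (\<lambda>\<xi>. hess D (F \<circ> \<psi>) u \<xi> (g b))" for b
    by (rule has_derivative_linear[OF hess_has_derivative[OF r(6) u gW]])
  have l1: "linear (A v)" for v
    unfolding A_def
    by (rule linearI) (simp_all add: linear_add[OF g(2)] linear_scale[OF g(2)] linear_add[OF lin_h] linear_scale[OF lin_h]
        inner_add_right scaleR_add_left sum.distrib scaleR_sum_right)
  have l2: "linear (\<lambda>v. A v x)" for x
    unfolding A_def by (rule linearI) (simp_all add: inner_add_left scaleR_add_left sum.distrib scaleR_sum_right)
  have AT: "A v x \<in> ?T" for v x
    unfolding A_def using onb_subset[OF T(1)] by (intro subspace_sum[OF T(1)] subspace_scale[OF T(1)]) auto
  have "shape_operator k Y n X F (\<psi> u) v x = A v x" if v: "v \<in> normal_space k Y n X F (\<psi> u)" and x: "x \<in> ?T" for v x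
  proof -
    note h = shape_operator_hess[OF p u gW[of x] Y ex[OF v], unfolded dg[OF x]]
    have "(\<Sum>b\<in>onb ?T. (shape_operator k Y n X F (\<psi> u) v x \<bullet> b) *\<^sub>R b) = A v x"
      unfolding A_def
    proof (intro sum.cong refl arg_cong2[of _ _ _ _ scaleR])
      fix b assume "b \<in> onb ?T"
      then have "b \<in> ?T" using onb_subset[OF T(1)] by auto
      then show "shape_operator k Y n X F (\<psi> u) v x \<bullet> b = v \<bullet> hess D (F \<circ> \<psi>) u (g x) (g b)"
        using h(2)[OF gW[of b]] dg[of b] by simp
    qed
    then show ?thesis using orthonormal_expand[OF onb(1)[OF T(1)]] h(1) onb(2)[OF T(1)] by simp
  qed
  then show ?thesis using l1 l2 AT by blast
qed

locale lifted_immersion = hopf_bundle X f m Xt F \<rho> \<kappa>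
  for X :: "'x::topological_space set" and f :: "'x \<Rightarrow> complex^'n^'n" and m :: nat
    and Xt :: "'y::topological_space set" and F :: "'y \<Rightarrow> complex^'n" and \<rho> :: "'y \<Rightarrow> 'x"
    and \<kappa> :: "'x \<times> (complex^'n) \<Rightarrow> 'y" +
  fixes N :: nat
  assumes card: "CARD('n) = N + 1" and codim: "m < N"
begin

section \<open>Tangent and normal spaces of the lifted immersion\<close>

abbreviation "TX \<equiv> tangent_space (2 * m) X f"
abbreviation "TXt \<equiv> tangent_space (2 * m + 1) Xt F"
abbreviation "NX \<equiv> normal_space (2 * N) CP (2 * m) X f"
abbreviation "NXt \<equiv> normal_space (2 * N + 1) (sphere 0 1) (2 * m + 1) Xt F"
abbreviation "SX \<equiv> shape_operator (2 * N) CP (2 * m) X f"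
abbreviation "SXt \<equiv> shape_operator (2 * N + 1) (sphere 0 1) (2 * m + 1) Xt F"
abbreviation "HX y \<equiv> {h. hinner h (F y) = 0 \<and> hopf_deriv (F y) h \<in> TX (\<rho> y)}"

lemma subspace_TX: "p \<in> X \<Longrightarrow> subspace (TX p)" "p \<in> X \<Longrightarrow> dim (TX p) = 2 * m"
  using params_cover_subspace[OF params_cover_base] by auto

lemma subspace_TXt: "y \<in> Xt \<Longrightarrow> subspace (TXt y)" "y \<in> Xt \<Longrightarrow> dim (TXt y) = 2 * m + 1"
  using params_cover_subspace[OF params_cover_total] by auto

lemma tangent_CP: "y \<in> Xt \<Longrightarrow> tangent_space (2 * N) CP id (f (\<rho> y)) = {hopf_deriv (F y) h | h. hinner h (F y) = 0}"
  using tangent_space_CP[OF card total_space(2)] by (simp add: total_space(3))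

lemma tangent_sphere: "y \<in> Xt \<Longrightarrow> tangent_space (2 * N + 1) (sphere 0 1) id (F y) = {h. h \<bullet> F y = 0}"
  by (rule tangent_space_sphere[OF card total_space(2)])

text \<open>With \<open>z0 = F y\<close> the local section passes through \<open>F y\<close> and
  \<open>y\<close> has angle \<open>0\<close>, which is the situation in which the Hessian formulas
  are available.\<close>

lemma centred_chart:
  assumes y: "y \<in> Xt"
  obtains W D \<psi> L e R u where "lift_chart X f m Xt F \<rho> \<kappa> W D \<psi> L e R" "u \<in> lift_chart.D0 f D \<psi> (F y)" "\<psi> u = \<rho> y"
    "L u \<in> lift_chart.Dt f W D \<psi> (F y) L e R" "lift_chart.\<Psi> f \<kappa> \<psi> (F y) e R (L u) = y" "R (L u) = u" "L u \<bullet> e = 0"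
    "lift_chart.s f \<psi> (F y) u = F y"
proof -
  obtain W D \<psi> L e R u where lc: "lift_chart X f m Xt F \<rho> \<kappa> W D \<psi> L e R" "u \<in> D" "\<psi> u = \<rho> y"
    using obtain_lift_chart[OF y] .
  interpret lc: lift_chart X f m Xt F \<rho> \<kappa> W D \<psi> "F y" L e R by (rule lc(1))
  have h: "hinner (F y) (F y) = 1" by (simp add: hinner_self total_space(2)[OF y])
  have uW: "u \<in> W" using lc(2) rel_openD(3)[OF lc.r(3)] by auto
  have a: "L u + Arg (hinner (F y) (F y)) *\<^sub>R e = L u" by (simp add: h)
  have w: "L u \<in> lc.Dt" "lc.\<Psi> (L u) = y"
    using lc.Psi_surj[OF y lc(2) lc(3)[symmetric]] unfolding a by (simp_all add: h)
  have c: "R (L u) = u" "L u \<bullet> e = 0" using lc.RL[OF uW] lc.Le[OF uW] by auto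
  have "lc.s u = F y" by (simp add: lc.s_def lc(3) total_space(3)[OF y] hopf_section_id[OF total_space(2)[OF y]])
  moreover have "u \<in> lc.D0" using lc.DtD(1)[OF w(1)] c by simp
  ultimately show ?thesis using that[OF lc(1) _ lc(3) w c] by blast
qed

lemma TX_lift:
  assumes y: "y \<in> Xt" shows "TX (\<rho> y) = hopf_deriv (F y) ` HX y"
proof (intro equalityI subsetI)
  fix x assume x: "x \<in> TX (\<rho> y)"
  obtain W D \<psi> L e R u where c: "lift_chart X f m Xt F \<rho> \<kappa> W D \<psi> L e R" "u \<in> lift_chart.D0 f D \<psi> (F y)" "\<psi> u = \<rho> y"
    "lift_chart.s f \<psi> (F y) u = F y" using centred_chart[OF y] by metis
  interpret lc: lift_chart X f m Xt F \<rho> \<kappa> W D \<psi> "F y" L e R by (rule c(1))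
  have "TX (\<psi> u) = fd D (f \<circ> \<psi>) u ` W" by (rule tangent_space_eq[OF lc.p]) (use c(2) lc.D0(2) in auto)
  then obtain \<xi> where \<xi>: "\<xi> \<in> W" "x = fd D (f \<circ> \<psi>) u \<xi>" using x c(3) by auto
  note s = lc.fd_s[OF c(2) \<xi>(1), unfolded c(4)]
  have "x = hopf_deriv (F y) (horiz (F y) (fd lc.D0 lc.s u \<xi>))" using \<xi> s hopf_deriv_horiz by simp
  then show "x \<in> hopf_deriv (F y) ` HX y" using x hinner_horiz[OF total_space(2)[OF y]] by auto
qed auto

lemma TX_CP: "y \<in> Xt \<Longrightarrow> TX (\<rho> y) \<subseteq> tangent_space (2 * N) CP id (f (\<rho> y))"
  using TX_lift tangent_CP by blast

lemma TXt_sphere: "y \<in> Xt \<Longrightarrow> TXt y \<subseteq> tangent_space (2 * N + 1) (sphere 0 1) id (F y)"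
  using tangent_space_total tangent_sphere by auto

lemma HX_rotate: "y \<in> Xt \<Longrightarrow> h \<in> HX y \<Longrightarrow> \<i> *s h \<in> HX y"
  using complex_tangent[OF total_space(1,2,3)] by (auto simp: hinner_scale_left)

lemma TXtD: "y \<in> Xt \<Longrightarrow> h \<in> TXt y \<Longrightarrow> h \<bullet> F y = 0" "y \<in> Xt \<Longrightarrow> h \<in> TXt y \<Longrightarrow> hopf_deriv (F y) h \<in> TX (\<rho> y)"
  and HX_TXt: "y \<in> Xt \<Longrightarrow> h \<in> HX y \<Longrightarrow> h \<in> TXt y"
  unfolding tangent_space_total by (auto simp: hinner_eq_0_iff)

lemma NXtD: "y \<in> Xt \<Longrightarrow> v \<in> NXt y \<Longrightarrow> v \<bullet> F y = 0" "v \<in> NXt y \<Longrightarrow> h \<in> TXt y \<Longrightarrow> v \<bullet> h = 0"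
  and NXtI: "y \<in> Xt \<Longrightarrow> v \<bullet> F y = 0 \<Longrightarrow> (\<And>h. h \<in> TXt y \<Longrightarrow> v \<bullet> h = 0) \<Longrightarrow> v \<in> NXt y"
  unfolding normal_space_def tangent_sphere by auto

lemma vertical_TXt: "y \<in> Xt \<Longrightarrow> \<i> *s F y \<in> TXt y"
  unfolding tangent_space_total
  using subspace_0[OF subspace_TX(1)[OF total_space(1)]] by (auto simp: hopf_vertical Re_hinner[symmetric] hinner_scale_left hinner_self)

lemma TXt_horiz:
  assumes y: "y \<in> Xt" and h: "h \<in> TXt y" shows "horiz (F y) h \<in> HX y"
  using TXtD[OF y h] hopf_deriv_horiz[OF TXtD(1)[OF y h]] hinner_horiz[OF total_space(2)[OF y]] by simp

text \<open>A vector tangent to the lift splits into a vector of \<open>HX y\<close> and a vertical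
  one. Orthogonality to the vertical direction, together with tangency to the sphere, is the
  vanishing of the Hermitian product with \<open>F y\<close>.\<close>

lemma NXt_iff:
  assumes y: "y \<in> Xt" shows "v \<in> NXt y \<longleftrightarrow> hinner v (F y) = 0 \<and> (\<forall>h\<in>HX y. v \<bullet> h = 0)"
proof
  assume v: "v \<in> NXt y"
  then show "hinner v (F y) = 0 \<and> (\<forall>h\<in>HX y. v \<bullet> h = 0)"
    using NXtD(1)[OF y v] NXtD(2)[OF v vertical_TXt[OF y]] NXtD(2)[OF v HX_TXt[OF y]] unfolding hinner_eq_0_iff by blast
next
  assume v: "hinner v (F y) = 0 \<and> (\<forall>h\<in>HX y. v \<bullet> h = 0)"
  have "v \<bullet> h = 0" if h: "h \<in> TXt y" for h
  proof -
    have "h = horiz (F y) h + (h \<bullet> (\<i> *s F y)) *\<^sub>R (\<i> *s F y)"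
      by (rule horiz_decomp[OF TXtD(1)[OF y h]])
    moreover have "v \<bullet> horiz (F y) h = 0" "v \<bullet> (\<i> *s F y) = 0" using v TXt_horiz[OF y h] by (auto simp: hinner_eq_0_iff)
    ultimately show ?thesis by (metis add.right_neutral inner_add_right inner_scaleR_right mult_zero_right)
  qed
  then show "v \<in> NXt y" using v by (intro NXtI[OF y]) (auto simp: hinner_eq_0_iff)
qed

text \<open>Here the complex structure of the tangent spaces enters. The horizontal part of a
  tangent vector may be multiplied by \<open>\<i>\<close> and stays tangent, so both real and
  imaginary parts of its product vanish; the vertical part is a multiple of
  \<open>F y\<close>.\<close>

lemma NXt_orthogonal:
  assumes y: "y \<in> Xt" and v: "v \<in> NXt y" and h: "h \<in> TXt y"
  shows "hinner v h = 0"
proof -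
  let ?z = "F y"
  note n = v[unfolded NXt_iff[OF y]] and k = TXt_horiz[OF y h]
  have "hinner v (horiz ?z h) = 0" using n k HX_rotate[OF y k] unfolding hinner_eq_0_iff by blast
  moreover have "h = horiz ?z h + (h \<bullet> (\<i> *s ?z)) *\<^sub>R (\<i> *s ?z)"
    by (rule horiz_decomp[OF TXtD(1)[OF y h]])
  ultimately show ?thesis
    using n by (metis add.right_neutral hinner_add_right hinner_scaleR_right hinner_scale_right mult_zero_right)
qed

lemma NX_lift:
  assumes y: "y \<in> Xt" shows "NX (\<rho> y) = hopf_deriv (F y) ` NXt y" "isometric_on (NXt y) (hopf_deriv (F y))"
proof -
  note z = total_space(2)[OF y]
  have "hopf_deriv (F y) v \<in> NX (\<rho> y) \<longleftrightarrow> v \<in> NXt y" if v: "hinner v (F y) = 0" for v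
  proof -
    have "hopf_deriv (F y) v \<in> NX (\<rho> y) \<longleftrightarrow> (\<forall>x\<in>TX (\<rho> y). hopf_deriv (F y) v \<bullet> x = 0)"
      using v unfolding normal_space_def tangent_CP[OF y] by blast
    also have "\<dots> \<longleftrightarrow> (\<forall>h\<in>HX y. hopf_deriv (F y) v \<bullet> hopf_deriv (F y) h = 0)"
      by (subst TX_lift[OF y]) blast
    also have "\<dots> \<longleftrightarrow> v \<in> NXt y" unfolding hopf_deriv_inner_horizontal[OF z v] NXt_iff[OF y] using v by blast
    finally show ?thesis .
  qed
  moreover have "\<exists>v. hinner v (F y) = 0 \<and> x = hopf_deriv (F y) v" if "x \<in> NX (\<rho> y)" for x
    using that by (auto simp: normal_space_def tangent_CP[OF y])
  ultimately show "NX (\<rho> y) = hopf_deriv (F y) ` NXt y" using NXt_iff[OF y] by blast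
  show "isometric_on (NXt y) (hopf_deriv (F y))"
    unfolding isometric_on_def using NXt_iff[OF y] by (auto simp: linear_hopf_deriv hopf_deriv_inner_horizontal[OF z])
qed

lemma subspace_NXt:
  assumes y: "y \<in> Xt" shows "subspace (NXt y)" "dim (NXt y) = 2 * N - 2 * m"
proof -
  let ?S = "{h. h \<bullet> F y = 0}"
  have S: "subspace ?S" by (auto simp: subspace_def inner_add_left)
  have "NXt y = {v \<in> ?S. \<forall>x\<in>TXt y. orthogonal x v}"
    unfolding normal_space_def tangent_sphere[OF y] by (auto simp: orthogonal_def inner_commute)
  moreover have "subspace {v \<in> ?S. \<forall>x\<in>TXt y. orthogonal x v}"
    by (auto simp: subspace_def inner_add_left orthogonal_def inner_add_right)
  ultimately show "subspace (NXt y)" by simp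
  have "dim ?S = 2 * N + 1"
  proof -
    interpret S: hopf_bundle "CP :: (complex^'n^'n) set" id N "sphere 0 1" id hopf snd by (rule hopf_bundle_sphere[OF card])
    show ?thesis using params_cover_subspace(2)[OF S.params_cover_total, of "F y"] tangent_sphere[OF y] total_space(2)[OF y] by simp
  qed
  moreover have "dim {v \<in> ?S. \<forall>x\<in>TXt y. orthogonal x v} + dim (TXt y) = dim ?S"
    by (rule dim_subspace_orthogonal_to_vectors[OF subspace_TXt(1)[OF y] S]) (use TXt_sphere[OF y] tangent_sphere[OF y] in auto)
  ultimately show "dim (NXt y) = 2 * N - 2 * m"
    using \<open>NXt y = _\<close> subspace_TXt(2)[OF y] codim by simp
qed

text \<open>The seed field is the constant vector \<open>v\<close> with its radial component
  removed.\<close>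

lemma normal_field_sphere:
  assumes y: "y \<in> Xt" and v: "v \<in> NXt y"
  shows "\<exists>U V. y \<in> U \<and> normal_field (2 * N + 1) (sphere 0 1) (2 * m + 1) Xt F U V \<and> V y = v"
proof (rule normal_field_exists[OF params_cover_total, of Xt y _ _ "\<lambda>q. v - (v \<bullet> F q) *\<^sub>R F q"])
  have S: "subspace {h. h \<bullet> a = 0}" for a :: "complex^'n" by (auto simp: subspace_def inner_add_left)
  show "subspace (tangent_space (2 * N + 1) (sphere 0 1) id (F q))" "TXt q \<subseteq> tangent_space (2 * N + 1) (sphere 0 1) id (F q)"
    "v - (v \<bullet> F q) *\<^sub>R F q \<in> tangent_space (2 * N + 1) (sphere 0 1) id (F q)" if "q \<in> Xt" for q
    using TXt_sphere[OF that] tangent_sphere[OF that] S total_space(2)[OF that] by (auto simp: inner_diff_left norm_eq_1)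
  show "smooth_map_on W D ((\<lambda>q. v - (v \<bullet> F q) *\<^sub>R F q) \<circ> \<psi>)" if p: "(W, D, \<psi>) \<in> regular_params (2 * m + 1) Xt F" for W D \<psi>
  proof -
    note r = regular_paramsD[OF p]
    have k: "Ck_on k W D (\<lambda>u. F (\<psi> u))" for k using r(6) by (auto simp: smooth_map_on_def comp_def)
    show ?thesis unfolding smooth_map_on_def comp_def
      by (intro allI Ck_diff[OF r(3)] Ck_const[OF r(3)] Ck_scaleR[OF r(3)] Ck_inner[OF r(3)] k)
  qed
  show "v - (v \<bullet> F y) *\<^sub>R F y = v" by (simp add: NXtD(1)[OF y v])
qed (use y v in auto)

text \<open>The seed field uses a local section: the fixed horizontal lift \<open>h\<close> of
  \<open>v\<close>, made orthogonal to the section, is pushed down by \<open>hopf_deriv\<close>. A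
  vertical component may remain, but \<open>hopf_deriv\<close> kills it.\<close>

lemma normal_field_CP:
  assumes y: "y \<in> Xt" and v: "v \<in> NX (\<rho> y)"
  shows "\<exists>U V. \<rho> y \<in> U \<and> normal_field (2 * N) CP (2 * m) X f U V \<and> V (\<rho> y) = v"
proof -
  let ?z = "F y"
  obtain h where h: "h \<in> NXt y" "v = hopf_deriv ?z h" using v NX_lift(1)[OF y] by auto
  obtain W D \<psi> L e R u where c: "lift_chart X f m Xt F \<rho> \<kappa> W D \<psi> L e R" "u \<in> lift_chart.D0 f D \<psi> (F y)" "\<psi> u = \<rho> y"
    using centred_chart[OF y] by metis
  interpret lc: lift_chart X f m Xt F \<rho> \<kappa> W D \<psi> ?z L e R by (rule c(1))
  let ?U = "\<psi> ` lc.D0"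
  define s where "s q = hopf_section ?z (f q)" for q
  define V0 where "V0 q = hopf_deriv (s q) (h - (h \<bullet> s q) *\<^sub>R s q)" for q
  have s: "norm (s q) = 1" "f q = hopf (s q)" "line_proj ?z (f q) \<noteq> 0" "\<kappa> (q, s q) \<in> Xt" "\<rho> (\<kappa> (q, s q)) = q" "F (\<kappa> (q, s q)) = s q"
    if q: "q \<in> ?U" for q
  proof -
    obtain w where w: "w \<in> lc.D0" "q = \<psi> w" using q by auto
    show n: "norm (s q) = 1" and f: "f q = hopf (s q)" using lc.s_props[OF w(1)] by (simp_all add: s_def w(2) lc.s_def)
    show "line_proj ?z (f q) \<noteq> 0" using w by (simp add: lc.D0_def)
    show "\<kappa> (q, s q) \<in> Xt" "\<rho> (\<kappa> (q, s q)) = q" "F (\<kappa> (q, s q)) = s q"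
      using total_point[OF _ n f] lc.s_props(4)[OF w(1)] w(2) by auto
  qed
  have T: "tangent_space (2 * N) CP id (f q) = {hopf_deriv (s q) k | k. hinner k (s q) = 0}" if "q \<in> ?U" for q
    using tangent_CP[OF s(4)[OF that]] s(5,6)[OF that] by simp
  show ?thesis
  proof (rule normal_field_exists[OF params_cover_base, of ?U _ _ _ V0])
    show "openin (top_of_set X) ?U" by (rule regular_paramsD(4)[OF regular_params_restrict[OF lc.p lc.D0]])
    show "\<rho> y \<in> ?U" using c(2,3) by force
    show "V0 (\<rho> y) = v"
      by (simp add: V0_def s_def total_space(3)[OF y] hopf_section_id[OF total_space(2)[OF y]] NXtD(1)[OF y h(1)] h(2))
    show "v \<in> NX (\<rho> y)" by (rule v)
    fix q assume q: "q \<in> ?U"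
    interpret C: hopf_base "CP :: (complex^'n^'n) set" id N by (rule hopf_base_CP[OF card])
    show "subspace (tangent_space (2 * N) CP id (f q))"
      using params_cover_subspace(1)[OF C.params_cover_base, of "f q"] s(1,2)[OF q] by (auto simp: CP_iff)
    show "TX q \<subseteq> tangent_space (2 * N) CP id (f q)" using TX_CP[OF s(4)[OF q]] s(5)[OF q] by simp
    have o: "(h - (h \<bullet> s q) *\<^sub>R s q) \<bullet> s q = 0" using s(1)[OF q] by (simp add: inner_diff_left norm_eq_1)
    show "V0 q \<in> tangent_space (2 * N) CP id (f q)"
      unfolding T[OF q] V0_def using hopf_deriv_horiz[OF o] hinner_horiz[OF s(1)[OF q]] by blast
  next
    fix W' D' \<psi>' assume p: "(W', D', \<psi>') \<in> regular_params (2 * m) X f" and sub: "\<psi>' ` D' \<subseteq> ?U"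
    note r = regular_paramsD[OF p]
    have "smooth_map_on W' D' (\<lambda>w. hopf_section ?z ((f \<circ> \<psi>') w))"
      by (rule smooth_hopf_section[OF r(3,6)]) (use s(3) sub in auto)
    then have k: "Ck_on k W' D' (\<lambda>w. s (\<psi>' w))" for k by (simp add: smooth_map_on_def s_def)
    show "smooth_map_on W' D' (V0 \<circ> \<psi>')" unfolding smooth_map_on_def comp_def V0_def
      by (intro allI Ck_bilinear[OF r(3) bounded_bilinear_hopf_deriv] Ck_diff[OF r(3)] Ck_const[OF r(3)] Ck_scaleR[OF r(3)] Ck_inner[OF r(3)] k)
  qed
qed

section \<open>Comparison of the shape operators\<close>

lemma ambient_subspaces:
  assumes y: "y \<in> Xt"
  shows "subspace (tangent_space (2 * N + 1) (sphere 0 1) id (F y))" "subspace (tangent_space (2 * N) CP id (f (\<rho> y)))"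
proof -
  show "subspace (tangent_space (2 * N + 1) (sphere 0 1) id (F y))"
    unfolding tangent_sphere[OF y] by (auto simp: subspace_def inner_add_left)
  interpret C: hopf_base "CP :: (complex^'n^'n) set" id N by (rule hopf_base_CP[OF card])
  show "subspace (tangent_space (2 * N) CP id (f (\<rho> y)))"
    using params_cover_subspace(1)[OF C.params_cover_base, of "f (\<rho> y)"] f_CP[OF total_space(1)[OF y]] by simp
qed

text \<open>The vertical direction drops out because the horizontal lifts of the tangent spaces are complex.\<close>

lemma shape_operator_lift:
  assumes y: "y \<in> Xt" and v: "v \<in> NXt y" and a: "a \<in> TXt y"
  shows "SXt y v a \<in> TXt y"
    and "b \<in> TXt y \<Longrightarrow> SXt y v a \<bullet> b = SX (\<rho> y) (hopf_deriv (F y) v) (hopf_deriv (F y) a) \<bullet> hopf_deriv (F y) b"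
proof -
  let ?z = "F y"
  obtain W D \<psi> L e R u where c: "lift_chart X f m Xt F \<rho> \<kappa> W D \<psi> L e R" "u \<in> lift_chart.D0 f D \<psi> (F y)" "\<psi> u = \<rho> y"
    "L u \<in> lift_chart.Dt f W D \<psi> (F y) L e R" "lift_chart.\<Psi> f \<kappa> \<psi> (F y) e R (L u) = y" "R (L u) = u" "L u \<bullet> e = 0"
    "lift_chart.s f \<psi> (F y) u = F y" by (rule centred_chart[OF y])
  interpret lc: lift_chart X f m Xt F \<rho> \<kappa> W D \<psi> ?z L e R by (rule c(1))
  have uD: "u \<in> D" using c(2) lc.D0(2) by auto
  have Fz: "lc.Ft (L u) = ?z" using lc.Ft_props(6)[OF c(4)] c(5) by simp
  have tan: "\<exists>\<xi>\<in>W. \<exists>\<sigma>. a = fd lc.Dt (F \<circ> lc.\<Psi>) (L u) (L \<xi> + \<sigma> *\<^sub>R e)" if "a \<in> TXt y" for a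
    using that tangent_space_eq[OF lc.lift_regular c(4)] c(5) by (auto simp: lc.Wt_def)
  have base: "hopf_deriv ?z (fd lc.Dt (F \<circ> lc.\<Psi>) (L u) (L \<xi> + \<sigma> *\<^sub>R e)) = fd D (f \<circ> \<psi>) u \<xi>" if "\<xi> \<in> W" for \<xi> \<sigma>
    using lc.hopf_deriv_fd_Ft(1)[OF c(4) that] Fz c(6) by simp
  obtain \<xi> \<sigma> where \<xi>: "\<xi> \<in> W" "a = fd lc.Dt (F \<circ> lc.\<Psi>) (L u) (L \<xi> + \<sigma> *\<^sub>R e)" using tan[OF a] by blast
  let ?v = "hopf_deriv ?z v"
  have vN: "?v \<in> NX (\<rho> y)" using NX_lift(1)[OF y] v by blast
  note sh = shape_operator_hess[OF lc.lift_regular c(4) lc.Wt_I[OF \<xi>(1), of \<sigma>],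
      unfolded c(5), OF ambient_subspaces(1)[OF y] TXt_sphere[OF y] normal_field_sphere[OF y v], folded \<xi>(2)]
  show "SXt y v a \<in> TXt y" by (rule sh(1))
  note shb = shape_operator_hess(2)[OF lc.p uD \<xi>(1),
      unfolded c(3), OF ambient_subspaces(2)[OF y] TX_CP[OF y] normal_field_CP[OF y vN]]
  have dsT: "fd lc.D0 lc.s u \<eta> \<in> TXt y" if "\<eta> \<in> W" for \<eta>
    using lc.fd_s[OF c(2) that] tangent_space_eq[OF lc.p uD] c(3,8) imageI[OF that, of "fd D (f \<circ> \<psi>) u"] unfolding tangent_space_total[OF y] by simp
  have orth: "v \<bullet> (\<i> *s h) = 0" if "h \<in> TXt y" for h
    using NXt_orthogonal[OF y v that] by (simp add: hinner_eq_0_iff)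
  show "SXt y v a \<bullet> b = SX (\<rho> y) ?v (hopf_deriv ?z a) \<bullet> hopf_deriv ?z b" if b: "b \<in> TXt y"
  proof -
    obtain \<eta> \<tau> where \<eta>: "\<eta> \<in> W" "b = fd lc.Dt (F \<circ> lc.\<Psi>) (L u) (L \<eta> + \<tau> *\<^sub>R e)" using tan[OF b] by blast
    have "SXt y v a \<bullet> b = v \<bullet> hess lc.Dt (F \<circ> lc.\<Psi>) (L u) (L \<xi> + \<sigma> *\<^sub>R e) (L \<eta> + \<tau> *\<^sub>R e)"
      unfolding \<eta>(2) by (rule sh(2)[OF lc.Wt_I[OF \<eta>(1)]])
    \<comment> \<open>Both rotation terms are \<open>\<i>\<close> times a vector tangent to the
      lift, hence orthogonal to \<open>v\<close>.\<close>
    also have "\<dots> = v \<bullet> hess lc.D0 lc.s u \<xi> \<eta>"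
      unfolding lc.hess_lift[OF c(4,7) \<xi>(1) \<eta>(1)] \<xi>(2)[symmetric] c(6)
      using orth[OF dsT[OF \<eta>(1)]] orth[OF a] by (simp add: inner_add_right)
    \<comment> \<open>The lifted normal vector \<open>v\<close> is horizontal, so pairing with
      \<open>hopf_deriv\<close> of the second derivative is isometric. The quadratic term of the
      base Hessian vanishes by Hermitian orthogonality.\<close>
    also have "\<dots> = ?v \<bullet> hess D (f \<circ> \<psi>) u \<xi> \<eta>"
    proof -
      have "hinner v ?z = 0" using v NXt_iff[OF y] by blast
      then show ?thesis
        unfolding lc.hess_base[OF c(2) \<xi>(1) \<eta>(1)] c(8) inner_add_right
        using hopf_deriv_inner_horizontal[OF total_space(2)[OF y]]
          hopf_deriv_inner_zero[OF NXt_orthogonal[OF y v dsT[OF \<xi>(1)]] NXt_orthogonal[OF y v dsT[OF \<eta>(1)]]] by simp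
    qed
    also have "\<dots> = SX (\<rho> y) ?v (hopf_deriv ?z a) \<bullet> hopf_deriv ?z b"
      unfolding \<xi>(2) \<eta>(2) base[OF \<xi>(1)] base[OF \<eta>(1)] by (rule shb[OF \<eta>(1), symmetric])
    finally show ?thesis .
  qed
qed

end

section \<open>Comparison of the curvature integrals\<close>

lemma set_det_uminus: "\<bar>set_det B (\<lambda>b c. - a b c)\<bar> = \<bar>set_det B a\<bar>"
proof -
  have "set_det B (\<lambda>b c. - a b c) = (- 1) ^ card B * set_det B a"
    unfolding set_det_def sum_distrib_left by (intro sum.cong refl) (simp add: prod_uminus)
  then show ?thesis by (simp add: abs_mult power_abs)
qed

lemma endo_det_cong:
  assumes "subspace S" "\<And>x. x \<in> S \<Longrightarrow> L x = L' x" shows "endo_det S L = endo_det S L'"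
  unfolding endo_det_def using onb_subset[OF assms(1)] assms(2) by (intro set_det_cong) auto

lemma sinc_measurable [measurable]: "sinc \<in> borel_measurable borel"
  unfolding sinc_def[abs_def] by measurable

text \<open>Applies to functions of unknown measurability, such as the integral over the normal
  space as a function of the base point: simple functions below \<open>f\<close> are scaled. The
  reverse inequality then follows with \<open>1 / c\<close> in place of \<open>c\<close>.\<close>

lemma nn_integral_cmult_le:
  fixes c :: real
  assumes c: "c > 0" shows "ennreal c * (\<integral>\<^sup>+x. f x \<partial>M) \<le> (\<integral>\<^sup>+x. ennreal c * f x \<partial>M)"
  unfolding nn_integral_def[of M f] SUP_mult_left_ennreal
proof (rule SUP_least)
  fix g assume "g \<in> {g. simple_function M g \<and> g \<le> f}"
  then have g: "simple_function M g" "\<And>x. g x \<le> f x" by (auto simp: le_fun_def)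
  have "ennreal c * integral\<^sup>S M g = (\<integral>\<^sup>+x. ennreal c * g x \<partial>M)"
    using borel_measurable_simple_function[OF g(1)] by (simp add: nn_integral_eq_simple_integral[OF g(1), symmetric] nn_integral_cmult)
  also have "\<dots> \<le> (\<integral>\<^sup>+x. ennreal c * f x \<partial>M)" by (intro nn_integral_mono mult_left_mono g) simp
  finally show "ennreal c * integral\<^sup>S M g \<le> (\<integral>\<^sup>+x. ennreal c * f x \<partial>M)" .
qed

lemma nn_integral_cmult_nonmeasurable:
  fixes c :: real
  assumes c: "c > 0" shows "(\<integral>\<^sup>+x. ennreal c * f x \<partial>M) = ennreal c * (\<integral>\<^sup>+x. f x \<partial>M)"
proof (rule antisym[OF _ nn_integral_cmult_le[OF c]])
  have 1: "ennreal (1 / c) * (ennreal c * x) = x" "ennreal c * (ennreal (1 / c) * x) = x" for x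
    using c by (simp_all add: mult.assoc[symmetric] ennreal_mult[symmetric])
  have "ennreal (1 / c) * (\<integral>\<^sup>+x. ennreal c * f x \<partial>M) \<le> (\<integral>\<^sup>+x. ennreal (1 / c) * (ennreal c * f x) \<partial>M)"
    by (rule nn_integral_cmult_le) (use c in simp)
  then have "ennreal (1 / c) * (\<integral>\<^sup>+x. ennreal c * f x \<partial>M) \<le> (\<integral>\<^sup>+x. f x \<partial>M)" by (simp only: 1)
  then have "ennreal c * (ennreal (1 / c) * (\<integral>\<^sup>+x. ennreal c * f x \<partial>M)) \<le> ennreal c * (\<integral>\<^sup>+x. f x \<partial>M)"
    by (rule mult_left_mono) simp
  then show "(\<integral>\<^sup>+x. ennreal c * f x \<partial>M) \<le> ennreal c * (\<integral>\<^sup>+x. f x \<partial>M)" by (simp only: 1)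
qed

context lifted_immersion
begin

section \<open>Jacobi determinants and integrals over normal spaces\<close>

abbreviation "JX \<equiv> jacobi_det (2 * N) CP (2 * m) X f"
abbreviation "JXt \<equiv> jacobi_det (2 * N + 1) (sphere 0 1) (2 * m + 1) Xt F"

lemma shape_operator_base:
  assumes y: "y \<in> Xt"
  obtains A where "\<And>v. linear (A v)" "\<And>x. linear (\<lambda>v. A v x)" "\<And>v x. A v x \<in> TX (\<rho> y)"
    "\<And>v x. v \<in> NX (\<rho> y) \<Longrightarrow> x \<in> TX (\<rho> y) \<Longrightarrow> SX (\<rho> y) v x = A v x"
proof -
  obtain W D \<psi> u where p: "(W, D, \<psi>) \<in> regular_params (2 * m) X f" "u \<in> D" "\<psi> u = \<rho> y"
    using base_chart[OF total_space(1)[OF y]] by blast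
  from shape_operator_linear_extension[OF p(1,2), of "2 * N" CP, unfolded p(3),
      OF ambient_subspaces(2)[OF y] TX_CP[OF y] normal_field_CP[OF y]] that
  show thesis by blast
qed

lemma jacobi_det_base:
  assumes y: "y \<in> Xt" and A: "\<And>v x. v \<in> NX (\<rho> y) \<Longrightarrow> x \<in> TX (\<rho> y) \<Longrightarrow> SX (\<rho> y) v x = A v x" and v: "v \<in> NX (\<rho> y)"
  shows "JX (\<rho> y) v = set_det (onb (TX (\<rho> y))) (\<lambda>b c. b \<bullet> (cos (norm v) *\<^sub>R c - sinc (norm v) *\<^sub>R A v c))"
  unfolding jacobi_det_def endo_det_def
  using onb_subset[OF subspace_TX(1)[OF total_space(1)[OF y]]] A[OF v] by (intro set_det_cong) (auto simp: subset_iff)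

text \<open>In the orthonormal basis consisting of \<open>\<i> *s F y\<close> and the lifts of a
  basis downstairs, the shape operator has horizontal values. The row of the vertical direction is
  therefore diagonal with entry \<open>cos (norm v)\<close>, and the remaining block is the operator
  downstairs.\<close>

lemma jacobi_det_lift:
  assumes y: "y \<in> Xt" and v: "v \<in> NXt y"
  shows "JXt y v = cos (norm v) * JX (\<rho> y) (hopf_deriv (F y) v)"
proof -
  let ?z = "F y" and ?v = "hopf_deriv (F y) v" and ?B = "onb (TX (\<rho> y))"
  note z = total_space(2)[OF y] and T = subspace_TX[OF total_space(1)[OF y]] and Tt = subspace_TXt[OF y]
  note B = onb[OF T(1)] and sub = onb_subset[OF T(1)] and fin = onb_finite[OF T(1)]
  have vN: "?v \<in> NX (\<rho> y)" and nv: "norm ?v = norm v"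
    using NX_lift[OF y] v isometric_on_norm by auto
  obtain A where A: "\<And>v. linear (A v)" "\<And>v x. A v x \<in> TX (\<rho> y)"
    "\<And>v x. v \<in> NX (\<rho> y) \<Longrightarrow> x \<in> TX (\<rho> y) \<Longrightarrow> SX (\<rho> y) v x = A v x" by (rule shape_operator_base[OF y]) blast
  have "\<forall>b\<in>?B. \<exists>h. h \<in> HX y \<and> hopf_deriv ?z h = b"
  proof
    fix b assume "b \<in> ?B"
    then have "b \<in> hopf_deriv ?z ` HX y" using sub unfolding TX_lift[OF y, symmetric] by auto
    then show "\<exists>h. h \<in> HX y \<and> hopf_deriv ?z h = b" by auto
  qed
  from bchoice[OF this] obtain l where l: "\<forall>b\<in>?B. l b \<in> HX y \<and> hopf_deriv ?z (l b) = b" by blast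
  \<comment> \<open>The horizontal lift is extended linearly to all matrices by expanding in the
    chosen basis. It inverts \<open>hopf_deriv\<close> on the tangent space.\<close>
  define lift where "lift x = (\<Sum>b\<in>?B. (x \<bullet> b) *\<^sub>R l b)" for x
  have lin: "linear lift" unfolding lift_def
    by (rule linearI) (simp_all add: inner_add_left scaleR_add_left sum.distrib scaleR_sum_right)
  have hd: "hopf_deriv ?z (lift x) = x" if "x \<in> TX (\<rho> y)" for x
  proof -
    have "hopf_deriv ?z (lift x) = (\<Sum>b\<in>?B. (x \<bullet> b) *\<^sub>R b)"
      unfolding lift_def linear_sum[OF linear_hopf_deriv] using l by (intro sum.cong refl) (simp add: hopf_deriv_scaleR_right)
    then show ?thesis using orthonormal_expand[OF B(1)] B(2) that by simp
  qed
  have hz: "hinner (lift x) ?z = 0" for x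
  proof -
    have S: "subspace {h. hinner h ?z = 0}" by (auto simp: subspace_def hinner_add_left hinner_scaleR_left)
    have "lift x \<in> {h. hinner h ?z = 0}" unfolding lift_def using l by (intro subspace_sum[OF S] subspace_scale[OF S]) auto
    then show ?thesis by simp
  qed
  have lT: "lift x \<in> TXt y" if "x \<in> TX (\<rho> y)" for x using HX_TXt[OF y] hz hd[OF that] that by simp
  have l_inner: "lift x \<bullet> h = x \<bullet> hopf_deriv ?z h" if "x \<in> TX (\<rho> y)" for x h
    using hopf_deriv_inner_horizontal[OF z hz, of x h] hd[OF that] by simp
  have iso: "isometric_on (TX (\<rho> y)) lift"
    unfolding isometric_on_def using lin l_inner hd by auto
  note iB = isometric_on_orthonormal[OF iso B(1) sub]
  let ?iz = "\<i> *s ?z"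
  have iz: "?iz \<bullet> ?iz = 1" "norm ?iz = 1" using z by (simp_all add: norm_scale_complex dot_square_norm)
  have iz_l: "lift x \<bullet> ?iz = 0" "?iz \<bullet> lift x = 0" for x using hz[of x] by (auto simp: hinner_eq_0_iff inner_commute)
  let ?Bt = "insert ?iz (lift ` ?B)"
  have niz: "?iz \<notin> lift ` ?B" using iz(1) iz_l by force
  have Bt: "orthonormal ?Bt"
    using iB(1) iz iz_l unfolding orthonormal_def by (auto simp: pairwise_insert orthogonal_def)
  have spBt: "span ?Bt = TXt y"
  proof (rule subspace_dim_equal)
    show "subspace (span ?Bt)" by simp
    show "span ?Bt \<subseteq> TXt y" by (intro span_minimal Tt) (use vertical_TXt[OF y] lT sub in auto)
    have "dim (span ?Bt) = card ?Bt" using orthonormal_card[OF Bt] by simp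
    also have "\<dots> = Suc (2 * m)" using niz fin iB(3) card_onb[OF T(1)] T(2) by simp
    finally show "dim (TXt y) \<le> dim (span ?Bt)" using Tt(2) by simp
  qed (use Tt in auto)
  let ?c = "cos (norm v)" and ?s = "sinc (norm v)"
  \<comment> \<open>A globally linear operator agreeing with the one in \<open>JXt\<close> on the
    tangent space; \<open>endo_det_orthonormal\<close> requires linearity everywhere.\<close>
  define Lt where "Lt x = ?c *\<^sub>R x - ?s *\<^sub>R lift (A ?v (hopf_deriv ?z x))" for x
  have linLt: "linear Lt" unfolding Lt_def
    by (rule linearI) (simp_all add: hopf_deriv_add_right hopf_deriv_scaleR_right linear_add[OF A(1)] linear_scale[OF A(1)]
      linear_add[OF lin] linear_scale[OF lin] algebra_simps)
  have shape: "SXt y v x = lift (A ?v (hopf_deriv ?z x))" if x: "x \<in> TXt y" for x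
  proof (rule subspace_eqI_inner[OF Tt(1)])
    show "SXt y v x \<in> TXt y" by (rule shape_operator_lift(1)[OF y v x])
    show "lift (A ?v (hopf_deriv ?z x)) \<in> TXt y" by (rule lT[OF A(2)])
    fix b assume b: "b \<in> TXt y"
    show "SXt y v x \<bullet> b = lift (A ?v (hopf_deriv ?z x)) \<bullet> b"
      unfolding shape_operator_lift(2)[OF y v x b] l_inner[OF A(2)] A(3)[OF vN TXtD(2)[OF y x]] ..
  qed
  have "JXt y v = endo_det (TXt y) Lt"
    unfolding jacobi_det_def Lt_def by (rule endo_det_cong[OF Tt(1)]) (simp only: shape)
  also have "\<dots> = set_det ?Bt (\<lambda>b c. b \<bullet> Lt c)"
    by (rule endo_det_orthonormal[OF Tt(1) Bt spBt linLt])
       (unfold Lt_def, intro subspace_diff[OF Tt(1)] subspace_scale[OF Tt(1)] lT A(2))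
  also have "\<dots> = (\<Prod>b\<in>?Bt - lift ` ?B. b \<bullet> Lt b) * set_det (lift ` ?B) (\<lambda>b c. b \<bullet> Lt c)"
    by (rule set_det_block) (use fin iz_l in \<open>auto simp: Lt_def inner_diff_right\<close>)
  also have "?Bt - lift ` ?B = {?iz}" using niz by auto
  also have "(\<Prod>b\<in>{?iz}. b \<bullet> Lt b) = ?c" using iz(1) iz_l by (simp add: Lt_def inner_diff_right)
  also have "set_det (lift ` ?B) (\<lambda>b c. b \<bullet> Lt c) = set_det ?B (\<lambda>b c. lift b \<bullet> Lt (lift c))"
    by (rule set_det_reindex[OF fin]) (simp add: bij_betw_def iB(2))
  also have "\<dots> = set_det ?B (\<lambda>b c. b \<bullet> (?c *\<^sub>R c - ?s *\<^sub>R A ?v c))"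
  proof (rule set_det_cong)
    fix b c assume "b \<in> ?B" "c \<in> ?B"
    then have bc: "b \<in> TX (\<rho> y)" "c \<in> TX (\<rho> y)" using sub by auto
    show "lift b \<bullet> Lt (lift c) = b \<bullet> (?c *\<^sub>R c - ?s *\<^sub>R A ?v c)"
      unfolding l_inner[OF bc(1)] Lt_def hd[OF bc(2)]
      by (simp add: linear_diff[OF linear_hopf_deriv] hopf_deriv_scaleR_right hd[OF bc(2)] hd[OF A(2)])
  qed
  also have "\<dots> = JX (\<rho> y) ?v" by (rule jacobi_det_base[where A=A, OF y A(3) vN, unfolded nv, symmetric])
  finally show ?thesis .
qed

text \<open>The normal space is carried to the base by the isometry \<open>hopf_deriv\<close>. The
  exponent of \<open>sinc\<close> is one less than the dimension of the normal space, so the polar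
  factor turns that power of \<open>sinc\<close> into the same power of \<open>sin\<close>. This
  exposes the reflection symmetry.\<close>

lemma fibre_integral_lift:
  assumes y: "y \<in> Xt"
  shows "(\<integral>\<^sup>+v\<in>{v \<in> NXt y. norm v < pi}. ennreal (\<bar>JXt y v\<bar> * sinc (norm v) ^ (2 * N - 2 * m - 1)) \<partial>subspace_lborel (NXt y)) =
    2 * (\<integral>\<^sup>+v\<in>{v \<in> NX (\<rho> y). norm v < pi / 2}. ennreal (\<bar>JX (\<rho> y) v\<bar> * cos (norm v) * sinc (norm v) ^ (2 * N - 2 * m - 1))
        \<partial>subspace_lborel (NX (\<rho> y)))"
proof -
  let ?d = "2 * N - 2 * m - 1" and ?hd = "hopf_deriv (F y)" and ?p = "\<rho> y" and ?B = "onb (TX (\<rho> y))"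
  note Nt = subspace_NXt[OF y] and lift = NX_lift[OF y]
  have N: "subspace (NX ?p)" unfolding lift(1) by (rule linear_subspace_image[OF linear_hopf_deriv Nt(1)])
  have dN: "dim (NX ?p) = 2 * N - 2 * m"
    unfolding lift(1) using isometric_on_inj[OF lift(2) Nt(1)] Nt by (subst dim_image_eq[OF linear_hopf_deriv]) (auto simp: span_eq_iff[THEN iffD2])
  obtain A where A: "\<And>v. linear (A v)" "\<And>x. linear (\<lambda>v. A v x)" "\<And>v x. A v x \<in> TX ?p"
    "\<And>v x. v \<in> NX ?p \<Longrightarrow> x \<in> TX ?p \<Longrightarrow> SX ?p v x = A v x" by (rule shape_operator_base[OF y]) blast
  \<comment> \<open>The coefficients are separate arguments so that linearity of \<open>A\<close> in
    \<open>v\<close> can trade \<open>sinc (norm v)\<close> at \<open>v\<close> for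
    \<open>sin (norm v)\<close> at the unit direction.\<close>
  define K where "K a b v = set_det ?B (\<lambda>c d. c \<bullet> (a *\<^sub>R d - b *\<^sub>R A v d))" for a b v
  have A_meas[measurable]: "(\<lambda>v. A v x) \<in> borel_measurable borel" for x by (rule linear_measurable[OF A(2)])
  define q where "q v = ennreal (\<bar>cos (norm v) * K (cos (norm v)) (sinc (norm v)) v\<bar> * sinc (norm v) ^ ?d)" for v
  have q[measurable]: "q \<in> borel_measurable borel" unfolding q_def K_def set_det_def by measurable
  \<comment> \<open>The integrand in polar form, with the power of the radius absorbed. Absolute
    values are taken since reflection may change signs.\<close>
  define Q where "Q r u = ennreal (\<bar>cos r * K (cos r) (sin r) u\<bar> * \<bar>sin r\<bar> ^ ?d)" for r u
  have JK: "JX ?p v = K (cos (norm v)) (sinc (norm v)) v" if "v \<in> NX ?p" for v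
    unfolding K_def by (rule jacobi_det_base[where A=A, OF y A(4) that])
  have [measurable]: "NX ?p \<in> sets borel" using closed_subspace[OF N] by simp
  have "(\<integral>\<^sup>+v\<in>{v \<in> NXt y. norm v < pi}. ennreal (\<bar>JXt y v\<bar> * sinc (norm v) ^ ?d) \<partial>subspace_lborel (NXt y)) =
    (\<integral>\<^sup>+v. q (?hd v) * indicator {v \<in> NX ?p. norm v < pi} (?hd v) \<partial>subspace_lborel (NXt y))"
  proof (rule nn_integral_cong_AE, use subspace_lborel_AE[OF Nt(1)] in eventually_elim)
    fix v assume v: "v \<in> NXt y"
    have n: "norm (?hd v) = norm v" and vN: "?hd v \<in> NX ?p" using lift v isometric_on_norm by auto
    show "ennreal (\<bar>JXt y v\<bar> * sinc (norm v) ^ ?d) * indicator {v \<in> NXt y. norm v < pi} v =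
      q (?hd v) * indicator {v \<in> NX ?p. norm v < pi} (?hd v)"
      unfolding jacobi_det_lift[OF y v] q_def JK[OF vN] n using v vN by (simp add: indicator_def n)
  qed
  also have "\<dots> = (\<integral>\<^sup>+v\<in>{v \<in> NX ?p. norm v < pi}. q v \<partial>distr (subspace_lborel (NXt y)) borel ?hd)"
    by (subst nn_integral_distr) (auto intro: linear_measurable[OF linear_hopf_deriv] simp: measurable_cong_sets[OF sets_subspace_lborel refl])
  also have "distr (subspace_lborel (NXt y)) borel ?hd = subspace_lborel (NX ?p)"
    unfolding lift(1) by (rule distr_subspace_lborel[OF Nt(1) lift(2)])
  also have "(\<integral>\<^sup>+v\<in>{v \<in> NX ?p. norm v < pi}. q v \<partial>subspace_lborel (NX ?p)) =
    2 * (\<integral>\<^sup>+v\<in>{v \<in> NX ?p. norm v < pi / 2}. q v \<partial>subspace_lborel (NX ?p))"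
  proof (rule nn_integral_reflect_radius[OF N, where Q=Q])
    show "dim (NX ?p) \<ge> 1" using dN codim by simp
    have "(\<lambda>v. A (snd v) x) \<in> borel_measurable (borel \<Otimes>\<^sub>M borel)" for x :: "complex^'n^'n"
      by (rule measurable_compose[OF measurable_snd A_meas])
    note [measurable] = this
    show "(\<lambda>(r, u). Q r u) \<in> borel_measurable (borel \<Otimes>\<^sub>M borel)"
      unfolding Q_def K_def set_det_def case_prod_beta' by measurable
    fix v assume v: "v \<in> NX ?p" "0 < norm v" "norm v < pi"
    have s: "sin (norm v) > 0" by (rule sin_gt_zero[OF v(2,3)])
    have "K a (sin (norm v)) (v /\<^sub>R norm v) = K a (sinc (norm v)) v" for a
      unfolding K_def linear_scale[OF A(2)] using v(2) by (simp add: sinc_def divide_inverse)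
    moreover have "\<bar>sin (norm v)\<bar> ^ ?d = norm v ^ ?d * sinc (norm v) ^ ?d"
      using s v(2) by (simp add: sinc_def power_divide)
    ultimately show "Q (norm v) (v /\<^sub>R norm v) = ennreal (norm v ^ (dim (NX ?p) - 1)) * q v"
      unfolding Q_def q_def dN using s v(2) by (simp add: sinc_def ennreal_mult[symmetric] mult_ac)
  next
    fix r u assume "0 < r" "r < pi"
    \<comment> \<open>Under the reflection \<open>cos\<close> changes sign while \<open>sin\<close>
      stays fixed, and \<open>A\<close> changes sign with the direction. The whole matrix is
      negated, which changes its determinant by a sign only.\<close>
    have "K (- cos r) (sin r) (- u) = set_det ?B (\<lambda>c d. - (c \<bullet> (cos r *\<^sub>R d - sin r *\<^sub>R A u d)))"
      unfolding K_def linear_neg[OF A(2)] by (rule set_det_cong) (simp add: inner_diff_right)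
    then have "\<bar>K (- cos r) (sin r) (- u)\<bar> = \<bar>K (cos r) (sin r) u\<bar>" by (simp add: K_def set_det_uminus)
    then show "Q (pi - r) (- u) = Q r u" by (simp add: Q_def abs_mult)
  qed
  also have "(\<integral>\<^sup>+v\<in>{v \<in> NX ?p. norm v < pi / 2}. q v \<partial>subspace_lborel (NX ?p)) =
    (\<integral>\<^sup>+v\<in>{v \<in> NX ?p. norm v < pi / 2}. ennreal (\<bar>JX ?p v\<bar> * cos (norm v) * sinc (norm v) ^ ?d) \<partial>subspace_lborel (NX ?p))"
  proof (rule nn_integral_cong)
    fix v :: "complex^'n^'n"
    \<comment> \<open>On the half ball the absolute value around the cosine may be dropped; this is
      how the weight \<open>cos\<close> of the projective formula arises.\<close>
    have "cos (norm v) > 0" if "norm v < pi / 2" using that by (intro cos_gt_zero_pi) (auto intro: less_le_trans[of _ 0])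
    then show "q v * indicator {v \<in> NX ?p. norm v < pi / 2} v =
      ennreal (\<bar>JX ?p v\<bar> * cos (norm v) * sinc (norm v) ^ ?d) * indicator {v \<in> NX ?p. norm v < pi / 2} v"
      using JK[of v] by (auto simp: indicator_def q_def abs_mult mult.commute)
  qed
  finally show ?thesis .
qed

lemma total_abs_curvature_lift: "total_abs_curvature_sphere (2 * m + 1) Xt F = total_abs_curvature_CP m X f"
proof -
  let ?\<mu> = "riemannian_volume (2 * m) X f" and ?\<mu>t = "riemannian_volume (2 * m + 1) Xt F"
  define I where "I p = (\<integral>\<^sup>+v\<in>{v \<in> NX p. norm v < pi / 2}. ennreal (\<bar>JX p v\<bar> * cos (norm v) * sinc (norm v) ^ (2 * N - 2 * m - 1))
        \<partial>subspace_lborel (NX p))" for p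
  let ?V = "emeasure (riemannian_volume (2 * N) (CP :: (complex^'n^'n) set) id) CP"
  have dims: "DIM(complex^'n) - 1 = 2 * N + 1" "2 * N + 1 - (2 * m + 1) - 1 = 2 * N - 2 * m - 1" "CARD('n) - 1 = N"
    using card by auto
  have "normal_bundle_integral (2 * N + 1) (sphere 0 1) (2 * m + 1) Xt F pi (\<lambda>p v. \<bar>JXt p v\<bar> * sinc (norm v) ^ (2 * N - 2 * m - 1)) =
    (\<integral>\<^sup>+y. 2 * I (\<rho> y) \<partial>?\<mu>t)"
    unfolding normal_bundle_integral_def I_def
    by (intro nn_integral_cong fibre_integral_lift) (simp only: is_rvol_space[OF rvol_total])
  also have "\<dots> = (\<integral>\<^sup>+p. ennreal (2 * pi) * (2 * I p) \<partial>?\<mu>)" by (rule nn_integral_total[OF rvol_base rvol_total])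
  also have "\<dots> = ennreal (2 * pi) * (ennreal 2 * (\<integral>\<^sup>+p. I p \<partial>?\<mu>))"
    by (subst nn_integral_cmult_nonmeasurable) (simp_all flip: ennreal_numeral add: nn_integral_cmult_nonmeasurable del: ennreal_numeral)
  finally have int: "normal_bundle_integral (2 * N + 1) (sphere 0 1) (2 * m + 1) Xt F pi
      (\<lambda>p v. \<bar>JXt p v\<bar> * sinc (norm v) ^ (2 * N - 2 * m - 1)) = ennreal (2 * pi) * (2 * (\<integral>\<^sup>+p. I p \<partial>?\<mu>))" by simp
  have "total_abs_curvature_sphere (2 * m + 1) Xt F = 1 / (ennreal (2 * pi) * ?V) * (ennreal (2 * pi) * (2 * (\<integral>\<^sup>+p. I p \<partial>?\<mu>)))"
    unfolding total_abs_curvature_sphere_def Let_def dims int volume_sphere[OF card] ..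
  \<comment> \<open>Since \<open>2 * pi\<close> is finite and nonzero, the inverse of the product
    splits while the volume of projective space remains an arbitrary extended real.\<close>
  also have "\<dots> = (ennreal (2 * pi) / ennreal (2 * pi)) * (2 / ?V * (\<integral>\<^sup>+p. I p \<partial>?\<mu>))"
  proof -
    have "inverse (ennreal (2 * pi) * ?V) = inverse (ennreal (2 * pi)) * inverse ?V" by (rule ennreal_inverse_mult') simp
    then show ?thesis unfolding divide_ennreal_def by (simp only: mult_ac mult_1)
  qed
  also have "ennreal (2 * pi) / ennreal (2 * pi) = 1" by (simp add: divide_ennreal)
  also have "1 * (2 / ?V * (\<integral>\<^sup>+p. I p \<partial>?\<mu>)) = total_abs_curvature_CP m X f"
    unfolding total_abs_curvature_CP_def Let_def dims normal_bundle_integral_def I_def by simp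
  finally show ?thesis .
qed

end

theorem proposition3p1:
  fixes M :: "'p::t2_space set"
    and \<A> :: "(complex^'k, 'p) param set"
    and f :: "'p \<Rightarrow> complex^'n^'n"
    and m N :: nat
  assumes dimension: "CARD('n) = N + 1"
    and codimension: "m < N"
    and manifold: "complex_manifold m M \<A>" "compact M"
    and immersion: "holomorphic_immersion \<A> f"
  shows "total_abs_curvature_sphere (2 * m + 1) (circle_bundle M f) snd
         = total_abs_curvature_CP m M f"
proof -
  have "m < CARD('n)" using dimension codimension by simp
  then interpret hopf_base M f m by (rule hopf_base_complex_manifold[OF _ manifold immersion])
  \<comment> \<open>For the given immersion the total space is the circle bundle itself, so the
    structural homeomorphism is the identity.\<close>
  interpret lifted_immersion M f m "circle_bundle M f" snd fst id N
    by unfold_locales (simp_all add: dimension codimension homeomorphism_def continuous_on_id)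
  show ?thesis by (rule total_abs_curvature_lift)
qed

end
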